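(* Let $u_0 \in \dot Z_{5,4}$ be real-valued and such that $$\int_{-\infty}^{\infty} x\,u_0(x)\,dx \neq 0.$$ Let $u \in C(\mathbb{R} : \dot Z_{5,7/2-})$ be the corresponding (global, real-valued) solution of the initial value problem for the Benjamin-Ono equation $$\partial_t u + \mathcal{H}\partial_x^2 u + u\,\partial_x u = 0, \quad t, x\in\mathbb{R}, \qquad u(x,0) = u_0(x).$$ Then $$u(\cdot, t^* ) \in \dot Z_{5,4}, \qquad \text{where} \qquad t^* = -\frac{4}{\|u_0\|_2^2}\int_{-\infty}^{\infty} x\,u_0(x)\,dx.$$
   Context: $\mathcal{H}$ denotes the Hilbert transform in the $x$ variable, $\mathcal{H} f(x) = \frac{1}{\pi}\lim_{\epsilon\downarrow 0}\int_{|y|\ge \epsilon}\frac{f(x-y)}{y}\,dy$, i.e. $\widehat{\mathcal{H}f}(\xi) = -i\,\mathrm{sgn}(\xi)\widehat{f}(\xi)$. $\|\cdot\|_2$ is the $L^2(\mathbb{R})$ norm. For $s, r\in\mathbb{R}$, $H^s(\mathbb{R}) = (1-\partial_x^2)^{-s/2}L^2(\mathbb{R})$ is the $L^2$-based Sobolev space and $$\dot Z_{s,r} = \{ f\in H^s(\mathbb{R})\cap L^2(|x|^{2r}dx) : \widehat{f}(0) = 0\},$$ with the natural norm $\|f\|_{H^s} + \||x|^r f\|_{L^2}$. For a normed space $X$ of functions of $x$, $C(\mathbb{R}:X)$ denotes the continuous curves $t\mapsto u(\cdot,t)$ from $\mathbb{R}$ into $X$. The notation $u\in C(\mathbb{R}:\dot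 Z_{5,7/2-})$ means that $u\in C(\mathbb{R}:\dot Z_{5,r})$ for every $r<7/2$ (with $r \geq 0$). The existence and uniqueness of the solution $u$ is a previously known result: for $r\in[5/2,7/2)$ and $r\le s$, the initial value problem for the Benjamin-Ono equation, $\partial_t u + \mathcal{H}\partial_x^2 u + u\,\partial_x u = 0$ for $t,x\in\mathbb{R}$ with $u(x,0)=u_0(x)$, is globally well-posed in $\dot Z_{s,r}$ (real-valued data and solutions); applied with $s=5$ and every $r\in[5/2,7/2)$, it provides the solution $u\in C(\mathbb{R}:\dot Z_{5,7/2-})$ corresponding to $u_0\in\dot Z_{5,4}$. *)

theory Defs
  imports "HOL-Analysis.Analysis"
begin

text \<open>
  Elements of $L^2$, $H^s$ etc. are represented by Borel functions on the line; every notion below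
  is invariant under changes on null sets.
\<close>

definition L2 :: "(real \<Rightarrow> 'a::{banach, second_countable_topology}) set" where
  "L2 = {f. f \<in> borel_measurable lborel \<and> integrable lborel (\<lambda>x. (norm (f x))\<^sup>2)}"

definition L2_norm :: "(real \<Rightarrow> 'a::{banach, second_countable_topology}) \<Rightarrow> real" where
  "L2_norm f = sqrt (LINT x|lborel. (norm (f x))\<^sup>2)"

text \<open>
  The membership clause is needed because the Bochner integral of a non-integrable function is 0.
\<close>

definition L2_tendsto ::
  "('i \<Rightarrow> real \<Rightarrow> 'a::{banach, second_countable_topology}) \<Rightarrow> (real \<Rightarrow> 'a) \<Rightarrow> 'i filter \<Rightarrow> bool" where
  "L2_tendsto G g F \<longleftrightarrow>
     (\<forall>\<^sub>F i in F. (\<lambda>x. G i x - g x) \<in> L2) \<and>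
     ((\<lambda>i. L2_norm (\<lambda>x. G i x - g x)) \<longlongrightarrow> 0) F"

definition fourier :: "(real \<Rightarrow> complex) \<Rightarrow> real \<Rightarrow> complex" where
  "fourier f \<xi> = (LINT x|lborel. cis (- (x * \<xi>)) * f x) / complex_of_real (sqrt (2 * pi))"

text \<open>
  The Fourier--Plancherel transform on $L^2$, as the $L^2$-limit of the transforms of truncations.
  It is determined up to null sets.
\<close>

definition has_fourier_L2 :: "(real \<Rightarrow> complex) \<Rightarrow> (real \<Rightarrow> complex) \<Rightarrow> bool" where
  "has_fourier_L2 f F \<longleftrightarrow> f \<in> L2 \<and> F \<in> L2 \<and>
     L2_tendsto (\<lambda>n::nat. fourier (\<lambda>x. indicator {- real n..real n} x * f x)) F sequentially"

definition fourier_L2 :: "(real \<Rightarrow> complex) \<Rightarrow> real \<Rightarrow> complex" where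
  "fourier_L2 f = (SOME F. has_fourier_L2 f F)"

text \<open>
  $H^s = (1 - \partial_x^2)^{-s/2} L^2$ for $s \ge 0$, the range in which all its elements are
  functions in $L^2$; the Bessel potential has the Fourier symbol $(1 + \xi^2)^{-s/2}$.
\<close>

definition sobolev :: "real \<Rightarrow> (real \<Rightarrow> complex) set" where
  "sobolev s = {f. \<exists>F. has_fourier_L2 f F \<and>
     (\<lambda>\<xi>. complex_of_real ((1 + \<xi>\<^sup>2) powr (s / 2)) * F \<xi>) \<in> L2}"

definition sobolev_norm :: "real \<Rightarrow> (real \<Rightarrow> complex) \<Rightarrow> real" where
  "sobolev_norm s f = L2_norm (\<lambda>\<xi>. complex_of_real ((1 + \<xi>\<^sup>2) powr (s / 2)) * fourier_L2 f \<xi>)"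

text \<open>
  The weighted spaces $\dot Z_{s,r}$. Integrability, which gives a meaning to $\hat f(0)$, follows
  from the other conditions when $r > 1/2$.
\<close>

definition Zdot :: "real \<Rightarrow> real \<Rightarrow> (real \<Rightarrow> complex) set" where
  "Zdot s r = {f. f \<in> sobolev s \<and> (\<lambda>x. complex_of_real (\<bar>x\<bar> powr r) * f x) \<in> L2 \<and>
     integrable lborel f \<and> fourier f 0 = 0}"

definition Zdot_norm :: "real \<Rightarrow> real \<Rightarrow> (real \<Rightarrow> complex) \<Rightarrow> real" where
  "Zdot_norm s r f = sobolev_norm s f + L2_norm (\<lambda>x. complex_of_real (\<bar>x\<bar> powr r) * f x)"

definition Zdot_curves :: "real \<Rightarrow> real \<Rightarrow> (real \<Rightarrow> real \<Rightarrow> complex) set" where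
  "Zdot_curves s r = {U. (\<forall>t. U t \<in> Zdot s r) \<and>
     (\<forall>t. ((\<lambda>\<tau>. Zdot_norm s r (\<lambda>x. U \<tau> x - U t x)) \<longlongrightarrow> 0) (at t))}"

definition hilbert :: "(real \<Rightarrow> real) \<Rightarrow> real \<Rightarrow> real" where
  "hilbert f x =
     1 / pi * Lim (at_right 0) (\<lambda>\<epsilon>. LINT y:{y. \<epsilon> \<le> \<bar>y\<bar>}|lborel. f (x - y) / y)"

definition test_function :: "(real \<Rightarrow> real) \<Rightarrow> bool" where
  "test_function \<phi> \<longleftrightarrow>
     (\<forall>k x. ((deriv ^^ k) \<phi>) differentiable (at x)) \<and> compact (closure {x. \<phi> x \<noteq> 0})"

definition locally_integrable :: "(real \<Rightarrow> real) \<Rightarrow> bool" where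
  "locally_integrable f \<longleftrightarrow> (\<forall>a b. set_integrable lborel {a..b} f)"

definition has_weak_deriv :: "(real \<Rightarrow> real) \<Rightarrow> (real \<Rightarrow> real) \<Rightarrow> bool" where
  "has_weak_deriv f g \<longleftrightarrow> locally_integrable f \<and> locally_integrable g \<and>
     (\<forall>\<phi>. test_function \<phi> \<longrightarrow>
        (LINT x|lborel. f x * deriv \<phi> x) = - (LINT x|lborel. g x * \<phi> x))"

text \<open>
  Strong solutions of the initial value problem for
  $\partial_t u + \mathcal{H} \partial_x^2 u + u \partial_x u = 0$: here \<open>u t x\<close> is $u(x,t)$, the
  time derivative is the limit of difference quotients in $L^2$, and \<open>v\<close>, \<open>w\<close> are the first and
  second derivatives of \<open>u t\<close> in $x$.
\<close>

definition benjamin_ono_solution :: "(real \<Rightarrow> real) \<Rightarrow> (real \<Rightarrow> real \<Rightarrow> real) \<Rightarrow> bool" where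
  "benjamin_ono_solution u0 u \<longleftrightarrow>
     (AE x in lborel. u 0 x = u0 x) \<and>
     (\<forall>t. \<exists>v w. has_weak_deriv (u t) v \<and> has_weak_deriv v w \<and>
        L2_tendsto (\<lambda>h x. (u (t + h) x - u t x) / h)
          (\<lambda>x. - hilbert w x - u t x * v x) (at 0))"

end

theory Submission
  imports Defs "HOL-Probability.Probability"
begin

text \<open>
  On the Fourier side and for $\xi > 0$, Duhamel's formula expresses $\hat u(T,\xi)$ through the chirps
  $e^{-i(T-s)\xi^2}$ applied to $\hat u_0$ and to $\xi\,\widehat{u^2}(s)$. Weighted interpolation
  between three moments and five derivatives of $u(s)$ shows that four $\xi$-derivatives of this
  expression are square integrable. As $u$ is real, $\hat u(T)$ on the left half line is the
  conjugate reflection, so $x^4 u(T) \in L^2$ as soon as the third derivative has no jump at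
  $\xi = 0$. By conservation of the $L^2$ norm the jump is a multiple of
  $T (\int x\,u_0\,dx + \frac{T}{4} \|u_0\|_2^2)$, which vanishes at $T = t^*$.
\<close>

text \<open>The dispersion relation \<open>\<eta> * \<bar>\<eta>\<bar>\<close> is not smooth at 0,
  but it equals \<xi>^2 for \<xi> > 0, so the right half of the transform extends smoothly to the
  whole line. The obstacle is that u(s) has no fourth moment to start from. In the nonlinearity, u^2
  has six moments, since these are shared between its factors, and the extra factor \<xi> is paid
  for by the derivatives of u. In the data, x^4 u_0 is only in L2; the fourth derivative is reached
  by averaging the transform over [\<xi>, \<xi> + h], with bounds uniform in h, and Fatou's lemma.
  Origin of t*: the third derivative of exp(a \<xi>^2 / 2) f at 0 is f''' + 3 a f'. With m the first
  moment and N the squared norm, the data contribute the real part -6 T m / sqrt(2 pi) and the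
  integral contributes -(T/2) 3 T N / sqrt(2 pi); here 1/2 comes from u u_x = (u^2)_x / 2, and 3 is
  6 times the integral of 1 - \<sigma> over [0, 1].\<close>

lemma integral_dominated_convergence_within:
  fixes s :: "'b::first_countable_topology \<Rightarrow> 'a \<Rightarrow> 'c::{banach, second_countable_topology}"
  assumes "f \<in> borel_measurable M" "\<And>t. s t \<in> borel_measurable M" "integrable M w"
    and lim: "\<And>x. x \<in> space M \<Longrightarrow> ((\<lambda>t. s t x) \<longlongrightarrow> f x) (at a within S)"
    and bd: "\<And>t x. t \<in> S \<Longrightarrow> x \<in> space M \<Longrightarrow> norm (s t x) \<le> w x"
  shows "((\<lambda>t. LINT x|M. s t x) \<longlongrightarrow> (LINT x|M. f x)) (at a within S)"
  unfolding tendsto_at_iff_sequentially comp_def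
proof (intro allI impI)
  fix X :: "nat \<Rightarrow> 'b" assume X: "\<forall>i. X i \<in> S - {a}" "X \<longlonglongrightarrow> a"
  have "\<And>x. x \<in> space M \<Longrightarrow> (\<lambda>i. s (X i) x) \<longlonglongrightarrow> f x"
    using lim X unfolding tendsto_at_iff_sequentially comp_def by blast
  then show "(\<lambda>i. LINT x|M. s (X i) x) \<longlonglongrightarrow> (LINT x|M. f x)"
    using X bd by (intro integral_dominated_convergence[where w=w] assms AE_I2) auto
qed

lemma continuous_on_LINT:
  fixes s :: "'b::first_countable_topology \<Rightarrow> 'a \<Rightarrow> 'c::{banach, second_countable_topology}"
  assumes "\<And>t. s t \<in> borel_measurable M" "integrable M w"
    and "\<And>x. x \<in> space M \<Longrightarrow> continuous_on UNIV (\<lambda>t. s t x)"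
    and "\<And>t x. x \<in> space M \<Longrightarrow> norm (s t x) \<le> w x"
  shows "continuous_on UNIV (\<lambda>t. LINT x|M. s t x)"
  unfolding continuous_on_def using assms
  by (auto intro!: integral_dominated_convergence_within[where w=w] simp: continuous_on_def)

lemma borel_measurable_cis [measurable (raw)]:
  "f \<in> borel_measurable M \<Longrightarrow> (\<lambda>x. cis (f x)) \<in> borel_measurable M"
  by (rule borel_measurable_continuous_on[of cis]) (auto intro: continuous_intros)

lemma integrable_cis_mult_iff [simp]:
  fixes f :: "'a \<Rightarrow> complex"
  assumes [measurable]: "a \<in> borel_measurable M"
  shows "integrable M (\<lambda>x. cis (a x) * f x) \<longleftrightarrow> integrable M f"
proof
  assume *: "integrable M (\<lambda>x. cis (a x) * f x)"
  have "integrable M (\<lambda>x. cis (- a x) * (cis (a x) * f x))"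
    using * by (rule Bochner_Integration.integrable_bound) (use * in \<open>auto simp: norm_mult\<close>)
  then show "integrable M f" by (simp add: mult.assoc[symmetric] cis_mult)
next
  assume f: "integrable M f"
  show "integrable M (\<lambda>x. cis (a x) * f x)"
    using f by (rule Bochner_Integration.integrable_bound) (use f in \<open>auto simp: norm_mult\<close>)
qed

subsection \<open>The Fourier transform of integrable functions\<close>

lemma fourier_cong_AE:
  assumes "AE x in lborel. f x = g x" "f \<in> borel_measurable lborel" "g \<in> borel_measurable lborel"
  shows "fourier f = fourier g"
proof
  fix \<xi>
  have [measurable]: "f \<in> borel_measurable borel" "g \<in> borel_measurable borel" using assms by auto
  have "(LINT x|lborel. cis (- (x * \<xi>)) * f x) = (LINT x|lborel. cis (- (x * \<xi>)) * g x)"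
    by (rule integral_cong_AE) (use assms(1) in auto)
  then show "fourier f \<xi> = fourier g \<xi>" by (simp add: fourier_def)
qed

lemma norm_fourier_le:
  "norm (fourier f \<xi>) \<le> (LINT x|lborel. norm (f x)) / sqrt (2 * pi)"
proof -
  have "norm (LINT x|lborel. cis (- (x * \<xi>)) * f x) \<le> (LINT x|lborel. norm (f x))"
    using integral_norm_bound[of lborel "\<lambda>x. cis (- (x * \<xi>)) * f x"] by (simp add: norm_mult)
  then show ?thesis by (simp add: fourier_def norm_divide divide_right_mono)
qed

lemma fourier_add:
  assumes "integrable lborel f" "integrable lborel g"
  shows "fourier (\<lambda>x. f x + g x) \<xi> = fourier f \<xi> + fourier g \<xi>"
  using assms by (simp add: fourier_def distrib_left add_divide_distrib)

lemma fourier_diff: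
  assumes "integrable lborel f" "integrable lborel g"
  shows "fourier (\<lambda>x. f x - g x) \<xi> = fourier f \<xi> - fourier g \<xi>"
  using assms by (simp add: fourier_def right_diff_distrib diff_divide_distrib)

lemma fourier_cmult:
  "fourier (\<lambda>x. c * f x) \<xi> = c * fourier f \<xi>"
  by (simp add: fourier_def mult.left_commute[of _ c])

lemma continuous_on_fourier:
  assumes "integrable lborel f"
  shows "continuous_on UNIV (fourier f)"
proof -
  have [measurable]: "f \<in> borel_measurable borel" using assms by auto
  have "continuous_on UNIV (\<lambda>\<xi>. LINT x|lborel. cis (- (x * \<xi>)) * f x)"
    using assms by (intro continuous_on_LINT[where w="\<lambda>x. norm (f x)"])
       (auto intro!: continuous_intros simp: norm_mult)
  then show ?thesis unfolding fourier_def[abs_def] by (intro continuous_intros) auto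
qed

lemma continuous_on_fourier' [continuous_intros]:
  assumes "integrable lborel f" "continuous_on S g"
  shows "continuous_on S (\<lambda>x. fourier f (g x))"
  using continuous_on_compose2[OF continuous_on_fourier[OF assms(1)] assms(2)] by auto

lemma borel_measurable_fourier [measurable]:
  assumes [measurable]: "f \<in> borel_measurable borel"
  shows "fourier f \<in> borel_measurable borel"
  unfolding fourier_def[abs_def] by measurable

text \<open>A chord is no longer than its arc; read off from the zeroth-order Taylor remainder of
  the exponential.\<close>

lemma norm_cis_diff_le: "norm (cis a - cis b) \<le> \<bar>a - b\<bar>"
proof -
  have "cis (a-b) - 1 = iexp (a-b) - (\<Sum>k\<le>0. (\<i> * (a-b))^k / fact k)"
    by (simp add: cis_conv_exp)
  then have "norm (cis (a-b) - 1) \<le> \<bar>a-b\<bar>"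
    using iexp_approx1[of "a-b" 0] by simp
  moreover have "cis a - cis b = cis b * (cis (a-b) - 1)"
    by (simp add: algebra_simps cis_mult)
  ultimately show ?thesis by (simp add: norm_mult)
qed

text \<open>Difference quotients are the form in which dominated convergence and L2 limits deliver
  derivatives below.\<close>

lemma has_vector_derivative_at_iff:
  fixes f :: "real \<Rightarrow> 'a::real_normed_vector"
  shows "(f has_vector_derivative D) (at x) \<longleftrightarrow> ((\<lambda>h. (f (x + h) - f x) /\<^sub>R h) \<longlongrightarrow> D) (at 0)"
proof -
  have "norm (f (x + h) - f x - h *\<^sub>R D) / norm h = norm ((f (x + h) - f x) /\<^sub>R h - D)" if "h \<noteq> 0" for h
  proof -
    have "(f (x + h) - f x) /\<^sub>R h - D = (f (x + h) - f x - h *\<^sub>R D) /\<^sub>R h"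
      using that by (simp add: scaleR_diff_right)
    then show ?thesis by (simp add: divide_inverse mult.commute)
  qed
  then have "(\<lambda>h. norm (f (x + h) - f x - h *\<^sub>R D) / norm h) \<midarrow>0\<rightarrow> 0 \<longleftrightarrow>
     (\<lambda>h. norm ((f (x + h) - f x) /\<^sub>R h - D)) \<midarrow>0\<rightarrow> 0"
    by (intro LIM_cong) auto
  then show ?thesis
    unfolding has_vector_derivative_def has_derivative_at
    by (simp add: bounded_linear_scaleR_left tendsto_norm_zero_iff LIM_zero_iff)
qed

text \<open>Differentiation under the integral sign: the difference quotients of the kernel are
  bounded by |x| uniformly in h, so \<open>x * f x\<close> is a majorant.\<close>

lemma fourier_has_vector_derivative:
  assumes f: "integrable lborel f" and xf: "integrable lborel (\<lambda>x. x * f x)"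
  shows "(fourier f has_vector_derivative fourier (\<lambda>x. - \<i> * x * f x) \<xi>) (at \<xi>)"
proof -
  have [measurable]: "f \<in> borel_measurable borel" using f by auto
  have eq: "(\<lambda>h. (fourier f (\<xi> + h) - fourier f \<xi>) /\<^sub>R h) =
     (\<lambda>h. (LINT x|lborel. ((cis (- (x * (\<xi> + h))) - cis (- (x * \<xi>))) /\<^sub>R h) * f x) / complex_of_real (sqrt (2 * pi)))"
  proof
    fix h
    have "(LINT x|lborel. ((cis (- (x * (\<xi> + h))) - cis (- (x * \<xi>))) /\<^sub>R h) * f x)
       = (LINT x|lborel. (cis (- (x * (\<xi> + h))) * f x - cis (- (x * \<xi>)) * f x) /\<^sub>R h)"
      by (intro Bochner_Integration.integral_cong) (auto simp: algebra_simps)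
    also have "\<dots> = ((LINT x|lborel. cis (- (x * (\<xi> + h))) * f x) - (LINT x|lborel. cis (- (x * \<xi>)) * f x)) /\<^sub>R h"
      using f by (subst integral_scaleR_right, subst Bochner_Integration.integral_diff) auto
    finally have key: "(LINT x|lborel. ((cis (- (x * (\<xi> + h))) - cis (- (x * \<xi>))) /\<^sub>R h) * f x)
       = ((LINT x|lborel. cis (- (x * (\<xi> + h))) * f x) - (LINT x|lborel. cis (- (x * \<xi>)) * f x)) /\<^sub>R h" .
    show "(fourier f (\<xi> + h) - fourier f \<xi>) /\<^sub>R h = 
      (LINT x|lborel. ((cis (- (x * (\<xi> + h))) - cis (- (x * \<xi>))) /\<^sub>R h) * f x) / complex_of_real (sqrt (2 * pi))"
      unfolding key unfolding fourier_def scaleR_conv_of_real divide_inverse left_diff_distrib right_diff_distrib mult.assoc ..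
  qed
  have "((\<lambda>h. LINT x|lborel. ((cis (- (x * (\<xi> + h))) - cis (- (x * \<xi>))) /\<^sub>R h) * f x)
     \<longlongrightarrow> (LINT x|lborel. cis (- (x * \<xi>)) * (- \<i> * x * f x))) (at 0)"
  proof (rule integral_dominated_convergence_within[where w="\<lambda>x. norm (x * f x)"])
    fix x :: real
    have "((\<lambda>\<xi>. cis (- (x * \<xi>))) has_vector_derivative cis (- (x * \<xi>)) * (- \<i> * x)) (at \<xi>)"
      unfolding has_vector_derivative_def
      by (auto intro!: derivative_eq_intros simp: fun_eq_iff scaleR_conv_of_real mult_ac)
    then have "((\<lambda>h. (cis (- (x * (\<xi> + h))) - cis (- (x * \<xi>))) /\<^sub>R h) \<longlongrightarrow> cis (- (x * \<xi>)) * (- \<i> * x)) (at 0)"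
      by (simp add: has_vector_derivative_at_iff)
    then show "((\<lambda>h. ((cis (- (x * (\<xi> + h))) - cis (- (x * \<xi>))) /\<^sub>R h) * f x) \<longlongrightarrow> cis (- (x * \<xi>)) * (- \<i> * x * f x)) (at 0)"
      by (auto dest: tendsto_mult_right[of _ _ _ "f x"] simp: mult.assoc)
  next
    fix h x :: real
    show "norm (((cis (- (x * (\<xi> + h))) - cis (- (x * \<xi>))) /\<^sub>R h) * f x) \<le> norm (x * f x)"
    proof -
      \<comment> \<open>The majorant is required for every h, including h = 0, where the quotient is
        0 because \<open>inverse 0 = 0\<close>.\<close>
      have "norm ((cis (- (x * (\<xi> + h))) - cis (- (x * \<xi>))) /\<^sub>R h) \<le> \<bar>x\<bar>"
        using norm_cis_diff_le[of "- (x * (\<xi> + h))" "- (x * \<xi>)"]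
        by (cases "h = 0") (auto simp: divide_inverse_commute[symmetric] divide_simps abs_mult algebra_simps simp del: scaleR_right_diff_distrib scaleR_diff_right)
      from mult_right_mono[OF this norm_ge_zero[of "f x"]] show ?thesis
        by (simp only: norm_mult norm_of_real)
    qed
  qed (use xf in auto)
  then have "((\<lambda>h. (fourier f (\<xi> + h) - fourier f \<xi>) /\<^sub>R h) \<longlongrightarrow> fourier (\<lambda>x. - \<i> * x * f x) \<xi>) (at 0)"
    unfolding eq unfolding fourier_def by (intro tendsto_intros) auto
  then show ?thesis by (simp add: has_vector_derivative_at_iff)
qed

lemma fourier_cis_shift:
  "fourier (\<lambda>x. cis (- (h * x)) * f x) \<xi> = fourier f (\<xi> + h)"
proof -
  have *: "cis (- (x * \<xi>)) * (cis (- (h * x)) * f x) = cis (- (x * (\<xi> + h))) * f x" for x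
    unfolding mult.assoc[symmetric] cis_mult by (simp add: algebra_simps)
  show ?thesis unfolding fourier_def * ..
qed

lemma fourier_cnj: "fourier (\<lambda>x. cnj (f x)) \<xi> = cnj (fourier f (- \<xi>))"
proof -
  have "(LINT x|lborel. cis (- (x * \<xi>)) * cnj (f x)) = (LINT x|lborel. cnj (cis (x * \<xi>) * f x))"
    by (simp add: cis_cnj)
  also have "\<dots> = cnj (LINT x|lborel. cis (x * \<xi>) * f x)" by (rule Bochner_Integration.integral_cnj)
  finally show ?thesis by (simp add: fourier_def)
qed

lemma fourier_of_real_minus:
  "fourier (\<lambda>x. complex_of_real (f x)) (- \<xi>) = cnj (fourier (\<lambda>x. complex_of_real (f x)) \<xi>)"
  using fourier_cnj[of "\<lambda>x. complex_of_real (f x)" "- \<xi>"] by simp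

lemma integrable_pair_mult:
  fixes f g :: "real \<Rightarrow> complex"
  assumes f: "integrable lborel f" and g: "integrable lborel g"
  shows "integrable (lborel \<Otimes>\<^sub>M lborel) (\<lambda>(x, y). f x * g y)"
proof -
  have [measurable]: "f \<in> borel_measurable borel" "g \<in> borel_measurable borel" using assms by auto
  show ?thesis
    by (rule lborel_pair.Fubini_integrable) (use f g in \<open>auto simp: norm_mult\<close>)
qed

text \<open>The kernel is symmetric in the two variables, so Fubini's theorem moves the transform
  from one factor to the other. Inversion, Plancherel and the convolution theorem below all come
  from this identity with a suitable g.\<close>

lemma fourier_multiplication:
  assumes f: "integrable lborel f" and g: "integrable lborel g"
  shows "(LINT \<xi>|lborel. fourier f \<xi> * g \<xi>) = (LINT x|lborel. f x * fourier g x)"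
proof -
  have [measurable]: "f \<in> borel_measurable borel" "g \<in> borel_measurable borel" using assms by auto
  have int: "integrable (lborel \<Otimes>\<^sub>M lborel) (\<lambda>(x, y). cis (- (x * y)) * (f x * g y))"
    using integrable_pair_mult[OF f g] unfolding case_prod_beta
    by (subst integrable_cis_mult_iff) (auto simp: case_prod_beta)
  have "(LINT \<xi>|lborel. fourier f \<xi> * g \<xi>) = 
     (LINT \<xi>|lborel. LINT x|lborel. cis (- (x * \<xi>)) * (f x * g \<xi>)) / complex_of_real (sqrt (2 * pi))"
    by (simp add: fourier_def mult.assoc[symmetric])
  also have "(LINT \<xi>|lborel. LINT x|lborel. cis (- (x * \<xi>)) * (f x * g \<xi>))
    = (LINT x|lborel. LINT \<xi>|lborel. cis (- (x * \<xi>)) * (f x * g \<xi>))"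
    by (rule lborel_pair.Fubini_integral[OF int])
  also have "\<dots> / complex_of_real (sqrt (2 * pi)) = (LINT x|lborel. f x * fourier g x)"
  proof -
    have "(LINT \<xi>|lborel. cis (- (x * \<xi>)) * (f x * g \<xi>)) = f x * (LINT \<xi>|lborel. cis (- (\<xi> * x)) * g \<xi>)" for x
      unfolding integral_mult_right_zero[symmetric] by (simp add: mult_ac)
    then show ?thesis by (simp add: fourier_def)
  qed
  finally show ?thesis .
qed

subsection \<open>Gaussian averages\<close>

text \<open>The expectation of f(x + \<epsilon> Z) for a standard normal Z, that is, f convolved
  with a Gaussian of width \<epsilon>. Keeping the density fixed and scaling the argument lets
  dominated convergence handle \<epsilon> -> 0.\<close>

definition gauss_avg :: "real \<Rightarrow> (real \<Rightarrow> complex) \<Rightarrow> real \<Rightarrow> complex" where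
  "gauss_avg \<epsilon> f x = (LINT z|lborel. complex_of_real (std_normal_density z) * f (x + \<epsilon> * z))"

abbreviation gaussian :: "real \<Rightarrow> complex" where
  "gaussian x \<equiv> complex_of_real (exp (- x\<^sup>2 / 2))"

lemma integrable_gaussian: "\<epsilon> \<noteq> 0 \<Longrightarrow> integrable lborel (\<lambda>x. gaussian (\<epsilon> * x))"
proof -
  assume "\<epsilon> \<noteq> 0"
  have "integrable lborel (\<lambda>x. sqrt (2 * pi) * std_normal_density x)" by simp
  then have "integrable lborel (\<lambda>x::real. exp (- x\<^sup>2 / 2))" by (simp add: std_normal_density_def)
  then have "integrable lborel gaussian" by (rule integrable_of_real)
  then show ?thesis
    using lborel_integrable_real_affine[of gaussian \<epsilon> 0] \<open>\<epsilon> \<noteq> 0\<close> by simp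
qed

text \<open>Taken from the characteristic function of the standard normal distribution; its density
  carries the same factor 1 / sqrt(2 pi) as \<open>fourier\<close>.\<close>

lemma fourier_gaussian: "fourier gaussian \<xi> = gaussian \<xi>"
proof -
  have "gaussian \<xi> = (LINT x|density lborel std_normal_density. cis (- (x * \<xi>)))"
    using fun_cong[OF char_std_normal_distribution, of "- \<xi>"]
    by (simp add: char_def cis_conv_exp mult_ac)
  also have "\<dots> = (LINT x|lborel. std_normal_density x *\<^sub>R cis (- (x * \<xi>)))"
    by (subst integral_density) auto
  also have "\<dots> = (LINT x|lborel. cis (- (x * \<xi>)) * gaussian x / complex_of_real (sqrt (2 * pi)))"
    by (intro Bochner_Integration.integral_cong) (auto simp: std_normal_density_def scaleR_conv_of_real)
  finally show ?thesis by (simp add: fourier_def)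
qed

lemma fourier_gaussian_scaled:
  assumes "\<epsilon> > 0"
  shows "fourier (\<lambda>x. gaussian (\<epsilon> * x)) \<xi> = gaussian (\<xi> / \<epsilon>) / \<epsilon>"
proof -
  have "(LINT x|lborel. cis (- (x * (\<xi> / \<epsilon>))) * gaussian x)
      = \<epsilon> *\<^sub>R (LINT x|lborel. cis (- (x * \<xi>)) * gaussian (\<epsilon> * x))"
    using assms by (subst lborel_integral_real_affine[of \<epsilon> _ 0]) auto
  then have "fourier gaussian (\<xi> / \<epsilon>) = \<epsilon> * fourier (\<lambda>x. gaussian (\<epsilon> * x)) \<xi>"
    by (simp add: fourier_def scaleR_conv_of_real)
  then show ?thesis using assms unfolding fourier_gaussian[of "\<xi> / \<epsilon>"] by simp
qed

text \<open>The inversion integral with a Gaussian cutoff converges for every integrable f, and it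
  produces an average of f around x because the transform of the modulated cutoff is a Gaussian
  centred at x.\<close>

lemma integral_fourier_gaussian:
  assumes f: "integrable lborel f" and "\<epsilon> > 0"
  shows "(LINT \<xi>|lborel. fourier f \<xi> * (cis (x * \<xi>) * gaussian (\<epsilon> * \<xi>))) = complex_of_real (sqrt (2 * pi)) * gauss_avg \<epsilon> f x"
proof -
  have int: "integrable lborel (\<lambda>\<xi>. cis (x * \<xi>) * gaussian (\<epsilon> * \<xi>))"
    using integrable_gaussian[of \<epsilon>] assms by simp
  have F: "fourier (\<lambda>\<xi>. cis (x * \<xi>) * gaussian (\<epsilon> * \<xi>)) y = gaussian ((y - x) / \<epsilon>) / \<epsilon>" for y
    using fourier_cis_shift[of "-x" "\<lambda>\<xi>. gaussian (\<epsilon> * \<xi>)" y] fourier_gaussian_scaled[OF \<open>\<epsilon> > 0\<close>, of "y - x"]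
    by (simp add: mult.commute)
  have "(LINT \<xi>|lborel. fourier f \<xi> * (cis (x * \<xi>) * gaussian (\<epsilon> * \<xi>))) =
     (LINT y|lborel. f y * (gaussian ((y - x) / \<epsilon>) / \<epsilon>))"
    unfolding fourier_multiplication[OF f int] F ..
  also have "\<dots> = \<epsilon> *\<^sub>R (LINT z|lborel. f (x + \<epsilon> * z) * (gaussian z / \<epsilon>))"
    using assms(2) by (subst lborel_integral_real_affine[of \<epsilon> _ x]) auto
  also have "\<dots> = (LINT z|lborel. complex_of_real (sqrt (2 * pi)) * (complex_of_real (std_normal_density z) * f (x + \<epsilon> * z)))"
    unfolding integral_scaleR_right[symmetric] using assms(2)
    by (intro Bochner_Integration.integral_cong) (auto simp: std_normal_density_def scaleR_conv_of_real)
  also have "\<dots> = complex_of_real (sqrt (2 * pi)) * gauss_avg \<epsilon> f x" unfolding gauss_avg_def by (rule integral_mult_right_zero)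
  finally show ?thesis .
qed

lemma gauss_avg_integrand_le:
  assumes bd: "\<And>y. norm (f y) \<le> C * (1 + y\<^sup>2)" and \<epsilon>: "\<bar>\<epsilon>\<bar> \<le> 1"
  shows "norm (complex_of_real (std_normal_density z) * f (x + \<epsilon> * z)) \<le> C * (std_normal_density z * (1 + 2 * x\<^sup>2 + 2 * z\<^sup>2))"
proof -
  have C0: "C \<ge> 0" using order_trans[OF norm_ge_zero bd[of 0]] by simp
  have "\<epsilon>\<^sup>2 \<le> 1" using \<epsilon> by (simp add: abs_square_le_1)
  then have "(\<epsilon> * z)\<^sup>2 \<le> z\<^sup>2" by (simp add: power_mult_distrib mult_left_le_one_le)
  moreover have "0 \<le> (x - \<epsilon> * z)\<^sup>2" by simp
  ultimately have "1 + (x + \<epsilon> * z)\<^sup>2 \<le> 1 + 2 * x\<^sup>2 + 2 * z\<^sup>2" unfolding power2_sum power2_diff by linarith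
  then have "C * (1 + (x + \<epsilon> * z)\<^sup>2) \<le> C * (1 + 2 * x\<^sup>2 + 2 * z\<^sup>2)" by (rule mult_left_mono) (rule C0)
  then have "norm (f (x + \<epsilon> * z)) \<le> C * (1 + 2 * x\<^sup>2 + 2 * z\<^sup>2)" using bd[of "x + \<epsilon> * z"] by linarith
  then have "std_normal_density z * norm (f (x + \<epsilon> * z)) \<le> std_normal_density z * (C * (1 + 2 * x\<^sup>2 + 2 * z\<^sup>2))"
    by (rule mult_left_mono) simp
  then show ?thesis by (simp add: norm_mult algebra_simps)
qed

lemma integrable_gauss_avg_bound: "integrable lborel (\<lambda>z. C * (std_normal_density z * (1 + 2 * x\<^sup>2 + 2 * z\<^sup>2)))"
proof -
  have "integrable lborel (\<lambda>z. (1 + 2 * x\<^sup>2) * std_normal_density z + 2 * (std_normal_density z * z ^ 2))"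
    using integrable_std_normal_moment[of 2] by (intro Bochner_Integration.integrable_add integrable_mult_right) auto
  then show ?thesis by (intro integrable_mult_right) (simp add: algebra_simps)
qed

lemma norm_gauss_avg_le:
  assumes bd: "\<And>y. norm (f y) \<le> C * (1 + y\<^sup>2)" and \<epsilon>: "\<bar>\<epsilon>\<bar> \<le> 1"
  shows "norm (gauss_avg \<epsilon> f x) \<le> C * (LINT z|lborel. std_normal_density z * (1 + 2 * x\<^sup>2 + 2 * z\<^sup>2))"
proof -
  have "norm (gauss_avg \<epsilon> f x) \<le> (LINT z|lborel. norm (complex_of_real (std_normal_density z) * f (x + \<epsilon> * z)))"
    unfolding gauss_avg_def by (rule integral_norm_bound)
  also have "\<dots> \<le> (LINT z|lborel. C * (std_normal_density z * (1 + 2 * x\<^sup>2 + 2 * z\<^sup>2)))"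
    using gauss_avg_integrand_le[OF assms] order_trans[OF norm_ge_zero gauss_avg_integrand_le[OF assms]]
    by (intro integral_mono_AE'[OF integrable_gauss_avg_bound] AE_I2)
  finally show ?thesis by simp
qed

lemma gauss_avg_tendsto:
  assumes [measurable]: "f \<in> borel_measurable borel" and bd: "\<And>x. norm (f x) \<le> C * (1 + x\<^sup>2)"
    and c: "isCont f x" and \<epsilon>: "\<epsilon> \<longlonglongrightarrow> 0" "\<And>n. \<bar>\<epsilon> n\<bar> \<le> 1"
  shows "(\<lambda>n. gauss_avg (\<epsilon> n) f x) \<longlonglongrightarrow> f x"
proof -
  have "(\<lambda>n. gauss_avg (\<epsilon> n) f x) \<longlonglongrightarrow> (LINT z|lborel. complex_of_real (std_normal_density z) * f x)"
    unfolding gauss_avg_def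
  proof (rule integral_dominated_convergence[OF _ _ integrable_gauss_avg_bound])
    show "AE z in lborel. (\<lambda>n. complex_of_real (std_normal_density z) * f (x + \<epsilon> n * z)) \<longlonglongrightarrow> complex_of_real (std_normal_density z) * f x"
    proof (intro AE_I2 tendsto_mult tendsto_const isCont_tendsto_compose[OF c])
      fix z
      have "(\<lambda>n. x + \<epsilon> n * z) \<longlonglongrightarrow> x + 0 * z" by (intro tendsto_intros \<epsilon>)
      then show "(\<lambda>n. x + \<epsilon> n * z) \<longlonglongrightarrow> x" by simp
    qed
    show "AE z in lborel. norm (complex_of_real (std_normal_density z) * f (x + \<epsilon> n * z)) \<le> C * (std_normal_density z * (1 + 2 * x\<^sup>2 + 2 * z\<^sup>2))" for n
      by (intro AE_I2 gauss_avg_integrand_le bd \<epsilon>)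
  qed measurable
  also have "(LINT z|lborel. complex_of_real (std_normal_density z) * f x) = f x"
    using integral_normal_density[of 1 0] by (simp del: integral_normal_density)
  finally show ?thesis .
qed

section \<open>Plancherel's identity for integrable functions\<close>

lemma nn_integral_std_normal: "(\<integral>\<^sup>+x. ennreal (std_normal_density x) \<partial>lborel) = 1"
  by (subst nn_integral_eq_integral) auto

text \<open>The squared L2 norm with values in \<open>ennreal\<close>: it is meaningful before
  square integrability is known, so Tonelli and Fatou apply freely and membership in
  \<open>L2\<close> is obtained as a finite bound.\<close>

definition sqn :: "(real \<Rightarrow> 'a::real_normed_vector) \<Rightarrow> ennreal" where
  "sqn f = (\<integral>\<^sup>+x. ennreal ((norm (f x))\<^sup>2) \<partial>lborel)"

lemma sqn_shift:
  assumes [measurable]: "(f :: real \<Rightarrow> 'a::{second_countable_topology, real_normed_vector}) \<in> borel_measurable borel"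
  shows "sqn (\<lambda>x. f (x + h)) = sqn f"
  unfolding sqn_def by (subst (2) nn_integral_real_affine[of _ 1 h]) (auto simp: add.commute)

text \<open>Under the average, |f(x)| |f(x + \<epsilon> z)| is at most half the sum of the squares;
  translation invariance and the total mass 1 of the density do the rest.\<close>

lemma gauss_avg_sqn:
  assumes [measurable]: "f \<in> borel_measurable borel"
  shows "(\<integral>\<^sup>+x. ennreal (norm (f x) * norm (gauss_avg \<epsilon> f x)) \<partial>lborel) \<le> sqn f"
proof -
  have "(\<integral>\<^sup>+x. ennreal (norm (f x) * norm (gauss_avg \<epsilon> f x)) \<partial>lborel) \<le>
    (\<integral>\<^sup>+x. \<integral>\<^sup>+z. ennreal (std_normal_density z * (norm (f x) * norm (f (x + \<epsilon> * z)))) \<partial>lborel \<partial>lborel)"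
  proof (intro nn_integral_mono)
    fix x
    have "ennreal (norm (gauss_avg \<epsilon> f x)) \<le> (\<integral>\<^sup>+z. ennreal (std_normal_density z * norm (f (x + \<epsilon> * z))) \<partial>lborel)"
    \<comment> \<open>If the integrand is not integrable, the average has the default value 0 and
      the bound is trivial.\<close>
    proof (cases "integrable lborel (\<lambda>z. complex_of_real (std_normal_density z) * f (x + \<epsilon> * z))")
      case True
      then show ?thesis unfolding gauss_avg_def
        using integral_norm_bound_ennreal[OF True] by (simp add: norm_mult)
    qed (simp add: gauss_avg_def not_integrable_integral_eq)
    then have "ennreal (norm (f x)) * ennreal (norm (gauss_avg \<epsilon> f x)) \<le>
       ennreal (norm (f x)) * (\<integral>\<^sup>+z. ennreal (std_normal_density z * norm (f (x + \<epsilon> * z))) \<partial>lborel)"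
      by (rule mult_left_mono) simp
    also have "\<dots> = (\<integral>\<^sup>+z. ennreal (norm (f x)) * ennreal (std_normal_density z * norm (f (x + \<epsilon> * z))) \<partial>lborel)"
      by (rule nn_integral_cmult[symmetric]) simp
    finally show "ennreal (norm (f x) * norm (gauss_avg \<epsilon> f x)) \<le> 
      (\<integral>\<^sup>+z. ennreal (std_normal_density z * (norm (f x) * norm (f (x + \<epsilon> * z)))) \<partial>lborel)"
      by (simp add: ennreal_mult[symmetric] mult_ac)
  qed
  also have "\<dots> = (\<integral>\<^sup>+z. \<integral>\<^sup>+x. ennreal (std_normal_density z * (norm (f x) * norm (f (x + \<epsilon> * z)))) \<partial>lborel \<partial>lborel)"
    by (rule lborel_pair.Fubini') simp
  also have "\<dots> \<le> (\<integral>\<^sup>+z. ennreal (std_normal_density z) * sqn f \<partial>lborel)"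
  proof (intro nn_integral_mono)
    fix z
    have le: "norm (f x) * norm (f (x + \<epsilon> * z)) \<le> (norm (f x))\<^sup>2 / 2 + (norm (f (x + \<epsilon> * z)))\<^sup>2 / 2" for x
      using sum_squares_bound[of "norm (f x)" "norm (f (x + \<epsilon> * z))"] by simp
    have "(\<integral>\<^sup>+x. ennreal (norm (f x) * norm (f (x + \<epsilon> * z))) \<partial>lborel) \<le>
      (\<integral>\<^sup>+x. ennreal (1/2) * ennreal ((norm (f x))\<^sup>2) + ennreal (1/2) * ennreal ((norm (f (x + \<epsilon> * z)))\<^sup>2) \<partial>lborel)"
    proof (intro nn_integral_mono)
      fix x
      show "ennreal (norm (f x) * norm (f (x + \<epsilon> * z))) \<le> ennreal (1/2) * ennreal ((norm (f x))\<^sup>2) + ennreal (1/2) * ennreal ((norm (f (x + \<epsilon> * z)))\<^sup>2)"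
        using ennreal_leI[OF le[of x]] ennreal_mult[of "1/2" "(norm (f x))\<^sup>2"] ennreal_mult[of "1/2" "(norm (f (x + \<epsilon> * z)))\<^sup>2"]
        by (subst (asm) ennreal_plus) simp_all
    qed
    also have "\<dots> = ennreal (1/2) * sqn f + ennreal (1/2) * sqn (\<lambda>x. f (x + \<epsilon> * z))"
      unfolding sqn_def by (subst nn_integral_add) (auto simp: nn_integral_cmult)
    also have "\<dots> = sqn f"
      unfolding sqn_shift[OF assms] distrib_right[symmetric] 
      by (subst ennreal_plus[symmetric]) (auto simp del: ennreal_plus)
    finally have "(\<integral>\<^sup>+x. ennreal (norm (f x) * norm (f (x + \<epsilon> * z))) \<partial>lborel) \<le> sqn f" .
    then show "(\<integral>\<^sup>+x. ennreal (std_normal_density z * (norm (f x) * norm (f (x + \<epsilon> * z)))) \<partial>lborel) \<le> ennreal (std_normal_density z) * sqn f"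
      by (simp add: ennreal_mult nn_integral_cmult mult_left_mono)
  qed
  also have "\<dots> = sqn f" by (simp add: nn_integral_multc nn_integral_std_normal)
  finally show ?thesis .
qed

lemma borel_measurable_cnj [measurable (raw)]:
  "f \<in> borel_measurable M \<Longrightarrow> (\<lambda>x. cnj (f x)) \<in> borel_measurable M"
  by (rule borel_measurable_continuous_on[of cnj]) (auto intro: continuous_intros)

text \<open>The multiplication formula with the conjugate transform times a Gaussian as second
  function; the transform of that product is the conjugate of the Gaussian average of f.\<close>

lemma integral_norm_sq_fourier_gaussian:
  assumes f: "integrable lborel f" and "\<epsilon> > 0"
  shows "(LINT \<xi>|lborel. fourier f \<xi> * (cnj (fourier f \<xi>) * gaussian (\<epsilon> * \<xi>)))
     = (LINT x|lborel. f x * cnj (gauss_avg \<epsilon> f x))"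
proof -
  have [measurable]: "f \<in> borel_measurable borel" using f by auto
  let ?g = "\<lambda>\<xi>. cnj (fourier f \<xi>) * gaussian (\<epsilon> * \<xi>)"
  have g: "integrable lborel ?g"
  proof (rule Bochner_Integration.integrable_bound)
    show "integrable lborel (\<lambda>\<xi>. ((LINT x|lborel. norm (f x)) / sqrt (2 * pi)) * gaussian (\<epsilon> * \<xi>))"
      using integrable_gaussian[of \<epsilon>] assms(2) by (intro integrable_mult_right) auto
    show "AE \<xi> in lborel. norm (?g \<xi>) \<le> norm (complex_of_real ((LINT x|lborel. norm (f x)) / sqrt (2 * pi)) * gaussian (\<epsilon> * \<xi>))"
      unfolding norm_mult norm_of_real complex_mod_cnj
      by (intro AE_I2 mult_right_mono order_trans[OF norm_fourier_le]) auto
  qed measurable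
  have F: "fourier ?g x = cnj (gauss_avg \<epsilon> f x)" for x
  proof -
    have "fourier ?g x = cnj (LINT \<xi>|lborel. fourier f \<xi> * (cis (x * \<xi>) * gaussian (\<epsilon> * \<xi>))) / complex_of_real (sqrt (2 * pi))"
      unfolding fourier_def[of ?g] 
      by (subst Bochner_Integration.integral_cnj[symmetric]) (simp add: cis_cnj mult_ac)
    then show ?thesis unfolding integral_fourier_gaussian[OF assms] by simp
  qed
  show ?thesis unfolding fourier_multiplication[OF f g] F ..
qed

text \<open>Plancherel's identity with a Gaussian cutoff, valid for merely integrable f. Letting
  \<epsilon> tend to 0 gives the two inequalities that follow.\<close>

lemma sqn_gaussian_le:
  assumes f: "integrable lborel f" and "\<epsilon> > 0"
  shows "(\<integral>\<^sup>+\<xi>. ennreal ((norm (fourier f \<xi>))\<^sup>2 * exp (- (\<epsilon> * \<xi>)\<^sup>2 / 2)) \<partial>lborel)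
     = ennreal (Re (LINT x|lborel. f x * cnj (gauss_avg \<epsilon> f x)))"
proof -
  have [measurable]: "f \<in> borel_measurable borel" using f by auto
  let ?h = "\<lambda>\<xi>. (norm (fourier f \<xi>))\<^sup>2 * exp (- (\<epsilon> * \<xi>)\<^sup>2 / 2)"
  have eq: "fourier f \<xi> * (cnj (fourier f \<xi>) * gaussian (\<epsilon> * \<xi>)) = complex_of_real (?h \<xi>)" for \<xi>
    unfolding mult.assoc[symmetric] complex_norm_square[symmetric] of_real_mult ..
  have "integrable lborel ?h"
  proof (rule Bochner_Integration.integrable_bound)
    show "integrable lborel (\<lambda>\<xi>. (((LINT x|lborel. norm (f x)) / sqrt (2 * pi))^2) * exp (- (\<epsilon> * \<xi>)\<^sup>2 / 2))"
      using integrable_norm[OF integrable_gaussian[of \<epsilon>]] assms(2) by (intro integrable_mult_right) auto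
    show "AE \<xi> in lborel. norm (?h \<xi>) \<le> norm ((((LINT x|lborel. norm (f x)) / sqrt (2 * pi))^2) * exp (- (\<epsilon> * \<xi>)\<^sup>2 / 2))"
      using norm_fourier_le[of f] by (intro AE_I2) (simp add: power_mono del: power_divide)
  qed measurable
  then have "(\<integral>\<^sup>+\<xi>. ennreal (?h \<xi>) \<partial>lborel) = ennreal (LINT \<xi>|lborel. ?h \<xi>)"
    by (rule nn_integral_eq_integral) simp
  moreover have "(LINT x|lborel. f x * cnj (gauss_avg \<epsilon> f x)) = complex_of_real (LINT \<xi>|lborel. ?h \<xi>)"
    unfolding integral_norm_sq_fourier_gaussian[OF assms, symmetric] eq by (rule integral_complex_of_real)
  ultimately show ?thesis by (simp only: Re_complex_of_real)
qed

text \<open>The cutoff is removed by Fatou's lemma, which yields one inequality only, but for every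
  integrable f whether or not \<open>sqn f\<close> is finite.\<close>

lemma Plancherel_le:
  assumes f: "integrable lborel f"
  shows "sqn (fourier f) \<le> sqn f"
proof -
  have [measurable]: "f \<in> borel_measurable borel" using f by auto
  define \<epsilon> where "\<epsilon> n = 1 / real (Suc n)" for n
  have \<epsilon>: "\<epsilon> n > 0" "\<epsilon> \<longlonglongrightarrow> 0" for n unfolding \<epsilon>_def using LIMSEQ_inverse_real_of_nat by (auto simp: inverse_eq_divide)
  have le: "(\<integral>\<^sup>+\<xi>. ennreal ((norm (fourier f \<xi>))\<^sup>2 * exp (- (\<epsilon> n * \<xi>)\<^sup>2 / 2)) \<partial>lborel) \<le> sqn f" for n
  proof (cases "integrable lborel (\<lambda>x. f x * cnj (gauss_avg (\<epsilon> n) f x))")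
    case True
    have "ennreal (Re (LINT x|lborel. f x * cnj (gauss_avg (\<epsilon> n) f x))) \<le> ennreal (norm (LINT x|lborel. f x * cnj (gauss_avg (\<epsilon> n) f x)))"
      by (intro ennreal_leI complex_Re_le_cmod)
    also have "\<dots> \<le> (\<integral>\<^sup>+x. ennreal (norm (f x) * norm (gauss_avg (\<epsilon> n) f x)) \<partial>lborel)"
      using integral_norm_bound_ennreal[OF True] by (simp add: norm_mult)
    also have "\<dots> \<le> sqn f" by (rule gauss_avg_sqn) simp
    finally show ?thesis unfolding sqn_gaussian_le[OF f \<epsilon>(1)] .
  next
    case False
    then show ?thesis unfolding sqn_gaussian_le[OF f \<epsilon>(1)] by (simp add: not_integrable_integral_eq)
  qed
  have lim: "(\<lambda>n. ennreal ((norm (fourier f \<xi>))\<^sup>2 * exp (- (\<epsilon> n * \<xi>)\<^sup>2 / 2))) \<longlonglongrightarrow> ennreal ((norm (fourier f \<xi>))\<^sup>2)" for \<xi>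
  proof (rule tendsto_ennrealI)
    have "(\<lambda>n. (norm (fourier f \<xi>))\<^sup>2 * exp (- (\<epsilon> n * \<xi>)\<^sup>2 / 2)) \<longlonglongrightarrow> (norm (fourier f \<xi>))\<^sup>2 * exp (- (0 * \<xi>)\<^sup>2 / 2)"
      by (intro tendsto_intros \<epsilon>) auto
    then show "(\<lambda>n. (norm (fourier f \<xi>))\<^sup>2 * exp (- (\<epsilon> n * \<xi>)\<^sup>2 / 2)) \<longlonglongrightarrow> (norm (fourier f \<xi>))\<^sup>2" by simp
  qed
  have "sqn (fourier f) = (\<integral>\<^sup>+\<xi>. liminf (\<lambda>n. ennreal ((norm (fourier f \<xi>))\<^sup>2 * exp (- (\<epsilon> n * \<xi>)\<^sup>2 / 2))) \<partial>lborel)"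
    unfolding sqn_def using lim_imp_Liminf[OF _ lim] by simp
  also have "\<dots> \<le> liminf (\<lambda>n. \<integral>\<^sup>+\<xi>. ennreal ((norm (fourier f \<xi>))\<^sup>2 * exp (- (\<epsilon> n * \<xi>)\<^sup>2 / 2)) \<partial>lborel)"
    by (rule nn_integral_liminf) simp
  also have "\<dots> \<le> sqn f" using le by (simp add: Liminf_le)
  finally show ?thesis .
qed

text \<open>The opposite inequality takes the limit on the side of f, where continuity and
  boundedness give dominated convergence of the averages. It serves to return from the transform to
  x at the end.\<close>

lemma Plancherel_ge:
  assumes f: "integrable lborel f" and c: "continuous_on UNIV f" and bd: "\<And>x. norm (f x) \<le> C"
  shows "sqn f \<le> sqn (fourier f)"
proof -
  have [measurable]: "f \<in> borel_measurable borel" using f by auto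
  define \<epsilon> where "\<epsilon> n = 1 / real (Suc n)" for n
  have \<epsilon>: "\<epsilon> n > 0" "\<epsilon> \<longlonglongrightarrow> 0" "\<bar>\<epsilon> n\<bar> \<le> 1" for n unfolding \<epsilon>_def using LIMSEQ_inverse_real_of_nat by (auto simp: inverse_eq_divide)
  have C0: "C \<ge> 0" using bd[of 0] norm_ge_zero[of "f 0"] by linarith
  have bd': "norm (f x) \<le> C * (1 + x\<^sup>2)" for x
    using bd[of x] C0 mult_left_mono[of 1 "1 + x\<^sup>2" C] by simp
  have ga: "norm (gauss_avg \<epsilon> f x) \<le> C" for \<epsilon> x
  proof -
    have "norm (gauss_avg \<epsilon> f x) \<le> (LINT z|lborel. std_normal_density z * C)"
      unfolding gauss_avg_def using bd
      by (intro order_trans[OF integral_norm_bound integral_mono'])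
         (auto simp: norm_mult mult_left_mono C0)
    then show ?thesis by simp
  qed
  have [measurable]: "(\<lambda>x. gauss_avg \<epsilon> f x) \<in> borel_measurable borel" for \<epsilon>
    unfolding gauss_avg_def by measurable
  have "(\<lambda>n. LINT x|lborel. f x * cnj (gauss_avg (\<epsilon> n) f x)) \<longlonglongrightarrow> (LINT x|lborel. f x * cnj (f x))"
  proof (rule integral_dominated_convergence[where w="\<lambda>x. norm (f x) * C"])
    show "AE x in lborel. (\<lambda>n. f x * cnj (gauss_avg (\<epsilon> n) f x)) \<longlonglongrightarrow> f x * cnj (f x)"
      using c by (intro AE_I2 tendsto_mult tendsto_const tendsto_cnj gauss_avg_tendsto[OF _ bd' _ \<epsilon>(2,3)]) 
        (auto simp: continuous_on_eq_continuous_at)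
    show "AE x in lborel. norm (f x * cnj (gauss_avg (\<epsilon> n) f x)) \<le> norm (f x) * C" for n
      using ga by (auto simp: norm_mult mult_left_mono)
  qed (use f in auto)
  then have "(\<lambda>n. ennreal (Re (LINT x|lborel. f x * cnj (gauss_avg (\<epsilon> n) f x)))) \<longlonglongrightarrow> ennreal (Re (LINT x|lborel. f x * cnj (f x)))"
    by (intro tendsto_ennrealI tendsto_Re)
  moreover have "ennreal (Re (LINT x|lborel. f x * cnj (gauss_avg (\<epsilon> n) f x))) \<le> sqn (fourier f)" for n
    unfolding sqn_gaussian_le[OF f \<epsilon>(1), symmetric] sqn_def
    by (intro nn_integral_mono ennreal_leI) (auto simp: mult_left_le)
  ultimately have "ennreal (Re (LINT x|lborel. f x * cnj (f x))) \<le> sqn (fourier f)"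
    by (intro LIMSEQ_le_const2) auto
  moreover have "sqn f = ennreal (Re (LINT x|lborel. f x * cnj (f x)))"
  proof -
    have i: "integrable lborel (\<lambda>x. (norm (f x))\<^sup>2)"
    proof (rule Bochner_Integration.integrable_bound)
      show "integrable lborel (\<lambda>x. C * norm (f x))" using f by simp
      show "AE x in lborel. norm ((norm (f x))\<^sup>2) \<le> norm (C * norm (f x))"
        using mult_right_mono[OF bd norm_ge_zero] C0 by (intro AE_I2) (simp add: power2_eq_square)
    qed simp
    have "(LINT x|lborel. f x * cnj (f x)) = complex_of_real (LINT x|lborel. (norm (f x))\<^sup>2)"
      unfolding complex_norm_square[symmetric] by (rule integral_complex_of_real)
    moreover have "sqn f = ennreal (LINT x|lborel. (norm (f x))\<^sup>2)"
      unfolding sqn_def using i by (rule nn_integral_eq_integral) simp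
    ultimately show ?thesis by (simp only: Re_complex_of_real)
  qed
  ultimately show ?thesis by simp
qed

lemma indicator_scaleR_complex: "indicator A x *\<^sub>R z = z * (indicator A x :: complex)"
  by (simp split: split_indicator)

lemma of_real_indicator: "(\<lambda>x. complex_of_real (indicator A x)) = indicator A"
  by (auto split: split_indicator)

section \<open>Functions determined by interval integrals, and Fourier inversion\<close>

text \<open>The positive and negative parts are densities of two measures that agree on all rays,
  hence agree; densities of a finite measure are unique almost everywhere.\<close>

lemma AE_zero_of_ray_integrals:
  fixes h :: "real \<Rightarrow> real"
  assumes h: "integrable lborel h" and z: "\<And>x. (LINT y|lborel. indicator {x<..} y * h y) = 0"
  shows "AE x in lborel. h x = 0"
proof -
  have [measurable]: "h \<in> borel_measurable borel" using h by auto
  define p n where "p x = max 0 (h x)" and "n x = max 0 (- h x)" for x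
  have [measurable]: "p \<in> borel_measurable borel" "n \<in> borel_measurable borel" unfolding p_def n_def by auto
  have pn: "integrable lborel p" "integrable lborel n" "\<And>x. p x \<ge> 0" "\<And>x. n x \<ge> 0" "\<And>x. h x = p x - n x"
    unfolding p_def n_def using h by auto
  have i: "integrable lborel (\<lambda>y. indicator A y * q y)" if "A \<in> sets borel" "integrable lborel q" for A and q :: "real \<Rightarrow> real"
    using that integrable_mult_indicator[of A lborel q] by simp
  have em: "emeasure (density lborel (\<lambda>x. ennreal (q x))) {x<..} = ennreal (LINT y|lborel. indicator {x<..} y * q y)"
    if "integrable lborel q" "\<And>x. q x \<ge> 0" for q :: "real \<Rightarrow> real" and x
  proof -
    have [measurable]: "q \<in> borel_measurable borel" using that by auto
    have "emeasure (density lborel (\<lambda>x. ennreal (q x))) {x<..} = (\<integral>\<^sup>+y. ennreal (indicator {x<..} y * q y) \<partial>lborel)"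
    proof (subst emeasure_density)
      show "{x<..} \<in> sets lborel" using borel_open[OF open_greaterThan[of x]] by simp
    qed (auto intro!: nn_integral_cong split: split_indicator)
    also have "\<dots> = ennreal (LINT y|lborel. indicator {x<..} y * q y)"
      using that by (intro nn_integral_eq_integral i[OF borel_open[OF open_greaterThan]]) auto
    finally show ?thesis .
  qed
  have eq: "(LINT y|lborel. indicator {x<..} y * p y) = (LINT y|lborel. indicator {x<..} y * n y)" for x
  proof -
    have "(LINT y|lborel. indicator {x<..} y * h y) = (LINT y|lborel. indicator {x<..} y * p y) - (LINT y|lborel. indicator {x<..} y * n y)"
      unfolding pn(5) right_diff_distrib using pn i by (intro Bochner_Integration.integral_diff) auto
    then show ?thesis using z[of x] by simp
  qed
  have "density lborel (\<lambda>x. ennreal (p x)) = density lborel (\<lambda>x. ennreal (n x))"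
    by (rule measure_eqI_lessThan) (simp_all add: em pn eq)
  then have "AE x in lborel. ennreal (p x) = ennreal (n x)"
  proof (rule finite_density_unique[THEN iffD1, rotated -1])
    have "(\<integral>\<^sup>+x. ennreal (p x) \<partial>lborel) = ennreal (LINT x|lborel. p x)"
      using pn by (intro nn_integral_eq_integral) auto
    then show "(\<integral>\<^sup>+x. ennreal (p x) \<partial>lborel) \<noteq> \<infinity>" by simp
  qed auto
  then show ?thesis
    using pn by (auto simp: ennreal_inj)
qed

lemma AE_zero_of_interval_integrals:
  fixes h :: "real \<Rightarrow> real"
  assumes h: "\<And>a b. set_integrable lborel {a..b} h" and z: "\<And>a b. a \<le> b \<Longrightarrow> (LINT x:{a..b}|lborel. h x) = 0"
  shows "AE x in lborel. h x = 0"
proof -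
  have "AE x in lborel. indicator {- real k..real k} x * h x = 0" for k :: nat
  proof (rule AE_zero_of_ray_integrals)
    show "integrable lborel (\<lambda>x. indicator {- real k..real k} x * h x)"
      using h[of "- real k" "real k"] by (simp add: set_integrable_def)
    fix x
    \<comment> \<open>The open ray cut with [-k, k] and the closed interval [c, k] differ at most in
      the point x, which is null.\<close>
    define c where "c = max x (- real k)"
    have "(LINT y|lborel. indicator {x<..} y * (indicator {- real k..real k} y * h y)) = (LINT y:{c..real k}|lborel. h y)"
      unfolding set_lebesgue_integral_def
    proof (rule integral_cong_AE)
      have "AE y in lborel. y \<noteq> x" by (rule AE_lborel_singleton)
      then show "AE y in lborel. indicator {x<..} y * (indicator {- real k..real k} y * h y) = indicator {c..real k} y *\<^sub>R h y"
        by eventually_elim (auto simp: c_def split: split_indicator)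
      have m: "(\<lambda>y. indicator {a..b} y * h y) \<in> borel_measurable lborel" for a b
        using borel_measurable_integrable[OF h[unfolded set_integrable_def]] by simp
      show "(\<lambda>y. indicator {x<..} y * (indicator {- real k..real k} y * h y)) \<in> borel_measurable lborel"
        by (intro borel_measurable_times m) auto
      show "(\<lambda>y. indicator {c..real k} y *\<^sub>R h y) \<in> borel_measurable lborel" using m by simp
    qed
    also have "\<dots> = 0"
      using z[of c "real k"] by (cases "c \<le> real k") (auto simp: set_lebesgue_integral_def)
    finally show "(LINT y|lborel. indicator {x<..} y * (indicator {- real k..real k} y * h y)) = 0" .
  qed
  then have "AE x in lborel. \<forall>k::nat. indicator {- real k..real k} x * h x = 0"
    unfolding AE_all_countable by blast
  then show ?thesis
  proof eventually_elim
    case (elim x)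
    obtain k :: nat where "\<bar>x\<bar> \<le> real k" using real_arch_simple by blast
    then have "x \<in> {- real k..real k}" by auto
    then show ?case using elim[rule_format, of k] by simp
  qed
qed

lemma integral_reflect_lborel:
  fixes f :: "real \<Rightarrow> 'a::{banach, second_countable_topology}"
  shows "(LINT x|lborel. f (- x)) = (LINT x|lborel. f x)"
  by (subst (2) lborel_integral_real_affine[of "-1" _ 0]) auto

lemma integrable_reflect_lborel:
  fixes f :: "real \<Rightarrow> 'a::{banach, second_countable_topology}"
  shows "integrable lborel (\<lambda>x. f (- x)) \<longleftrightarrow> integrable lborel f"
  using lborel_integrable_real_affine_iff[of "-1" f 0] by simp

lemma fourier_reflect: "fourier (\<lambda>x. f (- x)) \<xi> = fourier f (- \<xi>)"
  unfolding fourier_def using integral_reflect_lborel[of "\<lambda>x. cis (- (x * \<xi>)) * f (- x)"] by simp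

text \<open>The bilinear companion of the regularised Plancherel identity: a reflection takes the
  place of the conjugate.\<close>

lemma fourier_gaussian_duality:
  assumes f: "integrable lborel f" and g: "integrable lborel g" and "\<epsilon> > 0"
  shows "(LINT \<xi>|lborel. fourier f \<xi> * (fourier g (- \<xi>) * gaussian (\<epsilon> * \<xi>))) = (LINT x|lborel. f x * gauss_avg \<epsilon> g x)"
proof -
  have [measurable]: "g \<in> borel_measurable borel" using g by auto
  let ?g = "\<lambda>\<xi>. fourier g (- \<xi>) * gaussian (\<epsilon> * \<xi>)"
  have int: "integrable lborel ?g"
  proof (rule Bochner_Integration.integrable_bound)
    show "integrable lborel (\<lambda>\<xi>. ((LINT x|lborel. norm (g x)) / sqrt (2 * pi)) * gaussian (\<epsilon> * \<xi>))"
      using integrable_gaussian[of \<epsilon>] assms(3) by (intro integrable_mult_right) auto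
    show "AE \<xi> in lborel. norm (?g \<xi>) \<le> norm (complex_of_real ((LINT x|lborel. norm (g x)) / sqrt (2 * pi)) * gaussian (\<epsilon> * \<xi>))"
      unfolding norm_mult norm_of_real
      by (intro AE_I2 mult_right_mono order_trans[OF norm_fourier_le]) auto
  qed measurable
  have F: "fourier ?g x = gauss_avg \<epsilon> g x" for x
  proof -
    have "fourier ?g x = (LINT \<xi>|lborel. fourier g \<xi> * (cis (x * \<xi>) * gaussian (\<epsilon> * \<xi>))) / complex_of_real (sqrt (2 * pi))"
      unfolding fourier_def[of ?g]
      by (subst integral_reflect_lborel[symmetric]) (simp add: mult_ac)
    then show ?thesis unfolding integral_fourier_gaussian[OF g assms(3)] by simp
  qed
  show ?thesis unfolding fourier_multiplication[OF f int] F ..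
qed

text \<open>Inversion tested against an indicator. Its Gaussian averages converge away from the two
  endpoints, while on the Fourier side the integrability of \<open>fourier f\<close> removes the
  cutoff; multiplication formula and reflection then put the double transform under the
  integral.\<close>

lemma fourier_inversion_interval:
  assumes f: "integrable lborel f" and F: "integrable lborel (fourier f)"
  shows "(LINT x|lborel. f x * indicator {a..b} x) = (LINT x|lborel. fourier (fourier f) (- x) * indicator {a..b} x)"
proof -
  have [measurable]: "f \<in> borel_measurable borel" using f by auto
  define \<epsilon> where "\<epsilon> n = 1 / real (Suc n)" for n
  have \<epsilon>: "\<epsilon> n > 0" "\<epsilon> \<longlonglongrightarrow> 0" "\<bar>\<epsilon> n\<bar> \<le> 1" for n unfolding \<epsilon>_def using LIMSEQ_inverse_real_of_nat by (auto simp: inverse_eq_divide)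
  let ?I = "\<lambda>x. indicator {a..b} x :: complex"
  have "integrable lborel (\<lambda>x. indicator {a..b} x :: real)"
    by (rule integrable_real_indicator) (auto simp: emeasure_lborel_Icc_eq)
  then have "integrable lborel (\<lambda>x. complex_of_real (indicator {a..b} x))" by (rule integrable_of_real)
  then have I: "integrable lborel ?I" unfolding of_real_indicator .
  have ga: "norm (gauss_avg \<epsilon> ?I x) \<le> 1" for \<epsilon> x
  proof -
    have "norm (gauss_avg \<epsilon> ?I x) \<le> (LINT z|lborel. std_normal_density z * 1)"
      unfolding gauss_avg_def
      by (intro order_trans[OF integral_norm_bound integral_mono'])
         (auto simp: norm_mult split: split_indicator)
    then show ?thesis by simp
  qed
  have [measurable]: "(\<lambda>x. gauss_avg \<epsilon> ?I x) \<in> borel_measurable borel" for \<epsilon>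
    unfolding gauss_avg_def by measurable
  have "(\<lambda>n. LINT x|lborel. f x * gauss_avg (\<epsilon> n) ?I x) \<longlonglongrightarrow> (LINT x|lborel. f x * ?I x)"
  proof (rule integral_dominated_convergence[where w="\<lambda>x. norm (f x)"])
    have "AE x in lborel. x \<noteq> a \<and> x \<noteq> b" using AE_lborel_singleton[of a] AE_lborel_singleton[of b] by eventually_elim auto
    then show "AE x in lborel. (\<lambda>n. f x * gauss_avg (\<epsilon> n) ?I x) \<longlonglongrightarrow> f x * ?I x"
    proof eventually_elim
      case (elim x)
      have "isCont (\<lambda>x. complex_of_real (indicator {a..b} x)) x"
        using elim by (intro continuous_intros) (auto simp: isCont_indicator frontier_def)
      then have "isCont ?I x" unfolding of_real_indicator .
      then show ?case by (intro tendsto_mult tendsto_const gauss_avg_tendsto[where C=1] \<epsilon>) (auto split: split_indicator)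
    qed
    show "AE x in lborel. norm (f x * gauss_avg (\<epsilon> n) ?I x) \<le> norm (f x)" for n
      using ga by (auto simp: norm_mult mult_left_le)
  qed (use f in auto)
  moreover have "(\<lambda>n. LINT x|lborel. f x * gauss_avg (\<epsilon> n) ?I x) \<longlonglongrightarrow> (LINT \<xi>|lborel. fourier f \<xi> * fourier ?I (- \<xi>))"
    unfolding fourier_gaussian_duality[OF f I \<epsilon>(1), symmetric]
  proof (rule integral_dominated_convergence[where w="\<lambda>\<xi>. norm (fourier f \<xi>) * ((LINT x|lborel. norm (?I x)) / sqrt (2 * pi))"])
    show "AE \<xi> in lborel. (\<lambda>n. fourier f \<xi> * (fourier ?I (- \<xi>) * gaussian (\<epsilon> n * \<xi>))) \<longlonglongrightarrow> fourier f \<xi> * fourier ?I (- \<xi>)"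
    proof (rule AE_I2)
      fix \<xi>
      have "(\<lambda>n. fourier f \<xi> * (fourier ?I (- \<xi>) * gaussian (\<epsilon> n * \<xi>))) \<longlonglongrightarrow> fourier f \<xi> * (fourier ?I (- \<xi>) * gaussian (0 * \<xi>))"
        by (intro tendsto_intros \<epsilon>(2)) auto
      then show "(\<lambda>n. fourier f \<xi> * (fourier ?I (- \<xi>) * gaussian (\<epsilon> n * \<xi>))) \<longlonglongrightarrow> fourier f \<xi> * fourier ?I (- \<xi>)" by simp
    qed
    show "AE \<xi> in lborel. norm (fourier f \<xi> * (fourier ?I (- \<xi>) * gaussian (\<epsilon> n * \<xi>))) \<le> norm (fourier f \<xi>) * ((LINT x|lborel. norm (?I x)) / sqrt (2 * pi))" for n
    proof (rule AE_I2)
      fix \<xi>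
      have "norm (fourier ?I (- \<xi>) * gaussian (\<epsilon> n * \<xi>)) \<le> norm (fourier ?I (- \<xi>))"
        by (simp add: norm_mult mult_left_le)
      also have "\<dots> \<le> (LINT x|lborel. norm (?I x)) / sqrt (2 * pi)" by (rule norm_fourier_le)
      finally show "norm (fourier f \<xi> * (fourier ?I (- \<xi>) * gaussian (\<epsilon> n * \<xi>))) \<le> norm (fourier f \<xi>) * ((LINT x|lborel. norm (?I x)) / sqrt (2 * pi))"
        unfolding norm_mult[of "fourier f \<xi>"] by (rule mult_left_mono) simp
    qed
  qed (use F in \<open>auto intro!: integrable_mult_left\<close>)
  ultimately have "(LINT x|lborel. f x * ?I x) = (LINT \<xi>|lborel. fourier f \<xi> * fourier ?I (- \<xi>))"
    by (rule LIMSEQ_unique)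
  also have "\<dots> = (LINT \<xi>|lborel. fourier f (- \<xi>) * fourier ?I \<xi>)"
    by (subst integral_reflect_lborel[symmetric]) simp
  also have "\<dots> = (LINT x|lborel. fourier (\<lambda>\<xi>. fourier f (- \<xi>)) x * ?I x)"
    by (rule fourier_multiplication[symmetric]) (use F I in \<open>auto simp: integrable_reflect_lborel\<close>)
  finally show ?thesis by (simp add: fourier_reflect)
qed

text \<open>Both sides have equal integrals over all intervals. Real and imaginary parts are
  separated because the uniqueness lemma is stated for real functions.\<close>

lemma fourier_inversion:
  assumes f: "integrable lborel f" and F: "integrable lborel (fourier f)"
  shows "AE x in lborel. f x = fourier (fourier f) (- x)"
proof -
  let ?g = "\<lambda>x. fourier (fourier f) (- x)"
  have g: "set_integrable lborel {a..b} ?g" for a b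
    by (intro borel_integrable_atLeastAtMost' continuous_intros F)
  have ff: "set_integrable lborel {a..b} f" for a b
    using f unfolding set_integrable_def by (intro integrable_mult_indicator) auto
  have d: "set_integrable lborel {a..b} (\<lambda>x. f x - ?g x)" for a b
    using ff g by (rule set_integral_diff(1))
  have z: "(LINT x:{a..b}|lborel. f x - ?g x) = 0" for a b
    using fourier_inversion_interval[OF f F, of a b] set_integral_diff(2)[OF ff g, of a b]
    unfolding set_lebesgue_integral_def indicator_scaleR_complex by simp
  have "AE x in lborel. Re (f x - ?g x) = 0"
  proof (rule AE_zero_of_interval_integrals)
    fix a b
    show "set_integrable lborel {a..b} (\<lambda>x. Re (f x - ?g x))"
      using integrable_Re[OF d[of a b, unfolded set_integrable_def]] by (simp add: set_integrable_def)
    show "(LINT x:{a..b}|lborel. Re (f x - ?g x)) = 0"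
      using integral_Re[OF d[of a b, unfolded set_integrable_def]] z[of a b] by (simp add: set_lebesgue_integral_def)
  qed
  moreover have "AE x in lborel. Im (f x - ?g x) = 0"
  proof (rule AE_zero_of_interval_integrals)
    fix a b
    show "set_integrable lborel {a..b} (\<lambda>x. Im (f x - ?g x))"
      using integrable_Im[OF d[of a b, unfolded set_integrable_def]] by (simp add: set_integrable_def)
    show "(LINT x:{a..b}|lborel. Im (f x - ?g x)) = 0"
      using integral_Im[OF d[of a b, unfolded set_integrable_def]] z[of a b] by (simp add: set_lebesgue_integral_def)
  qed
  ultimately show ?thesis by eventually_elim (simp add: complex_eq_iff)
qed

text \<open>The convolution theorem with one factor presented as an inverse transform; it is the
  multiplication formula for f modulated by \<xi>.\<close>

lemma fourier_mult_inverse: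
  assumes f: "integrable lborel f" and G: "integrable lborel G"
  shows "fourier (\<lambda>x. f x * fourier G (- x)) \<xi> = (LINT \<eta>|lborel. fourier f (\<xi> - \<eta>) * G \<eta>) / complex_of_real (sqrt (2 * pi))"
proof -
  have m [measurable]: "f \<in> borel_measurable borel" using f by auto
  let ?h = "\<lambda>x. cis (- (\<xi> * x)) * f x"
  have h: "integrable lborel ?h" using f by simp
  have "(LINT \<eta>|lborel. fourier f (\<xi> - \<eta>) * G \<eta>) = (LINT \<eta>|lborel. fourier f (\<xi> + \<eta>) * G (- \<eta>))"
    by (subst integral_reflect_lborel[symmetric]) simp
  also have "\<dots> = (LINT \<eta>|lborel. fourier ?h \<eta> * G (- \<eta>))"
    unfolding fourier_cis_shift by (simp add: add.commute)
  also have "\<dots> = (LINT x|lborel. ?h x * fourier (\<lambda>\<eta>. G (- \<eta>)) x)"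
    by (rule fourier_multiplication[OF h]) (use G in \<open>simp add: integrable_reflect_lborel\<close>)
  finally show ?thesis unfolding fourier_reflect by (simp add: fourier_def[of _ \<xi>] mult_ac)
qed

section \<open>Passage to limits in square norms, and integrals of derivatives\<close>

text \<open>Fatou's lemma in the form used throughout: a uniform bound survives pointwise limits,
  which is how every regularisation in this proof is removed.\<close>

lemma sqn_le_liminf:
  fixes f :: "nat \<Rightarrow> real \<Rightarrow> 'a::{second_countable_topology, real_normed_vector}"
  assumes "\<And>n. f n \<in> borel_measurable borel" "AE x in lborel. (\<lambda>n. f n x) \<longlonglongrightarrow> g x"
    and "\<And>n. sqn (f n) \<le> K"
  shows "sqn g \<le> K"
proof -
  have [measurable]: "f n \<in> borel_measurable borel" for n using assms by auto
  have "sqn g = (\<integral>\<^sup>+x. liminf (\<lambda>n. ennreal ((norm (f n x))\<^sup>2)) \<partial>lborel)"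
    unfolding sqn_def
  proof (rule nn_integral_cong_AE)
    show "AE x in lborel. ennreal ((norm (g x))\<^sup>2) = liminf (\<lambda>n. ennreal ((norm (f n x))\<^sup>2))"
      using assms(2)
    proof eventually_elim
      case (elim x)
      have "(\<lambda>n. ennreal ((norm (f n x))\<^sup>2)) \<longlonglongrightarrow> ennreal ((norm (g x))\<^sup>2)"
        using elim by (intro tendsto_ennrealI tendsto_power tendsto_norm)
      then show ?case using lim_imp_Liminf[OF trivial_limit_sequentially] by metis
    qed
  qed
  also have "\<dots> \<le> liminf (\<lambda>n. \<integral>\<^sup>+x. ennreal ((norm (f n x))\<^sup>2) \<partial>lborel)"
    by (rule nn_integral_liminf) simp
  also have "\<dots> \<le> K" using assms(3) unfolding sqn_def by (simp add: Liminf_le)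
  finally show ?thesis .
qed

lemma sqn_L2:
  assumes "f \<in> L2"
  shows "sqn f = ennreal ((L2_norm f)\<^sup>2)"
  using assms unfolding sqn_def L2_norm_def L2_def
  by (subst nn_integral_eq_integral) (auto intro!: integral_nonneg_AE)

text \<open>The truncated transforms tend to F in L2 and pointwise to \<open>fourier f\<close>, so
  Fatou's lemma puts the distance of the two below every e. From here on the integral
  \<open>fourier\<close> can replace the Plancherel transform.\<close>

lemma has_fourier_L2_AE:
  assumes F: "has_fourier_L2 f F" and f: "integrable lborel f"
  shows "AE \<xi> in lborel. F \<xi> = fourier f \<xi>"
proof -
  have [measurable]: "f \<in> borel_measurable borel" using f by auto
  have [measurable]: "F \<in> borel_measurable borel" using F unfolding has_fourier_L2_def L2_def by auto
  let ?t = "\<lambda>n::nat. \<lambda>x. indicator {- real n..real n} x * f x"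
  have t: "integrable lborel (?t n)" for n
    using integrable_mult_indicator[of "{- real n..real n}" lborel f] f
    by (simp add: indicator_scaleR_complex mult.commute)
  have lim: "(\<lambda>n. fourier (?t n) \<xi>) \<longlonglongrightarrow> fourier f \<xi>" for \<xi>
    unfolding fourier_def
  proof (intro tendsto_divide tendsto_const integral_dominated_convergence[where w="\<lambda>x. norm (f x)"])
    show "AE x in lborel. (\<lambda>n. cis (- (x * \<xi>)) * (?t n x)) \<longlonglongrightarrow> cis (- (x * \<xi>)) * f x"
    proof (intro AE_I2 tendsto_mult tendsto_const tendsto_eventually)
      fix x
      obtain k :: nat where k: "\<bar>x\<bar> \<le> real k" using real_arch_simple by blast
      show "\<forall>\<^sub>F n in sequentially. ?t n x = f x"
        using eventually_ge_at_top[of k] by eventually_elim (use k in \<open>auto split: split_indicator\<close>)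
    qed
  qed (use f in \<open>auto simp: norm_mult split: split_indicator\<close>)
  obtain N where N: "\<And>n. n \<ge> N \<Longrightarrow> (\<lambda>x. fourier (?t n) x - F x) \<in> L2"
    using F unfolding has_fourier_L2_def L2_tendsto_def eventually_sequentially by auto
  have L: "(\<lambda>n. L2_norm (\<lambda>x. fourier (?t n) x - F x)) \<longlonglongrightarrow> 0"
    using F unfolding has_fourier_L2_def L2_tendsto_def by auto
  have "sqn (\<lambda>\<xi>. fourier f \<xi> - F \<xi>) \<le> ennreal e" if e: "e > 0" for e
  proof -
    have "(\<lambda>n. (L2_norm (\<lambda>x. fourier (?t n) x - F x))\<^sup>2) \<longlonglongrightarrow> 0\<^sup>2" by (intro tendsto_power L)
    then have "\<forall>\<^sub>F n in sequentially. (L2_norm (\<lambda>x. fourier (?t n) x - F x))\<^sup>2 < e"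
      using e by (intro order_tendstoD(2)) auto
    then obtain M where M: "\<And>n. n \<ge> M \<Longrightarrow> (L2_norm (\<lambda>x. fourier (?t n) x - F x))\<^sup>2 < e"
      unfolding eventually_sequentially by auto
    \<comment> \<open>Membership in \<open>L2\<close> and the bound e hold only for large n, so
      Fatou's lemma is applied to the tail that starts at \<open>max M N\<close>.\<close>
    show ?thesis
    proof (rule sqn_le_liminf[where f="\<lambda>n x. fourier (?t (n + max M N)) x - F x"])
      show "AE x in lborel. (\<lambda>n. fourier (?t (n + max M N)) x - F x) \<longlonglongrightarrow> fourier f x - F x"
        by (intro AE_I2 tendsto_diff tendsto_const LIMSEQ_ignore_initial_segment[OF lim])
      show "sqn (\<lambda>x. fourier (?t (n + max M N)) x - F x) \<le> ennreal e" for n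
      proof (subst sqn_L2[OF N])
        have "M \<le> n + max M N" by simp
        from M[OF this] show "ennreal ((L2_norm (\<lambda>x. fourier (?t (n + max M N)) x - F x))\<^sup>2) \<le> ennreal e"
          by (intro ennreal_leI less_imp_le)
      qed simp
    qed auto
  qed
  then have "sqn (\<lambda>\<xi>. fourier f \<xi> - F \<xi>) \<le> 0 + ennreal e" if "e > 0" for e
    using that by simp
  then have "sqn (\<lambda>\<xi>. fourier f \<xi> - F \<xi>) \<le> 0" 
    by (rule ennreal_le_epsilon)
  then have "(\<integral>\<^sup>+\<xi>. ennreal ((norm (fourier f \<xi> - F \<xi>))\<^sup>2) \<partial>lborel) = 0"
    by (simp add: sqn_def)
  then have "AE \<xi> in lborel. ennreal ((norm (fourier f \<xi> - F \<xi>))\<^sup>2) = 0"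
    by (subst (asm) nn_integral_0_iff_AE) simp
  then show ?thesis by eventually_elim simp
qed

text \<open>F is integrable but is not assumed to have limits at infinity. The fundamental theorem
  is therefore averaged over x in [0, 1]: the averages of F over [n, n + 1] and [-n, -n + 1] tend to
  0.\<close>

lemma integral_of_derivative_eq_0:
  fixes F :: "real \<Rightarrow> 'a::euclidean_space"
  assumes F: "integrable lborel F" and f: "integrable lborel f"
    and d: "\<And>x. (F has_vector_derivative f x) (at x)"
  shows "(LINT x|lborel. f x) = 0"
proof -
  have [measurable]: "F \<in> borel_measurable borel" "f \<in> borel_measurable borel" using F f by auto
  have FTC: "F (x + real n) - F (x - real n) = (LINT y|lborel. indicator {x - real n..x + real n} y *\<^sub>R f y)" for x n
  proof -
    have s: "set_integrable lborel {x - real n..x + real n} f"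
      using f unfolding set_integrable_def by (intro integrable_mult_indicator) auto
    have "(f has_integral (F (x + real n) - F (x - real n))) {x - real n..x + real n}"
      using d by (intro fundamental_theorem_of_calculus) (auto intro: has_vector_derivative_at_within)
    then show ?thesis
      using set_borel_integral_eq_integral(2)[OF s] by (simp add: set_lebesgue_integral_def integral_unique)
  qed
  have lim: "(\<lambda>n. F (x + real n) - F (x - real n)) \<longlonglongrightarrow> (LINT y|lborel. f y)" for x
    unfolding FTC
  proof (rule integral_dominated_convergence[where w="\<lambda>y. norm (f y)"])
    show "AE y in lborel. (\<lambda>n. indicator {x - real n..x + real n} y *\<^sub>R f y) \<longlonglongrightarrow> f y"
    proof (intro AE_I2 tendsto_eventually)
      fix y
      obtain k :: nat where k: "\<bar>x - y\<bar> \<le> real k" using real_arch_simple by blast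
      show "\<forall>\<^sub>F n in sequentially. indicator {x - real n..x + real n} y *\<^sub>R f y = f y"
        using eventually_ge_at_top[of k] by eventually_elim (use k in \<open>auto split: split_indicator\<close>)
    qed
  qed (use f in \<open>auto split: split_indicator\<close>)
  have bd: "norm (F (x + real n) - F (x - real n)) \<le> (LINT y|lborel. norm (f y))" for x n
    unfolding FTC by (intro order_trans[OF integral_norm_bound integral_mono']) (use f in \<open>auto split: split_indicator\<close>)
  let ?I = "indicator {0..1::real} :: real \<Rightarrow> real"
  have I: "integrable lborel ?I" by (rule integrable_real_indicator) (auto simp: emeasure_lborel_Icc_eq)
  have "(\<lambda>n. LINT x|lborel. ?I x *\<^sub>R (F (x + real n) - F (x - real n))) \<longlonglongrightarrow> (LINT x|lborel. ?I x *\<^sub>R (LINT y|lborel. f y))"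
    by (rule integral_dominated_convergence[where w="\<lambda>x. ?I x * (LINT y|lborel. norm (f y))"])
      (use I bd in \<open>auto intro!: tendsto_scaleR lim mult_left_mono split: split_indicator\<close>)
  moreover have "(\<lambda>n. LINT x|lborel. ?I x *\<^sub>R (F (x + real n) - F (x - real n))) \<longlonglongrightarrow> 0"
  proof -
    have shift: "(LINT x|lborel. ?I x *\<^sub>R F (x + c)) = (LINT x|lborel. indicator {c..c+1} x *\<^sub>R F x)" for c
      by (subst lborel_integral_real_affine[of 1 _ "-c"]) (auto intro!: Bochner_Integration.integral_cong split: split_indicator)
    have z: "(\<lambda>n. LINT x|lborel. indicator {s * real n..s * real n+1} x *\<^sub>R F x) \<longlonglongrightarrow> (LINT x::real|lborel. (0::'a))" if s: "\<bar>s\<bar> = 1" for s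
    proof (rule integral_dominated_convergence[where w="\<lambda>y. norm (F y)"])
      show "AE y in lborel. (\<lambda>n. indicator {s * real n..s * real n + 1} y *\<^sub>R F y) \<longlonglongrightarrow> 0"
      proof (intro AE_I2 tendsto_eventually)
        fix y :: real
        obtain k :: nat where k: "\<bar>y\<bar> + 2 \<le> real k" using real_arch_simple by blast
        show "\<forall>\<^sub>F n in sequentially. indicator {s * real n..s * real n + 1} y *\<^sub>R F y = 0"
          using eventually_ge_at_top[of k]
        proof eventually_elim
          case (elim n)
          have "s = 1 \<or> s = -1" using s by auto
          then show ?case using elim k by (auto split: split_indicator)
        qed
      qed
    qed (use F in \<open>auto split: split_indicator\<close>)
    have iF: "integrable lborel (\<lambda>x. ?I x *\<^sub>R F (x + c))" for c
      using lborel_integrable_real_affine[OF F, of 1 c] by (intro integrable_mult_indicator) (auto simp: add.commute)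
    have "(LINT x|lborel. ?I x *\<^sub>R (F (x + real n) - F (x - real n))) =
       (LINT x|lborel. indicator {1 * real n..1 * real n+1} x *\<^sub>R F x) - (LINT x|lborel. indicator {(-1) * real n..(-1) * real n+1} x *\<^sub>R F x)" for n
      using shift[of "real n"] shift[of "- real n"] iF[of "real n"] iF[of "- real n"] by (simp add: scaleR_diff_right)
    then show ?thesis using tendsto_diff[OF z[of 1] z[of "-1"]] by simp
  qed
  ultimately have "(LINT x|lborel. ?I x *\<^sub>R (LINT y|lborel. f y)) = 0" by (rule LIMSEQ_unique)
  then show ?thesis using I by (simp add: measure_def emeasure_lborel_Icc_eq)
qed

subsection \<open>Weighted convolution estimates\<close>

text \<open>The L2 * L1 case of Young's inequality: Cauchy-Schwarz with respect to the measure of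
  density g, then Tonelli and translation invariance.\<close>

lemma Young_nn:
  fixes f g :: "real \<Rightarrow> ennreal"
  assumes [measurable]: "f \<in> borel_measurable borel" "g \<in> borel_measurable borel"
  shows "(\<integral>\<^sup>+\<xi>. (\<integral>\<^sup>+\<eta>. f (\<xi> - \<eta>) * g \<eta> \<partial>lborel)\<^sup>2 \<partial>lborel) \<le> (\<integral>\<^sup>+\<xi>. (f \<xi>)\<^sup>2 \<partial>lborel) * (\<integral>\<^sup>+\<eta>. g \<eta> \<partial>lborel)\<^sup>2"
proof -
  let ?M = "density lborel g"
  have CS: "(\<integral>\<^sup>+\<eta>. f (\<xi> - \<eta>) * g \<eta> \<partial>lborel)\<^sup>2 \<le> (\<integral>\<^sup>+\<eta>. (f (\<xi> - \<eta>))\<^sup>2 * g \<eta> \<partial>lborel) * (\<integral>\<^sup>+\<eta>. g \<eta> \<partial>lborel)" for \<xi>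
    using Cauchy_Schwarz_nn_integral[of "\<lambda>\<eta>. f (\<xi> - \<eta>)" ?M "\<lambda>_. 1"]
    by (simp add: nn_integral_density mult.commute emeasure_density)
  have "(\<integral>\<^sup>+\<xi>. (\<integral>\<^sup>+\<eta>. f (\<xi> - \<eta>) * g \<eta> \<partial>lborel)\<^sup>2 \<partial>lborel) \<le>
    (\<integral>\<^sup>+\<xi>. (\<integral>\<^sup>+\<eta>. (f (\<xi> - \<eta>))\<^sup>2 * g \<eta> \<partial>lborel) * (\<integral>\<^sup>+\<eta>. g \<eta> \<partial>lborel) \<partial>lborel)"
    by (intro nn_integral_mono CS)
  also have "\<dots> = (\<integral>\<^sup>+\<xi>. (\<integral>\<^sup>+\<eta>. (f (\<xi> - \<eta>))\<^sup>2 * g \<eta> \<partial>lborel) \<partial>lborel) * (\<integral>\<^sup>+\<eta>. g \<eta> \<partial>lborel)"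
    by (rule nn_integral_multc) simp
  also have "(\<integral>\<^sup>+\<xi>. (\<integral>\<^sup>+\<eta>. (f (\<xi> - \<eta>))\<^sup>2 * g \<eta> \<partial>lborel) \<partial>lborel) = (\<integral>\<^sup>+\<eta>. (\<integral>\<^sup>+\<xi>. (f (\<xi> - \<eta>))\<^sup>2 * g \<eta> \<partial>lborel) \<partial>lborel)"
    by (rule lborel_pair.Fubini') simp
  also have "\<dots> = (\<integral>\<^sup>+\<eta>. (\<integral>\<^sup>+\<xi>. (f \<xi>)\<^sup>2 \<partial>lborel) * g \<eta> \<partial>lborel)"
  proof (intro nn_integral_cong)
    fix \<eta>
    have "(\<integral>\<^sup>+\<xi>. (f (\<xi> - \<eta>))\<^sup>2 * g \<eta> \<partial>lborel) = (\<integral>\<^sup>+\<xi>. (f (\<xi> - \<eta>))\<^sup>2 \<partial>lborel) * g \<eta>" by (rule nn_integral_multc) simp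
    also have "(\<integral>\<^sup>+\<xi>. (f (\<xi> - \<eta>))\<^sup>2 \<partial>lborel) = (\<integral>\<^sup>+\<xi>. (f \<xi>)\<^sup>2 \<partial>lborel)"
      by (subst (2) nn_integral_real_affine[of _ 1 "- \<eta>"]) auto
    finally show "(\<integral>\<^sup>+\<xi>. (f (\<xi> - \<eta>))\<^sup>2 * g \<eta> \<partial>lborel) = (\<integral>\<^sup>+\<xi>. (f \<xi>)\<^sup>2 \<partial>lborel) * g \<eta>" .
  qed
  also have "\<dots> = (\<integral>\<^sup>+\<xi>. (f \<xi>)\<^sup>2 \<partial>lborel) * (\<integral>\<^sup>+\<eta>. g \<eta> \<partial>lborel)" by (rule nn_integral_cmult) simp
  finally show ?thesis by (simp add: power2_eq_square mult.assoc)
qed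

lemma convolution_commute_nn:
  fixes f g :: "real \<Rightarrow> ennreal"
  assumes [measurable]: "f \<in> borel_measurable borel" "g \<in> borel_measurable borel"
  shows "(\<integral>\<^sup>+\<eta>. f (\<xi> - \<eta>) * g \<eta> \<partial>lborel) = (\<integral>\<^sup>+\<eta>. g (\<xi> - \<eta>) * f \<eta> \<partial>lborel)"
  by (subst nn_integral_real_affine[of _ "-1" \<xi>]) (auto simp: mult.commute)

lemma power2_add_le_ennreal: "(a + b)\<^sup>2 \<le> 2 * a\<^sup>2 + 2 * (b::ennreal)\<^sup>2"
proof (cases a; cases b)
  fix x y :: real assume a: "0 \<le> x" "a = ennreal x" "0 \<le> y" "b = ennreal y"
  have "(x + y)\<^sup>2 \<le> 2 * x\<^sup>2 + 2 * y\<^sup>2" using sum_squares_bound[of x y] by (simp add: power2_sum)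
  then have "ennreal ((x + y)\<^sup>2) \<le> ennreal (2 * x\<^sup>2 + 2 * y\<^sup>2)" by (rule ennreal_leI)
  then show ?thesis using a by (simp add: ennreal_power[symmetric] ennreal_mult del: ennreal_power)
qed (auto simp: power2_eq_square ennreal_mult_eq_top_iff ennreal_top_mult ennreal_mult_top)

text \<open>Quasi-additivity puts the weight on one factor, which is then measured in L2 and the
  other in L1. The factor 2 in the constant comes from squaring a sum of two convolutions.\<close>

lemma weighted_Young:
  fixes U V :: "real \<Rightarrow> complex" and m :: "real \<Rightarrow> real"
  assumes [measurable]: "U \<in> borel_measurable borel" "V \<in> borel_measurable borel" "m \<in> borel_measurable borel"
    and m0: "\<And>x. m x \<ge> 0" and C: "C \<ge> 0" and m: "\<And>\<xi> \<eta>. m \<xi> \<le> C * (m (\<xi> - \<eta>) + m \<eta>)"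
    and H: "\<And>\<xi>. H \<xi> = (LINT \<eta>|lborel. U (\<xi> - \<eta>) * V \<eta>)"
  shows "sqn (\<lambda>\<xi>. m \<xi> *\<^sub>R H \<xi>) \<le> ennreal (2 * C\<^sup>2) *
     (sqn (\<lambda>\<xi>. m \<xi> *\<^sub>R U \<xi>) * (\<integral>\<^sup>+\<eta>. ennreal (norm (V \<eta>)) \<partial>lborel)\<^sup>2 + sqn (\<lambda>\<xi>. m \<xi> *\<^sub>R V \<xi>) * (\<integral>\<^sup>+\<eta>. ennreal (norm (U \<eta>)) \<partial>lborel)\<^sup>2)"
proof -
  define u v u' v' where "u \<xi> = ennreal (m \<xi> * norm (U \<xi>))" and "v \<xi> = ennreal (norm (V \<xi>))" 
    and "u' \<xi> = ennreal (norm (U \<xi>))" and "v' \<xi> = ennreal (m \<xi> * norm (V \<xi>))" for \<xi>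
  have [measurable]: "u \<in> borel_measurable borel" "v \<in> borel_measurable borel" "u' \<in> borel_measurable borel" "v' \<in> borel_measurable borel"
    unfolding u_def v_def u'_def v'_def by auto
  have pt: "ennreal (norm (m \<xi> *\<^sub>R H \<xi>)) \<le> ennreal C * ((\<integral>\<^sup>+\<eta>. u (\<xi> - \<eta>) * v \<eta> \<partial>lborel) + (\<integral>\<^sup>+\<eta>. v' (\<xi> - \<eta>) * u' \<eta> \<partial>lborel))" for \<xi>
  proof -
    have "ennreal (norm (H \<xi>)) \<le> (\<integral>\<^sup>+\<eta>. ennreal (norm (U (\<xi> - \<eta>) * V \<eta>)) \<partial>lborel)"
      unfolding H
      by (cases "integrable lborel (\<lambda>\<eta>. U (\<xi> - \<eta>) * V \<eta>)") 
        (auto simp: not_integrable_integral_eq intro: integral_norm_bound_ennreal)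
    then have "ennreal (m \<xi>) * ennreal (norm (H \<xi>)) \<le> ennreal (m \<xi>) * (\<integral>\<^sup>+\<eta>. ennreal (norm (U (\<xi> - \<eta>) * V \<eta>)) \<partial>lborel)"
      by (rule mult_left_mono) simp
    also have "\<dots> = (\<integral>\<^sup>+\<eta>. ennreal (m \<xi>) * ennreal (norm (U (\<xi> - \<eta>) * V \<eta>)) \<partial>lborel)"
      by (rule nn_integral_cmult[symmetric]) simp
    also have "\<dots> \<le> (\<integral>\<^sup>+\<eta>. ennreal C * (u (\<xi> - \<eta>) * v \<eta> + u' (\<xi> - \<eta>) * v' \<eta>) \<partial>lborel)"
    proof (intro nn_integral_mono)
      fix \<eta>
      have "m \<xi> * (norm (U (\<xi> - \<eta>)) * norm (V \<eta>)) \<le> C * (m (\<xi> - \<eta>) + m \<eta>) * (norm (U (\<xi> - \<eta>)) * norm (V \<eta>))"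
        by (rule mult_right_mono[OF m]) simp
      also have "\<dots> = C * ((m (\<xi> - \<eta>) * norm (U (\<xi> - \<eta>))) * norm (V \<eta>) + norm (U (\<xi> - \<eta>)) * (m \<eta> * norm (V \<eta>)))"
        by (simp add: algebra_simps)
      finally have "ennreal (m \<xi> * norm (U (\<xi> - \<eta>) * V \<eta>)) \<le> ennreal \<dots>"
        by (intro ennreal_leI) (simp add: norm_mult)
      then show "ennreal (m \<xi>) * ennreal (norm (U (\<xi> - \<eta>) * V \<eta>)) \<le> ennreal C * (u (\<xi> - \<eta>) * v \<eta> + u' (\<xi> - \<eta>) * v' \<eta>)"
        unfolding u_def v_def u'_def v'_def using m0 C by (simp add: ennreal_mult)
    qed
    also have "\<dots> = ennreal C * ((\<integral>\<^sup>+\<eta>. u (\<xi> - \<eta>) * v \<eta> \<partial>lborel) + (\<integral>\<^sup>+\<eta>. u' (\<xi> - \<eta>) * v' \<eta> \<partial>lborel))"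
      by (subst nn_integral_cmult, simp, subst nn_integral_add) auto
    also have "(\<integral>\<^sup>+\<eta>. u' (\<xi> - \<eta>) * v' \<eta> \<partial>lborel) = (\<integral>\<^sup>+\<eta>. v' (\<xi> - \<eta>) * u' \<eta> \<partial>lborel)"
      by (rule convolution_commute_nn) auto
    finally show ?thesis using m0[of \<xi>] by (simp add: ennreal_mult'')
  qed
  have "sqn (\<lambda>\<xi>. m \<xi> *\<^sub>R H \<xi>) \<le> (\<integral>\<^sup>+\<xi>. ennreal (2 * C\<^sup>2) * ((\<integral>\<^sup>+\<eta>. u (\<xi> - \<eta>) * v \<eta> \<partial>lborel)\<^sup>2 + (\<integral>\<^sup>+\<eta>. v' (\<xi> - \<eta>) * u' \<eta> \<partial>lborel)\<^sup>2) \<partial>lborel)"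
    unfolding sqn_def
  proof (intro nn_integral_mono)
    fix \<xi>
    have "ennreal ((norm (m \<xi> *\<^sub>R H \<xi>))\<^sup>2) = (ennreal (norm (m \<xi> *\<^sub>R H \<xi>)))\<^sup>2" by (simp only: ennreal_power norm_ge_zero)
    also have "\<dots> \<le> (ennreal C * ((\<integral>\<^sup>+\<eta>. u (\<xi> - \<eta>) * v \<eta> \<partial>lborel) + (\<integral>\<^sup>+\<eta>. v' (\<xi> - \<eta>) * u' \<eta> \<partial>lborel)))\<^sup>2"
      by (rule power_mono[OF pt]) simp
    also have "\<dots> \<le> (ennreal C)\<^sup>2 * (2 * (\<integral>\<^sup>+\<eta>. u (\<xi> - \<eta>) * v \<eta> \<partial>lborel)\<^sup>2 + 2 * (\<integral>\<^sup>+\<eta>. v' (\<xi> - \<eta>) * u' \<eta> \<partial>lborel)\<^sup>2)"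
      unfolding power_mult_distrib by (rule mult_left_mono[OF power2_add_le_ennreal]) simp
    also have "\<dots> = ennreal (2 * C\<^sup>2) * ((\<integral>\<^sup>+\<eta>. u (\<xi> - \<eta>) * v \<eta> \<partial>lborel)\<^sup>2 + (\<integral>\<^sup>+\<eta>. v' (\<xi> - \<eta>) * u' \<eta> \<partial>lborel)\<^sup>2)"
      using C by (simp add: ennreal_mult ennreal_power distrib_left mult_ac)
    finally show "ennreal ((norm (m \<xi> *\<^sub>R H \<xi>))\<^sup>2) \<le> \<dots>" .
  qed
  also have "\<dots> = ennreal (2 * C\<^sup>2) * ((\<integral>\<^sup>+\<xi>. (\<integral>\<^sup>+\<eta>. u (\<xi> - \<eta>) * v \<eta> \<partial>lborel)\<^sup>2 \<partial>lborel) + (\<integral>\<^sup>+\<xi>. (\<integral>\<^sup>+\<eta>. v' (\<xi> - \<eta>) * u' \<eta> \<partial>lborel)\<^sup>2 \<partial>lborel))"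
    by (subst nn_integral_cmult, simp, subst nn_integral_add) auto
  also have "\<dots> \<le> ennreal (2 * C\<^sup>2) * ((\<integral>\<^sup>+\<xi>. (u \<xi>)\<^sup>2 \<partial>lborel) * (\<integral>\<^sup>+\<eta>. v \<eta> \<partial>lborel)\<^sup>2 + (\<integral>\<^sup>+\<xi>. (v' \<xi>)\<^sup>2 \<partial>lborel) * (\<integral>\<^sup>+\<eta>. u' \<eta> \<partial>lborel)\<^sup>2)"
    by (intro mult_left_mono add_mono Young_nn) auto
  also have "(\<integral>\<^sup>+\<xi>. (u \<xi>)\<^sup>2 \<partial>lborel) = sqn (\<lambda>\<xi>. m \<xi> *\<^sub>R U \<xi>)"
    unfolding sqn_def u_def by (intro nn_integral_cong) (simp add: m0 ennreal_power)
  also have "(\<integral>\<^sup>+\<xi>. (v' \<xi>)\<^sup>2 \<partial>lborel) = sqn (\<lambda>\<xi>. m \<xi> *\<^sub>R V \<xi>)"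
    unfolding sqn_def v'_def by (intro nn_integral_cong) (simp add: m0 ennreal_power)
  finally show ?thesis unfolding v_def u'_def .
qed

subsection \<open>Bump functions and weak derivatives\<close>

text \<open>With p = (x - a)(b - x), the functions r p^(-i) exp(-c/p) form a family closed under
  differentiation; this is why a polynomial and an exponent are carried along. As c tends to 0 with
  r = 1 and i = 0, they increase to the indicator of the open interval.\<close>

definition bump :: "real \<Rightarrow> real \<Rightarrow> real \<Rightarrow> real poly \<Rightarrow> nat \<Rightarrow> real \<Rightarrow> real" where
  "bump a b c r i x = (if a < x \<and> x < b
     then poly r x * inverse ((x - a) * (b - x)) ^ i * exp (- c * inverse ((x - a) * (b - x))) else 0)"

lemma exp_minus_le_power:
  fixes t :: real
  assumes "t > 0" "n > 0"
  shows "exp (- t) \<le> (real n / t) ^ n"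
proof -
  have "t / real n \<le> exp (t / real n)" using exp_ge_add_one_self[of "t / real n"] by linarith
  then have "(t / real n) ^ n \<le> exp (t / real n) ^ n" using assms by (intro power_mono) auto
  also have "\<dots> = exp t" using assms by (simp add: exp_of_nat_mult[symmetric])
  finally have "inverse (exp t) \<le> inverse ((t / real n) ^ n)" using assms by (intro le_imp_inverse_le) auto
  then show ?thesis by (simp add: exp_minus power_inverse[symmetric])
qed

lemma has_real_derivative_0_of_quadratic:
  fixes f :: "real \<Rightarrow> real"
  assumes "f x = 0" "\<And>y. \<bar>f y\<bar> \<le> M * (y - x)\<^sup>2"
  shows "(f has_real_derivative 0) (at x)"
  unfolding has_field_derivative_iff
proof (rule Lim_null_comparison)
  show "((\<lambda>y. M * \<bar>y - x\<bar>) \<longlongrightarrow> 0) (at x)"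
    by (auto intro!: tendsto_eq_intros)
  have "\<forall>\<^sub>F y in at x. y \<noteq> x" by (simp add: eventually_at_filter)
  then show "\<forall>\<^sub>F y in at x. norm ((f y - f x) / (y - x)) \<le> M * \<bar>y - x\<bar>"
  proof (rule eventually_mono)
    fix y assume "y \<noteq> x"
    then show "norm ((f y - f x) / (y - x)) \<le> M * \<bar>y - x\<bar>"
      using assms(2)[of y] assms(1) by (simp add: divide_le_eq power2_eq_square abs_mult_self_eq mult.assoc)
  qed
qed

text \<open>Quadratic vanishing at a and b makes the derivative there exist and equal 0, so the two
  pieces of the definition fit together.\<close>

lemma bump_le_quadratic:
  assumes "a < b" "c > 0"
  obtains M where "\<And>y. \<bar>bump a b c r i y\<bar> \<le> M * (y - a)\<^sup>2" "\<And>y. \<bar>bump a b c r i y\<bar> \<le> M * (y - b)\<^sup>2"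
proof -
  have "bounded ((\<lambda>x. poly r x) ` {a..b})"
    by (intro compact_imp_bounded compact_continuous_image continuous_intros compact_Icc)
  then obtain K where K: "\<And>x. x \<in> {a..b} \<Longrightarrow> \<bar>poly r x\<bar> \<le> K" unfolding bounded_iff by force
  have K0: "K \<ge> 0" using K[of a] assms(1) abs_ge_zero[of "poly r a"] by fastforce
  \<comment> \<open>The exponential absorbs the i inverse powers of p and leaves two positive
    ones.\<close>
  define n where "n = i + 2"
  define L where "L = K * (real n / c) ^ n"
  have L0: "L \<ge> 0" unfolding L_def using K0 assms by simp
  have key: "\<bar>bump a b c r i y\<bar> \<le> L * ((y - a) * (b - y))\<^sup>2" for y
  proof (cases "a < y \<and> y < b")
    case True
    define p where "p = (y - a) * (b - y)"
    have p: "p > 0" unfolding p_def using True by simp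
    have "exp (- c * inverse p) \<le> (real n / (c * inverse p)) ^ n"
      using exp_minus_le_power[of "c * inverse p" n] p assms by (simp add: n_def)
    also have "\<dots> = (real n / c) ^ n * p ^ n" using p by (simp add: field_simps power_mult_distrib)
    finally have e: "exp (- c * inverse p) \<le> (real n / c) ^ n * p ^ n" .
    have "\<bar>bump a b c r i y\<bar> = \<bar>poly r y\<bar> * inverse p ^ i * exp (- c * inverse p)"
      using True p by (simp add: bump_def p_def[symmetric] abs_mult)
    also have "\<dots> \<le> K * inverse p ^ i * ((real n / c) ^ n * p ^ n)"
      using True p e K[of y] K0 by (intro mult_mono) auto
    also have "\<dots> = L * (inverse p ^ i * p ^ n)" by (simp add: L_def)
    also have "inverse p ^ i * p ^ n = p\<^sup>2" using p by (simp add: n_def power_add power_inverse field_simps power2_eq_square)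
    finally show ?thesis by (simp add: p_def)
  next
    case False
    then have "bump a b c r i y = 0" by (auto simp: bump_def)
    then show ?thesis using L0 by simp
  qed
  define M where "M = L * (b - a)\<^sup>2"
  have M0: "M \<ge> 0" using L0 by (simp add: M_def)
  show thesis
  proof
    fix y
    show "\<bar>bump a b c r i y\<bar> \<le> M * (y - a)\<^sup>2"
    proof (cases "a < y \<and> y < b")
      case True
      then have "((y - a) * (b - y))\<^sup>2 \<le> (b - a)\<^sup>2 * (y - a)\<^sup>2"
        unfolding power_mult_distrib by (subst mult.commute, intro mult_right_mono power_mono) auto
      from order_trans[OF key mult_left_mono[OF this L0]] show ?thesis by (simp add: M_def mult_ac)
    next
      case False then have "bump a b c r i y = 0" by (auto simp: bump_def)
      then show ?thesis using M0 by simp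
    qed
    show "\<bar>bump a b c r i y\<bar> \<le> M * (y - b)\<^sup>2"
    proof (cases "a < y \<and> y < b")
      case True
      then have "((y - a) * (b - y))\<^sup>2 \<le> (b - a)\<^sup>2 * (y - b)\<^sup>2"
        unfolding power_mult_distrib by (subst power2_commute[of y b], intro mult_right_mono power_mono) auto
      from order_trans[OF key mult_left_mono[OF this L0]] show ?thesis by (simp add: M_def mult_ac)
    next
      case False then have "bump a b c r i y = 0" by (auto simp: bump_def)
      then show ?thesis using M0 by simp
    qed
  qed
qed

text \<open>Inside the interval this is calculus, outside it is trivial, and at the endpoints the
  quadratic bound applies.\<close>

lemma bump_deriv:
  assumes "a < b" "c > 0"
  shows "\<exists>r' j. \<forall>x. (bump a b c r i has_real_derivative bump a b c r' j x) (at x)"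
proof -
  define P :: "real poly" where "P = [:- a * b, a + b, -1:]"
  define P' :: "real poly" where "P' = [:a + b, -2:]"
  \<comment> \<open>Since q = 1/P has derivative - P' q^2, factoring q^(i+2) out of the derivative
    of r q^i exp(-c q) leaves this polynomial.\<close>
  define r' where "r' = pderiv r * P^2 - of_nat i * r * P' * P + [:c:] * r * P'"
  have P: "poly P x = (x - a) * (b - x)" "poly P' x = a + b - 2 * x" for x
    by (auto simp: P_def P'_def algebra_simps)
  have "(bump a b c r i has_real_derivative bump a b c r' (i + 2) x) (at x)" for x
  proof -
    consider "a < x" "x < b" | "x < a" | "b < x" | "x = a" | "x = b" by linarith
    then show ?thesis
    proof cases
      case 1
      define q where "q y = inverse ((y - a) * (b - y))" for y
      have pq: "(x - a) * (b - x) * q x = 1" using 1 by (simp add: q_def del: inverse_mult_distrib)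
      have q: "(q has_real_derivative - (a + b - 2 * x) * (q x)\<^sup>2) (at x)"
      proof -
        have "((\<lambda>y. (y - a) * (b - y)) has_real_derivative (a + b - 2 * x)) (at x)"
          by (auto intro!: derivative_eq_intros simp: algebra_simps)
        from DERIV_inverse_fun[OF this] 1
        have "(q has_real_derivative - (q x * (a + b - 2 * x) * q x)) (at x)" unfolding q_def by (auto simp: mult_ac)
        then show ?thesis by (simp only: power2_eq_square mult_ac mult_minus_left mult_minus_right)
      qed
      have "((\<lambda>y. poly r y * q y ^ i * exp (- c * q y)) has_real_derivative
         poly (pderiv r) x * q x ^ i * exp (- c * q x) + poly r x * (of_nat i * (- (a + b - 2 * x) * (q x)\<^sup>2) * q x ^ (i - 1)) * exp (- c * q x)
         + poly r x * q x ^ i * (exp (- c * q x) * (- c * (- (a + b - 2 * x) * (q x)\<^sup>2)))) (at x)"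
        by (rule derivative_eq_intros poly_DERIV q refl | simp add: algebra_simps)+
      also have "poly (pderiv r) x * q x ^ i * exp (- c * q x) + poly r x * (of_nat i * (- (a + b - 2 * x) * (q x)\<^sup>2) * q x ^ (i - 1)) * exp (- c * q x)
         + poly r x * q x ^ i * (exp (- c * q x) * (- c * (- (a + b - 2 * x) * (q x)\<^sup>2))) = bump a b c r' (i + 2) x"
      proof -
        have 1: "of_nat i * (q x)\<^sup>2 * q x ^ (i - 1) = of_nat i * q x ^ (i + 1)"
          by (cases i) (auto simp: power2_eq_square)
        have 2: "((x - a) * (b - x))\<^sup>2 * q x ^ (i + 2) = q x ^ i"
        proof -
          have "((x - a) * (b - x))\<^sup>2 * q x ^ (i + 2) = ((x - a) * (b - x) * q x)\<^sup>2 * q x ^ i"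
            by (simp add: power_mult_distrib power_add power2_eq_square mult_ac)
          then show ?thesis by (simp add: pq)
        qed
        have 3: "((x - a) * (b - x)) * q x ^ (i + 2) = q x ^ (i + 1)"
        proof -
          have "((x - a) * (b - x)) * q x ^ (i + 2) = ((x - a) * (b - x) * q x) * q x ^ (i + 1)" by simp
          then show ?thesis by (simp only: pq)
        qed
        have "bump a b c r' (i + 2) x = (poly (pderiv r) x * ((x - a) * (b - x))\<^sup>2 - of_nat i * poly r x * (a + b - 2 * x) * ((x - a) * (b - x)) + c * poly r x * (a + b - 2 * x)) * q x ^ (i + 2) * exp (- c * q x)"
        proof -
          have "bump a b c r' (i + 2) x = poly r' x * q x ^ (i + 2) * exp (- c * q x)"
            unfolding bump_def q_def by (simp only: \<open>a < x\<close> \<open>x < b\<close> simp_thms if_True)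
          moreover have "poly r' x = poly (pderiv r) x * ((x - a) * (b - x))\<^sup>2 - of_nat i * poly r x * (a + b - 2 * x) * ((x - a) * (b - x)) + c * poly r x * (a + b - 2 * x)"
            by (simp add: r'_def P of_nat_poly)
          ultimately show ?thesis by (simp only:)
        qed
        also have "\<dots> = (poly (pderiv r) x * (((x - a) * (b - x))\<^sup>2 * q x ^ (i + 2)) - of_nat i * poly r x * (a + b - 2 * x) * (((x - a) * (b - x)) * q x ^ (i + 2)) + c * poly r x * (a + b - 2 * x) * q x ^ (i + 2)) * exp (- c * q x)"
          by (simp only: left_diff_distrib distrib_right mult.assoc)
        also have "\<dots> = (poly (pderiv r) x * q x ^ i - poly r x * (a + b - 2 * x) * (of_nat i * q x ^ (i + 1)) + c * poly r x * (a + b - 2 * x) * (q x ^ i * (q x)\<^sup>2)) * exp (- c * q x)"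
          unfolding 2 3 by (simp add: power_add power2_eq_square mult_ac)
        also have "\<dots> = (poly (pderiv r) x * q x ^ i - poly r x * (a + b - 2 * x) * (of_nat i * (q x)\<^sup>2 * q x ^ (i - 1)) + c * poly r x * (a + b - 2 * x) * (q x ^ i * (q x)\<^sup>2)) * exp (- c * q x)"
          unfolding 1 ..
        finally show ?thesis by (simp add: algebra_simps)
      qed
      finally show ?thesis
        by (rule has_field_derivative_transform_within_open[of _ _ _ "{a<..<b}"]) (use 1 in \<open>auto simp: bump_def q_def\<close>)
    next
      case 2
      have "((\<lambda>x. 0) has_real_derivative 0) (at x)" by simp
      then have "(bump a b c r i has_real_derivative 0) (at x)"
        by (rule has_field_derivative_transform_within_open[of _ _ _ "{..<a}"]) (use 2 in \<open>auto simp: bump_def\<close>)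
      then show ?thesis using 2 by (simp add: bump_def)
    next
      case 3
      have "((\<lambda>x. 0) has_real_derivative 0) (at x)" by simp
      then have "(bump a b c r i has_real_derivative 0) (at x)"
        by (rule has_field_derivative_transform_within_open[of _ _ _ "{b<..}"]) (use 3 in \<open>auto simp: bump_def\<close>)
      then show ?thesis using 3 by (simp add: bump_def)
    next
      case 4
      obtain M where M: "\<And>y. \<bar>bump a b c r i y\<bar> \<le> M * (y - x)\<^sup>2" using bump_le_quadratic[OF assms] 4 by metis
      have "(bump a b c r i has_real_derivative 0) (at x)"
        by (rule has_real_derivative_0_of_quadratic[OF _ M]) (simp add: 4 bump_def)
      then show ?thesis using 4 by (simp add: bump_def)
    next
      case 5
      obtain M where M: "\<And>y. \<bar>bump a b c r i y\<bar> \<le> M * (y - x)\<^sup>2" using bump_le_quadratic[OF assms] 5 by metis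
      have "(bump a b c r i has_real_derivative 0) (at x)"
        by (rule has_real_derivative_0_of_quadratic[OF _ M]) (simp add: 5 bump_def)
      then show ?thesis using 5 by (simp add: bump_def)
    qed
  qed
  then show ?thesis by blast
qed

lemma test_function_bump:
  assumes "a < b" "c > 0"
  shows "test_function (bump a b c r i)"
proof -
  have it: "\<exists>r' j. (deriv ^^ k) (bump a b c r i) = bump a b c r' j" for k
  proof (induction k)
    case (Suc k)
    then obtain r' j where 1: "(deriv ^^ k) (bump a b c r i) = bump a b c r' j" by blast
    obtain r2 j2 where "\<And>x. (bump a b c r' j has_real_derivative bump a b c r2 j2 x) (at x)"
      using bump_deriv[OF assms] by blast
    then have "deriv (bump a b c r' j) = bump a b c r2 j2" by (auto intro!: DERIV_imp_deriv)
    then show ?case using 1 by auto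
  qed auto
  have "((deriv ^^ k) (bump a b c r i)) differentiable (at x)" for k x
  proof -
    obtain r' j where 1: "(deriv ^^ k) (bump a b c r i) = bump a b c r' j" using it by blast
    show ?thesis unfolding 1 using bump_deriv[OF assms, of r' j] by (auto simp: real_differentiable_def)
  qed
  moreover have "compact (closure {x. bump a b c r i x \<noteq> 0})"
  proof -
    have "{x. bump a b c r i x \<noteq> 0} \<subseteq> {a..b}" by (auto simp: bump_def split: if_splits)
    then show ?thesis by (meson bounded_closed_interval bounded_subset compact_closure)
  qed
  ultimately show ?thesis by (auto simp: test_function_def)
qed

text \<open>Tested against bumps, g - F' gives 0: the definition handles g, and integration by parts
  handles F'. The bumps converge boundedly to the indicator of the interval, so g - F' has integral
  0 over every interval.\<close>

lemma weak_deriv_eq_deriv: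
  assumes w: "has_weak_deriv f g" and f: "AE x in lborel. f x = F x" and [measurable]: "f \<in> borel_measurable borel"
    and d: "\<And>x. (F has_real_derivative F' x) (at x)" and F': "continuous_on UNIV F'"
  shows "AE x in lborel. g x = F' x"
proof -
  have lg: "set_integrable lborel {a..b} g" for a b using w by (auto simp: has_weak_deriv_def locally_integrable_def)
  have lF: "set_integrable lborel {a..b} F'" for a b
    by (intro borel_integrable_atLeastAtMost' continuous_on_subset[OF F']) auto
  have ld: "set_integrable lborel {a..b} (\<lambda>x. g x - F' x)" for a b
    using lg lF by (rule set_integral_diff(1))
  have cF: "continuous_on UNIV F" using d by (auto intro!: DERIV_continuous simp: continuous_on_eq_continuous_at)
  have "AE x in lborel. g x - F' x = 0"
  proof (rule AE_zero_of_interval_integrals[OF ld])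
    fix a b :: real assume "a \<le> b"
    show "(LINT x:{a..b}|lborel. g x - F' x) = 0"
    proof (cases "a = b")
      case True
      have "(LINT x:{a..b}|lborel. g x - F' x) = (LINT x::real|lborel. (0::real))"
        unfolding set_lebesgue_integral_def
      proof (rule integral_cong_AE)
        show "AE x in lborel. indicator {a..b} x *\<^sub>R (g x - F' x) = 0"
          using AE_lborel_singleton[of a] by eventually_elim (use True in auto)
      qed (use borel_measurable_integrable[OF ld[of a b, unfolded set_integrable_def]] in auto)
      then show ?thesis by simp
    next
      case False
      then have ab: "a < b" using \<open>a \<le> b\<close> by simp
      \<comment> \<open>The values stay in [0, 1] and tend to 1 inside the interval as the exponent
        parameter tends to 0.\<close>
      define \<phi> where "\<phi> n = bump a b (1 / real (Suc n)) 1 0" for n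
      have tf: "test_function (\<phi> n)" for n unfolding \<phi>_def using ab by (intro test_function_bump) auto
      have supp: "\<phi> n x = 0" if "x \<notin> {a..b}" for n x using that by (auto simp: \<phi>_def bump_def)
      have bd: "\<bar>\<phi> n x\<bar> \<le> 1" for n x by (auto simp: \<phi>_def bump_def)
      have z: "(LINT x|lborel. (g x - F' x) * \<phi> n x) = 0" for n
      proof -
        obtain r' j where dphi: "\<And>x. (\<phi> n has_real_derivative bump a b (1 / real (Suc n)) r' j x) (at x)"
          using bump_deriv[OF ab, of "1 / real (Suc n)" 1 0] unfolding \<phi>_def by auto
        let ?d = "bump a b (1 / real (Suc n)) r' j"
        have deq: "deriv (\<phi> n) = ?d" using dphi by (auto intro!: DERIV_imp_deriv)
        have cphi: "continuous_on UNIV (\<phi> n)" using dphi by (auto intro!: DERIV_continuous simp: continuous_on_eq_continuous_at)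
        have cd: "continuous_on UNIV ?d" 
          using bump_deriv[OF ab, of "1 / real (Suc n)" r' j] by (auto intro!: DERIV_continuous simp: continuous_on_eq_continuous_at)
        have suppd: "?d x = 0" if "x \<notin> {a..b}" for x using that by (auto simp: bump_def)
        have comp: "integrable lborel h" if "continuous_on UNIV h" "\<And>x. x \<notin> {a..b} \<Longrightarrow> h x = 0" for h :: "real \<Rightarrow> real"
        proof -
          have "set_integrable lborel {a..b} h" by (intro borel_integrable_atLeastAtMost' continuous_on_subset[OF that(1)]) auto
          moreover have "(\<lambda>x. indicator {a..b} x *\<^sub>R h x) = h" using that(2) by (auto simp: fun_eq_iff split: split_indicator)
          ultimately show ?thesis by (simp only: set_integrable_def)
        qed
        have i1: "integrable lborel (\<lambda>x. F' x * \<phi> n x)"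
          by (rule comp[OF continuous_on_mult[OF F' cphi]]) (simp only: supp mult_zero_right simp_thms)
        have i2: "integrable lborel (\<lambda>x. F x * ?d x)"
          by (rule comp[OF continuous_on_mult[OF cF cd]]) (simp only: suppd mult_zero_right simp_thms)
        have i3: "integrable lborel (\<lambda>x. F x * \<phi> n x)"
          by (rule comp[OF continuous_on_mult[OF cF cphi]]) (simp only: supp mult_zero_right simp_thms)
        have "(LINT x|lborel. F' x * \<phi> n x + F x * ?d x) = 0"
        proof (rule integral_of_derivative_eq_0[OF i3])
          show "integrable lborel (\<lambda>x. F' x * \<phi> n x + F x * ?d x)" using i1 i2 by simp
          show "((\<lambda>x. F x * \<phi> n x) has_vector_derivative F' x * \<phi> n x + F x * ?d x) (at x)" for x
            unfolding has_real_derivative_iff_has_vector_derivative[symmetric]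
            by (rule derivative_eq_intros d dphi refl)+ (simp add: mult_ac)
        qed
        then have "(LINT x|lborel. F' x * \<phi> n x) + (LINT x|lborel. F x * ?d x) = 0" using i1 i2 by simp
        moreover have "(LINT x|lborel. F x * ?d x) = (LINT x|lborel. f x * ?d x)"
        proof (rule integral_cong_AE)
          show "AE x in lborel. F x * ?d x = f x * ?d x" using f by eventually_elim simp
        qed (use borel_measurable_continuous_onI[OF cF] borel_measurable_continuous_onI[OF cd] in auto)
        moreover have "(LINT x|lborel. f x * ?d x) = - (LINT x|lborel. g x * \<phi> n x)"
          using w tf[of n] unfolding has_weak_deriv_def deq[symmetric] by blast
        moreover have "integrable lborel (\<lambda>x. g x * \<phi> n x)"
        proof -
          have "integrable lborel (\<lambda>x. \<phi> n x *\<^sub>R (indicator {a..b} x *\<^sub>R g x))"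
          proof (rule Bochner_Integration.integrable_bound[OF lg[of a b, unfolded set_integrable_def]])
            show "AE x in lborel. norm (\<phi> n x *\<^sub>R (indicator {a..b} x *\<^sub>R g x)) \<le> norm (indicator {a..b} x *\<^sub>R g x)"
              using bd[of n] by (auto simp: abs_mult mult_left_le_one_le)
          qed (use borel_measurable_continuous_onI[OF cphi] borel_measurable_integrable[OF lg[of a b, unfolded set_integrable_def]] in auto)
          moreover have "(\<lambda>x. \<phi> n x *\<^sub>R (indicator {a..b} x *\<^sub>R g x)) = (\<lambda>x. g x * \<phi> n x)" using supp by (auto simp: fun_eq_iff split: split_indicator)
          ultimately show ?thesis by (simp only:)
        qed
        ultimately show ?thesis using i1 by (simp add: left_diff_distrib)
      qed
      let ?h = "\<lambda>x. indicator {a..b} x *\<^sub>R (g x - F' x)"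
      have ih: "integrable lborel ?h" using ld[of a b] by (simp add: set_integrable_def)
      have "(\<lambda>n. LINT x|lborel. \<phi> n x *\<^sub>R ?h x) \<longlonglongrightarrow> (LINT x|lborel. ?h x)"
      proof (rule integral_dominated_convergence[where w="\<lambda>x. norm (?h x)"])
        have "AE x in lborel. x \<noteq> a \<and> x \<noteq> b" using AE_lborel_singleton[of a] AE_lborel_singleton[of b] by eventually_elim auto
        then show "AE x in lborel. (\<lambda>n. \<phi> n x *\<^sub>R ?h x) \<longlonglongrightarrow> ?h x"
        proof eventually_elim
          case (elim x)
          show ?case
          proof (cases "x \<in> {a..b}")
            case True
            have "(\<lambda>n. exp (- (1 / real (Suc n)) * inverse ((x - a) * (b - x)))) \<longlonglongrightarrow> exp (- 0 * inverse ((x - a) * (b - x)))"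
              by (intro tendsto_intros) (use LIMSEQ_inverse_real_of_nat in \<open>simp add: inverse_eq_divide\<close>)
            moreover have "\<phi> n x = exp (- (1 / real (Suc n)) * inverse ((x - a) * (b - x)))" for n
              using True elim by (simp add: \<phi>_def bump_def)
            ultimately have "(\<lambda>n. \<phi> n x) \<longlonglongrightarrow> 1" by simp
            then have "(\<lambda>n. \<phi> n x *\<^sub>R ?h x) \<longlonglongrightarrow> 1 *\<^sub>R ?h x" by (intro tendsto_intros)
            then show ?thesis by simp
          qed auto
        qed
        show "AE x in lborel. norm (\<phi> n x *\<^sub>R ?h x) \<le> norm (?h x)" for n
          using bd[of n] by (auto simp: abs_mult mult_left_le_one_le)
        have "continuous_on UNIV (\<phi> n)" for n
          using bump_deriv[OF ab, of "1 / real (Suc n)" 1 0] unfolding \<phi>_def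
          by (auto intro!: DERIV_continuous simp: continuous_on_eq_continuous_at)
        then show "(\<lambda>x. \<phi> n x *\<^sub>R ?h x) \<in> borel_measurable lborel" for n
          using borel_measurable_continuous_onI[of "\<phi> n"] borel_measurable_integrable[OF ih] by auto
      qed (use ih in auto)
      moreover have "(LINT x|lborel. \<phi> n x *\<^sub>R ?h x) = 0" for n
      proof -
        have "(\<lambda>x. \<phi> n x *\<^sub>R ?h x) = (\<lambda>x. (g x - F' x) * \<phi> n x)" using supp by (auto simp: fun_eq_iff split: split_indicator)
        then show ?thesis using z[of n] by (simp only:)
      qed
      ultimately have "(LINT x|lborel. ?h x) = 0" by (simp add: LIMSEQ_const_iff)
      then show ?thesis by (simp add: set_lebesgue_integral_def)
    qed
  qed
  then show ?thesis by eventually_elim simp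
qed

subsection \<open>The Hilbert transform\<close>

lemma integral_sin_over:
  assumes "0 < \<epsilon>" "\<epsilon> \<le> R"
  shows "(LINT y|lborel. indicator {\<epsilon>..R} y *\<^sub>R (sin (y * \<eta>) / y)) = Si (R * \<eta>) - Si (\<epsilon> * \<eta>)"
proof (rule integral_FTC_Icc)
  fix y assume y: "\<epsilon> \<le> y" "y \<le> R"
  have "((\<lambda>y. Si (y * \<eta>)) has_real_derivative (sinc (y * \<eta>) * \<eta>)) (at y within {\<epsilon>..R})"
    by (rule derivative_eq_intros DERIV_chain2[OF DERIV_Si] refl)+ simp
  moreover have "sinc (y * \<eta>) * \<eta> = sin (y * \<eta>) / y"
    using y assms by (auto simp: field_simps)
  ultimately show "((\<lambda>y. Si (y * \<eta>)) has_vector_derivative sin (y * \<eta>) / y) (at y within {\<epsilon>..R})"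
    by (simp add: has_real_derivative_iff_has_vector_derivative)
qed (use assms in \<open>auto intro!: continuous_intros\<close>)

lemma Si_0: "Si 0 = 0"
  by (simp add: Si_alt_def zero_ereal_def)

text \<open>The Dirichlet integral, with its sign; this is the source of the multiplier sgn of the
  Hilbert transform.\<close>

lemma Si_limit: "(\<lambda>n::nat. Si (real n * \<eta>)) \<longlonglongrightarrow> sgn \<eta> * (pi / 2)"
proof (cases "\<eta>" "0::real" rule: linorder_cases)
  case greater
  then have "filterlim (\<lambda>n::nat. real n * \<eta>) at_top sequentially"
    by (intro filterlim_at_top_mult_tendsto_pos[OF tendsto_const] filterlim_real_sequentially) auto
  from filterlim_compose[OF Si_at_top this] show ?thesis using greater by simp
next
  case less
  then have "filterlim (\<lambda>n::nat. real n * (- \<eta>)) at_top sequentially"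
    by (intro filterlim_at_top_mult_tendsto_pos[OF tendsto_const] filterlim_real_sequentially) auto
  from tendsto_minus[OF filterlim_compose[OF Si_at_top this]] have "(\<lambda>n::nat. - Si (real n * (- \<eta>))) \<longlonglongrightarrow> - (pi / 2)" .
  moreover have "- Si (real n * (- \<eta>)) = Si (real n * \<eta>)" for n :: nat
    using Si_neg[of "real n * (- \<eta>)"] Si_neg[of "real n * \<eta>"] less
    by (cases "n = 0") (auto simp: mult_nonneg_nonpos Si_0)
  ultimately show ?thesis using less by simp
qed (simp add: Si_0)

lemma integrable_inverse_one_plus_square: "integrable lborel (\<lambda>x::real. inverse (1 + x\<^sup>2))"
  using integrable_inverse_1_plus_square by (simp add: set_integrable_def einterval_def)

text \<open>Away from the origin 1/y is square integrable, so W in L2 suffices.\<close>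

lemma integrable_truncated_Cauchy_kernel:
  fixes W :: "real \<Rightarrow> complex"
  assumes [measurable]: "W \<in> borel_measurable borel" and W: "sqn W < \<infinity>" and e: "\<epsilon> > 0"
  shows "integrable lborel (\<lambda>y. indicator {y. \<epsilon> \<le> \<bar>y\<bar>} y *\<^sub>R (W (x - y) / y))"
proof (rule Bochner_Integration.integrable_bound)
  have "integrable lborel (\<lambda>x. (norm (W x))\<^sup>2)"
    using W unfolding sqn_def by (intro integrableI_bounded) auto
  from lborel_integrable_real_affine[OF this, of "-1" x]
  have 1: "integrable lborel (\<lambda>y. (norm (W (x - y)))\<^sup>2)" by simp
  \<comment> \<open>The constant comes from 1 + y^2 <= (1 + \<epsilon>^(-2)) y^2 for |y| >=
    \<epsilon>, which compares 1/y^2 with the integrable 1/(1 + y^2).\<close>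
  show "integrable lborel (\<lambda>y. (norm (W (x - y)))\<^sup>2 + (1 + inverse (\<epsilon>\<^sup>2)) * inverse (1 + y\<^sup>2))"
    by (intro Bochner_Integration.integrable_add 1 integrable_mult_right integrable_inverse_one_plus_square)
  show "AE y in lborel. norm (indicator {y. \<epsilon> \<le> \<bar>y\<bar>} y *\<^sub>R (W (x - y) / y)) \<le> norm ((norm (W (x - y)))\<^sup>2 + (1 + inverse (\<epsilon>\<^sup>2)) * inverse (1 + y\<^sup>2))"
  proof (rule AE_I2)
    fix y
    show "norm (indicator {y. \<epsilon> \<le> \<bar>y\<bar>} y *\<^sub>R (W (x - y) / y)) \<le> norm ((norm (W (x - y)))\<^sup>2 + (1 + inverse (\<epsilon>\<^sup>2)) * inverse (1 + y\<^sup>2))"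
    proof (cases "\<epsilon> \<le> \<bar>y\<bar>")
      case True
      then have y: "y \<noteq> 0" using e by auto
      have "\<epsilon>\<^sup>2 \<le> y\<^sup>2" using True e by (metis abs_le_square_iff abs_of_pos)
      then have "1 + y\<^sup>2 \<le> (1 + inverse (\<epsilon>\<^sup>2)) * y\<^sup>2" using e by (simp add: field_simps)
      then have "inverse (y\<^sup>2) \<le> (1 + inverse (\<epsilon>\<^sup>2)) * inverse (1 + y\<^sup>2)"
        using y by (simp add: inverse_eq_divide divide_simps add_pos_nonneg mult_ac)
      moreover have "norm (W (x - y)) * inverse \<bar>y\<bar> \<le> (norm (W (x - y)))\<^sup>2 + (inverse \<bar>y\<bar>)\<^sup>2"
      proof -
        have "0 \<le> norm (W (x - y)) * inverse \<bar>y\<bar>" by simp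
        then show ?thesis using sum_squares_bound[of "norm (W (x - y))" "inverse \<bar>y\<bar>"] by linarith
      qed
      ultimately show ?thesis using True by (simp add: norm_divide divide_inverse power_inverse norm_mult norm_inverse)
    qed (simp add: add_nonneg_nonneg)
  qed
qed measurable

text \<open>Truncation on both sides makes the kernel integrable, so Fubini's theorem turns the
  truncated singular integral into a multiplier, namely the transform of the truncated
  kernel.\<close>

lemma Cauchy_kernel_fourier:
  assumes G: "integrable lborel G" and e: "0 < \<epsilon>" "\<epsilon> \<le> R"
  shows "(LINT y|lborel. indicator {y. \<epsilon> \<le> \<bar>y\<bar> \<and> \<bar>y\<bar> \<le> R} y *\<^sub>R (fourier G (- (x - y)) / y))
    = fourier (\<lambda>\<eta>. - 2 * \<i> * complex_of_real (Si (R * \<eta>) - Si (\<epsilon> * \<eta>)) * G \<eta>) (- x)"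
proof -
  have [measurable]: "G \<in> borel_measurable borel" using G by auto
  let ?A = "{y. \<epsilon> \<le> \<bar>y\<bar> \<and> \<bar>y\<bar> \<le> R}"
  define k where "k y = complex_of_real (indicator ?A y / y)" for y
  have [measurable]: "k \<in> borel_measurable borel" unfolding k_def by measurable
  have k: "integrable lborel k"
  proof (rule Bochner_Integration.integrable_bound)
    show "integrable lborel (\<lambda>y. inverse \<epsilon> * indicator {-R..R} y)"
      by (intro integrable_mult_right integrable_real_indicator) (auto simp: emeasure_lborel_Icc_eq)
    show "AE y in lborel. norm (k y) \<le> norm (inverse \<epsilon> * indicator {-R..R} y)"
      using e by (intro AE_I2) (auto simp: k_def norm_divide inverse_eq_divide intro!: divide_left_mono split: split_indicator)
  qed simp
  have int: "integrable (lborel \<Otimes>\<^sub>M lborel) (\<lambda>(y, \<eta>). cis ((x - y) * \<eta>) * (k y * G \<eta>))"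
    using integrable_pair_mult[OF k G] unfolding case_prod_beta
    by (subst integrable_cis_mult_iff) (auto simp: case_prod_beta)
  have inner: "(LINT y|lborel. cis (- (y * \<eta>)) * k y) = - 2 * \<i> * complex_of_real (Si (R * \<eta>) - Si (\<epsilon> * \<eta>))" for \<eta>
  proof -
    have ik: "integrable lborel (\<lambda>y. cis (- (y * \<eta>)) * k y)" using k by simp
    have "(LINT y|lborel. cis (- (y * \<eta>)) * k y) = (LINT y|lborel. cis (y * \<eta>) * k (- y))"
      by (subst integral_reflect_lborel[symmetric]) simp
    \<comment> \<open>The kernel is odd: adding the reflected integral cancels the cosine part and
      leaves the sine part, which integrates to \<open>Si\<close>.\<close>
    then have "2 * (LINT y|lborel. cis (- (y * \<eta>)) * k y) = (LINT y|lborel. cis (- (y * \<eta>)) * k y) + (LINT y|lborel. cis (y * \<eta>) * k (- y))" by simp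
    also have "\<dots> = (LINT y|lborel. cis (- (y * \<eta>)) * k y + cis (y * \<eta>) * k (- y))"
      by (rule Bochner_Integration.integral_add[symmetric]) (use k in \<open>auto simp: integrable_reflect_lborel\<close>)
    also have "\<dots> = (LINT y|lborel. - 2 * \<i> * complex_of_real (indicator ?A y * (sin (y * \<eta>) / y)))"
    proof (rule Bochner_Integration.integral_cong[OF refl])
      fix y
      have 1: "k (- y) = - k y" by (simp add: k_def indicator_def)
      have 2: "cis (- (y * \<eta>)) - cis (y * \<eta>) = - 2 * \<i> * complex_of_real (sin (y * \<eta>))"
        by (simp add: complex_eq_iff)
      have "cis (- (y * \<eta>)) * k y + cis (y * \<eta>) * k (- y) = (cis (- (y * \<eta>)) - cis (y * \<eta>)) * k y"
        unfolding 1 by (simp add: algebra_simps)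
      then show "cis (- (y * \<eta>)) * k y + cis (y * \<eta>) * k (- y) = - 2 * \<i> * complex_of_real (indicator ?A y * (sin (y * \<eta>) / y))"
        unfolding 2 by (simp add: k_def)
    qed
    also have "\<dots> = - 2 * \<i> * complex_of_real (LINT y|lborel. indicator ?A y * (sin (y * \<eta>) / y))"
      unfolding integral_mult_right_zero integral_complex_of_real ..
    also have "(LINT y|lborel. indicator ?A y * (sin (y * \<eta>) / y)) = 2 * (Si (R * \<eta>) - Si (\<epsilon> * \<eta>))"
    proof -
      let ?p = "\<lambda>y. indicator {\<epsilon>..R} y *\<^sub>R (sin (y * \<eta>) / y)"
      have ip: "integrable lborel ?p"
        by (rule borel_integrable_atLeastAtMost'[unfolded set_integrable_def]) (use e in \<open>auto intro!: continuous_intros\<close>)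
      have "indicator ?A y * (sin (y * \<eta>) / y) = ?p y + ?p (- y)" for y
        using e by (auto split: split_indicator)
      then have "(LINT y|lborel. indicator ?A y * (sin (y * \<eta>) / y)) = (LINT y|lborel. ?p y) + (LINT y|lborel. ?p (- y))"
        using ip integrable_reflect_lborel[of ?p] by simp
      then show ?thesis using integral_reflect_lborel[of ?p] integral_sin_over[OF e, of \<eta>] by simp
    qed
    finally show ?thesis by simp
  qed
  have "(LINT y|lborel. indicator ?A y *\<^sub>R (fourier G (- (x - y)) / y)) = 
     (LINT y|lborel. (LINT \<eta>|lborel. cis ((x - y) * \<eta>) * (k y * G \<eta>))) / complex_of_real (sqrt (2 * pi))"
  proof -
    have "indicator ?A y *\<^sub>R (fourier G (- (x - y)) / y) = (LINT \<eta>|lborel. cis ((x - y) * \<eta>) * (k y * G \<eta>)) / complex_of_real (sqrt (2 * pi))" for y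
    proof -
      have eq: "(LINT \<eta>|lborel. cis ((x - y) * \<eta>) * (k y * G \<eta>)) = k y * (LINT \<eta>|lborel. cis (- (\<eta> * (- (x - y)))) * G \<eta>)"
        unfolding integral_mult_right_zero[symmetric]
      proof (rule Bochner_Integration.integral_cong[OF refl])
        fix \<eta>
        have "(x - y) * \<eta> = - (\<eta> * (- (x - y)))" by (simp add: algebra_simps)
        then show "cis ((x - y) * \<eta>) * (k y * G \<eta>) = k y * (cis (- (\<eta> * (- (x - y)))) * G \<eta>)"
          by (simp only: mult_ac)
      qed
      show ?thesis unfolding eq fourier_def by (simp add: k_def scaleR_conv_of_real)
    qed
    then show ?thesis by simp
  qed
  also have "(LINT y|lborel. (LINT \<eta>|lborel. cis ((x - y) * \<eta>) * (k y * G \<eta>))) = (LINT \<eta>|lborel. (LINT y|lborel. cis ((x - y) * \<eta>) * (k y * G \<eta>)))"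
    by (rule lborel_pair.Fubini_integral[OF int, symmetric])
  also have "\<dots> = (LINT \<eta>|lborel. cis (- (\<eta> * (- x))) * (- 2 * \<i> * complex_of_real (Si (R * \<eta>) - Si (\<epsilon> * \<eta>)) * G \<eta>))"
  proof (rule Bochner_Integration.integral_cong[OF refl])
    fix \<eta>
    have "(LINT y|lborel. cis ((x - y) * \<eta>) * (k y * G \<eta>)) = (LINT y|lborel. cis (x * \<eta>) * G \<eta> * (cis (- (y * \<eta>)) * k y))"
    proof (rule Bochner_Integration.integral_cong[OF refl])
      fix y
      have "cis ((x - y) * \<eta>) = cis (x * \<eta>) * cis (- (y * \<eta>))" by (simp add: cis_mult algebra_simps)
      then show "cis ((x - y) * \<eta>) * (k y * G \<eta>) = cis (x * \<eta>) * G \<eta> * (cis (- (y * \<eta>)) * k y)" by (simp only: mult_ac)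
    qed
    also have "\<dots> = cis (x * \<eta>) * G \<eta> * (LINT y|lborel. cis (- (y * \<eta>)) * k y)" by (rule integral_mult_right_zero)
    finally show "(LINT y|lborel. cis ((x - y) * \<eta>) * (k y * G \<eta>)) = cis (- (\<eta> * (- x))) * (- 2 * \<i> * complex_of_real (Si (R * \<eta>) - Si (\<epsilon> * \<eta>)) * G \<eta>)"
      unfolding inner by (simp add: mult_ac)
  qed
  finally show ?thesis unfolding fourier_def .
qed

lemma abs_diff_bound: "\<bar>a\<bar> \<le> A \<Longrightarrow> \<bar>b\<bar> \<le> B \<Longrightarrow> 2 * \<bar>a - b\<bar> \<le> 2 * A + 2 * (B::real)"
proof -
  assume "\<bar>a\<bar> \<le> A" "\<bar>b\<bar> \<le> B"
  then have "\<bar>a - b\<bar> \<le> A + B" using abs_triangle_ineq4[of a b] by (meson add_mono order_trans)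
  then show ?thesis by simp
qed

text \<open>The doubly truncated integrals have the multiplier -2i (Si(R \<eta>) - Si(\<epsilon>
  \<eta>)). As \<open>Si\<close> is bounded, dominated convergence allows R to infinity and then
  \<epsilon> to 0. The identity holds at every x because the truncated integrals do not see null
  sets.\<close>

lemma hilbert_eq_fourier:
  assumes G: "integrable lborel G" and G2: "sqn G < \<infinity>" and [measurable]: "w \<in> borel_measurable borel"
    and w: "AE x in lborel. complex_of_real (w x) = fourier G (- x)"
  shows "complex_of_real (hilbert w x) = fourier (\<lambda>\<eta>. - \<i> * complex_of_real (sgn \<eta>) * G \<eta>) (- x)"
proof -
  have [measurable]: "G \<in> borel_measurable borel" using G by auto
  obtain B where B: "\<And>t. \<bar>Si t\<bar> \<le> B" using bounded_Si by blast
  define W where "W z = fourier G (- z)" for z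
  have [measurable]: "W \<in> borel_measurable borel" unfolding W_def by measurable
  have sW: "sqn W < \<infinity>"
  proof -
    have "sqn W = sqn (fourier G)"
      unfolding sqn_def W_def by (subst (2) nn_integral_real_affine[of _ "-1" 0]) auto
    then show ?thesis using Plancherel_le[OF G] G2 by simp
  qed
  define K where "K \<epsilon> = fourier (\<lambda>\<eta>. - 2 * \<i> * complex_of_real (sgn \<eta> * (pi / 2) - Si (\<epsilon> * \<eta>)) * G \<eta>) (- x)" for \<epsilon>
  have AEw: "AE y in lborel. complex_of_real (w (x - y)) = W (x - y)"
    using AE_borel_affine[of "-1" "\<lambda>z. complex_of_real (w z) = W z" x] w by (simp add: W_def)
  have eps: "complex_of_real (LINT y:{y. \<epsilon> \<le> \<bar>y\<bar>}|lborel. w (x - y) / y) = K \<epsilon>" if e: "\<epsilon> > 0" for \<epsilon>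
  proof -
    have "complex_of_real (LINT y:{y. \<epsilon> \<le> \<bar>y\<bar>}|lborel. w (x - y) / y) = (LINT y|lborel. complex_of_real (indicator {y. \<epsilon> \<le> \<bar>y\<bar>} y *\<^sub>R (w (x - y) / y)))"
      unfolding set_lebesgue_integral_def by (rule integral_complex_of_real[symmetric])
    also have "\<dots> = (LINT y|lborel. indicator {y. \<epsilon> \<le> \<bar>y\<bar>} y *\<^sub>R (W (x - y) / y))"
    proof (rule integral_cong_AE)
      show "AE y in lborel. complex_of_real (indicator {y. \<epsilon> \<le> \<bar>y\<bar>} y *\<^sub>R (w (x - y) / y)) = indicator {y. \<epsilon> \<le> \<bar>y\<bar>} y *\<^sub>R (W (x - y) / y)"
        using AEw by eventually_elim (simp add: scaleR_conv_of_real)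
    qed measurable
    finally have eq: "complex_of_real (LINT y:{y. \<epsilon> \<le> \<bar>y\<bar>}|lborel. w (x - y) / y) = \<dots>" .
    have int: "integrable lborel (\<lambda>y. indicator {y. \<epsilon> \<le> \<bar>y\<bar>} y *\<^sub>R (W (x - y) / y))"
      by (rule integrable_truncated_Cauchy_kernel[OF _ sW e]) simp
    have "(\<lambda>n::nat. LINT y|lborel. indicator {y. \<epsilon> \<le> \<bar>y\<bar> \<and> \<bar>y\<bar> \<le> real n} y *\<^sub>R (W (x - y) / y)) \<longlonglongrightarrow> (LINT y|lborel. indicator {y. \<epsilon> \<le> \<bar>y\<bar>} y *\<^sub>R (W (x - y) / y))"
    proof (rule integral_dominated_convergence[where w="\<lambda>y. norm (indicator {y. \<epsilon> \<le> \<bar>y\<bar>} y *\<^sub>R (W (x - y) / y))"])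
      show "AE y in lborel. (\<lambda>n::nat. indicator {y. \<epsilon> \<le> \<bar>y\<bar> \<and> \<bar>y\<bar> \<le> real n} y *\<^sub>R (W (x - y) / y)) \<longlonglongrightarrow> indicator {y. \<epsilon> \<le> \<bar>y\<bar>} y *\<^sub>R (W (x - y) / y)"
      proof (intro AE_I2 tendsto_eventually)
        fix y :: real
        obtain k :: nat where k: "\<bar>y\<bar> \<le> real k" using real_arch_simple by blast
        show "\<forall>\<^sub>F n in sequentially. indicator {y. \<epsilon> \<le> \<bar>y\<bar> \<and> \<bar>y\<bar> \<le> real n} y *\<^sub>R (W (x - y) / y) = indicator {y. \<epsilon> \<le> \<bar>y\<bar>} y *\<^sub>R (W (x - y) / y)"
          using eventually_ge_at_top[of k] by eventually_elim (use k in \<open>auto split: split_indicator\<close>)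
      qed
      show "AE y in lborel. norm (indicator {y. \<epsilon> \<le> \<bar>y\<bar> \<and> \<bar>y\<bar> \<le> real n} y *\<^sub>R (W (x - y) / y)) \<le> norm (indicator {y. \<epsilon> \<le> \<bar>y\<bar>} y *\<^sub>R (W (x - y) / y))" for n :: nat
        by (intro AE_I2) (auto split: split_indicator)
      show "integrable lborel (\<lambda>y. norm (indicator {y. \<epsilon> \<le> \<bar>y\<bar>} y *\<^sub>R (W (x - y) / y)))"
        by (rule integrable_norm[OF int])
    qed (use int in auto)
    moreover have "(\<lambda>n::nat. LINT y|lborel. indicator {y. \<epsilon> \<le> \<bar>y\<bar> \<and> \<bar>y\<bar> \<le> real n} y *\<^sub>R (W (x - y) / y)) \<longlonglongrightarrow> K \<epsilon>"
    proof (rule Lim_transform_eventually)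
      obtain k :: nat where k: "\<epsilon> \<le> real k" using real_arch_simple by blast
      show "\<forall>\<^sub>F n in sequentially. fourier (\<lambda>\<eta>. - 2 * \<i> * complex_of_real (Si (real n * \<eta>) - Si (\<epsilon> * \<eta>)) * G \<eta>) (- x) =
          (LINT y|lborel. indicator {y. \<epsilon> \<le> \<bar>y\<bar> \<and> \<bar>y\<bar> \<le> real n} y *\<^sub>R (W (x - y) / y))"
        using eventually_ge_at_top[of k]
      proof eventually_elim
        case (elim n)
        then have "\<epsilon> \<le> real n" using k by linarith
        from Cauchy_kernel_fourier[OF G e this] show ?case unfolding W_def by (rule sym)
      qed
      show "(\<lambda>n::nat. fourier (\<lambda>\<eta>. - 2 * \<i> * complex_of_real (Si (real n * \<eta>) - Si (\<epsilon> * \<eta>)) * G \<eta>) (- x)) \<longlonglongrightarrow> K \<epsilon>"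
        unfolding K_def fourier_def
      proof (intro tendsto_divide tendsto_const integral_dominated_convergence[where w="\<lambda>\<eta>. 4 * B * norm (G \<eta>)"])
        show "AE \<eta> in lborel. (\<lambda>n::nat. cis (- (\<eta> * - x)) * (- 2 * \<i> * complex_of_real (Si (real n * \<eta>) - Si (\<epsilon> * \<eta>)) * G \<eta>)) \<longlonglongrightarrow>
           cis (- (\<eta> * - x)) * (- 2 * \<i> * complex_of_real (sgn \<eta> * (pi / 2) - Si (\<epsilon> * \<eta>)) * G \<eta>)"
          by (intro AE_I2 tendsto_mult tendsto_const tendsto_of_real tendsto_diff Si_limit)
        show "AE \<eta> in lborel. norm (cis (- (\<eta> * - x)) * (- 2 * \<i> * complex_of_real (Si (real n * \<eta>) - Si (\<epsilon> * \<eta>)) * G \<eta>)) \<le> 4 * B * norm (G \<eta>)" for n :: nat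
        proof (rule AE_I2)
          fix \<eta>
          have "2 * \<bar>Si (real n * \<eta>) - Si (\<epsilon> * \<eta>)\<bar> \<le> 4 * B" using abs_diff_bound[OF B B] by simp
          from mult_right_mono[OF this norm_ge_zero[of "G \<eta>"]]
          show "norm (cis (- (\<eta> * - x)) * (- 2 * \<i> * complex_of_real (Si (real n * \<eta>) - Si (\<epsilon> * \<eta>)) * G \<eta>)) \<le> 4 * B * norm (G \<eta>)"
            by (simp add: norm_mult del: of_real_diff)
        qed
      qed (use G in auto)
    qed
    ultimately show ?thesis unfolding eq by (rule LIMSEQ_unique)
  qed
  have Klim: "(K \<longlongrightarrow> fourier (\<lambda>\<eta>. - 2 * \<i> * complex_of_real (sgn \<eta> * (pi / 2) - Si (0 * \<eta>)) * G \<eta>) (- x)) (at_right 0)"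
    unfolding K_def fourier_def
  proof (intro tendsto_divide tendsto_const integral_dominated_convergence_within[where w="\<lambda>\<eta>. (pi + 2 * B) * norm (G \<eta>)"])
    fix \<eta> :: real
    show "((\<lambda>\<epsilon>. cis (- (\<eta> * - x)) * (- 2 * \<i> * complex_of_real (sgn \<eta> * (pi / 2) - Si (\<epsilon> * \<eta>)) * G \<eta>)) \<longlongrightarrow>
           cis (- (\<eta> * - x)) * (- 2 * \<i> * complex_of_real (sgn \<eta> * (pi / 2) - Si (0 * \<eta>)) * G \<eta>)) (at_right 0)"
      by (intro tendsto_mult tendsto_const tendsto_of_real tendsto_diff isCont_tendsto_compose[OF isCont_Si] tendsto_ident_at)
  next
    fix \<epsilon> \<eta> :: real
    have "\<bar>sgn \<eta> * (pi / 2)\<bar> \<le> pi / 2" by (simp add: abs_mult sgn_if)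
    from abs_diff_bound[OF this B[of "\<epsilon> * \<eta>"]]
    have "2 * \<bar>sgn \<eta> * (pi / 2) - Si (\<epsilon> * \<eta>)\<bar> \<le> pi + 2 * B" by simp
    from mult_right_mono[OF this norm_ge_zero[of "G \<eta>"]]
    show "norm (cis (- (\<eta> * - x)) * (- 2 * \<i> * complex_of_real (sgn \<eta> * (pi / 2) - Si (\<epsilon> * \<eta>)) * G \<eta>)) \<le> (pi + 2 * B) * norm (G \<eta>)"
      by (simp add: norm_mult del: of_real_diff of_real_mult)
  qed (use G in auto)
  define Q where "Q = fourier (\<lambda>\<eta>. - \<i> * complex_of_real (sgn \<eta>) * G \<eta>) (- x)"
  have Qeq: "fourier (\<lambda>\<eta>. - 2 * \<i> * complex_of_real (sgn \<eta> * (pi / 2) - Si (0 * \<eta>)) * G \<eta>) (- x) = complex_of_real pi * Q"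
    unfolding Q_def fourier_cmult[symmetric] by (simp add: Si_0 mult_ac)
  have "((\<lambda>\<epsilon>. complex_of_real (LINT y:{y. \<epsilon> \<le> \<bar>y\<bar>}|lborel. w (x - y) / y)) \<longlongrightarrow> complex_of_real pi * Q) (at_right 0)"
    using Klim unfolding Qeq
    by (rule Lim_transform_eventually) (auto simp: eventually_at_right_field eps intro!: exI[of _ 1])
  then have lim: "((\<lambda>\<epsilon>. LINT y:{y. \<epsilon> \<le> \<bar>y\<bar>}|lborel. w (x - y) / y) \<longlongrightarrow> Re (complex_of_real pi * Q)) (at_right 0)"
    and im: "((\<lambda>\<epsilon>. 0) \<longlongrightarrow> Im (complex_of_real pi * Q)) (at_right (0::real))"
    by (auto dest: tendsto_Re tendsto_Im)
  \<comment> \<open>A limit of real numbers is real, so Q coincides with the real limit that defines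
    \<open>hilbert\<close>.\<close>
  have "Im (complex_of_real pi * Q) = 0" 
    using im by (simp add: tendsto_const_iff)
  then have "Q = complex_of_real (Re Q)" by (simp add: complex_eq_iff)
  moreover have "hilbert w x = Re Q"
    unfolding hilbert_def using tendsto_Lim[OF _ lim] by simp
  ultimately show ?thesis unfolding Q_def by simp
qed

subsection \<open>Weighted interpolation\<close>

text \<open>Induction on k with \<epsilon> arbitrary. Either the \<open>X 0\<close> term dominates
  in the bound for the previous index, or that index is at most 2e times the present one, and the
  convexity relation can be divided by the present value. The constant is chosen before X and is
  therefore uniform.\<close>

lemma log_convex_interp_step:
  fixes c :: real
  assumes c: "c \<ge> 0" and "k < n" and "\<epsilon> > 0"
  shows "\<exists>C\<ge>0. \<forall>X. (\<forall>i. X i \<ge> 0) \<longrightarrow> (\<forall>i. 0 < i \<and> i < n \<longrightarrow> (X i)\<^sup>2 \<le> X (i - 1) * (X (Suc i) + c * X i)) \<longrightarrow>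
     X k \<le> \<epsilon> * X (Suc k) + C * X 0"
  using \<open>k < n\<close> \<open>\<epsilon> > 0\<close>
proof (induction k arbitrary: \<epsilon>)
  case 0
  show ?case by (rule exI[of _ 1]) (use 0 in auto)
next
  case (Suc k)
  \<comment> \<open>\<open>4 * e \<le> \<epsilon>\<close> serves the final coefficient, and
    \<open>4 * (e * c) \<le> 1\<close> lets half of x absorb the lower-order term 2 e c x.\<close>
  define e where "e = min (\<epsilon> / 4) (1 / (4 * c + 4))"
  have e: "e > 0" "4 * e \<le> \<epsilon>" unfolding e_def using Suc.prems c by auto
  have "e * (4 * c + 4) \<le> 1 / (4 * c + 4) * (4 * c + 4)"
    unfolding e_def using c by (intro mult_right_mono) auto
  then have "e * (4 * c + 4) \<le> 1" using c by simp
  then have ec: "4 * (e * c) \<le> 1" using e(1) by (simp add: distrib_left)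
  obtain C where C: "C \<ge> 0" and IH: "\<And>X. (\<forall>i. X i \<ge> 0) \<Longrightarrow> (\<forall>i. 0 < i \<and> i < n \<longrightarrow> (X i)\<^sup>2 \<le> X (i - 1) * (X (Suc i) + c * X i)) \<Longrightarrow> X k \<le> e * X (Suc k) + C * X 0"
    using Suc.IH[OF _ e(1)] Suc.prems by auto
  show ?case
  proof (intro exI[of _ "C / e"] conjI allI impI)
    show "C / e \<ge> 0" using C e by simp
    fix X :: "nat \<Rightarrow> real"
    assume X: "\<forall>i. X i \<ge> 0" and L: "\<forall>i. 0 < i \<and> i < n \<longrightarrow> (X i)\<^sup>2 \<le> X (i - 1) * (X (Suc i) + c * X i)"
    define x y z where "x = X (Suc k)" and "y = X k" and "z = X (Suc (Suc k))"
    have pos: "x \<ge> 0" "y \<ge> 0" "z \<ge> 0" "X 0 \<ge> 0" using X by (auto simp: x_def y_def z_def)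
    have y: "y \<le> e * x + C * X 0" using IH[OF X L] by (simp add: x_def y_def)
    have xx: "x * x \<le> y * (z + c * x)" using L[rule_format, of "Suc k"] Suc.prems by (simp add: x_def y_def z_def power2_eq_square)
    have "x \<le> \<epsilon> * z + C / e * X 0"
    proof (cases "C * X 0 \<le> e * x")
      case True
      then have "y \<le> 2 * e * x" using y by simp
      then have "x * x \<le> (2 * e * x) * (z + c * x)"
        using xx mult_right_mono[of y "2 * e * x" "z + c * x"] pos c by (meson add_nonneg_nonneg mult_nonneg_nonneg order_trans)
      then have "x * x \<le> x * (2 * e * (z + c * x))" by (simp add: mult_ac)
      then have "x = 0 \<or> x \<le> 2 * e * (z + c * x)" using pos(1) by (auto simp: mult_le_cancel_left less_le)
      moreover have "2 * e * (z + c * x) \<le> 2 * e * z + x / 2"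
        using mult_right_mono[OF ec pos(1)] by (simp add: algebra_simps)
      ultimately have "x = 0 \<or> x \<le> 4 * e * z" by auto
      moreover have "4 * e * z \<le> \<epsilon> * z" using e(2) pos by (intro mult_right_mono) auto
      ultimately have "x \<le> \<epsilon> * z" using pos Suc.prems by auto
      moreover have "0 \<le> C / e * X 0" using C e pos by simp
      ultimately show ?thesis by linarith
    next
      case False
      then have "x \<le> C * X 0 / e" using e by (simp add: field_simps)
      moreover have "0 \<le> \<epsilon> * z" using pos Suc.prems by simp
      ultimately show ?thesis by simp
    qed
    then show "X (Suc k) \<le> \<epsilon> * X (Suc (Suc k)) + C / e * X 0" by (simp add: x_def z_def)
  qed
qed

text \<open>Downward induction from k = n, each time applying the step with \<epsilon> = 1.\<close>

lemma log_convex_interp: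
  fixes c :: real
  assumes c: "c \<ge> 0" and "k \<le> n"
  shows "\<exists>C\<ge>0. \<forall>X. (\<forall>i. X i \<ge> 0) \<longrightarrow> (\<forall>i. 0 < i \<and> i < n \<longrightarrow> (X i)\<^sup>2 \<le> X (i - 1) * (X (Suc i) + c * X i)) \<longrightarrow>
     X k \<le> X n + C * X 0"
  using assms(2)
proof (induction k rule: inc_induct)
  case base
  show ?case by (rule exI[of _ 0]) auto
next
  case (step k)
  obtain C1 where C1: "C1 \<ge> 0" "\<And>X. (\<forall>i. X i \<ge> 0) \<Longrightarrow> (\<forall>i. 0 < i \<and> i < n \<longrightarrow> (X i)\<^sup>2 \<le> X (i - 1) * (X (Suc i) + c * X i)) \<Longrightarrow> X (Suc k) \<le> X n + C1 * X 0"
    using step by blast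
  obtain C2 where C2: "C2 \<ge> 0" "\<And>X. (\<forall>i. X i \<ge> 0) \<Longrightarrow> (\<forall>i. 0 < i \<and> i < n \<longrightarrow> (X i)\<^sup>2 \<le> X (i - 1) * (X (Suc i) + c * X i)) \<Longrightarrow> X k \<le> 1 * X (Suc k) + C2 * X 0"
    using log_convex_interp_step[OF c, of k n 1] step by auto
  show ?case
  proof (intro exI[of _ "C1 + C2"] conjI allI impI)
    fix X :: "nat \<Rightarrow> real"
    assume X: "\<forall>i. X i \<ge> 0" and L: "\<forall>i. 0 < i \<and> i < n \<longrightarrow> (X i)\<^sup>2 \<le> X (i - 1) * (X (Suc i) + c * X i)"
    show "X k \<le> X n + (C1 + C2) * X 0" using C1(2)[OF X L] C2(2)[OF X L] by (simp add: algebra_simps)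
  qed (use C1 C2 in auto)
qed

lemma Cauchy_Schwarz_LINT:
  fixes f g :: "'a \<Rightarrow> real"
  assumes [measurable]: "f \<in> borel_measurable M" "g \<in> borel_measurable M"
    and f: "integrable M (\<lambda>x. (f x)\<^sup>2)" and g: "integrable M (\<lambda>x. (g x)\<^sup>2)"
  shows "integrable M (\<lambda>x. f x * g x)" "\<bar>LINT x|M. f x * g x\<bar> \<le> sqrt (LINT x|M. (f x)\<^sup>2) * sqrt (LINT x|M. (g x)\<^sup>2)"
proof -
  show i: "integrable M (\<lambda>x. f x * g x)"
  proof (rule Bochner_Integration.integrable_bound)
    show "integrable M (\<lambda>x. (f x)\<^sup>2 + (g x)\<^sup>2)" using f g by simp
    show "AE x in M. norm (f x * g x) \<le> norm ((f x)\<^sup>2 + (g x)\<^sup>2)"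
    proof (rule AE_I2)
      fix x
      have "\<bar>f x\<bar> * \<bar>g x\<bar> \<le> (f x)\<^sup>2 + (g x)\<^sup>2"
        using sum_squares_bound[of "\<bar>f x\<bar>" "\<bar>g x\<bar>"] mult_nonneg_nonneg[of "\<bar>f x\<bar>" "\<bar>g x\<bar>"] by (simp del: mult_nonneg_nonneg)
      then show "norm (f x * g x) \<le> norm ((f x)\<^sup>2 + (g x)\<^sup>2)" by (simp add: abs_mult)
    qed
  qed simp
  have "(\<integral>\<^sup>+x. ennreal \<bar>f x\<bar> * ennreal \<bar>g x\<bar> \<partial>M)\<^sup>2 \<le> (\<integral>\<^sup>+x. (ennreal \<bar>f x\<bar>)\<^sup>2 \<partial>M) * (\<integral>\<^sup>+x. (ennreal \<bar>g x\<bar>)\<^sup>2 \<partial>M)"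
    by (rule Cauchy_Schwarz_nn_integral) auto
  also have "(\<integral>\<^sup>+x. (ennreal \<bar>f x\<bar>)\<^sup>2 \<partial>M) = ennreal (LINT x|M. (f x)\<^sup>2)"
    using f by (subst nn_integral_eq_integral[symmetric]) (auto simp: ennreal_power)
  also have "(\<integral>\<^sup>+x. (ennreal \<bar>g x\<bar>)\<^sup>2 \<partial>M) = ennreal (LINT x|M. (g x)\<^sup>2)"
    using g by (subst nn_integral_eq_integral[symmetric]) (auto simp: ennreal_power)
  also have "(\<integral>\<^sup>+x. ennreal \<bar>f x\<bar> * ennreal \<bar>g x\<bar> \<partial>M) = ennreal (LINT x|M. \<bar>f x * g x\<bar>)"
    using integrable_abs[OF i, unfolded abs_mult]
    by (subst nn_integral_eq_integral[symmetric]) (auto simp: ennreal_mult abs_mult)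
  finally have "ennreal ((LINT x|M. \<bar>f x * g x\<bar>)\<^sup>2) \<le> ennreal ((LINT x|M. (f x)\<^sup>2) * (LINT x|M. (g x)\<^sup>2))"
    by (simp add: ennreal_power ennreal_mult)
  then have "(LINT x|M. \<bar>f x * g x\<bar>)\<^sup>2 \<le> (LINT x|M. (f x)\<^sup>2) * (LINT x|M. (g x)\<^sup>2)"
    by (subst (asm) ennreal_le_iff) auto
  then have "LINT x|M. \<bar>f x * g x\<bar> \<le> sqrt ((LINT x|M. (f x)\<^sup>2) * (LINT x|M. (g x)\<^sup>2))"
    by (rule real_le_rsqrt)
  then show "\<bar>LINT x|M. f x * g x\<bar> \<le> sqrt (LINT x|M. (f x)\<^sup>2) * sqrt (LINT x|M. (g x)\<^sup>2)"
    unfolding real_sqrt_mult by (rule order_trans[OF integral_abs_bound])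
qed

lemma integrable_poly_gauss:
  fixes g :: "real \<Rightarrow> 'a::{banach, second_countable_topology}"
  assumes [measurable]: "g \<in> borel_measurable borel" and \<delta>: "\<delta> > 0"
    and bd: "\<And>x. norm (g x) \<le> A * (1 + x\<^sup>2) ^ m * exp (- \<delta> * x\<^sup>2)"
  shows "integrable lborel g"
proof (rule Bochner_Integration.integrable_bound)
  \<comment> \<open>Apply \<open>exp_minus_le_power\<close> to \<delta> (1 + x^2) with exponent m +
    1: this cancels the polynomial and leaves 1/(1 + x^2). The factor \<open>exp \<delta>\<close>
    corrects x^2 to 1 + x^2.\<close>
  define K where "K = exp \<delta> * (real (Suc m) / \<delta>) ^ Suc m"
  have A: "A \<ge> 0" using order_trans[OF norm_ge_zero bd[of 0]] by simp
  show "integrable lborel (\<lambda>x::real. A * K * inverse (1 + x\<^sup>2))"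
    by (intro integrable_mult_right integrable_inverse_one_plus_square)
  show "AE x in lborel. norm (g x) \<le> norm (A * K * inverse (1 + x\<^sup>2))"
  proof (rule AE_I2)
    fix x :: real
    have p: "1 + x\<^sup>2 > 0" by (simp add: add_pos_nonneg)
    have "exp (- (\<delta> * (1 + x\<^sup>2))) \<le> (real (Suc m) / (\<delta> * (1 + x\<^sup>2))) ^ Suc m"
      using p \<delta> by (intro exp_minus_le_power) auto
    then have "exp \<delta> * exp (- (\<delta> * (1 + x\<^sup>2))) \<le> exp \<delta> * (real (Suc m) / (\<delta> * (1 + x\<^sup>2))) ^ Suc m"
      by (rule mult_left_mono) simp
    also have "exp \<delta> * exp (- (\<delta> * (1 + x\<^sup>2))) = exp (- \<delta> * x\<^sup>2)" by (simp add: exp_add[symmetric] algebra_simps)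
    also have "exp \<delta> * (real (Suc m) / (\<delta> * (1 + x\<^sup>2))) ^ Suc m = K * inverse (1 + x\<^sup>2) ^ Suc m"
      unfolding K_def by (simp only: divide_inverse inverse_mult_distrib power_mult_distrib mult_ac)
    finally have "(1 + x\<^sup>2) ^ m * exp (- \<delta> * x\<^sup>2) \<le> (1 + x\<^sup>2) ^ m * (K * inverse (1 + x\<^sup>2) ^ Suc m)"
      using p by (intro mult_left_mono) auto
    also have "\<dots> = K * inverse (1 + x\<^sup>2) * ((1 + x\<^sup>2) * inverse (1 + x\<^sup>2)) ^ m"
      by (simp only: power_mult_distrib power_Suc mult_ac)
    also have "\<dots> = K * inverse (1 + x\<^sup>2)" using p by simp
    finally have "A * ((1 + x\<^sup>2) ^ m * exp (- \<delta> * x\<^sup>2)) \<le> A * (K * inverse (1 + x\<^sup>2))" using A by (rule mult_left_mono)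
    then show "norm (g x) \<le> norm (A * K * inverse (1 + x\<^sup>2))"
      using bd[of x] by (simp add: mult.assoc)
  qed
qed simp

text \<open>The weight has the Gaussian cutoff \<open>exp (- \<delta> x\<^sup>2)\<close> so that integrations by parts have no
  boundary terms; \<open>\<bar>weight'\<bar> \<le> c (1 + x\<^sup>2)\<^bsup>1/2\<^esup> weight\<close> uniformly in \<open>\<delta> \<le> 1\<close>, which keeps the
  lower-order terms within the same scale of norms.\<close>

definition gweight :: "real \<Rightarrow> nat \<Rightarrow> real \<Rightarrow> real" where
  "gweight \<delta> j x = (1 + x\<^sup>2) ^ j * exp (- \<delta> * x\<^sup>2)"

lemma gweight_pos: "gweight \<delta> j x > 0"
  unfolding gweight_def by (simp add: add_pos_nonneg)

lemma continuous_on_gweight [continuous_intros]: "continuous_on S (gweight \<delta> j)"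
  unfolding gweight_def by (intro continuous_intros)

lemma gweight_deriv:
  assumes \<delta>: "0 < \<delta>" "\<delta> \<le> 1"
  obtains D where "\<And>x. (gweight \<delta> j has_real_derivative D x) (at x)" "continuous_on UNIV D"
    "\<And>x. \<bar>D x\<bar> \<le> (2 * real j + 2) * (sqrt (gweight \<delta> (Suc j) x) * sqrt (gweight \<delta> j x))"
proof
  let ?D = "\<lambda>x. (2 * real j * x * (1 + x\<^sup>2) ^ (j - 1) - 2 * \<delta> * x * (1 + x\<^sup>2) ^ j) * exp (- \<delta> * x\<^sup>2)"
  show "(gweight \<delta> j has_real_derivative ?D x) (at x)" for x
    unfolding gweight_def by (auto intro!: derivative_eq_intros simp: algebra_simps)
  show "continuous_on UNIV ?D" by (intro continuous_intros)
  fix x :: real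
  have p: "1 + x\<^sup>2 \<ge> 1" by simp
  have sx: "\<bar>x\<bar> \<le> sqrt (1 + x\<^sup>2)" by (rule real_le_rsqrt) simp
  have pw: "(1 + x\<^sup>2) ^ (j - 1) \<le> (1 + x\<^sup>2) ^ j" using p by (intro power_increasing) auto
  have "\<bar>2 * real j * x * (1 + x\<^sup>2) ^ (j - 1) - 2 * \<delta> * x * (1 + x\<^sup>2) ^ j\<bar> \<le> \<bar>2 * real j * x * (1 + x\<^sup>2) ^ (j - 1)\<bar> + \<bar>2 * \<delta> * x * (1 + x\<^sup>2) ^ j\<bar>"
    by (rule abs_triangle_ineq4)
  also have "\<dots> = 2 * real j * \<bar>x\<bar> * (1 + x\<^sup>2) ^ (j - 1) + 2 * \<delta> * \<bar>x\<bar> * (1 + x\<^sup>2) ^ j"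
    using \<delta> p by (simp add: abs_mult)
  also have "\<dots> \<le> 2 * real j * \<bar>x\<bar> * (1 + x\<^sup>2) ^ j + 2 * 1 * \<bar>x\<bar> * (1 + x\<^sup>2) ^ j"
    using \<delta> p pw by (intro add_mono mult_left_mono mult_right_mono) auto
  also have "\<dots> = (2 * real j + 2) * (\<bar>x\<bar> * (1 + x\<^sup>2) ^ j)" by (simp add: algebra_simps)
  also have "\<dots> \<le> (2 * real j + 2) * (sqrt (1 + x\<^sup>2) * (1 + x\<^sup>2) ^ j)"
    using sx p by (intro mult_left_mono mult_right_mono) auto
  finally have "\<bar>?D x\<bar> \<le> (2 * real j + 2) * (sqrt (1 + x\<^sup>2) * (1 + x\<^sup>2) ^ j) * exp (- \<delta> * x\<^sup>2)"
    by (simp add: abs_mult mult_right_mono)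
  moreover have "sqrt (gweight \<delta> (Suc j) x) * sqrt (gweight \<delta> j x) = sqrt (1 + x\<^sup>2) * (1 + x\<^sup>2) ^ j * exp (- \<delta> * x\<^sup>2)"
  proof -
    have "sqrt (gweight \<delta> (Suc j) x) * sqrt (gweight \<delta> j x) = sqrt (gweight \<delta> (Suc j) x * gweight \<delta> j x)" by (rule real_sqrt_mult[symmetric])
    also have "gweight \<delta> (Suc j) x * gweight \<delta> j x = (1 + x\<^sup>2) * (gweight \<delta> j x)\<^sup>2" by (simp add: gweight_def power2_eq_square)
    also have "sqrt \<dots> = sqrt (1 + x\<^sup>2) * gweight \<delta> j x" using gweight_pos[of \<delta> j x] by (simp add: real_sqrt_mult)
    finally show ?thesis by (simp add: gweight_def mult.assoc)
  qed
  ultimately show "\<bar>?D x\<bar> \<le> (2 * real j + 2) * (sqrt (gweight \<delta> (Suc j) x) * sqrt (gweight \<delta> j x))"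
    by (simp add: mult.assoc)
qed

text \<open>The derivative of W times the inner product of f_(k-1) and f_k has integral 0. It
  contains W |f_k|^2, and Cauchy-Schwarz bounds the remaining terms, including the one with W', by
  products of the neighbouring norms.\<close>

lemma interpolation_step:
  fixes f :: "nat \<Rightarrow> real \<Rightarrow> complex"
  assumes d: "\<And>k x. k < n \<Longrightarrow> (f k has_vector_derivative f (Suc k) x) (at x)"
    and cont: "\<And>k. k \<le> n \<Longrightarrow> continuous_on UNIV (f k)"
    and bd: "\<And>k x. k \<le> n \<Longrightarrow> norm (f k x) \<le> A * (1 + x\<^sup>2) ^ m"
    and \<delta>: "0 < \<delta>" "\<delta> \<le> 1" and k: "0 < k" "k < n"
  defines "X \<equiv> \<lambda>k. sqrt (LINT x|lborel. (sqrt (gweight \<delta> (n - k) x) * norm (f k x))\<^sup>2)"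
  shows "(X k)\<^sup>2 \<le> X (k - 1) * (X (Suc k) + (2 * real n + 2) * X k)"
proof -
  have A: "A \<ge> 0" using order_trans[OF norm_ge_zero bd[of 0 0]] by simp
  have p1: "1 + (x::real)\<^sup>2 \<ge> 1" for x by simp
  have int: "integrable lborel g" if "continuous_on UNIV g" "\<And>x. norm (g x) \<le> B * (1 + x\<^sup>2) ^ l * exp (- \<delta> * x\<^sup>2)" for g :: "real \<Rightarrow> real" and B l
    using borel_measurable_continuous_onI[OF that(1)] \<delta>(1) that(2) by (rule integrable_poly_gauss)
  define p where "p k x = sqrt (gweight \<delta> (n - k) x) * norm (f k x)" for k x
  have pc: "continuous_on UNIV (p k)" if "k \<le> n" for k
    unfolding p_def by (intro continuous_intros cont that)
  have p2: "(p k x)\<^sup>2 = gweight \<delta> (n - k) x * (norm (f k x))\<^sup>2" for k x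
    unfolding p_def power_mult_distrib using gweight_pos[of \<delta> "n - k" x] by simp
  have pi: "integrable lborel (\<lambda>x. (p k x)\<^sup>2)" if "k \<le> n" for k
  proof (rule int)
    show "continuous_on UNIV (\<lambda>x. (p k x)\<^sup>2)" by (intro continuous_intros pc that)
    fix x
    have "(norm (f k x))\<^sup>2 \<le> (A * (1 + x\<^sup>2) ^ m)\<^sup>2" by (intro power_mono bd that) simp
    then have "gweight \<delta> (n - k) x * (norm (f k x))\<^sup>2 \<le> gweight \<delta> (n - k) x * (A * (1 + x\<^sup>2) ^ m)\<^sup>2"
      using gweight_pos[of \<delta> "n - k" x] by (intro mult_left_mono) auto
    also have "\<dots> = A\<^sup>2 * (1 + x\<^sup>2) ^ (n - k + 2 * m) * exp (- \<delta> * x\<^sup>2)"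
      unfolding gweight_def by (simp add: power_add power_mult_distrib power_mult[symmetric] mult_ac)
    finally show "norm ((p k x)\<^sup>2) \<le> A\<^sup>2 * (1 + x\<^sup>2) ^ (n - k + 2 * m) * exp (- \<delta> * x\<^sup>2)"
      using gweight_pos[of \<delta> "n - k" x] by (simp add: p2 abs_mult)
  qed
  have Xp: "X k = sqrt (LINT x|lborel. (p k x)\<^sup>2)" for k by (simp add: X_def p_def)
  have CS: "integrable lborel (\<lambda>x. p i x * p j x)" "(LINT x|lborel. p i x * p j x) \<le> X i * X j" if "i \<le> n" "j \<le> n" for i j
    using Cauchy_Schwarz_LINT[of "p i" lborel "p j"] pi that borel_measurable_continuous_onI[OF pc] by (auto simp: Xp)
  define W where "W = gweight \<delta> (n - k)"
  obtain D where D: "\<And>x. (W has_real_derivative D x) (at x)" "continuous_on UNIV D"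
    "\<And>x. \<bar>D x\<bar> \<le> (2 * real (n - k) + 2) * (sqrt (gweight \<delta> (Suc (n - k)) x) * sqrt (W x))"
    unfolding W_def using gweight_deriv[OF \<delta>] by metis
  define c where "c = 2 * real n + 2"
  have c: "0 \<le> c" "2 * real (n - k) + 2 \<le> c" by (auto simp: c_def)
  obtain k' where k': "k = Suc k'" using k by (cases k) auto
  have nk: "Suc (n - k) = n - k'" "n - k' \<le> n" "n - k = Suc (n - Suc k)" using k k' by auto
  define F where "F x = W x * (f k' x \<bullet> f k x)" for x
  define G where "G x = D x * (f k' x \<bullet> f k x) + W x * (f k' x \<bullet> f (Suc k) x)" for x
  have cW: "continuous_on UNIV W" unfolding W_def by (intro continuous_intros)
  have F': "(F has_vector_derivative G x + (p k x)\<^sup>2) (at x)" for x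
  proof -
    have W: "(W has_vector_derivative D x) (at x)" using D(1) by (simp add: has_real_derivative_iff_has_vector_derivative)
    have i: "((\<lambda>x. f k' x \<bullet> f k x) has_vector_derivative f k' x \<bullet> f (Suc k) x + f k x \<bullet> f k x) (at x)"
      using bounded_bilinear.has_vector_derivative[OF bounded_bilinear_inner d[of k' x] d[of k x]] k k' by (simp add: inner_commute)
    from has_vector_derivative_mult[OF W i] show ?thesis
      unfolding F_def G_def p2 W_def dot_square_norm by (simp add: algebra_simps)
  qed
  have G1: "\<bar>G x\<bar> \<le> p k' x * p (Suc k) x + c * (p k' x * p k x)" for x
  proof -
    have in1: "\<bar>f k' x \<bullet> f k x\<bar> \<le> norm (f k' x) * norm (f k x)" and in2: "\<bar>f k' x \<bullet> f (Suc k) x\<bar> \<le> norm (f k' x) * norm (f (Suc k) x)"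
      by (rule Cauchy_Schwarz_ineq2)+
    have W0: "W x > 0" unfolding W_def by (rule gweight_pos)
    have "\<bar>D x\<bar> \<le> c * (sqrt (gweight \<delta> (n - k') x) * sqrt (W x))"
    proof (rule order_trans[OF D(3)[of x, unfolded nk(1)] mult_right_mono[OF c(2)]])
      show "0 \<le> sqrt (gweight \<delta> (n - k') x) * sqrt (W x)"
        using gweight_pos[of \<delta> "n - k'" x] W0 by simp
    qed
    then have 1: "\<bar>D x\<bar> * \<bar>f k' x \<bullet> f k x\<bar> \<le> c * (sqrt (gweight \<delta> (n - k') x) * sqrt (W x)) * (norm (f k' x) * norm (f k x))"
      using in1 by (intro mult_mono) (use W0 gweight_pos[of \<delta> "n - k'" x] c in auto)
    \<comment> \<open>The exponents of the weights of f_(k-1), f_k and f_(k+1) are consecutive, so W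
      is the geometric mean of the outer two.\<close>
    have "W x = sqrt (gweight \<delta> (n - k') x) * sqrt (gweight \<delta> (n - Suc k) x)"
    proof -
      have "gweight \<delta> (n - k') x * gweight \<delta> (n - Suc k) x = (W x)\<^sup>2"
        unfolding nk(1)[symmetric] W_def nk(3) gweight_def by (simp add: power2_eq_square mult_ac)
      then show ?thesis using W0 by (simp add: real_sqrt_mult[symmetric])
    qed
    then have 2: "W x * \<bar>f k' x \<bullet> f (Suc k) x\<bar> \<le> sqrt (gweight \<delta> (n - k') x) * sqrt (gweight \<delta> (n - Suc k) x) * (norm (f k' x) * norm (f (Suc k) x))"
      using in2 W0 by (metis mult_left_mono less_imp_le)
    have "\<bar>G x\<bar> \<le> \<bar>D x\<bar> * \<bar>f k' x \<bullet> f k x\<bar> + W x * \<bar>f k' x \<bullet> f (Suc k) x\<bar>"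
      unfolding G_def using abs_triangle_ineq[of "D x * (f k' x \<bullet> f k x)" "W x * (f k' x \<bullet> f (Suc k) x)"] W0 by (simp add: abs_mult)
    with 1 2 show ?thesis unfolding p_def W_def by (simp add: mult_ac)
  qed
  have iG: "integrable lborel G"
  proof (rule Bochner_Integration.integrable_bound)
    show "integrable lborel (\<lambda>x. p k' x * p (Suc k) x + c * (p k' x * p k x))"
      using CS(1)[of k' "Suc k"] CS(1)[of k' k] k k' by simp
    have "continuous_on UNIV G" unfolding G_def using k k' by (intro continuous_intros D(2) cW cont) auto
    then show "G \<in> borel_measurable lborel" using borel_measurable_continuous_onI by auto
    show "AE x in lborel. norm (G x) \<le> norm (p k' x * p (Suc k) x + c * (p k' x * p k x))"
      using G1 by (intro AE_I2) (simp add: order_trans[OF _ abs_ge_self])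
  qed
  have iF: "integrable lborel F"
  proof (rule int)
    show "continuous_on UNIV F" unfolding F_def using k k' by (intro continuous_intros cW cont) auto
    fix x
    have "\<bar>f k' x \<bullet> f k x\<bar> \<le> (A * (1 + x\<^sup>2) ^ m) * (A * (1 + x\<^sup>2) ^ m)"
      by (intro order_trans[OF Cauchy_Schwarz_ineq2] mult_mono bd) (use k k' A in auto)
    then have "W x * \<bar>f k' x \<bullet> f k x\<bar> \<le> W x * ((A * (1 + x\<^sup>2) ^ m) * (A * (1 + x\<^sup>2) ^ m))"
      by (rule mult_left_mono) (simp add: W_def gweight_pos less_imp_le)
    also have "\<dots> = A\<^sup>2 * (1 + x\<^sup>2) ^ (n - k + m + m) * exp (- \<delta> * x\<^sup>2)"
      unfolding W_def gweight_def by (simp add: power_add power2_eq_square mult_ac)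
    finally show "norm (F x) \<le> A\<^sup>2 * (1 + x\<^sup>2) ^ (n - k + m + m) * exp (- \<delta> * x\<^sup>2)"
      unfolding F_def using gweight_pos[of \<delta> "n - k" x] by (simp add: abs_mult W_def)
  qed
  have "(LINT x|lborel. G x + (p k x)\<^sup>2) = 0"
    by (rule integral_of_derivative_eq_0[OF iF _ F']) (use iG pi k in auto)
  then have "(LINT x|lborel. (p k x)\<^sup>2) = - (LINT x|lborel. G x)"
    using iG pi[of k] k by simp
  also have "\<dots> \<le> (LINT x|lborel. \<bar>G x\<bar>)" by (rule order_trans[OF abs_ge_minus_self integral_abs_bound])
  also have "\<dots> \<le> (LINT x|lborel. p k' x * p (Suc k) x + c * (p k' x * p k x))"
    by (rule integral_mono) (use iG G1 CS(1)[of k' "Suc k"] CS(1)[of k' k] k k' in auto)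
  also have "\<dots> = (LINT x|lborel. p k' x * p (Suc k) x) + c * (LINT x|lborel. p k' x * p k x)"
    using CS(1)[of k' "Suc k"] CS(1)[of k' k] k k' by simp
  also have "\<dots> \<le> X k' * X (Suc k) + c * (X k' * X k)"
    using CS(2)[of k' "Suc k"] CS(2)[of k' k] k k' c by (intro add_mono mult_left_mono) auto
  finally show ?thesis unfolding Xp[of k] by (simp add: k' c_def algebra_simps)
qed

text \<open>The polynomial bound with A and m is qualitative: it makes the Gaussian-weighted norms
  finite, while C depends on n and k alone. After the algebraic interpolation the cutoff is removed
  by Fatou's lemma.\<close>

lemma weighted_interpolation:
  assumes kn: "k \<le> n"
  shows "\<exists>C\<ge>0. \<forall>(f :: nat \<Rightarrow> real \<Rightarrow> complex) A m.
    (\<forall>k x. k < n \<longrightarrow> (f k has_vector_derivative f (Suc k) x) (at x)) \<longrightarrow>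
    (\<forall>k. k \<le> n \<longrightarrow> continuous_on UNIV (f k)) \<longrightarrow>
    (\<forall>k x. k \<le> n \<longrightarrow> norm (f k x) \<le> A * (1 + x\<^sup>2) ^ m) \<longrightarrow>
    sqn (\<lambda>x. sqrt ((1 + x\<^sup>2) ^ (n - k)) *\<^sub>R f k x) \<le> ennreal C * (sqn (\<lambda>x. sqrt ((1 + x\<^sup>2) ^ n) *\<^sub>R f 0 x) + sqn (f n))"
proof -
  obtain C0 where C0: "C0 \<ge> 0" "\<And>X. (\<forall>i. X i \<ge> 0) \<Longrightarrow> (\<forall>i. 0 < i \<and> i < n \<longrightarrow> (X i)\<^sup>2 \<le> X (i - 1) * (X (Suc i) + (2 * real n + 2) * X i)) \<Longrightarrow> X k \<le> X n + C0 * X 0"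
    using log_convex_interp[of "2 * real n + 2" k n] kn by auto
  \<comment> \<open>From (x + C0 y)^2 <= 2 x^2 + 2 C0^2 y^2.\<close>
  define C where "C = 2 + 2 * C0\<^sup>2"
  show ?thesis
  proof (intro exI[of _ C] conjI allI impI)
    show "C \<ge> 0" by (simp add: C_def)
    fix f :: "nat \<Rightarrow> real \<Rightarrow> complex" and A m
    assume "\<forall>k x. k < n \<longrightarrow> (f k has_vector_derivative f (Suc k) x) (at x)" "\<forall>k. k \<le> n \<longrightarrow> continuous_on UNIV (f k)"
      "\<forall>k x. k \<le> n \<longrightarrow> norm (f k x) \<le> A * (1 + x\<^sup>2) ^ m"
    then have d: "\<And>k x. k < n \<Longrightarrow> (f k has_vector_derivative f (Suc k) x) (at x)"
      and cont: "\<And>k. k \<le> n \<Longrightarrow> continuous_on UNIV (f k)"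
      and bd: "\<And>k x. k \<le> n \<Longrightarrow> norm (f k x) \<le> A * (1 + x\<^sup>2) ^ m" by auto

    define S where "S = sqn (\<lambda>x. sqrt ((1 + x\<^sup>2) ^ n) *\<^sub>R f 0 x) + sqn (f n)"
    define p where "p \<delta> j x = sqrt (gweight \<delta> (n - j) x) * norm (f j x)" for \<delta> j x
    have one: "sqn (\<lambda>x. sqrt (gweight \<delta> (n - k) x) *\<^sub>R f k x) \<le> ennreal C * S" if \<delta>: "0 < \<delta>" "\<delta> \<le> 1" for \<delta>
    proof -
      define X where "X j = sqrt (LINT x|lborel. (p \<delta> j x)\<^sup>2)" for j
      have X0: "X j \<ge> 0" for j by (simp add: X_def)
      have "(X i)\<^sup>2 \<le> X (i - 1) * (X (Suc i) + (2 * real n + 2) * X i)" if "0 < i" "i < n" for i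
        unfolding X_def p_def by (rule interpolation_step[where f=f and n=n and k=i and A=A and m=m, OF d cont bd \<delta> that])
      then have "X k \<le> X n + C0 * X 0" using C0(2)[of X] X0 by auto
      then have "(X k)\<^sup>2 \<le> (X n + C0 * X 0)\<^sup>2" using X0 by (intro power_mono) auto
      also have "\<dots> \<le> 2 * (X n)\<^sup>2 + 2 * (C0 * X 0)\<^sup>2" using sum_squares_bound[of "X n" "C0 * X 0"] by (simp add: power2_sum)
      also have "\<dots> \<le> C * (X n)\<^sup>2 + C * (X 0)\<^sup>2"
        unfolding C_def power_mult_distrib by (simp add: algebra_simps)
      finally have le: "(X k)\<^sup>2 \<le> C * ((X 0)\<^sup>2 + (X n)\<^sup>2)" by (simp add: algebra_simps)
      have mp: "p \<delta> j \<in> borel_measurable borel" if "j \<le> n" for j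
        unfolding p_def by (intro borel_measurable_continuous_onI continuous_intros cont that)
      have pint: "integrable lborel (\<lambda>x. (p \<delta> j x)\<^sup>2)" if "j \<le> n" for j
      proof (rule integrable_poly_gauss[OF _ \<delta>(1)])
        show "(\<lambda>x. (p \<delta> j x)\<^sup>2) \<in> borel_measurable borel" using mp[OF that] by simp
        fix x
        have "(norm (f j x))\<^sup>2 \<le> (A * (1 + x\<^sup>2) ^ m)\<^sup>2" by (intro power_mono bd that) simp
        then have "gweight \<delta> (n - j) x * (norm (f j x))\<^sup>2 \<le> gweight \<delta> (n - j) x * (A * (1 + x\<^sup>2) ^ m)\<^sup>2"
          using gweight_pos[of \<delta> "n - j" x] by (intro mult_left_mono) auto
        also have "\<dots> = A\<^sup>2 * (1 + x\<^sup>2) ^ (n - j + 2 * m) * exp (- \<delta> * x\<^sup>2)"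
          unfolding gweight_def by (simp add: power_add power_mult_distrib power_mult[symmetric] mult_ac)
        finally show "norm ((p \<delta> j x)\<^sup>2) \<le> A\<^sup>2 * (1 + x\<^sup>2) ^ (n - j + 2 * m) * exp (- \<delta> * x\<^sup>2)"
          unfolding p_def power_mult_distrib using gweight_pos[of \<delta> "n - j" x] by simp
      qed
      have Xsq: "ennreal ((X j)\<^sup>2) = (\<integral>\<^sup>+x. ennreal (gweight \<delta> (n - j) x * (norm (f j x))\<^sup>2) \<partial>lborel)" if "j \<le> n" for j
      proof -
        have "ennreal ((X j)\<^sup>2) = ennreal (LINT x|lborel. (p \<delta> j x)\<^sup>2)" by (simp add: X_def)
        also have "\<dots> = (\<integral>\<^sup>+x. ennreal ((p \<delta> j x)\<^sup>2) \<partial>lborel)" using pint[OF that] by (intro nn_integral_eq_integral[symmetric]) auto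
        finally show ?thesis unfolding p_def power_mult_distrib using gweight_pos[of \<delta> "n - j"] by (simp add: less_imp_le)
      qed
      have e1: "exp (- \<delta> * x\<^sup>2) \<le> 1" for x :: real using \<delta> by simp
      have 0: "ennreal ((X 0)\<^sup>2) \<le> sqn (\<lambda>x. sqrt ((1 + x\<^sup>2) ^ n) *\<^sub>R f 0 x)"
        unfolding Xsq[OF le0] sqn_def
      proof (intro nn_integral_mono ennreal_leI)
        fix x
        have "(1 + x\<^sup>2) ^ n * exp (- \<delta> * x\<^sup>2) * (norm (f 0 x))\<^sup>2 \<le> (1 + x\<^sup>2) ^ n * 1 * (norm (f 0 x))\<^sup>2"
          by (intro mult_right_mono mult_left_mono e1) auto
        then show "gweight \<delta> (n - 0) x * (norm (f 0 x))\<^sup>2 \<le> (norm (sqrt ((1 + x\<^sup>2) ^ n) *\<^sub>R f 0 x))\<^sup>2"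
          by (simp add: gweight_def power_mult_distrib)
      qed
      have n: "ennreal ((X n)\<^sup>2) \<le> sqn (f n)"
        unfolding Xsq[OF order_refl] sqn_def
        by (intro nn_integral_mono ennreal_leI) (use e1 in \<open>simp add: gweight_def mult_left_le_one_le\<close>)
      have "sqn (\<lambda>x. sqrt (gweight \<delta> (n - k) x) *\<^sub>R f k x) = ennreal ((X k)\<^sup>2)"
        unfolding Xsq[OF kn] sqn_def using gweight_pos[of \<delta> "n - k"]
        by (simp add: power_mult_distrib less_imp_le)
      also have "\<dots> \<le> ennreal (C * ((X 0)\<^sup>2 + (X n)\<^sup>2))" using le by (rule ennreal_leI)
      also have "\<dots> = ennreal C * (ennreal ((X 0)\<^sup>2) + ennreal ((X n)\<^sup>2))" by (simp add: C_def ennreal_mult)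
      also have "\<dots> \<le> ennreal C * S" unfolding S_def by (intro mult_left_mono add_mono 0 n) auto
      finally show ?thesis .
    qed
    show "sqn (\<lambda>x. sqrt ((1 + x\<^sup>2) ^ (n - k)) *\<^sub>R f k x) \<le> ennreal C * (sqn (\<lambda>x. sqrt ((1 + x\<^sup>2) ^ n) *\<^sub>R f 0 x) + sqn (f n))"
      unfolding S_def[symmetric]
    proof (rule sqn_le_liminf[where f="\<lambda>i x. sqrt (gweight (1 / real (Suc i)) (n - k) x) *\<^sub>R f k x"])
      show "(\<lambda>x. sqrt (gweight (1 / real (Suc i)) (n - k) x) *\<^sub>R f k x) \<in> borel_measurable borel" for i
        by (intro borel_measurable_continuous_onI continuous_intros cont kn)
      show "sqn (\<lambda>x. sqrt (gweight (1 / real (Suc i)) (n - k) x) *\<^sub>R f k x) \<le> ennreal C * S" for i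
        by (rule one) auto
      show "AE x in lborel. (\<lambda>i. sqrt (gweight (1 / real (Suc i)) (n - k) x) *\<^sub>R f k x) \<longlonglongrightarrow> sqrt ((1 + x\<^sup>2) ^ (n - k)) *\<^sub>R f k x"
      proof (rule AE_I2)
        fix x :: real
        have "(\<lambda>i. sqrt (gweight (1 / real (Suc i)) (n - k) x) *\<^sub>R f k x) \<longlonglongrightarrow> sqrt ((1 + x\<^sup>2) ^ (n - k) * exp (- 0 * x\<^sup>2)) *\<^sub>R f k x"
          unfolding gweight_def by (intro tendsto_intros) (use LIMSEQ_inverse_real_of_nat in \<open>simp add: inverse_eq_divide\<close>)
        then show "(\<lambda>i. sqrt (gweight (1 / real (Suc i)) (n - k) x) *\<^sub>R f k x) \<longlonglongrightarrow> sqrt ((1 + x\<^sup>2) ^ (n - k)) *\<^sub>R f k x" by simp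
      qed
    qed
  qed
qed

subsection \<open>Derivatives of Fourier transforms and their averages\<close>

text \<open>The k-th derivative of \<open>fourier u\<close> when the moments up to order k are
  integrable.\<close>

definition FD :: "nat \<Rightarrow> (real \<Rightarrow> complex) \<Rightarrow> real \<Rightarrow> complex" where
  "FD k u = fourier (\<lambda>x. (- \<i> * complex_of_real x) ^ k * u x)"

lemma FD_0: "FD 0 u = fourier u"
  by (simp add: FD_def)

lemma integrable_monomial_iff:
  "integrable lborel (\<lambda>x. (- \<i> * complex_of_real x) ^ k * u x) \<longleftrightarrow> integrable lborel (\<lambda>x. complex_of_real (x ^ k) * u x)"
proof -
  have "(\<lambda>x. (- \<i> * complex_of_real x) ^ k * u x) = (\<lambda>x. (- \<i>) ^ k * (complex_of_real (x ^ k) * u x))"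
    by (simp only: power_mult_distrib of_real_power mult.assoc)
  note eq = this
  have c: "(- \<i>) ^ k \<noteq> (0::complex)" by simp
  show ?thesis unfolding eq
  proof
    assume "integrable lborel (\<lambda>x. (- \<i>) ^ k * (complex_of_real (x ^ k) * u x))"
    from integrable_mult_right[OF this, of "inverse ((- \<i>) ^ k)"]
    show "integrable lborel (\<lambda>x. complex_of_real (x ^ k) * u x)"
      unfolding mult.assoc[symmetric] left_inverse[OF c] by simp
  qed (rule integrable_mult_right)
qed

lemma FD_has_vector_derivative:
  assumes "integrable lborel (\<lambda>x. complex_of_real (x ^ k) * u x)" "integrable lborel (\<lambda>x. complex_of_real (x ^ Suc k) * u x)"
  shows "(FD k u has_vector_derivative FD (Suc k) u \<xi>) (at \<xi>)"
proof -
  let ?f = "\<lambda>x. (- \<i> * complex_of_real x) ^ k * u x"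
  have "integrable lborel (\<lambda>x. \<i> * ((- \<i> * complex_of_real x) ^ Suc k * u x))"
    using assms(2) by (intro integrable_mult_right) (simp only: integrable_monomial_iff)
  then have "integrable lborel (\<lambda>x. complex_of_real x * ?f x)"
    by (simp add: mult.assoc[symmetric])
  moreover have "integrable lborel ?f" using assms(1) by (simp only: integrable_monomial_iff)
  ultimately have "(fourier ?f has_vector_derivative fourier (\<lambda>x. - \<i> * x * ?f x) \<xi>) (at \<xi>)"
    by (intro fourier_has_vector_derivative)
  moreover have "(\<lambda>x. - \<i> * complex_of_real x * ?f x) = (\<lambda>x. (- \<i> * complex_of_real x) ^ Suc k * u x)"
    by (simp add: mult.assoc)
  ultimately show ?thesis by (simp only: FD_def)
qed

lemma continuous_on_FD [continuous_intros]:
  assumes "integrable lborel (\<lambda>x. complex_of_real (x ^ k) * u x)" "continuous_on S g"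
  shows "continuous_on S (\<lambda>x. FD k u (g x))"
  using assms unfolding FD_def integrable_monomial_iff[symmetric] by (intro continuous_intros)

lemma norm_FD_le:
  "norm (FD k u \<xi>) \<le> (LINT x|lborel. \<bar>x\<bar> ^ k * norm (u x)) / sqrt (2 * pi)"
  using norm_fourier_le[of "\<lambda>x. (- \<i> * complex_of_real x) ^ k * u x" \<xi>]
  by (simp add: FD_def norm_mult norm_power)

section \<open>Averages of the transform over short intervals\<close>

text \<open>In closed form (1 - exp(-ihx)) / (ihx), with value 1 at x = 0. Multiplying u by it
  averages the transform over [\<xi>, \<xi> + h]; it decays like 1/x, which buys one integrable
  moment, and tends to 1 as h -> 0. Written as a transform so that the multiplication formula
  applies.\<close>

definition smear :: "real \<Rightarrow> real \<Rightarrow> complex" where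
  "smear h x = complex_of_real (sqrt (2 * pi) / h) * fourier (indicator {0..h}) x"

lemma integrable_indicator_complex: "integrable lborel (indicator {a..b::real} :: real \<Rightarrow> complex)"
proof -
  have "integrable lborel (\<lambda>x. indicator {a..b} x :: real)"
    by (rule integrable_real_indicator) (auto simp: emeasure_lborel_Icc_eq)
  then have "integrable lborel (\<lambda>x. complex_of_real (indicator {a..b} x))" by (rule integrable_of_real)
  then show ?thesis unfolding of_real_indicator .
qed

lemma borel_measurable_smear [measurable]: "smear h \<in> borel_measurable borel"
  unfolding smear_def[abs_def] by measurable

lemma smear_eq:
  assumes "h > 0"
  shows "smear h x = (LINT a|lborel. indicator {0..h} a *\<^sub>R cis (- (a * x))) / complex_of_real h"
  using assms unfolding smear_def fourier_def indicator_scaleR_complex by (simp add: field_simps)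


lemma norm_smear_le: "h > 0 \<Longrightarrow> norm (smear h x) \<le> 1"
proof -
  assume h: "h > 0"
  have "norm (LINT a|lborel. indicator {0..h} a *\<^sub>R cis (- (a * x))) \<le> (LINT a|lborel. indicator {0..h} a)"
    by (rule order_trans[OF integral_norm_bound integral_mono']) (auto intro!: integrable_real_indicator simp: emeasure_lborel_Icc_eq)
  then show ?thesis using h by (simp add: smear_eq norm_divide divide_le_eq)
qed

lemma smear_tendsto:
  assumes "h \<longlonglongrightarrow> 0" "\<And>n. h n > 0"
  shows "(\<lambda>n. smear (h n) x) \<longlonglongrightarrow> 1"
proof -
  have "norm (smear (h n) x - 1) \<le> h n * \<bar>x\<bar>" for n
  proof -
    let ?I = "indicator {0..h n} :: real \<Rightarrow> real"
    have I: "integrable lborel ?I" by (auto intro!: integrable_real_indicator simp: emeasure_lborel_Icc_eq)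
    have i1: "integrable lborel (\<lambda>a. ?I a *\<^sub>R cis (- (a * x)))"
      by (rule Bochner_Integration.integrable_bound[OF I]) auto
    have "(LINT a|lborel. ?I a *\<^sub>R cis (- (a * x))) - h n = (LINT a|lborel. ?I a *\<^sub>R cis (- (a * x)) - ?I a *\<^sub>R (1::complex))"
      using i1 I assms(2)[of n] by (subst Bochner_Integration.integral_diff) (auto simp: scaleR_conv_of_real)
    also have "norm \<dots> \<le> (LINT a|lborel. ?I a * (h n * \<bar>x\<bar>))"
    proof (rule order_trans[OF integral_norm_bound integral_mono'])
      fix a
      have "norm (cis (- (a * x)) - cis 0) \<le> \<bar>- (a * x) - 0\<bar>" by (rule norm_cis_diff_le)
      then have "norm (cis (- (a * x)) - 1) \<le> \<bar>a\<bar> * \<bar>x\<bar>" by (simp add: abs_mult)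
      moreover have "\<bar>a\<bar> * \<bar>x\<bar> \<le> h n * \<bar>x\<bar>" if "a \<in> {0..h n}" using that by (intro mult_right_mono) auto
      ultimately show "norm (?I a *\<^sub>R cis (- (a * x)) - ?I a *\<^sub>R 1) \<le> ?I a * (h n * \<bar>x\<bar>)"
        by (auto split: split_indicator)
    qed (use I assms(2)[of n] in auto)
    also have "\<dots> = h n * (h n * \<bar>x\<bar>)" using assms(2)[of n] by simp
    finally have "norm ((LINT a|lborel. ?I a *\<^sub>R cis (- (a * x))) - h n) \<le> h n * (h n * \<bar>x\<bar>)" .
    moreover have "smear (h n) x - 1 = ((LINT a|lborel. ?I a *\<^sub>R cis (- (a * x))) - h n) / complex_of_real (h n)"
      using assms(2)[of n] by (simp add: smear_eq field_simps)
    ultimately show ?thesis using assms(2)[of n] by (simp add: norm_divide divide_le_eq mult_ac)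
  qed
  then have "\<forall>\<^sub>F n in sequentially. norm (smear (h n) x - 1) \<le> h n * \<bar>x\<bar>" by (intro always_eventually allI)
  moreover have "(\<lambda>n. h n * \<bar>x\<bar>) \<longlonglongrightarrow> 0" using tendsto_mult_right[OF assms(1), of "\<bar>x\<bar>"] by simp
  ultimately have "(\<lambda>n. smear (h n) x - 1) \<longlonglongrightarrow> 0" by (rule Lim_null_comparison)
  then show ?thesis by (simp add: LIM_zero_iff)
qed

lemma mult_smear:
  assumes h: "h > 0"
  shows "(- \<i> * complex_of_real x) * smear h x = (cis (- (h * x)) - 1) / complex_of_real h"
proof -
  have "(LINT a|lborel. indicator {0..h} a *\<^sub>R (cis (- (a * x)) * (- \<i> * x))) = cis (- (h * x)) - cis (- (0 * x))"
  proof (rule integral_FTC_Icc)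
    fix a
    show "((\<lambda>a. cis (- (a * x))) has_vector_derivative cis (- (a * x)) * (- \<i> * complex_of_real x)) (at a within {0..h})"
      unfolding has_vector_derivative_def
      by (auto intro!: derivative_eq_intros simp: fun_eq_iff scaleR_conv_of_real mult_ac)
  qed (use h in \<open>auto intro!: continuous_intros\<close>)
  moreover have "(LINT a|lborel. indicator {0..h} a *\<^sub>R (cis (- (a * x)) * (- \<i> * x))) = (- \<i> * complex_of_real x) * (LINT a|lborel. indicator {0..h} a *\<^sub>R cis (- (a * x)))"
    unfolding integral_mult_right_zero[symmetric] by (simp add: mult_ac scaleR_conv_of_real)
  ultimately show ?thesis using h by (simp add: smear_eq)
qed

text \<open>Two uses of the same product: the first bound trades one power of x for 1/h and gives
  integrability, the second is uniform in h and gives estimates.\<close>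

lemma norm_mult_smear_le:
  assumes "h > 0"
  shows "norm ((- \<i> * complex_of_real x) ^ Suc k * (u x * smear h x)) \<le> (2 / h) * norm (complex_of_real (x ^ k) * u x)"
    and "norm ((- \<i> * complex_of_real x) ^ Suc k * (u x * smear h x)) \<le> norm (complex_of_real (x ^ Suc k) * u x)"
proof -
  have "norm (cis (- (h * x)) - 1) \<le> norm (cis (- (h * x))) + norm (1::complex)" by (rule norm_triangle_ineq4)
  then have 1: "norm ((- \<i> * complex_of_real x) * smear h x) \<le> 2 / h"
    unfolding mult_smear[OF assms] using assms by (simp add: norm_divide divide_right_mono)
  have eq: "(- \<i> * complex_of_real x) ^ Suc k * (u x * smear h x) = ((- \<i> * complex_of_real x) * smear h x) * ((- \<i> * complex_of_real x) ^ k * u x)"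
    by (simp only: power_Suc mult_ac)
  have "norm ((- \<i> * complex_of_real x) ^ Suc k * (u x * smear h x)) = norm ((- \<i> * complex_of_real x) * smear h x) * norm ((- \<i> * complex_of_real x) ^ k * u x)"
    unfolding eq by (rule norm_mult)
  also have "\<dots> \<le> 2 / h * norm ((- \<i> * complex_of_real x) ^ k * u x)" by (rule mult_right_mono[OF 1]) simp
  finally show "norm ((- \<i> * complex_of_real x) ^ Suc k * (u x * smear h x)) \<le> (2 / h) * norm (complex_of_real (x ^ k) * u x)"
    by (simp add: norm_mult norm_power)
  have "norm ((- \<i> * complex_of_real x) ^ Suc k * (u x * smear h x)) = norm ((- \<i> * complex_of_real x) ^ Suc k * u x) * norm (smear h x)"
    by (simp add: norm_mult)
  also have "\<dots> \<le> norm ((- \<i> * complex_of_real x) ^ Suc k * u x) * 1" by (rule mult_left_mono[OF norm_smear_le[OF assms]]) simp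
  finally show "norm ((- \<i> * complex_of_real x) ^ Suc k * (u x * smear h x)) \<le> norm (complex_of_real (x ^ Suc k) * u x)"
    by (simp add: norm_mult norm_power)
qed

lemma integrable_smear:
  assumes "h > 0" "integrable lborel (\<lambda>x. complex_of_real (x ^ k) * u x)" and [measurable]: "u \<in> borel_measurable borel"
  shows "integrable lborel (\<lambda>x. complex_of_real (x ^ k) * (u x * smear h x))"
    "integrable lborel (\<lambda>x. complex_of_real (x ^ Suc k) * (u x * smear h x))"
proof -
  show "integrable lborel (\<lambda>x. complex_of_real (x ^ k) * (u x * smear h x))"
  proof (rule Bochner_Integration.integrable_bound[OF assms(2)])
    show "AE x in lborel. norm (complex_of_real (x ^ k) * (u x * smear h x)) \<le> norm (complex_of_real (x ^ k) * u x)"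
    proof (rule AE_I2)
      fix x
      have "norm (complex_of_real (x ^ k) * (u x * smear h x)) = norm (complex_of_real (x ^ k) * u x) * norm (smear h x)"
        by (simp add: norm_mult)
      also have "\<dots> \<le> norm (complex_of_real (x ^ k) * u x) * 1"
        by (rule mult_left_mono[OF norm_smear_le[OF assms(1)]]) simp
      finally show "norm (complex_of_real (x ^ k) * (u x * smear h x)) \<le> norm (complex_of_real (x ^ k) * u x)" by simp
    qed
  qed measurable
  have "integrable lborel (\<lambda>x. (- \<i> * complex_of_real x) ^ Suc k * (u x * smear h x))"
  proof (rule Bochner_Integration.integrable_bound)
    show "integrable lborel (\<lambda>x. complex_of_real (2 / h) * (complex_of_real (x ^ k) * u x))"
      using assms(2) by (rule integrable_mult_right)
    show "AE x in lborel. norm ((- \<i> * complex_of_real x) ^ Suc k * (u x * smear h x)) \<le> norm (complex_of_real (2 / h) * (complex_of_real (x ^ k) * u x))"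
      unfolding norm_mult[of "complex_of_real (2/h)"] norm_of_real using norm_mult_smear_le(1)[OF assms(1)] assms(1) by (intro AE_I2) simp
  qed measurable
  then show "integrable lborel (\<lambda>x. complex_of_real (x ^ Suc k) * (u x * smear h x))"
    by (simp only: integrable_monomial_iff)
qed

lemma fourier_smear:
  assumes u: "integrable lborel u" and h: "h > 0"
  shows "fourier (\<lambda>x. u x * smear h x) \<xi> = (LINT a|lborel. fourier u (\<xi> + a) * indicator {0..h} a) / complex_of_real h"
proof -
  let ?v = "\<lambda>x. cis (- (\<xi> * x)) * u x"
  have m [measurable]: "u \<in> borel_measurable borel" using u by auto
  have "(LINT a|lborel. fourier u (\<xi> + a) * indicator {0..h} a) = (LINT a|lborel. fourier ?v a * indicator {0..h} a)"
    unfolding fourier_cis_shift by (simp add: add.commute)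
  also have "\<dots> = (LINT x|lborel. ?v x * fourier (indicator {0..h}) x)"
    by (rule fourier_multiplication) (use u integrable_indicator_complex in auto)
  also have "\<dots> = (LINT x|lborel. complex_of_real (h / sqrt (2 * pi)) * (cis (- (x * \<xi>)) * (u x * smear h x)))"
    using h by (intro Bochner_Integration.integral_cong) (auto simp: smear_def mult_ac)
  also have "\<dots> = complex_of_real h * fourier (\<lambda>x. u x * smear h x) \<xi>"
    unfolding integral_mult_right_zero fourier_def by simp
  finally show ?thesis using h by simp
qed

text \<open>The square of an average is at most the average of the squares, and a shift by at most 1
  changes the weight by at most the factor 3^n.\<close>

lemma sqn_weighted_fourier_smear:
  assumes u: "integrable lborel u" and h: "0 < h" "h \<le> 1"
  shows "sqn (\<lambda>\<xi>. sqrt ((1 + \<xi>\<^sup>2) ^ n) *\<^sub>R fourier (\<lambda>x. u x * smear h x) \<xi>) \<le> ennreal (3 ^ n) * sqn (\<lambda>\<xi>. sqrt ((1 + \<xi>\<^sup>2) ^ n) *\<^sub>R fourier u \<xi>)"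
proof -
  have [measurable]: "u \<in> borel_measurable borel" using u by auto
  define w where "w \<xi> = ennreal ((1 + \<xi>\<^sup>2) ^ n * (norm (fourier u \<xi>))\<^sup>2)" for \<xi>
  have [measurable]: "w \<in> borel_measurable borel" unfolding w_def by measurable
  have pt: "ennreal ((norm (sqrt ((1 + \<xi>\<^sup>2) ^ n) *\<^sub>R fourier (\<lambda>x. u x * smear h x) \<xi>))\<^sup>2) \<le>
     ennreal (3 ^ n / h) * (\<integral>\<^sup>+a. w (\<xi> + a) * indicator {0..h} a \<partial>lborel)" for \<xi>
  proof -
    have int: "integrable lborel (\<lambda>a. fourier u (\<xi> + a) * indicator {0..h} a)"
    proof (rule Bochner_Integration.integrable_bound)
      show "integrable lborel (\<lambda>a. complex_of_real ((LINT x|lborel. norm (u x)) / sqrt (2 * pi)) * indicator {0..h} a)"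
        by (intro integrable_mult_right integrable_indicator_complex)
      show "AE a in lborel. norm (fourier u (\<xi> + a) * indicator {0..h} a) \<le> norm (complex_of_real ((LINT x|lborel. norm (u x)) / sqrt (2 * pi)) * indicator {0..h} a)"
        unfolding norm_mult norm_of_real
        by (intro AE_I2 mult_right_mono order_trans[OF norm_fourier_le abs_ge_self]) auto
    qed measurable
    have "(ennreal (norm (LINT a|lborel. fourier u (\<xi> + a) * indicator {0..h} a)))\<^sup>2 \<le> (\<integral>\<^sup>+a. ennreal (norm (fourier u (\<xi> + a)) * indicator {0..h} a) * indicator {0..h} a \<partial>lborel)\<^sup>2"
      by (intro power_mono order_trans[OF integral_norm_bound_ennreal[OF int]] nn_integral_mono) (auto simp: norm_mult split: split_indicator)
    also have "\<dots> \<le> (\<integral>\<^sup>+a. (ennreal (norm (fourier u (\<xi> + a)) * indicator {0..h} a))\<^sup>2 \<partial>lborel) * (\<integral>\<^sup>+a. (indicator {0..h} a)\<^sup>2 \<partial>lborel)"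
      by (rule Cauchy_Schwarz_nn_integral) auto
    also have "(\<integral>\<^sup>+a. (indicator {0..h} a)\<^sup>2 \<partial>lborel) = (\<integral>\<^sup>+a. indicator {0..h} (a::real) \<partial>lborel)"
      by (intro nn_integral_cong) (auto split: split_indicator)
    also have "\<dots> = ennreal h" using h by simp
    also have "(\<integral>\<^sup>+a. (ennreal (norm (fourier u (\<xi> + a)) * indicator {0..h} a))\<^sup>2 \<partial>lborel) = (\<integral>\<^sup>+a. ennreal ((norm (fourier u (\<xi> + a)))\<^sup>2) * indicator {0..h} a \<partial>lborel)"
      by (intro nn_integral_cong) (auto simp: ennreal_power split: split_indicator)
    finally have CS: "(ennreal (norm (LINT a|lborel. fourier u (\<xi> + a) * indicator {0..h} a)))\<^sup>2 \<le> (\<integral>\<^sup>+a. ennreal ((norm (fourier u (\<xi> + a)))\<^sup>2) * indicator {0..h} a \<partial>lborel) * ennreal h" .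
    have "ennreal ((norm (sqrt ((1 + \<xi>\<^sup>2) ^ n) *\<^sub>R fourier (\<lambda>x. u x * smear h x) \<xi>))\<^sup>2)
       = ennreal ((1 + \<xi>\<^sup>2) ^ n / h\<^sup>2) * (ennreal (norm (LINT a|lborel. fourier u (\<xi> + a) * indicator {0..h} a)))\<^sup>2"
      using h unfolding fourier_smear[OF u h(1)] by (simp add: power_mult_distrib norm_divide power_divide ennreal_power ennreal_mult[symmetric])
    also have "\<dots> \<le> ennreal ((1 + \<xi>\<^sup>2) ^ n / h\<^sup>2) * ((\<integral>\<^sup>+a. ennreal ((norm (fourier u (\<xi> + a)))\<^sup>2) * indicator {0..h} a \<partial>lborel) * ennreal h)"
      by (rule mult_left_mono[OF CS]) simp
    also have "\<dots> = ennreal ((1 + \<xi>\<^sup>2) ^ n / h) * (\<integral>\<^sup>+a. ennreal ((norm (fourier u (\<xi> + a)))\<^sup>2) * indicator {0..h} a \<partial>lborel)"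
    proof -
      have "ennreal ((1 + \<xi>\<^sup>2) ^ n / h\<^sup>2) * ennreal h = ennreal ((1 + \<xi>\<^sup>2) ^ n / h)"
        using h by (subst ennreal_mult[symmetric]) (auto simp: power2_eq_square)
      note eq = this
      have "a * (b * c) = (a * c) * b" for a b c :: ennreal by (simp only: mult_ac)
      then show ?thesis unfolding eq[symmetric] .
    qed
    also have "\<dots> = (\<integral>\<^sup>+a. ennreal ((1 + \<xi>\<^sup>2) ^ n / h) * (ennreal ((norm (fourier u (\<xi> + a)))\<^sup>2) * indicator {0..h} a) \<partial>lborel)"
      by (rule nn_integral_cmult[symmetric]) simp
    also have "\<dots> \<le> (\<integral>\<^sup>+a. ennreal (3 ^ n / h) * (w (\<xi> + a) * indicator {0..h} a) \<partial>lborel)"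
    proof (intro nn_integral_mono)
      fix a
      show "ennreal ((1 + \<xi>\<^sup>2) ^ n / h) * (ennreal ((norm (fourier u (\<xi> + a)))\<^sup>2) * indicator {0..h} a) \<le> ennreal (3 ^ n / h) * (w (\<xi> + a) * indicator {0..h} a)"
      proof (cases "a \<in> {0..h}")
        case True
        then have "a * a \<le> 1 * 1" using h by (intro mult_mono) auto
        \<comment> \<open>Completing the square: twice the difference of the two sides of the next
          inequality is (2 \<xi> + 3 a)^2 + 4 - 3 a^2.\<close>
        moreover have "0 \<le> (2 * \<xi> + 3 * a) * (2 * \<xi> + 3 * a)" by simp
        ultimately have "1 + \<xi>\<^sup>2 \<le> 3 * (1 + (\<xi> + a)\<^sup>2)"
          unfolding power2_eq_square by (simp add: algebra_simps)
        then have "(1 + \<xi>\<^sup>2) ^ n \<le> (3 * (1 + (\<xi> + a)\<^sup>2)) ^ n" by (intro power_mono) auto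
        then have "(1 + \<xi>\<^sup>2) ^ n / h * (norm (fourier u (\<xi> + a)))\<^sup>2 \<le> (3 * (1 + (\<xi> + a)\<^sup>2)) ^ n / h * (norm (fourier u (\<xi> + a)))\<^sup>2"
          using h by (intro mult_right_mono divide_right_mono) auto
        also have "\<dots> = (3 ^ n / h) * ((1 + (\<xi> + a)\<^sup>2) ^ n * (norm (fourier u (\<xi> + a)))\<^sup>2)" by (simp only: power_mult_distrib times_divide_eq_left mult.assoc)
        finally have "ennreal ((1 + \<xi>\<^sup>2) ^ n / h * (norm (fourier u (\<xi> + a)))\<^sup>2) \<le> ennreal \<dots>" by (rule ennreal_leI)
        then show ?thesis using True h by (simp add: w_def ennreal_mult''[symmetric])
      qed simp
    qed
    also have "\<dots> = ennreal (3 ^ n / h) * (\<integral>\<^sup>+a. w (\<xi> + a) * indicator {0..h} a \<partial>lborel)"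
      by (rule nn_integral_cmult) simp
    finally show ?thesis .
  qed
  have "sqn (\<lambda>\<xi>. sqrt ((1 + \<xi>\<^sup>2) ^ n) *\<^sub>R fourier (\<lambda>x. u x * smear h x) \<xi>) \<le> (\<integral>\<^sup>+\<xi>. ennreal (3 ^ n / h) * (\<integral>\<^sup>+a. w (\<xi> + a) * indicator {0..h} a \<partial>lborel) \<partial>lborel)"
    unfolding sqn_def by (intro nn_integral_mono pt)
  also have "\<dots> = ennreal (3 ^ n / h) * (\<integral>\<^sup>+\<xi>. (\<integral>\<^sup>+a. w (\<xi> + a) * indicator {0..h} a \<partial>lborel) \<partial>lborel)"
    by (rule nn_integral_cmult) simp
  also have "(\<integral>\<^sup>+\<xi>. (\<integral>\<^sup>+a. w (\<xi> + a) * indicator {0..h} a \<partial>lborel) \<partial>lborel) = (\<integral>\<^sup>+a. (\<integral>\<^sup>+\<xi>. w (\<xi> + a) * indicator {0..h} a \<partial>lborel) \<partial>lborel)"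
    by (rule lborel_pair.Fubini') simp
  also have "\<dots> = (\<integral>\<^sup>+a. (\<integral>\<^sup>+\<xi>. w \<xi> \<partial>lborel) * indicator {0..h} a \<partial>lborel)"
  proof (intro nn_integral_cong)
    fix a
    have "(\<integral>\<^sup>+\<xi>. w (\<xi> + a) * indicator {0..h} a \<partial>lborel) = (\<integral>\<^sup>+\<xi>. w (\<xi> + a) \<partial>lborel) * indicator {0..h} a" by (rule nn_integral_multc) simp
    also have "(\<integral>\<^sup>+\<xi>. w (\<xi> + a) \<partial>lborel) = (\<integral>\<^sup>+\<xi>. w \<xi> \<partial>lborel)"
      by (subst (2) nn_integral_real_affine[of _ 1 a]) (auto simp: add.commute)
    finally show "(\<integral>\<^sup>+\<xi>. w (\<xi> + a) * indicator {0..h} a \<partial>lborel) = (\<integral>\<^sup>+\<xi>. w \<xi> \<partial>lborel) * indicator {0..h} a" .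
  qed
  also have "\<dots> = (\<integral>\<^sup>+\<xi>. w \<xi> \<partial>lborel) * ennreal h" using h by (subst nn_integral_cmult) auto
  also have "(\<integral>\<^sup>+\<xi>. w \<xi> \<partial>lborel) = sqn (\<lambda>\<xi>. sqrt ((1 + \<xi>\<^sup>2) ^ n) *\<^sub>R fourier u \<xi>)"
    unfolding sqn_def w_def by (simp add: power_mult_distrib)
  also have "ennreal (3 ^ n / h) * (sqn (\<lambda>\<xi>. sqrt ((1 + \<xi>\<^sup>2) ^ n) *\<^sub>R fourier u \<xi>) * ennreal h) = ennreal (3 ^ n) * sqn (\<lambda>\<xi>. sqrt ((1 + \<xi>\<^sup>2) ^ n) *\<^sub>R fourier u \<xi>)"
  proof -
    have "ennreal (3 ^ n / h) * ennreal h = ennreal (3 ^ n)" using h by (subst ennreal_mult[symmetric]) auto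
    note eq = this
    have "a * (b * c) = (a * c) * b" for a b c :: ennreal by (simp only: mult_ac)
    then show ?thesis unfolding eq[symmetric] .
  qed
  finally show ?thesis .
qed

lemma FD_smear_tendsto:
  assumes "h \<longlonglongrightarrow> 0" "\<And>n. h n > 0" and i: "integrable lborel (\<lambda>x. complex_of_real (x ^ k) * u x)" and [measurable]: "u \<in> borel_measurable borel"
  shows "(\<lambda>n. FD k (\<lambda>x. u x * smear (h n) x) \<xi>) \<longlonglongrightarrow> FD k u \<xi>"
  unfolding FD_def fourier_def
proof (intro tendsto_divide tendsto_const integral_dominated_convergence[where w="\<lambda>x. norm (complex_of_real (x ^ k) * u x)"])
  show "AE x in lborel. (\<lambda>n. cis (- (x * \<xi>)) * ((- \<i> * complex_of_real x) ^ k * (u x * smear (h n) x))) \<longlonglongrightarrow> cis (- (x * \<xi>)) * ((- \<i> * complex_of_real x) ^ k * u x)"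
  proof (rule AE_I2)
    fix x
    have "(\<lambda>n. cis (- (x * \<xi>)) * ((- \<i> * complex_of_real x) ^ k * (u x * smear (h n) x))) \<longlonglongrightarrow> cis (- (x * \<xi>)) * ((- \<i> * complex_of_real x) ^ k * (u x * 1))"
      by (intro tendsto_mult tendsto_const smear_tendsto assms)
    then show "(\<lambda>n. cis (- (x * \<xi>)) * ((- \<i> * complex_of_real x) ^ k * (u x * smear (h n) x))) \<longlonglongrightarrow> cis (- (x * \<xi>)) * ((- \<i> * complex_of_real x) ^ k * u x)" by simp
  qed
  show "AE x in lborel. norm (cis (- (x * \<xi>)) * ((- \<i> * complex_of_real x) ^ k * (u x * smear (h n) x))) \<le> norm (complex_of_real (x ^ k) * u x)" for n
  proof (rule AE_I2)
    fix x
    have "norm (cis (- (x * \<xi>)) * ((- \<i> * complex_of_real x) ^ k * (u x * smear (h n) x))) = norm (complex_of_real (x ^ k) * u x) * norm (smear (h n) x)"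
      by (simp add: norm_mult norm_power)
    also have "\<dots> \<le> norm (complex_of_real (x ^ k) * u x) * 1"
      by (rule mult_left_mono[OF norm_smear_le[OF assms(2)]]) simp
    finally show "norm (cis (- (x * \<xi>)) * ((- \<i> * complex_of_real x) ^ k * (u x * smear (h n) x))) \<le> norm (complex_of_real (x ^ k) * u x)" by simp
  qed
qed (use i in auto)

text \<open>An n-th moment in L2 does not make the n-th derivative of the transform classical. After
  smearing all derivatives up to order n are classical, interpolation applies, and the resulting
  bound does not involve h.\<close>

lemma fourier_interpolation_smear:
  assumes "k \<le> n" "0 < n"
  shows "\<exists>C\<ge>0. \<forall>u h. (\<forall>j<n. integrable lborel (\<lambda>x. complex_of_real (x ^ j) * u x)) \<longrightarrow> 0 < h \<longrightarrow> h \<le> 1 \<longrightarrow>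
    sqn (\<lambda>\<xi>. sqrt ((1 + \<xi>\<^sup>2) ^ (n - k)) *\<^sub>R FD k (\<lambda>x. u x * smear h x) \<xi>)
     \<le> ennreal C * (sqn (\<lambda>\<xi>. sqrt ((1 + \<xi>\<^sup>2) ^ n) *\<^sub>R fourier u \<xi>) + sqn (\<lambda>x. complex_of_real (x ^ n) * u x))"
proof -
  obtain C where C: "C \<ge> 0" "\<And>(f :: nat \<Rightarrow> real \<Rightarrow> complex) A m.
    (\<forall>k x. k < n \<longrightarrow> (f k has_vector_derivative f (Suc k) x) (at x)) \<Longrightarrow>
    (\<forall>k. k \<le> n \<longrightarrow> continuous_on UNIV (f k)) \<Longrightarrow>
    (\<forall>k x. k \<le> n \<longrightarrow> norm (f k x) \<le> A * (1 + x\<^sup>2) ^ m) \<Longrightarrow>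
    sqn (\<lambda>x. sqrt ((1 + x\<^sup>2) ^ (n - k)) *\<^sub>R f k x) \<le> ennreal C * (sqn (\<lambda>x. sqrt ((1 + x\<^sup>2) ^ n) *\<^sub>R f 0 x) + sqn (f n))"
    using weighted_interpolation[OF assms(1)] by blast
  show ?thesis
  proof (intro exI[of _ "C * 3 ^ n"] conjI allI impI)
    fix u :: "real \<Rightarrow> complex" and h :: real
    assume u: "\<forall>j<n. integrable lborel (\<lambda>x. complex_of_real (x ^ j) * u x)" and h: "0 < h" "h \<le> 1"
    have u0: "integrable lborel u" using u[rule_format, of 0] assms by simp
    then have [measurable]: "u \<in> borel_measurable borel" by auto
    let ?v = "\<lambda>x. u x * smear h x"
    have v: "integrable lborel (\<lambda>x. complex_of_real (x ^ j) * ?v x)" if "j \<le> n" for j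
    proof (cases "j < n")
      case True then show ?thesis using u integrable_smear(1)[OF h(1), of j u] by auto
    next
      case False
      then have "j = Suc (n - 1)" using that assms by simp
      then show ?thesis using u[rule_format, of "n - 1"] integrable_smear(2)[OF h(1), of "n - 1" u] assms by simp
    qed
    define A where "A = (\<Sum>k\<le>n. (LINT x|lborel. \<bar>x\<bar> ^ k * norm (?v x)) / sqrt (2 * pi))"
    have "norm (FD k ?v \<xi>) \<le> A * (1 + \<xi>\<^sup>2) ^ 0" if "k \<le> n" for k \<xi>
    proof -
      have "norm (FD k ?v \<xi>) \<le> (LINT x|lborel. \<bar>x\<bar> ^ k * norm (?v x)) / sqrt (2 * pi)" by (rule norm_FD_le)
      also have "\<dots> \<le> A" unfolding A_def using that by (intro member_le_sum) auto
      finally show ?thesis by simp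
    qed
    then have "sqn (\<lambda>x. sqrt ((1 + x\<^sup>2) ^ (n - k)) *\<^sub>R FD k ?v x) \<le> ennreal C * (sqn (\<lambda>x. sqrt ((1 + x\<^sup>2) ^ n) *\<^sub>R FD 0 ?v x) + sqn (FD n ?v))"
      by (intro C(2)[of "\<lambda>k. FD k ?v" A 0]) (auto intro!: FD_has_vector_derivative continuous_intros v)
    also have "\<dots> \<le> ennreal C * (ennreal (3 ^ n) * sqn (\<lambda>\<xi>. sqrt ((1 + \<xi>\<^sup>2) ^ n) *\<^sub>R fourier u \<xi>) + ennreal (3 ^ n) * sqn (\<lambda>x. complex_of_real (x ^ n) * u x))"
    proof (intro mult_left_mono add_mono)
      show "sqn (\<lambda>x. sqrt ((1 + x\<^sup>2) ^ n) *\<^sub>R FD 0 ?v x) \<le> ennreal (3 ^ n) * sqn (\<lambda>\<xi>. sqrt ((1 + \<xi>\<^sup>2) ^ n) *\<^sub>R fourier u \<xi>)"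
        unfolding FD_0 by (rule sqn_weighted_fourier_smear[OF u0 h])
      have "sqn (FD n ?v) \<le> sqn (\<lambda>x. (- \<i> * complex_of_real x) ^ n * ?v x)"
        unfolding FD_def by (rule Plancherel_le) (use v in \<open>simp only: integrable_monomial_iff order_refl\<close>)
      also have "\<dots> \<le> sqn (\<lambda>x. complex_of_real (x ^ n) * u x)"
        unfolding sqn_def using norm_mult_smear_le(2)[OF h(1), of _ "n - 1" u] assms
        by (intro nn_integral_mono ennreal_leI power_mono) auto
      also have "\<dots> \<le> ennreal (3 ^ n) * sqn (\<lambda>x. complex_of_real (x ^ n) * u x)"
        using mult_right_mono[of 1 "ennreal (3 ^ n)" "sqn (\<lambda>x. complex_of_real (x ^ n) * u x)"] by simp
      finally show "sqn (FD n ?v) \<le> ennreal (3 ^ n) * sqn (\<lambda>x. complex_of_real (x ^ n) * u x)" .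
    qed auto
    also have "\<dots> = ennreal (C * 3 ^ n) * (sqn (\<lambda>\<xi>. sqrt ((1 + \<xi>\<^sup>2) ^ n) *\<^sub>R fourier u \<xi>) + sqn (\<lambda>x. complex_of_real (x ^ n) * u x))"
      using C(1) by (simp add: ennreal_mult distrib_left mult.assoc)
    finally show "sqn (\<lambda>\<xi>. sqrt ((1 + \<xi>\<^sup>2) ^ (n - k)) *\<^sub>R FD k ?v \<xi>) \<le> \<dots>" .
  qed (use C in auto)
qed

text \<open>For k < n the k-th moment is integrable, so the smeared derivatives converge pointwise
  and Fatou's lemma removes h.\<close>

lemma fourier_interpolation:
  assumes "k < n"
  shows "\<exists>C\<ge>0. \<forall>u. (\<forall>j<n. integrable lborel (\<lambda>x. complex_of_real (x ^ j) * u x)) \<longrightarrow>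
    sqn (\<lambda>\<xi>. sqrt ((1 + \<xi>\<^sup>2) ^ (n - k)) *\<^sub>R FD k u \<xi>)
     \<le> ennreal C * (sqn (\<lambda>\<xi>. sqrt ((1 + \<xi>\<^sup>2) ^ n) *\<^sub>R fourier u \<xi>) + sqn (\<lambda>x. complex_of_real (x ^ n) * u x))"
proof -
  have kn: "k \<le> n" "0 < n" using assms by auto
  obtain C where C: "C \<ge> 0" "\<And>u h. (\<forall>j<n. integrable lborel (\<lambda>x. complex_of_real (x ^ j) * u x)) \<Longrightarrow> 0 < h \<Longrightarrow> h \<le> 1 \<Longrightarrow>
    sqn (\<lambda>\<xi>. sqrt ((1 + \<xi>\<^sup>2) ^ (n - k)) *\<^sub>R FD k (\<lambda>x. u x * smear h x) \<xi>)
     \<le> ennreal C * (sqn (\<lambda>\<xi>. sqrt ((1 + \<xi>\<^sup>2) ^ n) *\<^sub>R fourier u \<xi>) + sqn (\<lambda>x. complex_of_real (x ^ n) * u x))"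
    using fourier_interpolation_smear[OF kn] by blast
  show ?thesis
  proof (intro exI[of _ C] conjI allI impI)
    fix u assume u: "\<forall>j<n. integrable lborel (\<lambda>x. complex_of_real (x ^ j) * u x)"
    then have "integrable lborel (\<lambda>x. complex_of_real (x ^ 0) * u x)" using kn by blast
    then have [measurable]: "u \<in> borel_measurable borel" by auto
    define h where "h i = 1 / real (Suc i)" for i
    have h: "h i > 0" "h i \<le> 1" "h \<longlonglongrightarrow> 0" for i
      unfolding h_def using LIMSEQ_inverse_real_of_nat by (auto simp: inverse_eq_divide)
    show "sqn (\<lambda>\<xi>. sqrt ((1 + \<xi>\<^sup>2) ^ (n - k)) *\<^sub>R FD k u \<xi>) \<le> ennreal C * (sqn (\<lambda>\<xi>. sqrt ((1 + \<xi>\<^sup>2) ^ n) *\<^sub>R fourier u \<xi>) + sqn (\<lambda>x. complex_of_real (x ^ n) * u x))"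
    proof (rule sqn_le_liminf[where f="\<lambda>i \<xi>. sqrt ((1 + \<xi>\<^sup>2) ^ (n - k)) *\<^sub>R FD k (\<lambda>x. u x * smear (h i) x) \<xi>"])
      show "AE \<xi> in lborel. (\<lambda>i. sqrt ((1 + \<xi>\<^sup>2) ^ (n - k)) *\<^sub>R FD k (\<lambda>x. u x * smear (h i) x) \<xi>) \<longlonglongrightarrow> sqrt ((1 + \<xi>\<^sup>2) ^ (n - k)) *\<^sub>R FD k u \<xi>"
        using u assms by (intro AE_I2 tendsto_scaleR tendsto_const FD_smear_tendsto h) auto
      show "sqn (\<lambda>\<xi>. sqrt ((1 + \<xi>\<^sup>2) ^ (n - k)) *\<^sub>R FD k (\<lambda>x. u x * smear (h i) x) \<xi>) \<le> ennreal C * (sqn (\<lambda>\<xi>. sqrt ((1 + \<xi>\<^sup>2) ^ n) *\<^sub>R fourier u \<xi>) + sqn (\<lambda>x. complex_of_real (x ^ n) * u x))" for i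
        by (rule C(2)[OF u h(1,2)])
      show "(\<lambda>\<xi>. sqrt ((1 + \<xi>\<^sup>2) ^ (n - k)) *\<^sub>R FD k (\<lambda>x. u x * smear (h i) x) \<xi>) \<in> borel_measurable borel" for i
        unfolding FD_def by measurable
    qed
  qed (use C in auto)
qed

subsection \<open>Functions with three moments and five derivatives in mean square\<close>

abbreviation cr :: "(real \<Rightarrow> real) \<Rightarrow> real \<Rightarrow> complex" where
  "cr u \<equiv> \<lambda>x. complex_of_real (u x)"

text \<open>K bounds squared norms. Five is the Sobolev index of the solution, and three is the
  largest integer below 7/2.\<close>

definition wclass :: "real \<Rightarrow> (real \<Rightarrow> real) \<Rightarrow> bool" where
  "wclass K u \<longleftrightarrow> u \<in> borel_measurable borel \<and> sqn (cr u) \<le> ennreal K \<and>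
     sqn (\<lambda>x. complex_of_real (x ^ 3) * cr u x) \<le> ennreal K \<and>
     sqn (\<lambda>\<xi>. sqrt ((1 + \<xi>\<^sup>2) ^ 5) *\<^sub>R fourier (cr u) \<xi>) \<le> ennreal K"

text \<open>The number pi, kept abstract as a Cauchy-Schwarz constant.\<close>

definition cauchy_mass :: real where
  "cauchy_mass = (LINT x|lborel. inverse (1 + x\<^sup>2))"

lemma cauchy_mass_nonneg: "cauchy_mass \<ge> 0"
  unfolding cauchy_mass_def by (rule integral_nonneg_AE) simp

lemma sqn_mono: "(\<And>x. norm (f x) \<le> norm (g x)) \<Longrightarrow> sqn f \<le> sqn g"
  unfolding sqn_def by (intro nn_integral_mono ennreal_leI power_mono) auto

text \<open>Cauchy-Schwarz against (1 + x^2)^(-1/2), whose square has the integral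
  \<open>cauchy_mass\<close>.\<close>

lemma L1_le_weighted_sqn:
  fixes g :: "real \<Rightarrow> complex"
  assumes [measurable]: "g \<in> borel_measurable borel"
  shows "(\<integral>\<^sup>+x. ennreal (norm (g x)) \<partial>lborel)\<^sup>2 \<le> sqn (\<lambda>x. sqrt (1 + x\<^sup>2) *\<^sub>R g x) * ennreal cauchy_mass"
proof -
  have p: "1 + x\<^sup>2 > 0" for x :: real by (simp add: add_pos_nonneg)
  have "(\<integral>\<^sup>+x. ennreal (norm (g x)) \<partial>lborel) = (\<integral>\<^sup>+x. ennreal (norm (sqrt (1 + x\<^sup>2) *\<^sub>R g x)) * ennreal (inverse (sqrt (1 + x\<^sup>2))) \<partial>lborel)"
  proof (intro nn_integral_cong)
    fix x
    have "norm (g x) = norm (sqrt (1 + x\<^sup>2) *\<^sub>R g x) * inverse (sqrt (1 + x\<^sup>2))" using p[of x] by simp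
    then show "ennreal (norm (g x)) = ennreal (norm (sqrt (1 + x\<^sup>2) *\<^sub>R g x)) * ennreal (inverse (sqrt (1 + x\<^sup>2)))"
      by (metis ennreal_mult' norm_ge_zero)
  qed
  also have "\<dots>\<^sup>2 \<le> (\<integral>\<^sup>+x. (ennreal (norm (sqrt (1 + x\<^sup>2) *\<^sub>R g x)))\<^sup>2 \<partial>lborel) * (\<integral>\<^sup>+x. (ennreal (inverse (sqrt (1 + x\<^sup>2))))\<^sup>2 \<partial>lborel)"
    by (rule Cauchy_Schwarz_nn_integral) auto
  also have "(\<integral>\<^sup>+x. (ennreal (norm (sqrt (1 + x\<^sup>2) *\<^sub>R g x)))\<^sup>2 \<partial>lborel) = sqn (\<lambda>x. sqrt (1 + x\<^sup>2) *\<^sub>R g x)"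
    unfolding sqn_def by (intro nn_integral_cong) (simp only: ennreal_power norm_ge_zero)
  also have "(\<integral>\<^sup>+x. (ennreal (inverse (sqrt (1 + x\<^sup>2))))\<^sup>2 \<partial>lborel) = (\<integral>\<^sup>+x. ennreal (inverse (1 + x\<^sup>2)) \<partial>lborel)"
    using p by (intro nn_integral_cong) (simp add: ennreal_power power_inverse less_imp_le)
  also have "\<dots> = ennreal cauchy_mass"
    unfolding cauchy_mass_def by (intro nn_integral_eq_integral integrable_inverse_one_plus_square AE_I2) (use p in \<open>simp add: less_imp_le\<close>)
  finally show ?thesis .
qed

lemma moment_weight_le:
  fixes x :: real
  assumes "j < n"
  shows "(1 + x\<^sup>2) * (x ^ j)\<^sup>2 \<le> 2 * (1 + (x ^ n)\<^sup>2)"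
proof -
  have p: "(x ^ i)\<^sup>2 \<le> 1 + (x ^ n)\<^sup>2" if "i \<le> n" for i
  proof (cases "x\<^sup>2 \<le> 1")
    case True
    then have "(x\<^sup>2) ^ i \<le> 1" by (rule power_le_one[OF zero_le_power2])
    moreover have "(x ^ i)\<^sup>2 = (x\<^sup>2) ^ i" by (simp add: power_mult[symmetric] mult.commute)
    ultimately have "(x ^ i)\<^sup>2 \<le> 1" by simp
    moreover have "(x ^ n)\<^sup>2 \<ge> 0" by simp
    ultimately show ?thesis by linarith
  next
    case False
    then have "(x\<^sup>2) ^ i \<le> (x\<^sup>2) ^ n" using that by (intro power_increasing) auto
    moreover have "(x ^ i)\<^sup>2 = (x\<^sup>2) ^ i" "(x ^ n)\<^sup>2 = (x\<^sup>2) ^ n" by (simp_all only: power_mult[symmetric] mult.commute)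
    ultimately show ?thesis by linarith
  qed
  have "(1 + x\<^sup>2) * (x ^ j)\<^sup>2 = (x ^ j)\<^sup>2 + (x ^ Suc j)\<^sup>2" by (simp add: power2_eq_square algebra_simps)
  also have "\<dots> \<le> 2 * (1 + (x ^ n)\<^sup>2)" using p[of j] p[of "Suc j"] assms by simp
  finally show ?thesis .
qed

text \<open>One power of the weight is spent on passing from L2 to L1, hence j < n.\<close>

lemma moment_L1_le:
  assumes [measurable]: "u \<in> borel_measurable borel" and "j < n"
  shows "(\<integral>\<^sup>+x. ennreal (norm (complex_of_real (x ^ j) * cr u x)) \<partial>lborel)\<^sup>2
     \<le> ennreal (2 * cauchy_mass) * (sqn (cr u) + sqn (\<lambda>x. complex_of_real (x ^ n) * cr u x))"
proof -
  have "(\<integral>\<^sup>+x. ennreal (norm (complex_of_real (x ^ j) * cr u x)) \<partial>lborel)\<^sup>2 \<le> sqn (\<lambda>x. sqrt (1 + x\<^sup>2) *\<^sub>R (complex_of_real (x ^ j) * cr u x)) * ennreal cauchy_mass"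
    by (rule L1_le_weighted_sqn) measurable
  also have "sqn (\<lambda>x. sqrt (1 + x\<^sup>2) *\<^sub>R (complex_of_real (x ^ j) * cr u x)) \<le> (\<integral>\<^sup>+x. ennreal 2 * (ennreal ((norm (cr u x))\<^sup>2) + ennreal ((norm (complex_of_real (x ^ n) * cr u x))\<^sup>2)) \<partial>lborel)"
    unfolding sqn_def
  proof (intro nn_integral_mono)
    fix x
    have "(norm (sqrt (1 + x\<^sup>2) *\<^sub>R (complex_of_real (x ^ j) * cr u x)))\<^sup>2 = (1 + x\<^sup>2) * (x ^ j)\<^sup>2 * (u x)\<^sup>2"
      by (simp add: norm_mult power_mult_distrib norm_power power_even_abs flip: power_mult)
    also have "\<dots> \<le> 2 * (1 + (x ^ n)\<^sup>2) * (u x)\<^sup>2" by (intro mult_right_mono moment_weight_le assms) simp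
    also have "\<dots> = 2 * ((norm (cr u x))\<^sup>2 + (norm (complex_of_real (x ^ n) * cr u x))\<^sup>2)"
      by (simp add: norm_mult norm_power power_mult_distrib power_even_abs algebra_simps flip: power_mult)
    finally have "ennreal ((norm (sqrt (1 + x\<^sup>2) *\<^sub>R (complex_of_real (x ^ j) * cr u x)))\<^sup>2) \<le> ennreal (2 * ((norm (cr u x))\<^sup>2 + (norm (complex_of_real (x ^ n) * cr u x))\<^sup>2))" by (rule ennreal_leI)
    also have "\<dots> = ennreal 2 * (ennreal ((norm (cr u x))\<^sup>2) + ennreal ((norm (complex_of_real (x ^ n) * cr u x))\<^sup>2))"
      by (simp only: ennreal_mult zero_le_numeral add_nonneg_nonneg zero_le_power2 ennreal_plus)
    finally show "ennreal ((norm (sqrt (1 + x\<^sup>2) *\<^sub>R (complex_of_real (x ^ j) * cr u x)))\<^sup>2) \<le> \<dots>" .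
  qed
  also have "\<dots> = ennreal 2 * (sqn (cr u) + sqn (\<lambda>x. complex_of_real (x ^ n) * cr u x))"
    unfolding sqn_def by (subst nn_integral_cmult, simp, subst nn_integral_add) auto
  finally show ?thesis using cauchy_mass_nonneg by (simp add: ennreal_mult mult_right_mono mult_ac)
qed

lemma integrable_of_sq_le:
  fixes g :: "real \<Rightarrow> complex"
  assumes "g \<in> borel_measurable borel" "(\<integral>\<^sup>+x. ennreal (norm (g x)) \<partial>lborel)\<^sup>2 \<le> ennreal c" and c: "c \<ge> 0"
  shows "integrable lborel g" "(\<integral>\<^sup>+x. ennreal (norm (g x)) \<partial>lborel) = ennreal (LINT x|lborel. norm (g x))" "(LINT x|lborel. norm (g x)) \<le> sqrt c"
proof -
  let ?I = "\<integral>\<^sup>+x. ennreal (norm (g x)) \<partial>lborel"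
  have fin: "?I < \<infinity>"
  proof (rule ccontr)
    assume "\<not> ?I < \<infinity>"
    then have "?I = \<infinity>" by (auto simp: less_top[symmetric])
    then have "?I\<^sup>2 = \<infinity>" by (simp add: power2_eq_square ennreal_top_mult)
    then show False using assms(2) by (simp add: top_unique)
  qed
  then show int: "integrable lborel g" using assms(1) by (intro integrableI_bounded) auto
  show eq: "?I = ennreal (LINT x|lborel. norm (g x))" using int by (intro nn_integral_eq_integral) auto
  have "ennreal ((LINT x|lborel. norm (g x))\<^sup>2) \<le> ennreal c"
    using assms(2) unfolding eq by (simp add: ennreal_power)
  then have "(LINT x|lborel. norm (g x))\<^sup>2 \<le> c"
    using c by (simp add: ennreal_le_iff)
  then show "(LINT x|lborel. norm (g x)) \<le> sqrt c" by (rule real_le_rsqrt)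
qed

lemma wclass_measurable: "wclass K u \<Longrightarrow> u \<in> borel_measurable borel"
  by (simp add: wclass_def)

lemma wclass_moments:
  assumes u: "wclass K u" and j: "j \<le> 2" and K: "K \<ge> 0"
  shows "integrable lborel (\<lambda>x. complex_of_real (x ^ j) * cr u x)" "(LINT x|lborel. norm (complex_of_real (x ^ j) * cr u x)) \<le> sqrt (4 * cauchy_mass * K)"
proof -
  have [measurable]: "u \<in> borel_measurable borel" using u by (rule wclass_measurable)
  have "(\<integral>\<^sup>+x. ennreal (norm (complex_of_real (x ^ j) * cr u x)) \<partial>lborel)\<^sup>2 \<le> ennreal (2 * cauchy_mass) * (ennreal K + ennreal K)"
    using u j by (intro order_trans[OF moment_L1_le[of _ _ 3]] mult_left_mono add_mono) (auto simp: wclass_def)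
  also have "\<dots> = ennreal (4 * cauchy_mass * K)"
    using K cauchy_mass_nonneg by (simp add: ennreal_plus[symmetric] ennreal_mult[symmetric] del: ennreal_plus)
  finally have b: "(\<integral>\<^sup>+x. ennreal (norm (complex_of_real (x ^ j) * cr u x)) \<partial>lborel)\<^sup>2 \<le> ennreal (4 * cauchy_mass * K)" .
  have m: "(\<lambda>x. complex_of_real (x ^ j) * cr u x) \<in> borel_measurable borel" by measurable
  show "integrable lborel (\<lambda>x. complex_of_real (x ^ j) * cr u x)" "(LINT x|lborel. norm (complex_of_real (x ^ j) * cr u x)) \<le> sqrt (4 * cauchy_mass * K)"
    using integrable_of_sq_le[OF m b] K cauchy_mass_nonneg by auto
qed

lemma borel_measurable_FD [measurable]:
  assumes [measurable]: "u \<in> borel_measurable borel"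
  shows "FD k u \<in> borel_measurable borel"
  unfolding FD_def by measurable

text \<open>Interpolation with n = 3 leaves a weight of order 3 - k on the k-th derivative. For k <=
  2 at least one power remains; it makes the derivative integrable, and for k = 2 it also pays for
  the factor \<xi> in the nonlinearity.\<close>

lemma wclass_FD:
  assumes K: "K \<ge> 0" and k: "k \<le> 2"
  shows "\<exists>M\<ge>0. \<forall>u. wclass K u \<longrightarrow> sqn (\<lambda>\<xi>. sqrt (1 + \<xi>\<^sup>2) *\<^sub>R FD k (cr u) \<xi>) \<le> ennreal M"
proof -
  have kn: "k < 3" using k by simp
  obtain C where C: "C \<ge> 0" "\<And>u. (\<forall>j<3. integrable lborel (\<lambda>x. complex_of_real (x ^ j) * u x)) \<Longrightarrow>
    sqn (\<lambda>\<xi>. sqrt ((1 + \<xi>\<^sup>2) ^ (3 - k)) *\<^sub>R FD k u \<xi>)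
     \<le> ennreal C * (sqn (\<lambda>\<xi>. sqrt ((1 + \<xi>\<^sup>2) ^ 3) *\<^sub>R fourier u \<xi>) + sqn (\<lambda>x. complex_of_real (x ^ 3) * u x))"
    using fourier_interpolation[OF kn] by blast
  show ?thesis
  proof (intro exI[of _ "C * (2 * K)"] conjI allI impI)
    fix u assume u: "wclass K u"
    have "sqn (\<lambda>\<xi>. sqrt (1 + \<xi>\<^sup>2) *\<^sub>R FD k (cr u) \<xi>) \<le> sqn (\<lambda>\<xi>. sqrt ((1 + \<xi>\<^sup>2) ^ (3 - k)) *\<^sub>R FD k (cr u) \<xi>)"
    proof (rule sqn_mono)
      fix \<xi> :: real
      have "(1 + \<xi>\<^sup>2) ^ 1 \<le> (1 + \<xi>\<^sup>2) ^ (3 - k)" using k by (intro power_increasing) auto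
      then show "norm (sqrt (1 + \<xi>\<^sup>2) *\<^sub>R FD k (cr u) \<xi>) \<le> norm (sqrt ((1 + \<xi>\<^sup>2) ^ (3 - k)) *\<^sub>R FD k (cr u) \<xi>)"
        by (auto intro!: mult_right_mono)
    qed
    also have "\<dots> \<le> ennreal C * (sqn (\<lambda>\<xi>. sqrt ((1 + \<xi>\<^sup>2) ^ 3) *\<^sub>R fourier (cr u) \<xi>) + sqn (\<lambda>x. complex_of_real (x ^ 3) * cr u x))"
      using wclass_moments(1)[OF u _ K] by (intro C(2)) auto
    also have "\<dots> \<le> ennreal C * (ennreal K + ennreal K)"
    proof (intro mult_left_mono add_mono)
      have "sqn (\<lambda>\<xi>. sqrt ((1 + \<xi>\<^sup>2) ^ 3) *\<^sub>R fourier (cr u) \<xi>) \<le> sqn (\<lambda>\<xi>. sqrt ((1 + \<xi>\<^sup>2) ^ 5) *\<^sub>R fourier (cr u) \<xi>)"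
      proof (rule sqn_mono)
        fix \<xi> :: real
        have "(1 + \<xi>\<^sup>2) ^ 3 \<le> (1 + \<xi>\<^sup>2) ^ 5" by (intro power_increasing) auto
        then show "norm (sqrt ((1 + \<xi>\<^sup>2) ^ 3) *\<^sub>R fourier (cr u) \<xi>) \<le> norm (sqrt ((1 + \<xi>\<^sup>2) ^ 5) *\<^sub>R fourier (cr u) \<xi>)"
          by (auto intro!: mult_right_mono)
      qed
      also have "\<dots> \<le> ennreal K" using u by (simp add: wclass_def)
      finally show "sqn (\<lambda>\<xi>. sqrt ((1 + \<xi>\<^sup>2) ^ 3) *\<^sub>R fourier (cr u) \<xi>) \<le> ennreal K" .
    qed (use u in \<open>auto simp: wclass_def\<close>)
    also have "\<dots> = ennreal (C * (2 * K))"
      using K C by (simp add: ennreal_plus[symmetric] ennreal_mult[symmetric] del: ennreal_plus)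
    finally show "sqn (\<lambda>\<xi>. sqrt (1 + \<xi>\<^sup>2) *\<^sub>R FD k (cr u) \<xi>) \<le> \<dots>" .
  qed (use C K in auto)
qed

lemma wclass_FD_L1:
  assumes K: "K \<ge> 0" and k: "k \<le> 2"
  shows "\<exists>M\<ge>0. \<forall>u. wclass K u \<longrightarrow> integrable lborel (FD k (cr u)) \<and> (\<integral>\<^sup>+\<xi>. ennreal (norm (FD k (cr u) \<xi>)) \<partial>lborel) \<le> ennreal M"
proof -
  obtain M where M: "M \<ge> 0" "\<And>u. wclass K u \<Longrightarrow> sqn (\<lambda>\<xi>. sqrt (1 + \<xi>\<^sup>2) *\<^sub>R FD k (cr u) \<xi>) \<le> ennreal M"
    using wclass_FD[OF K k] by blast
  show ?thesis
  proof (intro exI[of _ "sqrt (M * cauchy_mass)"] conjI allI impI)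
    fix u assume u: "wclass K u"
    have [measurable]: "u \<in> borel_measurable borel" using u by (rule wclass_measurable)
    have m: "FD k (cr u) \<in> borel_measurable borel" by measurable
    have c0: "M * cauchy_mass \<ge> 0" using M cauchy_mass_nonneg by simp
    have b: "(\<integral>\<^sup>+x. ennreal (norm (FD k (cr u) x)) \<partial>lborel)\<^sup>2 \<le> ennreal (M * cauchy_mass)"
      using order_trans[OF L1_le_weighted_sqn[OF m] mult_right_mono[OF M(2)[OF u]]] M cauchy_mass_nonneg by (simp add: ennreal_mult)
    show "integrable lborel (FD k (cr u))" by (rule integrable_of_sq_le(1)[OF m b c0])
    show "(\<integral>\<^sup>+\<xi>. ennreal (norm (FD k (cr u) \<xi>)) \<partial>lborel) \<le> ennreal (sqrt (M * cauchy_mass))"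
      unfolding integrable_of_sq_le(2)[OF m b c0] by (rule ennreal_leI[OF integrable_of_sq_le(3)[OF m b c0]])
  qed (use M cauchy_mass_nonneg in auto)
qed

lemma wclass_moment_inversion:
  assumes u: "wclass K u" and K: "K \<ge> 0" and k: "k \<le> 2"
  shows "AE x in lborel. (- \<i> * complex_of_real x) ^ k * cr u x = fourier (FD k (cr u)) (- x)"
  unfolding FD_def
proof (rule fourier_inversion)
  show "integrable lborel (\<lambda>x. (- \<i> * complex_of_real x) ^ k * cr u x)"
    unfolding integrable_monomial_iff by (rule wclass_moments(1)[OF u k K])
  show "integrable lborel (fourier (\<lambda>x. (- \<i> * complex_of_real x) ^ k * cr u x))"
    using wclass_FD_L1[OF K k] u unfolding FD_def by blast
qed

subsection \<open>The transform of the square\<close>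

abbreviation sq :: "(real \<Rightarrow> real) \<Rightarrow> real \<Rightarrow> complex" where
  "sq u \<equiv> \<lambda>x. complex_of_real ((u x)\<^sup>2)"

text \<open>Three L2 moments on each factor give six integrable moments of the square.\<close>

lemma wclass_sq_moments:
  assumes u: "wclass K u" and j: "j \<le> 6"
  shows "integrable lborel (\<lambda>x. complex_of_real (x ^ j) * sq u x)"
proof -
  have [measurable]: "u \<in> borel_measurable borel" using u by (rule wclass_measurable)
  have i: "integrable lborel (\<lambda>x. (norm (g x))\<^sup>2)" if "sqn g \<le> ennreal K" "g \<in> borel_measurable borel" for g :: "real \<Rightarrow> complex"
    using that unfolding sqn_def by (intro integrableI_bounded) (auto intro: le_less_trans)
  show ?thesis
  proof (rule Bochner_Integration.integrable_bound)
    show "integrable lborel (\<lambda>x. (norm (cr u x))\<^sup>2 + (norm (complex_of_real (x ^ 3) * cr u x))\<^sup>2)"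
      using u by (intro Bochner_Integration.integrable_add i) (auto simp: wclass_def)
    show "AE x in lborel. norm (complex_of_real (x ^ j) * sq u x) \<le> norm ((norm (cr u x))\<^sup>2 + (norm (complex_of_real (x ^ 3) * cr u x))\<^sup>2)"
    proof (rule AE_I2)
      fix x :: real
      have "\<bar>x\<bar> ^ j \<le> 1 + \<bar>x\<bar> ^ 6"
      proof (cases "\<bar>x\<bar> \<le> 1")
        case True then show ?thesis using power_le_one[of "\<bar>x\<bar>" j] zero_le_power[of "\<bar>x\<bar>" 6] by linarith
      next
        case False then show ?thesis using power_increasing[of j 6 "\<bar>x\<bar>"] j by simp
      qed
      from mult_right_mono[OF this zero_le_power2[of "u x"]]
      show "norm (complex_of_real (x ^ j) * sq u x) \<le> norm ((norm (cr u x))\<^sup>2 + (norm (complex_of_real (x ^ 3) * cr u x))\<^sup>2)"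
        by (simp add: norm_mult norm_power power_mult_distrib algebra_simps flip: power_mult)
    qed
  qed measurable
qed

text \<open>The monomial of degree a + b is split between the two factors before the convolution
  theorem is applied. Thus up to four derivatives of the transform of u^2 are controlled by at most
  two derivatives of the transform of u.\<close>

lemma wclass_FD_sq:
  assumes u: "wclass K u" and K: "K \<ge> 0" and ab: "a \<le> 2" "b \<le> 2"
  shows "FD (a + b) (sq u) \<xi> = (LINT \<eta>|lborel. FD a (cr u) (\<xi> - \<eta>) * FD b (cr u) \<eta>) / complex_of_real (sqrt (2 * pi))"
proof -
  have [measurable]: "u \<in> borel_measurable borel" using u by (rule wclass_measurable)
  let ?a = "\<lambda>x. (- \<i> * complex_of_real x) ^ a * cr u x"
  have ia: "integrable lborel ?a" unfolding integrable_monomial_iff by (rule wclass_moments(1)[OF u ab(1) K])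
  have iB: "integrable lborel (FD b (cr u))" using wclass_FD_L1[OF K ab(2)] u by blast
  have "fourier (\<lambda>x. (- \<i> * complex_of_real x) ^ (a + b) * sq u x) = fourier (\<lambda>x. ?a x * fourier (FD b (cr u)) (- x))"
  proof (rule fourier_cong_AE)
    show "AE x in lborel. (- \<i> * complex_of_real x) ^ (a + b) * sq u x = ?a x * fourier (FD b (cr u)) (- x)"
      using wclass_moment_inversion[OF u K ab(2)]
      by eventually_elim (simp add: power_add power2_eq_square mult_ac)
  qed measurable
  then show ?thesis
    using fourier_mult_inverse[OF ia iB, of \<xi>] by (simp add: FD_def)
qed

text \<open>The constant is sqrt(4^5), since 1 + (a + b)^2 is at most 4 times the larger of 1 + a^2
  and 1 + b^2.\<close>

lemma sqrt_weight_quasi_additive: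
  fixes a b :: real
  shows "sqrt ((1 + (a + b)\<^sup>2) ^ 5) \<le> 32 * (sqrt ((1 + a\<^sup>2) ^ 5) + sqrt ((1 + b\<^sup>2) ^ 5))"
proof -
  define m where "m = max (1 + a\<^sup>2) (1 + b\<^sup>2)"
  have "0 \<le> (a - b)\<^sup>2" by simp
  then have "1 + (a + b)\<^sup>2 \<le> 4 * m" unfolding m_def by (simp add: power2_sum power2_diff max_def)
  then have "(1 + (a + b)\<^sup>2) ^ 5 \<le> (4 * m) ^ 5" by (intro power_mono) auto
  also have "\<dots> = (32:: real)\<^sup>2 * m ^ 5" by (simp add: power_mult_distrib)
  finally have "sqrt ((1 + (a + b)\<^sup>2) ^ 5) \<le> sqrt ((32:: real)\<^sup>2 * m ^ 5)" by simp
  also have "\<dots> = 32 * sqrt (m ^ 5)" by (simp only: real_sqrt_mult real_sqrt_abs abs_numeral)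
  also have "sqrt (m ^ 5) \<le> sqrt ((1 + a\<^sup>2) ^ 5) + sqrt ((1 + b\<^sup>2) ^ 5)"
    unfolding m_def max_def by auto
  finally show ?thesis by simp
qed

text \<open>The derivatives are split as 4 = 2 + 2, 3 = 1 + 2 and 0 = 0 + 0, with the weights
  |\<xi>|, 1 and order 5. All three weights are quasi-additive with constant 32, so one application
  of \<open>weighted_Young\<close> covers them.\<close>

lemma wclass_sq_bounds:
  assumes K: "K \<ge> 0"
  shows "\<exists>M\<ge>0. \<forall>u. wclass K u \<longrightarrow> sqn (\<lambda>\<xi>. \<bar>\<xi>\<bar> *\<^sub>R FD 4 (sq u) \<xi>) \<le> ennreal M \<and> sqn (FD 3 (sq u)) \<le> ennreal M \<and>
    sqn (\<lambda>\<xi>. sqrt ((1 + \<xi>\<^sup>2) ^ 5) *\<^sub>R FD 0 (sq u) \<xi>) \<le> ennreal M"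
proof -
  have ex: "\<exists>M\<ge>0. \<forall>u. wclass K u \<longrightarrow> sqn (\<lambda>\<xi>. sqrt (1 + \<xi>\<^sup>2) *\<^sub>R FD k (cr u) \<xi>) \<le> ennreal M \<and>
     (\<integral>\<^sup>+\<xi>. ennreal (norm (FD k (cr u) \<xi>)) \<partial>lborel) \<le> ennreal M" if k: "k \<le> 2" for k
  proof -
    obtain M1 where "M1 \<ge> 0" "\<And>u. wclass K u \<Longrightarrow> sqn (\<lambda>\<xi>. sqrt (1 + \<xi>\<^sup>2) *\<^sub>R FD k (cr u) \<xi>) \<le> ennreal M1"
      using wclass_FD[OF K k] by blast
    moreover obtain M2 where "M2 \<ge> 0" "\<And>u. wclass K u \<Longrightarrow> (\<integral>\<^sup>+\<xi>. ennreal (norm (FD k (cr u) \<xi>)) \<partial>lborel) \<le> ennreal M2"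
      using wclass_FD_L1[OF K k] by blast
    moreover have "ennreal M1 \<le> ennreal (max M1 M2)" "ennreal M2 \<le> ennreal (max M1 M2)" by (auto intro!: ennreal_leI)
    ultimately show ?thesis
      by (intro exI[of _ "max M1 M2"]) (meson max.coboundedI1 order_trans)
  qed
  obtain N0 where N0: "N0 \<ge> 0" "\<And>u. wclass K u \<Longrightarrow> sqn (\<lambda>\<xi>. sqrt (1 + \<xi>\<^sup>2) *\<^sub>R FD 0 (cr u) \<xi>) \<le> ennreal N0"
    "\<And>u. wclass K u \<Longrightarrow> (\<integral>\<^sup>+\<xi>. ennreal (norm (FD 0 (cr u) \<xi>)) \<partial>lborel) \<le> ennreal N0" using ex[of 0] by auto
  obtain N1 where N1: "N1 \<ge> 0" "\<And>u. wclass K u \<Longrightarrow> sqn (\<lambda>\<xi>. sqrt (1 + \<xi>\<^sup>2) *\<^sub>R FD 1 (cr u) \<xi>) \<le> ennreal N1"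
    "\<And>u. wclass K u \<Longrightarrow> (\<integral>\<^sup>+\<xi>. ennreal (norm (FD 1 (cr u) \<xi>)) \<partial>lborel) \<le> ennreal N1" using ex[of 1] by auto
  obtain N2 where N2: "N2 \<ge> 0" "\<And>u. wclass K u \<Longrightarrow> sqn (\<lambda>\<xi>. sqrt (1 + \<xi>\<^sup>2) *\<^sub>R FD 2 (cr u) \<xi>) \<le> ennreal N2"
    "\<And>u. wclass K u \<Longrightarrow> (\<integral>\<^sup>+\<xi>. ennreal (norm (FD 2 (cr u) \<xi>)) \<partial>lborel) \<le> ennreal N2" using ex[of 2] by auto
  define N where "N = N0 + N1 + N2 + K"
  have NN: "N \<ge> 0" "N0 \<le> N" "N1 \<le> N" "N2 \<le> N" "K \<le> N" using N0(1) N1(1) N2(1) K by (auto simp: N_def)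
  show ?thesis
  \<comment> \<open>N bounds all norms that occur; \<open>weighted_Young\<close> gives 2 * 32^2
    times two equal terms N * N^2.\<close>
  proof (intro exI[of _ "4 * 32\<^sup>2 * (N * N\<^sup>2)"] conjI allI impI)
    show "4 * 32\<^sup>2 * (N * N\<^sup>2) \<ge> 0" using NN by simp
    fix u assume u: "wclass K u"
    have [measurable]: "u \<in> borel_measurable borel" using u by (rule wclass_measurable)
    have s1: "sqn (\<lambda>\<xi>. sqrt (1 + \<xi>\<^sup>2) *\<^sub>R FD k (cr u) \<xi>) \<le> ennreal N" if "k \<in> {0,1,2}" for k
      using that order_trans[OF N0(2)[OF u] ennreal_leI[OF NN(2)]] order_trans[OF N1(2)[OF u] ennreal_leI[OF NN(3)]] order_trans[OF N2(2)[OF u] ennreal_leI[OF NN(4)]] by blast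
    have s2: "(\<integral>\<^sup>+\<xi>. ennreal (norm (FD k (cr u) \<xi>)) \<partial>lborel) \<le> ennreal N" if "k \<in> {0,1,2}" for k
      using that order_trans[OF N0(3)[OF u] ennreal_leI[OF NN(2)]] order_trans[OF N1(3)[OF u] ennreal_leI[OF NN(3)]] order_trans[OF N2(3)[OF u] ennreal_leI[OF NN(4)]] by blast
    have gen: "sqn (\<lambda>\<xi>. m \<xi> *\<^sub>R FD (a + b) (sq u) \<xi>) \<le> ennreal (4 * 32\<^sup>2 * (N * N\<^sup>2))"
      if ab: "a \<in> {0,1,2}" "b \<in> {0,1,2}" and [measurable]: "m \<in> borel_measurable borel" and m0: "\<And>x. m x \<ge> 0" and m: "\<And>\<xi> \<eta>. m \<xi> \<le> 32 * (m (\<xi> - \<eta>) + m \<eta>)"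
        and ma: "sqn (\<lambda>\<xi>. m \<xi> *\<^sub>R FD a (cr u) \<xi>) \<le> ennreal N" and mb: "sqn (\<lambda>\<xi>. m \<xi> *\<^sub>R FD b (cr u) \<xi>) \<le> ennreal N" for a b and m :: "real \<Rightarrow> real"
    proof -
      define H where "H \<xi> = (LINT \<eta>|lborel. FD a (cr u) (\<xi> - \<eta>) * FD b (cr u) \<eta>)" for \<xi>
      have "sqrt (2 * pi) \<ge> 1" using pi_gt3 by simp
      then have "1 / sqrt (2 * pi) \<le> 1" by simp
      have "sqn (\<lambda>\<xi>. m \<xi> *\<^sub>R FD (a + b) (sq u) \<xi>) \<le> sqn (\<lambda>\<xi>. m \<xi> *\<^sub>R H \<xi>)"
      proof (rule sqn_mono)
        fix \<xi>
        have "FD (a + b) (sq u) \<xi> = H \<xi> / complex_of_real (sqrt (2 * pi))" unfolding H_def using ab by (intro wclass_FD_sq[OF u K]) auto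
        then have "norm (FD (a + b) (sq u) \<xi>) = norm (H \<xi>) * (1 / sqrt (2 * pi))" by (simp add: norm_divide)
        also have "\<dots> \<le> norm (H \<xi>) * 1" by (rule mult_left_mono[OF \<open>1 / sqrt (2 * pi) \<le> 1\<close>]) simp
        finally have "norm (FD (a + b) (sq u) \<xi>) \<le> norm (H \<xi>)" by simp
        then show "norm (m \<xi> *\<^sub>R FD (a + b) (sq u) \<xi>) \<le> norm (m \<xi> *\<^sub>R H \<xi>)" by (simp add: mult_left_mono)
      qed
      also have "\<dots> \<le> ennreal (2 * 32\<^sup>2) * (sqn (\<lambda>\<xi>. m \<xi> *\<^sub>R FD a (cr u) \<xi>) * (\<integral>\<^sup>+\<eta>. ennreal (norm (FD b (cr u) \<eta>)) \<partial>lborel)\<^sup>2 +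
          sqn (\<lambda>\<xi>. m \<xi> *\<^sub>R FD b (cr u) \<xi>) * (\<integral>\<^sup>+\<eta>. ennreal (norm (FD a (cr u) \<eta>)) \<partial>lborel)\<^sup>2)"
        by (rule weighted_Young[OF _ _ _ m0 _ m H_def]) auto
      also have "\<dots> \<le> ennreal (2 * 32\<^sup>2) * (ennreal N * (ennreal N)\<^sup>2 + ennreal N * (ennreal N)\<^sup>2)"
        by (intro mult_left_mono add_mono mult_mono power_mono ma mb s2 ab) auto
      also have "\<dots> = ennreal (4 * 32\<^sup>2 * (N * N\<^sup>2))"
      proof -
        have "ennreal N * (ennreal N)\<^sup>2 = ennreal (N * N\<^sup>2)" using NN(1) by (simp add: ennreal_power ennreal_mult)
        then have "ennreal N * (ennreal N)\<^sup>2 + ennreal N * (ennreal N)\<^sup>2 = ennreal (N * N\<^sup>2 + N * N\<^sup>2)"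
          using NN(1) by (subst ennreal_plus) simp_all
        moreover have "4 * 32\<^sup>2 * (N * N\<^sup>2) = (2 * 32\<^sup>2) * (N * N\<^sup>2 + N * N\<^sup>2)" by simp
        ultimately show ?thesis using NN(1) by (simp only: ennreal_mult zero_le_numeral mult_nonneg_nonneg add_nonneg_nonneg zero_le_power2)
      qed
      finally show ?thesis .
    qed
    have w1: "sqn (\<lambda>\<xi>. \<bar>\<xi>\<bar> *\<^sub>R FD 2 (cr u) \<xi>) \<le> ennreal N"
    proof (rule order_trans[OF sqn_mono s1])
      fix \<xi> :: real
      have "\<bar>\<xi>\<bar> \<le> sqrt (1 + \<xi>\<^sup>2)" by (rule real_le_rsqrt) simp
      then show "norm (\<bar>\<xi>\<bar> *\<^sub>R FD 2 (cr u) \<xi>) \<le> norm (sqrt (1 + \<xi>\<^sup>2) *\<^sub>R FD 2 (cr u) \<xi>)" by (simp add: mult_right_mono)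
    qed simp
    have w2: "sqn (\<lambda>\<xi>. 1 *\<^sub>R FD k (cr u) \<xi>) \<le> ennreal N" if "k \<in> {0,1,2}" for k
    proof (rule order_trans[OF sqn_mono s1[OF that]])
      fix \<xi> :: real
      have "1 \<le> sqrt (1 + \<xi>\<^sup>2)" by simp
      from mult_right_mono[OF this norm_ge_zero] show "norm (1 *\<^sub>R FD k (cr u) \<xi>) \<le> norm (sqrt (1 + \<xi>\<^sup>2) *\<^sub>R FD k (cr u) \<xi>)" by simp
    qed
    have w3: "sqn (\<lambda>\<xi>. sqrt ((1 + \<xi>\<^sup>2) ^ 5) *\<^sub>R FD 0 (cr u) \<xi>) \<le> ennreal N"
    proof -
      have "sqn (\<lambda>\<xi>. sqrt ((1 + \<xi>\<^sup>2) ^ 5) *\<^sub>R fourier (cr u) \<xi>) \<le> ennreal K" using u by (simp add: wclass_def)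
      also have "ennreal K \<le> ennreal N" by (rule ennreal_leI[OF NN(5)])
      finally show ?thesis unfolding FD_0 .
    qed
    have "sqn (\<lambda>\<xi>. \<bar>\<xi>\<bar> *\<^sub>R FD (2 + 2) (sq u) \<xi>) \<le> ennreal (4 * 32\<^sup>2 * (N * N\<^sup>2))"
    proof (rule gen)
      fix \<xi> \<eta> :: real
      have "\<bar>\<xi>\<bar> \<le> \<bar>\<xi> - \<eta>\<bar> + \<bar>\<eta>\<bar>" using abs_triangle_ineq[of "\<xi> - \<eta>" \<eta>] by simp
      moreover have "0 \<le> \<bar>\<xi> - \<eta>\<bar>" "0 \<le> \<bar>\<eta>\<bar>" by auto
      ultimately show "\<bar>\<xi>\<bar> \<le> 32 * (\<bar>\<xi> - \<eta>\<bar> + \<bar>\<eta>\<bar>)" by argo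
    qed (use w1 in auto)
    then show "sqn (\<lambda>\<xi>. \<bar>\<xi>\<bar> *\<^sub>R FD 4 (sq u) \<xi>) \<le> ennreal (4 * 32\<^sup>2 * (N * N\<^sup>2))" by simp
    have "sqn (\<lambda>\<xi>. 1 *\<^sub>R FD (1 + 2) (sq u) \<xi>) \<le> ennreal (4 * 32\<^sup>2 * (N * N\<^sup>2))"
      by (rule gen) (use w2[of 1] w2[of 2] in auto)
    then show "sqn (FD 3 (sq u)) \<le> ennreal (4 * 32\<^sup>2 * (N * N\<^sup>2))" by (simp add: numeral_3_eq_3)
    have "sqn (\<lambda>\<xi>. sqrt ((1 + \<xi>\<^sup>2) ^ 5) *\<^sub>R FD (0 + 0) (sq u) \<xi>) \<le> ennreal (4 * 32\<^sup>2 * (N * N\<^sup>2))"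
    proof (rule gen)
      fix \<xi> \<eta> :: real
      show "sqrt ((1 + \<xi>\<^sup>2) ^ 5) \<le> 32 * (sqrt ((1 + (\<xi> - \<eta>)\<^sup>2) ^ 5) + sqrt ((1 + \<eta>\<^sup>2) ^ 5))"
        using sqrt_weight_quasi_additive[of "\<xi> - \<eta>" \<eta>] by simp
    qed (use w3 in auto)
    then show "sqn (\<lambda>\<xi>. sqrt ((1 + \<xi>\<^sup>2) ^ 5) *\<^sub>R FD 0 (sq u) \<xi>) \<le> ennreal (4 * 32\<^sup>2 * (N * N\<^sup>2))" by simp
  qed
qed

text \<open>\<open>QD k u\<close> is the \<open>k\<close>-th derivative of \<open>\<xi> \<mapsto> \<xi> fourier (u\<^sup>2) \<xi>\<close>.\<close>

definition QD :: "nat \<Rightarrow> (real \<Rightarrow> real) \<Rightarrow> real \<Rightarrow> complex" where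
  "QD k u \<xi> = complex_of_real \<xi> * FD k (sq u) \<xi> + of_nat k * FD (k - 1) (sq u) \<xi>"

lemma QD_has_vector_derivative:
  assumes u: "wclass K u" and k: "k \<le> 4"
  shows "(QD k u has_vector_derivative QD (Suc k) u \<xi>) (at \<xi>)"
proof -
  have d: "(FD j (sq u) has_vector_derivative FD (Suc j) (sq u) \<xi>) (at \<xi>)" if "j \<le> 4" for j
    using that by (intro FD_has_vector_derivative wclass_sq_moments[OF u]) auto
  have x: "(complex_of_real has_vector_derivative 1) (at \<xi>)"
    using has_vector_derivative_of_real[OF DERIV_ident] by simp
  have "((\<lambda>\<xi>. complex_of_real \<xi> * FD k (sq u) \<xi>) has_vector_derivative complex_of_real \<xi> * FD (Suc k) (sq u) \<xi> + 1 * FD k (sq u) \<xi>) (at \<xi>)"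
    by (rule has_vector_derivative_mult[OF x d[OF k]])
  \<comment> \<open>For k = 0 the truncated index k - 1 is harmless, because its coefficient is
    0.\<close>
  moreover have "((\<lambda>\<xi>. of_nat k * FD (k - 1) (sq u) \<xi>) has_vector_derivative of_nat k * FD k (sq u) \<xi>) (at \<xi>)"
    using d[of "k - 1"] k by (cases k) (auto intro!: has_vector_derivative_mult_right)
  ultimately have "(QD k u has_vector_derivative (complex_of_real \<xi> * FD (Suc k) (sq u) \<xi> + 1 * FD k (sq u) \<xi>) + of_nat k * FD k (sq u) \<xi>) (at \<xi>)"
    unfolding QD_def[abs_def] by (rule has_vector_derivative_add)
  then show ?thesis by (simp add: QD_def algebra_simps)
qed

text \<open>Only the ends k = 0 and k = 4 are estimated directly; the cases between follow by
  interpolating the sequence \<open>QD\<close> itself.\<close>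

lemma wclass_QD:
  assumes K: "K \<ge> 0" and k: "k \<le> 4"
  shows "\<exists>M\<ge>0. \<forall>u. wclass K u \<longrightarrow> sqn (\<lambda>\<xi>. sqrt ((1 + \<xi>\<^sup>2) ^ (4 - k)) *\<^sub>R QD k u \<xi>) \<le> ennreal M"
proof -
  obtain M where M: "M \<ge> 0" "\<And>u. wclass K u \<Longrightarrow> sqn (\<lambda>\<xi>. \<bar>\<xi>\<bar> *\<^sub>R FD 4 (sq u) \<xi>) \<le> ennreal M" "\<And>u. wclass K u \<Longrightarrow> sqn (FD 3 (sq u)) \<le> ennreal M"
    "\<And>u. wclass K u \<Longrightarrow> sqn (\<lambda>\<xi>. sqrt ((1 + \<xi>\<^sup>2) ^ 5) *\<^sub>R FD 0 (sq u) \<xi>) \<le> ennreal M"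
    using wclass_sq_bounds[OF K] by blast
  obtain D where D0: "D \<ge> 0" and D: "\<And>(f :: nat \<Rightarrow> real \<Rightarrow> complex) A m.
    (\<forall>k x. k < 4 \<longrightarrow> (f k has_vector_derivative f (Suc k) x) (at x)) \<Longrightarrow>
    (\<forall>k. k \<le> 4 \<longrightarrow> continuous_on UNIV (f k)) \<Longrightarrow>
    (\<forall>k x. k \<le> 4 \<longrightarrow> norm (f k x) \<le> A * (1 + x\<^sup>2) ^ m) \<Longrightarrow>
    sqn (\<lambda>x. sqrt ((1 + x\<^sup>2) ^ (4 - k)) *\<^sub>R f k x) \<le> ennreal D * (sqn (\<lambda>x. sqrt ((1 + x\<^sup>2) ^ 4) *\<^sub>R f 0 x) + sqn (f 4))"
    using weighted_interpolation[OF k] by blast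
  show ?thesis
  \<comment> \<open>35 = 1 + 34: the end k = 0 costs M, and the end k = 4, where QD is \<xi> FD_4 +
    4 FD_3, costs 2 M + 2 * 4^2 M.\<close>
  proof (intro exI[of _ "D * (35 * M)"] conjI allI impI)
    show "D * (35 * M) \<ge> 0" using D0 M by simp
    fix u assume u: "wclass K u"
    have [measurable]: "u \<in> borel_measurable borel" using u by (rule wclass_measurable)
    define B where "B = (\<Sum>j\<le>4. (LINT x|lborel. \<bar>x\<bar> ^ j * norm (sq u x)) / sqrt (2 * pi))"
    have B: "norm (FD j (sq u) \<xi>) \<le> B" if "j \<le> 4" for j \<xi>
      unfolding B_def using that by (intro order_trans[OF norm_FD_le] member_le_sum) auto
    have B0: "B \<ge> 0" using order_trans[OF norm_ge_zero B[of 0 0]] by simp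
    have bd: "norm (QD j u \<xi>) \<le> (5 * B) * (1 + \<xi>\<^sup>2) ^ 1" if j: "j \<le> 4" for j \<xi>
    proof -
      have "2 * \<bar>\<xi>\<bar> \<le> 1 + \<xi>\<^sup>2" using sum_squares_bound[of 1 "\<bar>\<xi>\<bar>"] by simp
      then have x: "\<bar>\<xi>\<bar> \<le> 1 + \<xi>\<^sup>2" using abs_ge_zero[of \<xi>] by linarith
      have "norm (QD j u \<xi>) \<le> norm (complex_of_real \<xi> * FD j (sq u) \<xi>) + norm (of_nat j * FD (j - 1) (sq u) \<xi>)"
        unfolding QD_def by (rule norm_triangle_ineq)
      also have "\<dots> = \<bar>\<xi>\<bar> * norm (FD j (sq u) \<xi>) + real j * norm (FD (j - 1) (sq u) \<xi>)" by (simp add: norm_mult)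
      also have "\<dots> \<le> (1 + \<xi>\<^sup>2) * B + 4 * B"
        using x j B0 by (intro add_mono mult_mono B) auto
      also have "\<dots> \<le> (5 * B) * (1 + \<xi>\<^sup>2)" using B0 mult_nonneg_nonneg[OF B0 zero_le_power2[of \<xi>]] by (simp add: algebra_simps)
      finally show ?thesis by simp
    qed
    have "sqn (\<lambda>\<xi>. sqrt ((1 + \<xi>\<^sup>2) ^ (4 - k)) *\<^sub>R QD k u \<xi>) \<le> ennreal D * (sqn (\<lambda>x. sqrt ((1 + x\<^sup>2) ^ 4) *\<^sub>R QD 0 u x) + sqn (QD 4 u))"
    proof (rule D[where f="\<lambda>k. QD k u" and A="5 * B" and m=1])
      show "\<forall>k x. k < 4 \<longrightarrow> (QD k u has_vector_derivative QD (Suc k) u x) (at x)"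
        using QD_has_vector_derivative[OF u] by auto
      show "\<forall>k\<le>4. continuous_on UNIV (QD k u)"
      proof (intro allI impI)
        fix k :: nat assume "k \<le> 4"
        have c: "continuous_on UNIV (FD j (sq u))" if "j \<le> 6" for j
          by (rule continuous_on_FD[OF wclass_sq_moments[OF u that] continuous_on_id])
        show "continuous_on UNIV (QD k u)"
          unfolding QD_def[abs_def] using \<open>k \<le> 4\<close> by (intro continuous_intros c) auto
      qed
    qed (use bd in auto)
    also have "\<dots> \<le> ennreal D * (ennreal M + ennreal (34 * M))"
    proof (intro mult_left_mono add_mono)
      have "sqn (\<lambda>x. sqrt ((1 + x\<^sup>2) ^ 4) *\<^sub>R QD 0 u x) \<le> sqn (\<lambda>\<xi>. sqrt ((1 + \<xi>\<^sup>2) ^ 5) *\<^sub>R FD 0 (sq u) \<xi>)"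
      proof (rule sqn_mono)
        fix \<xi> :: real
        have "\<bar>\<xi>\<bar> \<le> sqrt (1 + \<xi>\<^sup>2)" by (rule real_le_rsqrt) simp
        then have "sqrt ((1 + \<xi>\<^sup>2) ^ 4) * \<bar>\<xi>\<bar> \<le> sqrt ((1 + \<xi>\<^sup>2) ^ 4) * sqrt (1 + \<xi>\<^sup>2)" by (rule mult_left_mono) simp
        also have "\<dots> = sqrt ((1 + \<xi>\<^sup>2) ^ 5)" unfolding real_sqrt_mult[symmetric] using power_add[of "1 + \<xi>\<^sup>2" 4 1] by simp
        finally have "sqrt ((1 + \<xi>\<^sup>2) ^ 4) * \<bar>\<xi>\<bar> \<le> sqrt ((1 + \<xi>\<^sup>2) ^ 5)" .
        from mult_right_mono[OF this norm_ge_zero[of "FD 0 (sq u) \<xi>"]]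
        show "norm (sqrt ((1 + \<xi>\<^sup>2) ^ 4) *\<^sub>R QD 0 u \<xi>) \<le> norm (sqrt ((1 + \<xi>\<^sup>2) ^ 5) *\<^sub>R FD 0 (sq u) \<xi>)"
          by (simp add: QD_def norm_mult mult.assoc)
      qed
      then show "sqn (\<lambda>x. sqrt ((1 + x\<^sup>2) ^ 4) *\<^sub>R QD 0 u x) \<le> ennreal M" using M(4)[OF u] by (rule order_trans)
      have "sqn (QD 4 u) \<le> (\<integral>\<^sup>+\<xi>. ennreal 2 * ennreal ((norm (\<bar>\<xi>\<bar> *\<^sub>R FD 4 (sq u) \<xi>))\<^sup>2) + ennreal 32 * ennreal ((norm (FD 3 (sq u) \<xi>))\<^sup>2) \<partial>lborel)"
        unfolding sqn_def
      proof (intro nn_integral_mono)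
        fix \<xi>
        let ?a = "norm (\<bar>\<xi>\<bar> *\<^sub>R FD 4 (sq u) \<xi>)" and ?b = "norm (FD 3 (sq u) \<xi>)"
        have "norm (QD 4 u \<xi>) \<le> norm (complex_of_real \<xi> * FD 4 (sq u) \<xi>) + norm (of_nat 4 * FD (4 - 1) (sq u) \<xi>)"
          unfolding QD_def by (rule norm_triangle_ineq)
        also have "\<dots> = ?a + 4 * ?b" by (simp add: norm_mult)
        finally have "(norm (QD 4 u \<xi>))\<^sup>2 \<le> (?a + 4 * ?b)\<^sup>2" by (intro power_mono) auto
        also have "\<dots> \<le> 2 * ?a\<^sup>2 + 32 * ?b\<^sup>2"
          using sum_squares_bound[of ?a "4 * ?b"] by (simp add: power2_sum power_mult_distrib)
        finally have "ennreal ((norm (QD 4 u \<xi>))\<^sup>2) \<le> ennreal (2 * ?a\<^sup>2 + 32 * ?b\<^sup>2)" by (rule ennreal_leI)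
        also have "\<dots> = ennreal 2 * ennreal (?a\<^sup>2) + ennreal 32 * ennreal (?b\<^sup>2)"
          by (simp only: ennreal_mult zero_le_numeral add_nonneg_nonneg zero_le_power2 ennreal_plus mult_nonneg_nonneg)
        finally show "ennreal ((norm (QD 4 u \<xi>))\<^sup>2) \<le> \<dots>" .
      qed
      also have "\<dots> = ennreal 2 * sqn (\<lambda>\<xi>. \<bar>\<xi>\<bar> *\<^sub>R FD 4 (sq u) \<xi>) + ennreal 32 * sqn (FD 3 (sq u))"
        unfolding sqn_def by (subst nn_integral_add) (auto simp: nn_integral_cmult)
      also have "\<dots> \<le> ennreal 2 * ennreal M + ennreal 32 * ennreal M"
        by (intro add_mono mult_left_mono M(2,3) u) auto
      also have "\<dots> = ennreal (34 * M)"
      proof -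
        have "ennreal (34 * M) = ennreal (2 * M + 32 * M)" by simp
        also have "\<dots> = ennreal 2 * ennreal M + ennreal 32 * ennreal M"
          using M(1) by (subst ennreal_plus) (auto simp: ennreal_mult)
        finally show ?thesis by (rule sym)
      qed
      finally show "sqn (QD 4 u) \<le> ennreal (34 * M)" .
    qed auto
    also have "\<dots> = ennreal (D * (35 * M))"
      using M(1) D0 by (simp add: ennreal_mult[symmetric] ennreal_plus[symmetric] del: ennreal_plus)
    finally show "sqn (\<lambda>\<xi>. sqrt ((1 + \<xi>\<^sup>2) ^ (4 - k)) *\<^sub>R QD k u \<xi>) \<le> ennreal (D * (35 * M))" .
  qed
qed

subsection \<open>Translations and differences\<close>

lemma set_integrable_of_sqn:
  fixes B :: "real \<Rightarrow> complex"
  assumes [measurable]: "B \<in> borel_measurable borel" and "sqn B < \<infinity>"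
  shows "set_integrable lborel {a..b} B"
  unfolding set_integrable_def
proof (rule Bochner_Integration.integrable_bound)
  have "integrable lborel (\<lambda>x. (norm (B x))\<^sup>2)"
    using assms unfolding sqn_def by (intro integrableI_bounded) auto
  then show "integrable lborel (\<lambda>x. (norm (B x))\<^sup>2 + indicator {a..b} x)"
    by (intro Bochner_Integration.integrable_add integrable_real_indicator) (auto simp: emeasure_lborel_Icc_eq)
  show "AE x in lborel. norm (indicator {a..b} x *\<^sub>R B x) \<le> norm ((norm (B x))\<^sup>2 + indicator {a..b} x)"
  proof (rule AE_I2)
    fix x
    have "2 * norm (B x) \<le> (norm (B x))\<^sup>2 + 1" using sum_squares_bound[of "norm (B x)" 1] by simp
    then have "norm (B x) \<le> (norm (B x))\<^sup>2 + 1" using norm_ge_zero[of "B x"] by linarith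
    then show "norm (indicator {a..b} x *\<^sub>R B x) \<le> norm ((norm (B x))\<^sup>2 + indicator {a..b} x)"
      by (auto split: split_indicator)
  qed
qed measurable

text \<open>Cauchy-Schwarz for the integral of B' over [x, x + h], then Tonelli. The exceptional set
  S allows for the kinks of functions glued together at 0.\<close>

lemma sqn_translation_difference:
  fixes B B' :: "real \<Rightarrow> complex"
  assumes c: "continuous_on UNIV B" and S: "finite S" and d: "\<And>x. x \<notin> S \<Longrightarrow> (B has_vector_derivative B' x) (at x)"
    and [measurable]: "B' \<in> borel_measurable borel" and h: "h > 0"
  shows "sqn (\<lambda>x. B (x + h) - B x) \<le> ennreal (h\<^sup>2) * sqn B'"
proof (cases "sqn B' < \<infinity>")
  case fin: True
  have pt: "ennreal ((norm (B (x + h) - B x))\<^sup>2) \<le> ennreal h * (\<integral>\<^sup>+a. ennreal ((norm (B' (x + a)))\<^sup>2) * indicator {0..h} a \<partial>lborel)" for x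
  proof -
    have si: "set_integrable lborel {x..x+h} B'" by (rule set_integrable_of_sqn[OF _ fin]) simp
    have "(B' has_integral (B (x + h) - B x)) {x..x+h}"
      using h c by (intro fundamental_theorem_of_calculus_interior_strong[OF S]) (auto intro: d continuous_on_subset)
    then have "B (x + h) - B x = (LINT y:{x..x+h}|lborel. B' y)"
      using set_borel_integral_eq_integral(2)[OF si] by (simp add: integral_unique)
    then have "ennreal (norm (B (x + h) - B x)) \<le> (\<integral>\<^sup>+y. ennreal (norm (indicator {x..x+h} y *\<^sub>R B' y)) \<partial>lborel)"
      using integral_norm_bound_ennreal[OF si[unfolded set_integrable_def]] by (simp add: set_lebesgue_integral_def)
    also have "\<dots> = (\<integral>\<^sup>+a. ennreal (norm (indicator {x..x+h} (x + 1 * a) *\<^sub>R B' (x + 1 * a))) \<partial>lborel)"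
      by (subst nn_integral_real_affine[of _ 1 x]) auto
    also have "\<dots> = (\<integral>\<^sup>+a. (ennreal (norm (B' (x + a))) * indicator {0..h} a) * indicator {0..h} a \<partial>lborel)"
      by (intro nn_integral_cong) (auto split: split_indicator)
    finally have "(ennreal (norm (B (x + h) - B x)))\<^sup>2 \<le> \<dots>\<^sup>2" by (rule power_mono) simp
    also have "\<dots> \<le> (\<integral>\<^sup>+a. (ennreal (norm (B' (x + a))) * indicator {0..h} a)\<^sup>2 \<partial>lborel) * (\<integral>\<^sup>+a. (indicator {0..h} a)\<^sup>2 \<partial>lborel)"
      by (rule Cauchy_Schwarz_nn_integral) auto
    also have "(\<integral>\<^sup>+a. (indicator {0..h} a)\<^sup>2 \<partial>lborel) = (\<integral>\<^sup>+a. indicator {0..h} (a::real) \<partial>lborel)"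
      by (intro nn_integral_cong) (auto split: split_indicator)
    also have "\<dots> = ennreal h" using h by simp
    also have "(\<integral>\<^sup>+a. (ennreal (norm (B' (x + a))) * indicator {0..h} a)\<^sup>2 \<partial>lborel) = (\<integral>\<^sup>+a. ennreal ((norm (B' (x + a)))\<^sup>2) * indicator {0..h} a \<partial>lborel)"
      by (intro nn_integral_cong) (auto simp: ennreal_power split: split_indicator)
    finally show ?thesis by (simp add: ennreal_power mult.commute)
  qed
  have "sqn (\<lambda>x. B (x + h) - B x) \<le> (\<integral>\<^sup>+x. ennreal h * (\<integral>\<^sup>+a. ennreal ((norm (B' (x + a)))\<^sup>2) * indicator {0..h} a \<partial>lborel) \<partial>lborel)"
    unfolding sqn_def by (intro nn_integral_mono pt)
  also have "\<dots> = ennreal h * (\<integral>\<^sup>+x. (\<integral>\<^sup>+a. ennreal ((norm (B' (x + a)))\<^sup>2) * indicator {0..h} a \<partial>lborel) \<partial>lborel)"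
    by (rule nn_integral_cmult) simp
  also have "(\<integral>\<^sup>+x. (\<integral>\<^sup>+a. ennreal ((norm (B' (x + a)))\<^sup>2) * indicator {0..h} a \<partial>lborel) \<partial>lborel) = (\<integral>\<^sup>+a. (\<integral>\<^sup>+x. ennreal ((norm (B' (x + a)))\<^sup>2) * indicator {0..h} a \<partial>lborel) \<partial>lborel)"
    by (rule lborel_pair.Fubini') simp
  also have "\<dots> = (\<integral>\<^sup>+a. sqn B' * indicator {0..h} a \<partial>lborel)"
  proof (intro nn_integral_cong)
    fix a
    have "(\<integral>\<^sup>+x. ennreal ((norm (B' (x + a)))\<^sup>2) * indicator {0..h} a \<partial>lborel) = sqn (\<lambda>x. B' (x + a)) * indicator {0..h} a"
      unfolding sqn_def by (rule nn_integral_multc) simp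
    then show "(\<integral>\<^sup>+x. ennreal ((norm (B' (x + a)))\<^sup>2) * indicator {0..h} a \<partial>lborel) = sqn B' * indicator {0..h} a"
      by (simp add: sqn_shift)
  qed
  also have "\<dots> = sqn B' * ennreal h" using h by (subst nn_integral_cmult) auto
  finally show ?thesis using h by (simp add: power2_eq_square ennreal_mult mult_ac)
next
  case False
  then have "sqn B' = \<infinity>" by (auto simp: less_top[symmetric])
  then show ?thesis using h by (simp add: ennreal_mult_top)
qed

lemma sqn_cong_AE: "AE x in lborel. f x = g x \<Longrightarrow> sqn f = sqn g"
  unfolding sqn_def by (rule nn_integral_cong_AE) auto

lemma derivative_unique_Ioi:
  fixes f g :: "real \<Rightarrow> complex"
  assumes "\<And>x. x > 0 \<Longrightarrow> f x = g x" "x > 0" "(f has_vector_derivative f') (at x)" "(g has_vector_derivative g') (at x)"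
  shows "f' = g'"
proof -
  have "(f has_vector_derivative g') (at x)"
    using assms by (intro has_vector_derivative_transform_within_open[OF assms(4), where S="{0<..}"]) auto
  then show ?thesis using assms(3) vector_derivative_unique_at by blast
qed

text \<open>\<open>E\<close> agrees with the transform of \<open>v\<close> on the right half line only; on the left half line the
  transform is its complex conjugate reflection. The two halves of the third derivative fit together
  at 0 exactly when \<open>Re (E 3 0) = 0\<close>.\<close>

lemma fourth_moment_of_half_line_regularity:
  fixes v :: "real \<Rightarrow> real" and E :: "nat \<Rightarrow> real \<Rightarrow> complex" and A :: "nat \<Rightarrow> nat \<Rightarrow> real \<Rightarrow> complex"
  assumes v: "wclass K v" "K \<ge> 0"
    and E: "\<And>j \<xi>. j < 3 \<Longrightarrow> (E j has_vector_derivative E (Suc j) \<xi>) (at \<xi>)"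
    and Ev: "\<And>\<xi>. \<xi> > 0 \<Longrightarrow> fourier (cr v) \<xi> = E 0 \<xi>"
    and E0: "Re (E 3 0) = 0"
    and A: "\<And>i \<xi>. (A i 3 has_vector_derivative A i 4 \<xi>) (at \<xi>)" "\<And>i. A i 4 \<in> borel_measurable borel"
    and AK: "\<And>i. sqn (A i 4) \<le> ennreal L"
    and lim: "\<And>\<xi>. (\<lambda>i. A i 3 \<xi>) \<longlonglongrightarrow> E 3 \<xi>"
  shows "sqn (\<lambda>x. complex_of_real (x ^ 4) * cr v x) \<le> 2 * ennreal L"
proof -
  have [measurable]: "v \<in> borel_measurable borel" using v by (rule_tac wclass_measurable)
  have mom: "integrable lborel (\<lambda>x. complex_of_real (x ^ j) * cr v x)" if "j \<le> 2" for j
    by (rule wclass_moments(1)[OF v(1) that v(2)])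
  define G where "G = FD 2 (cr v)"
  have cG: "continuous_on UNIV G" unfolding G_def by (rule continuous_on_FD[OF mom continuous_on_id]) simp
  have D0: "(fourier (cr v) has_vector_derivative FD 1 (cr v) \<xi>) (at \<xi>)" for \<xi>
    using FD_has_vector_derivative[of 0 "cr v"] mom[of 0] mom[of 1] by (simp add: FD_0)
  have D1: "(FD 1 (cr v) has_vector_derivative G \<xi>) (at \<xi>)" for \<xi>
    using FD_has_vector_derivative[of 1 "cr v"] mom[of 1] mom[of 2] by (simp add: G_def numeral_2_eq_2)
  have E1: "FD 1 (cr v) \<xi> = E 1 \<xi>" if "\<xi> > 0" for \<xi>
    using derivative_unique_Ioi[OF Ev that D0] E[of 0 \<xi>] by simp
  have E2: "G \<xi> = E 2 \<xi>" if "\<xi> > 0" for \<xi>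
    using derivative_unique_Ioi[OF E1 that D1] E[of 1 \<xi>] by (simp add: numeral_2_eq_2)
  \<comment> \<open>The second derivative of the transform is again the transform of a real
    function, namely of -x^2 v.\<close>
  have Gr: "G (- \<xi>) = cnj (G \<xi>)" for \<xi>
  proof -
    have "(\<lambda>x. (- \<i> * complex_of_real x) ^ 2 * cr v x) = (\<lambda>x. complex_of_real (- (x\<^sup>2) * v x))"
      by (simp add: power_mult_distrib)
    then show ?thesis unfolding G_def FD_def using fourier_of_real_minus[of "\<lambda>x. - (x\<^sup>2) * v x" \<xi>] by simp
  qed
  have E3': "(E 2 has_vector_derivative E 3 \<xi>) (at \<xi>)" for \<xi> using E[of 2 \<xi>] by (simp add: eval_nat_numeral)
  have G3: "(G has_vector_derivative E 3 \<xi>) (at \<xi>)" if "\<xi> > 0" for \<xi>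
    using E2 that by (intro has_vector_derivative_transform_within_open[OF E3', where S="{0<..}"]) auto
  \<comment> \<open>The chain rule of the reflection produces the minus sign, so the two one-sided
    values at 0 differ by twice the real part of \<open>E 3 0\<close>.\<close>
  define B where "B \<xi> = (if \<xi> \<ge> 0 then E 3 \<xi> else - cnj (E 3 (- \<xi>)))" for \<xi>
  have reflect: "((\<lambda>x. cnj (f (- x))) has_vector_derivative - cnj f') (at \<xi>)" if "(f has_vector_derivative f') (at (- \<xi>))" for f f' and \<xi> :: real
  proof -
    have "(uminus has_vector_derivative -1) (at \<xi>)" by (auto intro!: derivative_eq_intros)
    from vector_diff_chain_at[OF this that] have "((\<lambda>x. f (- x)) has_vector_derivative - f') (at \<xi>)" by (simp add: o_def)
    from bounded_linear.has_vector_derivative[OF bounded_linear_cnj this] show ?thesis by simp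
  qed
  have GB: "(G has_vector_derivative B \<xi>) (at \<xi>)" if "\<xi> \<noteq> 0" for \<xi>
  proof (cases "\<xi> > 0")
    case True then show ?thesis using G3 by (simp add: B_def)
  next
    case False
    then have neg: "\<xi> < 0" using that by simp
    have "((\<lambda>x. cnj (G (- x))) has_vector_derivative - cnj (E 3 (- \<xi>))) (at \<xi>)"
      using neg by (intro reflect G3) simp
    then show ?thesis using neg Gr by (simp add: B_def)
  qed
  \<comment> \<open>The approximants need not satisfy the compatibility condition at 0. Opposite
    real shifts on the two half lines make them continuous there, and by \<open>E0\<close> the
    shifts vanish in the limit.\<close>
  define Bi where "Bi i \<xi> = (if \<xi> \<ge> 0 then A i 3 \<xi> - complex_of_real (Re (A i 3 0)) else - cnj (A i 3 (- \<xi>)) + complex_of_real (Re (A i 3 0)))" for i \<xi>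
  define Bi' where "Bi' i \<xi> = (if \<xi> \<ge> 0 then A i 4 \<xi> else cnj (A i 4 (- \<xi>)))" for i \<xi>
  have cA: "continuous_on UNIV (A i 3)" for i
    using A(1)[of i] by (auto intro!: has_vector_derivative_continuous simp: continuous_on_eq_continuous_at)
  have cBi: "continuous_on UNIV (Bi i)" for i
  proof -
    have U: "(UNIV :: real set) = {0..} \<union> {..0}" by auto
    have "continuous_on ({0..} \<union> {..0}) (\<lambda>\<xi>. if \<xi> \<in> {0..} then A i 3 \<xi> - complex_of_real (Re (A i 3 0)) else - cnj (A i 3 (- \<xi>)) + complex_of_real (Re (A i 3 0)))"
      by (rule continuous_on_cases)
        (auto intro!: continuous_intros continuous_on_compose2[OF cA] simp: complex_eq_iff)
    then show ?thesis unfolding U[symmetric] by (simp add: Bi_def[abs_def])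
  qed
  have dBi: "(Bi i has_vector_derivative Bi' i \<xi>) (at \<xi>)" if "\<xi> \<notin> {0}" for i \<xi>
  proof (cases "\<xi> > 0")
    case True
    have "((\<lambda>\<xi>. A i 3 \<xi> - complex_of_real (Re (A i 3 0))) has_vector_derivative A i 4 \<xi> - 0) (at \<xi>)"
      by (intro has_vector_derivative_diff A has_vector_derivative_const)
    then have d: "((\<lambda>\<xi>. A i 3 \<xi> - complex_of_real (Re (A i 3 0))) has_vector_derivative A i 4 \<xi>) (at \<xi>)" by simp
    have "(Bi i has_vector_derivative A i 4 \<xi>) (at \<xi>)"
      by (rule has_vector_derivative_transform_within_open[OF d, where S="{0<..}"]) (use True in \<open>auto simp: Bi_def\<close>)
    then show ?thesis using True by (simp add: Bi'_def)
  next
    case False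
    then have neg: "\<xi> < 0" using that by simp
    have "((\<lambda>\<xi>. - cnj (A i 3 (- \<xi>)) + complex_of_real (Re (A i 3 0))) has_vector_derivative - (- cnj (A i 4 (- \<xi>))) + 0) (at \<xi>)"
      by (intro has_vector_derivative_add has_vector_derivative_minus reflect A has_vector_derivative_const)
    then have d: "((\<lambda>\<xi>. - cnj (A i 3 (- \<xi>)) + complex_of_real (Re (A i 3 0))) has_vector_derivative cnj (A i 4 (- \<xi>))) (at \<xi>)" by simp
    have "(Bi i has_vector_derivative cnj (A i 4 (- \<xi>))) (at \<xi>)"
      by (rule has_vector_derivative_transform_within_open[OF d, where S="{..<0}"]) (use neg in \<open>auto simp: Bi_def\<close>)
    then show ?thesis using neg by (simp add: Bi'_def)
  qed
  have [measurable]: "A i 4 \<in> borel_measurable borel" for i by (rule A(2))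
  have [measurable]: "Bi' i \<in> borel_measurable borel" for i unfolding Bi'_def by measurable
  have [measurable]: "Bi i \<in> borel_measurable borel" for i by (rule borel_measurable_continuous_onI[OF cBi])
  have sBi': "sqn (Bi' i) \<le> 2 * ennreal L" for i
  proof -
    have "sqn (Bi' i) \<le> (\<integral>\<^sup>+x. ennreal ((norm (A i 4 x))\<^sup>2) + ennreal ((norm (A i 4 (- x)))\<^sup>2) \<partial>lborel)"
      unfolding sqn_def Bi'_def by (intro nn_integral_mono) auto
    also have "\<dots> = sqn (A i 4) + (\<integral>\<^sup>+x. ennreal ((norm (A i 4 (0 + (-1) * x)))\<^sup>2) \<partial>lborel)"
      unfolding sqn_def by (subst nn_integral_add) auto
    also have "(\<integral>\<^sup>+x. ennreal ((norm (A i 4 (0 + (-1) * x)))\<^sup>2) \<partial>lborel) = sqn (A i 4)"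
      unfolding sqn_def by (subst (2) nn_integral_real_affine[of _ "-1" 0]) auto
    also have "sqn (A i 4) + sqn (A i 4) \<le> ennreal L + ennreal L" by (intro add_mono AK)
    finally show ?thesis by (simp add: mult_2)
  qed
  have Bilim: "(\<lambda>i. Bi i \<xi>) \<longlonglongrightarrow> B \<xi>" for \<xi>
  proof -
    have r: "(\<lambda>i. complex_of_real (Re (A i 3 0))) \<longlonglongrightarrow> complex_of_real (Re (E 3 0))" by (intro tendsto_of_real tendsto_Re lim)
    show ?thesis
    proof (cases "\<xi> \<ge> 0")
      case True then show ?thesis using tendsto_diff[OF lim[of \<xi>] r] E0 by (simp add: Bi_def B_def)
    next
      case False
      then show ?thesis using tendsto_add[OF tendsto_minus[OF tendsto_cnj[OF lim[of "- \<xi>"]]] r] E0 by (simp add: Bi_def B_def)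
    qed
  qed
  have [measurable]: "B \<in> borel_measurable borel"
    by (rule borel_measurable_LIMSEQ_metric[of Bi]) (auto intro: Bilim)
  \<comment> \<open>The fourth derivatives of the approximants are only bounded in L2. First
    differences of the third derivatives do converge pointwise, so the bound is transferred to B
    through them.\<close>
  have sB: "sqn (\<lambda>x. B (x + h) - B x) \<le> ennreal (h\<^sup>2) * (2 * ennreal L)" if h: "h > 0" for h
  proof (rule sqn_le_liminf[where f="\<lambda>i x. Bi i (x + h) - Bi i x"])
    show "sqn (\<lambda>x. Bi i (x + h) - Bi i x) \<le> ennreal (h\<^sup>2) * (2 * ennreal L)" for i
      by (rule order_trans[OF sqn_translation_difference[OF cBi finite.insertI[OF finite.emptyI] dBi _ h] mult_left_mono[OF sBi']]) auto
  qed (auto intro!: tendsto_diff Bilim)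
  \<comment> \<open>G is continuous and has derivative B off 0, so its first difference has the
    first difference of B as derivative off 0 and -h.\<close>
  have sG: "sqn (\<lambda>x. (G (x + h + h) - G (x + h)) - (G (x + h) - G x)) \<le> ennreal (h\<^sup>2) * (ennreal (h\<^sup>2) * (2 * ennreal L))" if h: "h > 0" for h
  proof -
    have "((\<lambda>x. G (x + h) - G x) has_vector_derivative B (x + h) - B x) (at x)" if "x \<notin> {0, - h}" for x
    proof -
      have "((\<lambda>x. x + h) has_vector_derivative 1) (at x)" by (auto intro!: derivative_eq_intros)
      from vector_diff_chain_at[OF this GB[of "x + h"]] that have "((\<lambda>x. G (x + h)) has_vector_derivative B (x + h)) (at x)" by (simp add: o_def add_eq_0_iff)
      then show ?thesis using GB[of x] that by (intro has_vector_derivative_diff) auto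
    qed
    then have "sqn (\<lambda>x. (\<lambda>x. G (x + h) - G x) (x + h) - (\<lambda>x. G (x + h) - G x) x) \<le> ennreal (h\<^sup>2) * sqn (\<lambda>x. B (x + h) - B x)"
      using h by (intro sqn_translation_difference[of _ "{0, - h}"]) (auto intro!: continuous_intros continuous_on_compose2[OF cG])
    also have "\<dots> \<le> ennreal (h\<^sup>2) * (ennreal (h\<^sup>2) * (2 * ennreal L))" by (intro mult_left_mono sB h) simp
    finally show ?thesis by simp
  qed
  \<comment> \<open>The continuous representative of (-ix)^2 v, as required by
    \<open>Plancherel_ge\<close>.\<close>
  define g where "g x = fourier (FD 2 (cr v)) (- x)" for x
  have iF: "integrable lborel (FD 2 (cr v))" using wclass_FD_L1[OF v(2), of 2] v(1) by auto
  have gAE: "AE x in lborel. (- \<i> * complex_of_real x) ^ 2 * cr v x = g x"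
    unfolding g_def by (rule wclass_moment_inversion[OF v]) simp
  have cg: "continuous_on UNIV g" unfolding g_def by (intro continuous_intros iF)
  have [measurable]: "g \<in> borel_measurable borel" by (rule borel_measurable_continuous_onI[OF cg])
  have ix2: "integrable lborel (\<lambda>x. (- \<i> * complex_of_real x) ^ 2 * cr v x)"
    unfolding integrable_monomial_iff by (rule mom) simp
  have ig: "integrable lborel g"
    using ix2 by (subst integrable_cong_AE[of _ _ "\<lambda>x. (- \<i> * complex_of_real x) ^ 2 * cr v x"]) (use gAE in auto)
  have fg: "fourier g = G" unfolding G_def FD_def by (rule fourier_cong_AE) (use gAE in auto)
  obtain Cg where Cg: "\<And>x. norm (g x) \<le> Cg"
    using norm_fourier_le[of "FD 2 (cr v)"] unfolding g_def by blast
  \<comment> \<open>On the x side the second difference of G is multiplication by the square of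
    cis(-hx) - 1.\<close>
  have sp: "sqn (\<lambda>x. (cis (- (h * x)) - 1)\<^sup>2 * g x) \<le> ennreal (h\<^sup>2) * (ennreal (h\<^sup>2) * (2 * ennreal L))" if h: "h > 0" for h
  proof -
    let ?p = "\<lambda>x. (cis (- (h * x)) - 1)\<^sup>2 * g x"
    have eq: "?p x = cis (- ((h + h) * x)) * g x - (cis (- (h * x)) * g x + cis (- (h * x)) * g x) + g x" for x
    proof -
      have "cis (- ((h + h) * x)) = cis (- (h * x)) * cis (- (h * x))" by (simp add: cis_mult algebra_simps)
      then show ?thesis by (simp add: power2_eq_square algebra_simps)
    qed
    have i: "integrable lborel (\<lambda>x. cis (- (c * x)) * g x)" for c using ig by simp
    have ip: "integrable lborel ?p" unfolding eq using i ig by (intro Bochner_Integration.integrable_add Bochner_Integration.integrable_diff)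
    have fp: "fourier ?p \<xi> = (G (\<xi> + h + h) - G (\<xi> + h)) - (G (\<xi> + h) - G \<xi>)" for \<xi>
    proof -
      have "fourier ?p \<xi> = fourier (\<lambda>x. cis (- ((h + h) * x)) * g x) \<xi> - (fourier (\<lambda>x. cis (- (h * x)) * g x) \<xi> + fourier (\<lambda>x. cis (- (h * x)) * g x) \<xi>) + fourier g \<xi>"
        unfolding eq using i ig
        by (subst fourier_add fourier_diff, (intro Bochner_Integration.integrable_add Bochner_Integration.integrable_diff i ig)+)+ simp
      then show ?thesis unfolding fourier_cis_shift fg by (simp add: algebra_simps)
    qed
    have "sqn ?p \<le> sqn (fourier ?p)"
    proof (rule Plancherel_ge[OF ip])
      show "continuous_on UNIV ?p" by (intro continuous_intros cg)
      fix x
      have "norm (cis (- (h * x)) - 1) \<le> norm (cis (- (h * x))) + norm (1::complex)" by (rule norm_triangle_ineq4)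
      then have "norm (cis (- (h * x)) - 1) ^ 2 \<le> 2 ^ 2" by (intro power_mono) auto
      then show "norm (?p x) \<le> 2\<^sup>2 * Cg" unfolding norm_mult norm_power
        using Cg[of x] by (intro mult_mono) auto
    qed
    also have "\<dots> \<le> ennreal (h\<^sup>2) * (ennreal (h\<^sup>2) * (2 * ennreal L))" using sG[OF h] unfolding fp .
    finally show ?thesis .
  qed
  define h where "h n = 1 / real (Suc n)" for n
  have h: "h n > 0" "h \<longlonglongrightarrow> 0" for n unfolding h_def using LIMSEQ_inverse_real_of_nat by (auto simp: inverse_eq_divide)
  \<comment> \<open>Dividing by h^2 cancels the two factors h^2 of the square norm, and (cis(-hx) -
    1)/h tends to -ix: two more powers of x are recovered.\<close>
  have "sqn (\<lambda>x. (- \<i> * complex_of_real x)\<^sup>2 * g x) \<le> 2 * ennreal L"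
  proof (rule sqn_le_liminf[where f="\<lambda>n x. ((cis (- (h n * x)) - 1) / complex_of_real (h n))\<^sup>2 * g x"])
    show "AE x in lborel. (\<lambda>n. ((cis (- (h n * x)) - 1) / complex_of_real (h n))\<^sup>2 * g x) \<longlonglongrightarrow> (- \<i> * complex_of_real x)\<^sup>2 * g x"
    proof (rule AE_I2)
      fix x
      have "(\<lambda>n. ((- \<i> * complex_of_real x) * smear (h n) x)\<^sup>2 * g x) \<longlonglongrightarrow> ((- \<i> * complex_of_real x) * 1)\<^sup>2 * g x"
        by (intro tendsto_mult tendsto_power tendsto_const smear_tendsto h)
      then show "(\<lambda>n. ((cis (- (h n * x)) - 1) / complex_of_real (h n))\<^sup>2 * g x) \<longlonglongrightarrow> (- \<i> * complex_of_real x)\<^sup>2 * g x"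
        unfolding mult_smear[OF h(1)] by simp
    qed
    fix n
    have "sqn (\<lambda>x. ((cis (- (h n * x)) - 1) / complex_of_real (h n))\<^sup>2 * g x) = ennreal (1 / (h n)\<^sup>2 * (1 / (h n)\<^sup>2)) * sqn (\<lambda>x. (cis (- (h n * x)) - 1)\<^sup>2 * g x)"
      unfolding sqn_def using h(1)[of n]
      by (subst nn_integral_cmult[symmetric]) (auto intro!: nn_integral_cong simp: ennreal_mult[symmetric] norm_mult norm_power norm_divide power_divide power_mult_distrib power2_eq_square)
    also have "\<dots> \<le> ennreal (1 / (h n)\<^sup>2 * (1 / (h n)\<^sup>2)) * (ennreal ((h n)\<^sup>2) * (ennreal ((h n)\<^sup>2) * (2 * ennreal L)))"
      by (rule mult_left_mono[OF sp[OF h(1)]]) simp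
    also have "\<dots> = ennreal ((1 / (h n)\<^sup>2 * (1 / (h n)\<^sup>2)) * ((h n)\<^sup>2 * (h n)\<^sup>2)) * (2 * ennreal L)"
    proof -
      have "ennreal a * (ennreal b * (ennreal b * c)) = ennreal (a * (b * b)) * c" if "a \<ge> 0" "b \<ge> 0" for a b :: real and c
        using that by (simp add: ennreal_mult mult.assoc)
      note gen = this
      show ?thesis by (rule gen) auto
    qed
    also have "(1 / (h n)\<^sup>2 * (1 / (h n)\<^sup>2)) * ((h n)\<^sup>2 * (h n)\<^sup>2) = 1" using h(1)[of n] by simp
    finally show "sqn (\<lambda>x. ((cis (- (h n * x)) - 1) / complex_of_real (h n))\<^sup>2 * g x) \<le> 2 * ennreal L" by simp
  qed measurable
  moreover have "sqn (\<lambda>x. complex_of_real (x ^ 4) * cr v x) = sqn (\<lambda>x. (- \<i> * complex_of_real x)\<^sup>2 * ((- \<i> * complex_of_real x) ^ 2 * cr v x))"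
    unfolding sqn_def by (intro nn_integral_cong) (simp add: norm_mult norm_power power_add[symmetric] flip: mult.assoc)
  moreover have "\<dots> = sqn (\<lambda>x. (- \<i> * complex_of_real x)\<^sup>2 * g x)"
    by (rule sqn_cong_AE) (use gAE in eventually_elim, simp)
  ultimately show ?thesis by simp
qed

subsection \<open>Multiplication by a chirp\<close>

text \<open>\<open>dseq n f\<close>: the functions \<open>f k\<close>, \<open>k \<le> n\<close>, are the successive derivatives of \<open>f 0\<close>. The operator
  \<open>chirp_step a\<close> maps such a sequence to that of \<open>f 1 \<xi> + a \<xi> f 0 \<xi>\<close>; it is conjugate to
  differentiation under multiplication by \<open>exp (a \<xi>\<^sup>2 / 2)\<close>.\<close>

definition dseq :: "nat \<Rightarrow> (nat \<Rightarrow> real \<Rightarrow> complex) \<Rightarrow> bool" where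
  "dseq n f \<longleftrightarrow> (\<forall>k<n. \<forall>\<xi>. (f k has_vector_derivative f (Suc k) \<xi>) (at \<xi>))"

definition chirp_step :: "complex \<Rightarrow> (nat \<Rightarrow> real \<Rightarrow> complex) \<Rightarrow> nat \<Rightarrow> real \<Rightarrow> complex" where
  "chirp_step a f k \<xi> = f (Suc k) \<xi> + a * (complex_of_real \<xi> * f k \<xi> + of_nat k * f (k - 1) \<xi>)"

definition chirp :: "complex \<Rightarrow> (nat \<Rightarrow> real \<Rightarrow> complex) \<Rightarrow> nat \<Rightarrow> real \<Rightarrow> complex" where
  "chirp a f j \<xi> = exp (a * (complex_of_real \<xi>)\<^sup>2 / 2) * (chirp_step a ^^ j) f 0 \<xi>"

lemma of_real_has_vector_derivative: "(complex_of_real has_vector_derivative 1) (at \<xi>)"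
  using has_vector_derivative_of_real[OF DERIV_ident] by simp

text \<open>The k-th derivative of \<xi> f_0 is \<xi> f_k + k f_(k-1). Each step uses up one member
  of the sequence.\<close>

lemma dseq_chirp_step:
  assumes "dseq (Suc n) f"
  shows "dseq n (chirp_step a f)"
  unfolding dseq_def
proof (intro allI impI)
  fix k \<xi> assume k: "k < n"
  have d: "(f j has_vector_derivative f (Suc j) \<xi>) (at \<xi>)" if "j \<le> Suc k" for j
    using assms that k by (auto simp: dseq_def)
  have 1: "((\<lambda>\<xi>. complex_of_real \<xi> * f k \<xi>) has_vector_derivative complex_of_real \<xi> * f (Suc k) \<xi> + 1 * f k \<xi>) (at \<xi>)"
    by (rule has_vector_derivative_mult[OF of_real_has_vector_derivative d]) simp
  have 2: "((\<lambda>\<xi>. of_nat k * f (k - 1) \<xi>) has_vector_derivative of_nat k * f k \<xi>) (at \<xi>)"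
    using d[of "k - 1"] by (cases k) (auto intro!: has_vector_derivative_mult_right)
  have "(chirp_step a f k has_vector_derivative f (Suc (Suc k)) \<xi> + a * ((complex_of_real \<xi> * f (Suc k) \<xi> + 1 * f k \<xi>) + of_nat k * f k \<xi>)) (at \<xi>)"
    unfolding chirp_step_def[abs_def]
    by (intro has_vector_derivative_add has_vector_derivative_mult_right 1 2 d) simp
  then show "(chirp_step a f k has_vector_derivative chirp_step a f (Suc k) \<xi>) (at \<xi>)"
    by (simp add: chirp_step_def algebra_simps)
qed

lemma dseq_chirp_step_pow: "dseq (j + n) f \<Longrightarrow> dseq n ((chirp_step a ^^ j) f)"
  by (induction j arbitrary: n) (auto intro: dseq_chirp_step)

text \<open>Differentiation passes through the exponential and becomes \<open>chirp_step\<close>.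
  After j steps, j < n still leaves one derivative for the product rule.\<close>

lemma chirp_has_vector_derivative:
  assumes "dseq n f" "j < n"
  shows "(chirp a f j has_vector_derivative chirp a f (Suc j) \<xi>) (at \<xi>)"
proof -
  let ?g = "(chirp_step a ^^ j) f"
  have "dseq (j + 1) f" using assms by (auto simp: dseq_def)
  then have "dseq 1 ?g" by (rule dseq_chirp_step_pow)
  then have g: "(?g 0 has_vector_derivative ?g 1 \<xi>) (at \<xi>)" by (simp add: dseq_def)
  have e: "((\<lambda>\<xi>. exp (a * (complex_of_real \<xi>)\<^sup>2 / 2)) has_vector_derivative a * complex_of_real \<xi> * exp (a * (complex_of_real \<xi>)\<^sup>2 / 2)) (at \<xi>)"
  proof -
    have "((\<lambda>z. exp (a * z\<^sup>2 / 2)) has_field_derivative a * complex_of_real \<xi> * exp (a * (complex_of_real \<xi>)\<^sup>2 / 2)) (at (complex_of_real \<xi>))"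
      by (auto intro!: derivative_eq_intros simp: power2_eq_square)
    from field_vector_diff_chain_at[OF of_real_has_vector_derivative this] show ?thesis by (simp add: o_def)
  qed
  from has_vector_derivative_mult[OF e g]
  have "(chirp a f j has_vector_derivative exp (a * (complex_of_real \<xi>)\<^sup>2 / 2) * ?g 1 \<xi> + a * complex_of_real \<xi> * exp (a * (complex_of_real \<xi>)\<^sup>2 / 2) * ?g 0 \<xi>) (at \<xi>)"
    unfolding chirp_def[abs_def] .
  then show ?thesis by (simp add: chirp_def chirp_step_def algebra_simps)
qed

text \<open>In this scale multiplication by \<xi> and differentiation cost one level each, so
  \<open>chirp_step\<close> is bounded from level m + 1 to level m.\<close>

definition wsum :: "nat \<Rightarrow> (nat \<Rightarrow> real \<Rightarrow> complex) \<Rightarrow> real \<Rightarrow> real" where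
  "wsum m f \<xi> = (\<Sum>k\<le>m. sqrt ((1 + \<xi>\<^sup>2) ^ (m - k)) * norm (f k \<xi>))"

text \<open>Each of the m + 1 summands is at most 1 + \<alpha> (1 + m) times the sum at the next
  level: f_(k+1) contributes 1, \<xi> f_k contributes \<alpha>, and k f_(k-1) at most \<alpha>
  m.\<close>

lemma wsum_chirp_step:
  assumes a: "norm a \<le> \<alpha>"
  shows "wsum m (chirp_step a f) \<xi> \<le> (real m + 1) * (1 + \<alpha> * (real m + 1)) * wsum (Suc m) f \<xi>"
proof -
  define w where "w i = sqrt ((1 + \<xi>\<^sup>2) ^ i)" for i
  define s where "s = wsum (Suc m) f \<xi>"
  have al: "\<alpha> \<ge> 0" using a norm_ge_zero[of a] by linarith
  have w0: "w i \<ge> 0" for i by (simp add: w_def)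
  have wm: "w i \<le> w j" if "i \<le> j" for i j using that unfolding w_def by (simp add: power_increasing)
  have tm: "w (Suc m - k) * norm (f k \<xi>) \<le> s" if "k \<le> Suc m" for k
    unfolding s_def wsum_def w_def[symmetric] using that w0
    by (intro member_le_sum[of k "{..Suc m}" "\<lambda>k. w (Suc m - k) * norm (f k \<xi>)"]) auto
  have s0: "s \<ge> 0" unfolding s_def wsum_def by (intro sum_nonneg) auto
  have "w (m - k) * norm (chirp_step a f k \<xi>) \<le> (1 + \<alpha> * (real m + 1)) * s" if k: "k \<le> m" for k
  proof -
    have x: "\<bar>\<xi>\<bar> * w (m - k) \<le> w (Suc m - k)"
    proof -
      have "\<bar>\<xi>\<bar> \<le> sqrt (1 + \<xi>\<^sup>2)" by (rule real_le_rsqrt) simp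
      then have "\<bar>\<xi>\<bar> * w (m - k) \<le> sqrt (1 + \<xi>\<^sup>2) * w (m - k)" by (rule mult_right_mono[OF _ w0])
      also have "\<dots> = w (Suc m - k)" using k by (simp add: w_def real_sqrt_mult[symmetric] Suc_diff_le)
      finally show ?thesis .
    qed
    have t1: "w (m - k) * norm (f (Suc k) \<xi>) \<le> s" using tm[of "Suc k"] k by simp
    have t2: "w (m - k) * (\<bar>\<xi>\<bar> * norm (f k \<xi>)) \<le> s"
      using order_trans[OF mult_right_mono[OF x norm_ge_zero[of "f k \<xi>"]] tm[of k]] k by (simp add: mult_ac)
    have t3: "w (m - k) * (real k * norm (f (k - 1) \<xi>)) \<le> real m * s"
    proof -
      have "w (m - k) * norm (f (k - 1) \<xi>) \<le> w (Suc m - (k - 1)) * norm (f (k - 1) \<xi>)"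
        by (intro mult_right_mono wm) auto
      also have "\<dots> \<le> s" using k by (intro tm) simp
      finally have "real k * (w (m - k) * norm (f (k - 1) \<xi>)) \<le> real m * s"
        using k w0 by (intro mult_mono) auto
      then show ?thesis by (simp add: mult_ac)
    qed
    have "norm (chirp_step a f k \<xi>) \<le> norm (f (Suc k) \<xi>) + norm (a * (complex_of_real \<xi> * f k \<xi> + of_nat k * f (k - 1) \<xi>))"
      unfolding chirp_step_def by (rule norm_triangle_ineq)
    also have "\<dots> \<le> norm (f (Suc k) \<xi>) + \<alpha> * (\<bar>\<xi>\<bar> * norm (f k \<xi>) + real k * norm (f (k - 1) \<xi>))"
    proof -
      have "norm (complex_of_real \<xi> * f k \<xi> + of_nat k * f (k - 1) \<xi>) \<le> \<bar>\<xi>\<bar> * norm (f k \<xi>) + real k * norm (f (k - 1) \<xi>)"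
        using norm_triangle_ineq[of "complex_of_real \<xi> * f k \<xi>" "of_nat k * f (k - 1) \<xi>"] by (simp add: norm_mult)
      then have "norm a * norm (complex_of_real \<xi> * f k \<xi> + of_nat k * f (k - 1) \<xi>) \<le> \<alpha> * (\<bar>\<xi>\<bar> * norm (f k \<xi>) + real k * norm (f (k - 1) \<xi>))"
        using a al by (intro mult_mono) auto
      then show ?thesis by (simp add: norm_mult)
    qed
    finally have "w (m - k) * norm (chirp_step a f k \<xi>) \<le> w (m - k) * (norm (f (Suc k) \<xi>) + \<alpha> * (\<bar>\<xi>\<bar> * norm (f k \<xi>) + real k * norm (f (k - 1) \<xi>)))"
      by (rule mult_left_mono[OF _ w0])
    also have "\<dots> = w (m - k) * norm (f (Suc k) \<xi>) + \<alpha> * (w (m - k) * (\<bar>\<xi>\<bar> * norm (f k \<xi>)) + w (m - k) * (real k * norm (f (k - 1) \<xi>)))"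
      by (simp add: algebra_simps)
    also have "\<dots> \<le> s + \<alpha> * (s + real m * s)" by (intro add_mono mult_left_mono t1 t2 t3 al)
    finally show ?thesis by (simp add: algebra_simps)
  qed
  then have "wsum m (chirp_step a f) \<xi> \<le> of_nat (card {..m}) * ((1 + \<alpha> * (real m + 1)) * s)"
    unfolding wsum_def w_def[symmetric] by (intro sum_bounded_above) auto
  then show ?thesis by (simp add: s_def mult.assoc add.commute)
qed

lemma wsum_chirp_step_pow:
  assumes "\<alpha> \<ge> 0"
  shows "\<exists>C\<ge>0. \<forall>a f \<xi>. norm a \<le> \<alpha> \<longrightarrow> wsum m ((chirp_step a ^^ j) f) \<xi> \<le> C * wsum (m + j) f \<xi>"
proof (induction j arbitrary: m)
  case 0
  show ?case by (rule exI[of _ 1]) auto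
next
  case (Suc j)
  obtain C where C: "C \<ge> 0" "\<And>a f \<xi>. norm a \<le> \<alpha> \<Longrightarrow> wsum (Suc m) ((chirp_step a ^^ j) f) \<xi> \<le> C * wsum (Suc m + j) f \<xi>"
    using Suc.IH[of "Suc m"] by blast
  define c where "c = (real m + 1) * (1 + \<alpha> * (real m + 1))"
  have c0: "c \<ge> 0" unfolding c_def using assms by simp
  show ?case
  proof (intro exI[of _ "c * C"] conjI allI impI)
    fix a f \<xi> assume a: "norm (a::complex) \<le> \<alpha>"
    have "wsum m ((chirp_step a ^^ Suc j) f) \<xi> \<le> c * wsum (Suc m) ((chirp_step a ^^ j) f) \<xi>"
      unfolding c_def using wsum_chirp_step[OF a] by simp
    also have "\<dots> \<le> c * (C * wsum (Suc m + j) f \<xi>)" by (rule mult_left_mono[OF C(2)[OF a] c0])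
    finally show "wsum m ((chirp_step a ^^ Suc j) f) \<xi> \<le> c * C * wsum (m + Suc j) f \<xi>" by (simp add: mult.assoc)
  qed (use c0 C in auto)
qed

text \<open>For imaginary a the exponential has modulus 1, so only the iterated step has to be
  bounded, uniformly for |a| at most \<alpha>.\<close>

lemma sqn_chirp:
  assumes "\<alpha> \<ge> 0"
  shows "\<exists>C\<ge>0. \<forall>a (f :: nat \<Rightarrow> real \<Rightarrow> complex) M. Re a = 0 \<longrightarrow> norm a \<le> \<alpha> \<longrightarrow> (\<forall>k\<le>n. f k \<in> borel_measurable borel) \<longrightarrow>
     (\<forall>k\<le>n. sqn (\<lambda>\<xi>. sqrt ((1 + \<xi>\<^sup>2) ^ (n - k)) *\<^sub>R f k \<xi>) \<le> M) \<longrightarrow> sqn (chirp a f n) \<le> ennreal C * M"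
proof -
  obtain C where C: "C \<ge> 0" "\<And>a f \<xi>. norm a \<le> \<alpha> \<Longrightarrow> wsum 0 ((chirp_step a ^^ n) f) \<xi> \<le> C * wsum (0 + n) f \<xi>"
    using wsum_chirp_step_pow[OF assms, of 0 n] by blast
  \<comment> \<open>Cauchy-Schwarz over the n + 1 summands of \<open>wsum\<close>. The second factor
    n + 1 in the witness comes from adding n + 1 integrals, each at most M.\<close>
  define D where "D = C\<^sup>2 * (real n + 1)"
  have D0: "D \<ge> 0" by (simp add: D_def)
  show ?thesis
  proof (intro exI[of _ "D * (real n + 1)"] conjI allI impI)
    fix a and f :: "nat \<Rightarrow> real \<Rightarrow> complex" and M assume a: "Re a = 0" "norm a \<le> \<alpha>" and m: "\<forall>k\<le>n. f k \<in> borel_measurable borel"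
      and M: "\<forall>k\<le>n. sqn (\<lambda>\<xi>. sqrt ((1 + \<xi>\<^sup>2) ^ (n - k)) *\<^sub>R f k \<xi>) \<le> M"
    have e: "norm (exp (a * (complex_of_real \<xi>)\<^sup>2 / 2)) = 1" for \<xi>
      using a(1) by (simp add: norm_exp_eq_Re flip: of_real_power)
    define t where "t k \<xi> = sqrt ((1 + \<xi>\<^sup>2) ^ (n - k)) * norm (f k \<xi>)" for k \<xi>
    have pt: "(norm (chirp a f n \<xi>))\<^sup>2 \<le> D * (\<Sum>k\<le>n. (t k \<xi>)\<^sup>2)" for \<xi>
    proof -
      have "norm (chirp a f n \<xi>) = wsum 0 ((chirp_step a ^^ n) f) \<xi>"
        unfolding chirp_def norm_mult e wsum_def by simp
      also have "\<dots> \<le> C * wsum n f \<xi>" using C(2)[OF a(2), of f \<xi>] by simp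
      also have "wsum n f \<xi> = (\<Sum>k\<le>n. t k \<xi>)" by (simp add: wsum_def t_def)
      finally have "(norm (chirp a f n \<xi>))\<^sup>2 \<le> (C * (\<Sum>k\<le>n. t k \<xi>))\<^sup>2" by (rule power_mono) simp
      also have "\<dots> = C\<^sup>2 * (\<Sum>k\<le>n. t k \<xi>)\<^sup>2" by (rule power_mult_distrib)
      also have "(\<Sum>k\<le>n. t k \<xi>)\<^sup>2 \<le> (real n + 1) * (\<Sum>k\<le>n. (t k \<xi>)\<^sup>2)"
        using Cauchy_Schwarz_ineq_sum[of "\<lambda>_. 1" "\<lambda>k. t k \<xi>" "{..n}"] by (simp add: add.commute)
      finally show ?thesis by (simp add: D_def mult_left_mono mult.assoc)
    qed
    have "sqn (chirp a f n) \<le> (\<integral>\<^sup>+\<xi>. ennreal D * (\<Sum>k\<le>n. ennreal ((t k \<xi>)\<^sup>2)) \<partial>lborel)"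
      unfolding sqn_def using D0 pt by (intro nn_integral_mono) (simp add: sum_ennreal ennreal_mult[symmetric] sum_nonneg ennreal_leI)
    also have "\<dots> = ennreal D * (\<integral>\<^sup>+\<xi>. (\<Sum>k\<le>n. ennreal ((t k \<xi>)\<^sup>2)) \<partial>lborel)"
    proof (rule nn_integral_cmult)
      have mt: "t k \<in> borel_measurable borel" if "k \<le> n" for k
        using m that unfolding t_def by auto
      show "(\<lambda>\<xi>. \<Sum>k\<le>n. ennreal ((t k \<xi>)\<^sup>2)) \<in> borel_measurable lborel"
        by (rule borel_measurable_sum) (use mt in auto)
    qed
    also have "(\<integral>\<^sup>+\<xi>. (\<Sum>k\<le>n. ennreal ((t k \<xi>)\<^sup>2)) \<partial>lborel) = (\<Sum>k\<le>n. \<integral>\<^sup>+\<xi>. ennreal ((t k \<xi>)\<^sup>2) \<partial>lborel)"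
      by (rule nn_integral_sum) (use m in \<open>auto simp: t_def\<close>)
    also have "\<dots> = (\<Sum>k\<le>n. sqn (\<lambda>\<xi>. sqrt ((1 + \<xi>\<^sup>2) ^ (n - k)) *\<^sub>R f k \<xi>))"
      by (simp add: sqn_def t_def)
    also have "\<dots> \<le> of_nat (card {..n}) * M" using M by (intro sum_bounded_above) auto
    also have "ennreal D * (of_nat (card {..n}) * M) = ennreal (D * (real n + 1)) * M"
      using D0 by (simp add: ennreal_mult mult.assoc add.commute flip: ennreal_of_nat_eq_real_of_nat)
    finally show "sqn (chirp a f n) \<le> ennreal (D * (real n + 1)) * M" by (simp add: mult_left_mono)
  qed (use D0 in auto)
qed

lemma chirp_step_Suc:
  "(chirp_step a ^^ Suc j) f k \<xi> = (chirp_step a ^^ j) f (Suc k) \<xi> +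
     a * (complex_of_real \<xi> * (chirp_step a ^^ j) f k \<xi> + of_nat k * (chirp_step a ^^ j) f (k - 1) \<xi>)"
  by (simp add: chirp_step_def)

lemma chirp_step_pow_tendsto:
  assumes "\<And>k. k \<le> j + n \<Longrightarrow> (\<lambda>i. f i k \<xi>) \<longlonglongrightarrow> g k \<xi>" "k \<le> n"
  shows "(\<lambda>i. (chirp_step a ^^ j) (f i) k \<xi>) \<longlonglongrightarrow> (chirp_step a ^^ j) g k \<xi>"
  using assms
proof (induction j arbitrary: n k)
  case (Suc j)
  have IH: "(\<lambda>i. (chirp_step a ^^ j) (f i) l \<xi>) \<longlonglongrightarrow> (chirp_step a ^^ j) g l \<xi>" if "l \<le> Suc n" for l
    by (rule Suc.IH[OF _ that]) (use Suc.prems in auto)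
  show ?case
    unfolding chirp_step_Suc using Suc.prems(2)
    by (intro tendsto_add tendsto_mult tendsto_const IH) auto
qed simp

lemma chirp_tendsto:
  assumes "\<And>k. k \<le> j \<Longrightarrow> (\<lambda>i. f i k \<xi>) \<longlonglongrightarrow> g k \<xi>"
  shows "(\<lambda>i. chirp a (f i) j \<xi>) \<longlonglongrightarrow> chirp a g j \<xi>"
  unfolding chirp_def by (intro tendsto_mult tendsto_const chirp_step_pow_tendsto[where n=0]) (use assms in auto)

lemma chirp_step_pow_continuous:
  assumes "\<And>k. k \<le> j + n \<Longrightarrow> continuous_on UNIV (\<lambda>p. f (fst p) k (snd p))" "k \<le> n" "continuous_on UNIV a"
  shows "continuous_on UNIV (\<lambda>p::real\<times>real. (chirp_step (a (fst p)) ^^ j) (f (fst p)) k (snd p))"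
  using assms
proof (induction j arbitrary: n k)
  case (Suc j)
  have IH: "continuous_on UNIV (\<lambda>p::real\<times>real. (chirp_step (a (fst p)) ^^ j) (f (fst p)) l (snd p))" if "l \<le> Suc n" for l
    by (rule Suc.IH[OF _ that Suc.prems(3)]) (use Suc.prems in auto)
  show ?case
    unfolding chirp_step_Suc using Suc.prems(2)
    by (intro continuous_intros IH continuous_on_compose2[OF Suc.prems(3)]) auto
qed simp

lemma chirp_continuous:
  assumes "\<And>k. k \<le> j \<Longrightarrow> continuous_on UNIV (\<lambda>p. f (fst p) k (snd p))" "continuous_on UNIV a"
  shows "continuous_on UNIV (\<lambda>p::real\<times>real. chirp (a (fst p)) (f (fst p)) j (snd p))"
  unfolding chirp_def
  by (intro continuous_intros chirp_step_pow_continuous[where n=0] continuous_on_compose2[OF assms(2)]) (use assms in auto)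

text \<open>Leibniz' rule with exp(a \<xi>^2 / 2) = 1 + a \<xi>^2 / 2 + ... at 0. The term with a is
  what brings the first moment and the conserved norm into the jump.\<close>

lemma chirp_3_at_0: "chirp a f 3 0 = f 3 0 + 3 * a * f 1 0"
  by (simp add: chirp_def chirp_step_def eval_nat_numeral algebra_simps)

lemma chirp_0: "chirp a f 0 \<xi> = exp (a * (complex_of_real \<xi>)\<^sup>2 / 2) * f 0 \<xi>"
  by (simp add: chirp_def)

subsection \<open>Integrals over a time parameter\<close>

lemma param_integral_has_vector_derivative:
  fixes g g' :: "real \<times> real \<Rightarrow> complex"
  assumes g: "continuous_on UNIV g" and g': "continuous_on UNIV g'"
    and d: "\<And>\<sigma> \<xi>. ((\<lambda>\<xi>. g (\<sigma>, \<xi>)) has_vector_derivative g' (\<sigma>, \<xi>)) (at \<xi>)"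
  shows "((\<lambda>\<xi>. integral {0..1} (\<lambda>\<sigma>. g (\<sigma>, \<xi>))) has_vector_derivative integral {0..1} (\<lambda>\<sigma>. g' (\<sigma>, \<xi>))) (at \<xi>)"
proof -
  have "((\<lambda>\<xi>. integral (cbox 0 1) (\<lambda>\<sigma>. g (\<sigma>, \<xi>))) has_vector_derivative integral (cbox 0 1) (\<lambda>\<sigma>. g' (\<sigma>, \<xi>))) (at \<xi> within UNIV)"
  proof (rule leibniz_rule_vector_derivative)
    show "continuous_on (UNIV \<times> cbox 0 1) (\<lambda>(\<xi>, \<sigma>). g' (\<sigma>, \<xi>))"
      unfolding case_prod_beta by (intro continuous_on_compose2[OF g']) (auto intro!: continuous_intros)
    show "(\<lambda>\<sigma>. g (\<sigma>, \<xi>)) integrable_on cbox 0 1" for \<xi>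
      by (intro integrable_continuous continuous_on_compose2[OF g]) (auto intro!: continuous_intros)
  qed (use d in auto)
  then show ?thesis by simp
qed

text \<open>On the unit interval Cauchy-Schwarz costs no constant. This is one reason to write times
  as T \<sigma> with \<sigma> in [0, 1]; another is that both signs of T are treated alike.\<close>

lemma sqn_param_integral:
  fixes g :: "real \<times> real \<Rightarrow> complex"
  assumes g: "continuous_on UNIV g" and K: "\<And>\<sigma>. \<sigma> \<in> {0..1} \<Longrightarrow> sqn (\<lambda>\<xi>. g (\<sigma>, \<xi>)) \<le> K"
  shows "sqn (\<lambda>\<xi>. integral {0..1} (\<lambda>\<sigma>. g (\<sigma>, \<xi>))) \<le> K"
proof -
  have gm: "g \<in> borel_measurable borel" by (rule borel_measurable_continuous_onI[OF g])
  then have [measurable]: "g \<in> borel_measurable (borel \<Otimes>\<^sub>M borel)" by (simp add: borel_prod)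
  have pt: "ennreal ((norm (integral {0..1} (\<lambda>\<sigma>. g (\<sigma>, \<xi>))))\<^sup>2) \<le> (\<integral>\<^sup>+\<sigma>. ennreal ((norm (g (\<sigma>, \<xi>)))\<^sup>2) * indicator {0..1} \<sigma> \<partial>lborel)" for \<xi>
  proof -
    have si: "set_integrable lborel {0..1} (\<lambda>\<sigma>. g (\<sigma>, \<xi>))"
      by (intro borel_integrable_atLeastAtMost' continuous_on_compose2[OF g]) (auto intro!: continuous_intros)
    have "ennreal (norm (integral {0..1} (\<lambda>\<sigma>. g (\<sigma>, \<xi>)))) \<le> (\<integral>\<^sup>+\<sigma>. ennreal (norm (indicator {0..1} \<sigma> *\<^sub>R g (\<sigma>, \<xi>))) \<partial>lborel)"
      unfolding set_borel_integral_eq_integral(2)[OF si, symmetric] set_lebesgue_integral_def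
      by (rule integral_norm_bound_ennreal[OF si[unfolded set_integrable_def]])
    also have "\<dots> = (\<integral>\<^sup>+\<sigma>. (ennreal (norm (g (\<sigma>, \<xi>))) * indicator {0..1} \<sigma>) * indicator {0..1} \<sigma> \<partial>lborel)"
      by (intro nn_integral_cong) (auto split: split_indicator)
    finally have "(ennreal (norm (integral {0..1} (\<lambda>\<sigma>. g (\<sigma>, \<xi>)))))\<^sup>2 \<le> \<dots>\<^sup>2" by (rule power_mono) simp
    also have "\<dots> \<le> (\<integral>\<^sup>+\<sigma>. (ennreal (norm (g (\<sigma>, \<xi>))) * indicator {0..1} \<sigma>)\<^sup>2 \<partial>lborel) * (\<integral>\<^sup>+\<sigma>. (indicator {0..1} (\<sigma>::real))\<^sup>2 \<partial>lborel)"
      by (rule Cauchy_Schwarz_nn_integral) auto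
    also have "(\<integral>\<^sup>+\<sigma>. (indicator {0..1} (\<sigma>::real))\<^sup>2 \<partial>lborel) = (\<integral>\<^sup>+\<sigma>. indicator {0..1} (\<sigma>::real) \<partial>lborel)"
      by (intro nn_integral_cong) (auto split: split_indicator)
    also have "\<dots> = 1" by simp
    also have "(\<integral>\<^sup>+\<sigma>. (ennreal (norm (g (\<sigma>, \<xi>))) * indicator {0..1} \<sigma>)\<^sup>2 \<partial>lborel) = (\<integral>\<^sup>+\<sigma>. ennreal ((norm (g (\<sigma>, \<xi>)))\<^sup>2) * indicator {0..1} \<sigma> \<partial>lborel)"
      by (intro nn_integral_cong) (auto simp: ennreal_power split: split_indicator)
    finally show ?thesis by (simp add: ennreal_power)
  qed
  have "sqn (\<lambda>\<xi>. integral {0..1} (\<lambda>\<sigma>. g (\<sigma>, \<xi>))) \<le> (\<integral>\<^sup>+\<xi>. (\<integral>\<^sup>+\<sigma>. ennreal ((norm (g (\<sigma>, \<xi>)))\<^sup>2) * indicator {0..1} \<sigma> \<partial>lborel) \<partial>lborel)"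
    unfolding sqn_def by (intro nn_integral_mono pt)
  also have "\<dots> = (\<integral>\<^sup>+\<sigma>. (\<integral>\<^sup>+\<xi>. ennreal ((norm (g (\<sigma>, \<xi>)))\<^sup>2) * indicator {0..1} \<sigma> \<partial>lborel) \<partial>lborel)"
    by (rule lborel_pair.Fubini') simp
  also have "\<dots> = (\<integral>\<^sup>+\<sigma>. sqn (\<lambda>\<xi>. g (\<sigma>, \<xi>)) * indicator {0..1} \<sigma> \<partial>lborel)"
    unfolding sqn_def by (intro nn_integral_cong nn_integral_multc) simp
  also have "\<dots> \<le> (\<integral>\<^sup>+\<sigma>. K * indicator {0..1} (\<sigma>::real) \<partial>lborel)"
    using K by (intro nn_integral_mono) (auto split: split_indicator)
  also have "\<dots> = K" by (subst nn_integral_cmult) auto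
  finally show ?thesis .
qed

subsection \<open>From Duhamel's formula to the fourth moment\<close>

lemma sqn_add_le:
  fixes f g :: "real \<Rightarrow> complex"
  assumes [measurable]: "f \<in> borel_measurable borel" "g \<in> borel_measurable borel"
  shows "sqn (\<lambda>x. f x + g x) \<le> 2 * sqn f + 2 * sqn g"
proof -
  have "sqn (\<lambda>x. f x + g x) \<le> (\<integral>\<^sup>+x. 2 * ennreal ((norm (f x))\<^sup>2) + 2 * ennreal ((norm (g x))\<^sup>2) \<partial>lborel)"
    unfolding sqn_def
  proof (intro nn_integral_mono)
    fix x
    have "ennreal ((norm (f x + g x))\<^sup>2) \<le> (ennreal (norm (f x)) + ennreal (norm (g x)))\<^sup>2"
      by (auto simp: ennreal_power ennreal_plus[symmetric] simp del: ennreal_plus intro!: ennreal_leI power_mono norm_triangle_ineq)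
    also have "\<dots> \<le> 2 * (ennreal (norm (f x)))\<^sup>2 + 2 * (ennreal (norm (g x)))\<^sup>2" by (rule power2_add_le_ennreal)
    finally show "ennreal ((norm (f x + g x))\<^sup>2) \<le> 2 * ennreal ((norm (f x))\<^sup>2) + 2 * ennreal ((norm (g x))\<^sup>2)"
      by (simp add: ennreal_power)
  qed
  also have "\<dots> = 2 * sqn f + 2 * sqn g"
    unfolding sqn_def by (subst nn_integral_add) (auto simp: nn_integral_cmult)
  finally show ?thesis .
qed

lemma sqn_cmult:
  fixes f :: "real \<Rightarrow> complex"
  assumes [measurable]: "f \<in> borel_measurable borel"
  shows "sqn (\<lambda>x. c * f x) = ennreal ((norm c)\<^sup>2) * sqn f"
  unfolding sqn_def by (subst nn_integral_cmult[symmetric]) (auto simp: norm_mult power_mult_distrib ennreal_mult)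

lemma FD_at_0_moment:
  assumes "integrable lborel (\<lambda>x. x ^ k * f x)"
  shows "FD k (cr f) 0 = (- \<i>) ^ k * complex_of_real ((LINT x|lborel. x ^ k * f x) / sqrt (2 * pi))"
proof -
  have "(LINT x|lborel. (- \<i> * complex_of_real x) ^ k * cr f x) = (LINT x|lborel. (- \<i>) ^ k * complex_of_real (x ^ k * f x))"
    by (simp only: power_mult_distrib of_real_mult of_real_power mult.assoc)
  also have "\<dots> = (- \<i>) ^ k * complex_of_real (LINT x|lborel. x ^ k * f x)"
    unfolding integral_mult_right_zero integral_complex_of_real ..
  finally show ?thesis by (simp add: FD_def fourier_def)
qed

text \<open>The equation enters here only through Duhamel's formula and the conserved norm;
  everything else is regularity of the two terms of that formula.\<close>

lemma fourth_moment_of_Duhamel: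
  fixes u0 :: "real \<Rightarrow> real" and u :: "real \<Rightarrow> real \<Rightarrow> real"
  assumes K: "K \<ge> 0" and u: "\<And>\<sigma>. \<sigma> \<in> {0..1} \<Longrightarrow> wclass K (u (T * \<sigma>))" and u': "\<And>t. \<exists>K. wclass K (u t)"
    and cont: "\<And>k. k \<le> 4 \<Longrightarrow> continuous_on UNIV (\<lambda>p. QD k (u (T * fst p)) (snd p))"
    and u0: "\<And>j. j < 4 \<Longrightarrow> integrable lborel (\<lambda>x. complex_of_real (x ^ j) * cr u0 x)"
      "sqn (\<lambda>\<xi>. sqrt ((1 + \<xi>\<^sup>2) ^ 4) *\<^sub>R fourier (cr u0) \<xi>) \<le> ennreal K" "sqn (\<lambda>x. complex_of_real (x ^ 4) * cr u0 x) \<le> ennreal K"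
    and Duhamel: "\<And>\<xi>. \<xi> > 0 \<Longrightarrow> fourier (cr (u T)) \<xi> = cis (- (T * \<xi>\<^sup>2)) * fourier (cr u0) \<xi> -
       \<i> / 2 * complex_of_real T * integral {0..1} (\<lambda>\<sigma>. cis (- (T * (1 - \<sigma>) * \<xi>\<^sup>2)) * (complex_of_real \<xi> * fourier (sq (u (T * \<sigma>))) \<xi>))"
    and mass: "\<And>\<sigma>. \<sigma> \<in> {0..1} \<Longrightarrow> (LINT x|lborel. (u (T * \<sigma>) x)\<^sup>2) = N"
    and T: "T * ((LINT x|lborel. x * u0 x) + T * N / 4) = 0"
  shows "sqn (\<lambda>x. complex_of_real (x ^ 4) * cr (u T) x) < \<infinity>"
proof -
  have uT: "wclass K (u T)" using u[of 1] by simp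
  have "integrable lborel (cr u0)" using u0(1)[of 0] by simp
  then have [measurable]: "cr u0 \<in> borel_measurable borel" by auto
  \<comment> \<open>Chosen so that exp(a0 \<xi>^2 / 2) = exp(-i T \<xi>^2); likewise
    \<open>a \<sigma>\<close> for the remaining time T (1 - \<sigma>).\<close>
  define a0 where "a0 = - 2 * \<i> * complex_of_real T"
  define a where "a \<sigma> = - 2 * \<i> * complex_of_real (T * (1 - \<sigma>))" for \<sigma>
  define Q where "Q \<sigma> k = QD k (u (T * \<sigma>))" for \<sigma> k
  have ca: "continuous_on UNIV a" unfolding a_def by (intro continuous_intros)
  have exp_a: "exp (- 2 * \<i> * complex_of_real s * (complex_of_real \<xi>)\<^sup>2 / 2) = cis (- (s * \<xi>\<^sup>2))" for s \<xi>
    by (simp add: cis_conv_exp)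
  define g where "g j p = chirp (a (fst p)) (Q (fst p)) j (snd p)" for j and p :: "real \<times> real"
  have cg: "continuous_on UNIV (g j)" if "j \<le> 4" for j
    unfolding g_def using that by (intro chirp_continuous ca) (auto simp: Q_def intro: cont)
  have dQ: "dseq 5 (Q \<sigma>)" for \<sigma>
    unfolding dseq_def Q_def using QD_has_vector_derivative u'[of "T * \<sigma>"] by auto
  define I where "I j \<xi> = integral {0..1} (\<lambda>\<sigma>. g j (\<sigma>, \<xi>))" for j \<xi>
  have dI: "(I j has_vector_derivative I (Suc j) \<xi>) (at \<xi>)" if "j < 4" for j \<xi>
    unfolding I_def
    by (rule param_integral_has_vector_derivative) (use that cg in \<open>auto simp: g_def intro!: chirp_has_vector_derivative[OF dQ]\<close>)
  have mI: "I 4 \<in> borel_measurable borel"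
  proof (rule borel_measurable_continuous_onI)
    have "continuous_on UNIV (\<lambda>\<xi>. integral (cbox 0 1) (\<lambda>\<sigma>. g 4 (\<sigma>, \<xi>)))"
      by (intro integral_continuous_on_param) (auto simp: case_prod_beta intro!: continuous_on_compose2[OF cg] continuous_intros)
    then show "continuous_on UNIV (I 4)" by (simp add: I_def[abs_def])
  qed
  have "\<forall>k\<in>{..4}. \<exists>M\<ge>0. \<forall>v. wclass K v \<longrightarrow> sqn (\<lambda>\<xi>. sqrt ((1 + \<xi>\<^sup>2) ^ (4 - k)) *\<^sub>R QD k v \<xi>) \<le> ennreal M"
    using wclass_QD[OF K] by auto
  from bchoice[OF this] obtain Mq where Mq: "\<And>k. k \<le> 4 \<Longrightarrow> Mq k \<ge> (0::real)"
    "\<And>k v. k \<le> 4 \<Longrightarrow> wclass K v \<Longrightarrow> sqn (\<lambda>\<xi>. sqrt ((1 + \<xi>\<^sup>2) ^ (4 - k)) *\<^sub>R QD k v \<xi>) \<le> ennreal (Mq k)" by auto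
  define M where "M = (\<Sum>k\<le>4. Mq k)"
  have M0: "M \<ge> 0" unfolding M_def using Mq(1) by (intro sum_nonneg) auto
  have M: "sqn (\<lambda>\<xi>. sqrt ((1 + \<xi>\<^sup>2) ^ (4 - k)) *\<^sub>R QD k v \<xi>) \<le> ennreal M" if "k \<le> 4" "wclass K v" for k v
  proof -
    have "Mq k \<le> M" unfolding M_def using that Mq(1) by (intro member_le_sum) auto
    then show ?thesis using order_trans[OF Mq(2)[OF that] ennreal_leI] by simp
  qed
  have "\<forall>k\<in>{..4}. \<exists>C\<ge>0. \<forall>u h. (\<forall>j<4. integrable lborel (\<lambda>x. complex_of_real (x ^ j) * u x)) \<longrightarrow> 0 < h \<longrightarrow> h \<le> 1 \<longrightarrow>
    sqn (\<lambda>\<xi>. sqrt ((1 + \<xi>\<^sup>2) ^ (4 - k)) *\<^sub>R FD k (\<lambda>x. u x * smear h x) \<xi>)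
     \<le> ennreal C * (sqn (\<lambda>\<xi>. sqrt ((1 + \<xi>\<^sup>2) ^ 4) *\<^sub>R fourier u \<xi>) + sqn (\<lambda>x. complex_of_real (x ^ 4) * u x))"
    by (intro ballI fourier_interpolation_smear) auto
  from bchoice[OF this] obtain Cs where Cs: "\<forall>k\<in>{..4}. (0::real) \<le> Cs k \<and> (\<forall>u h. (\<forall>j<4. integrable lborel (\<lambda>x. complex_of_real (x ^ j) * u x)) \<longrightarrow> 0 < h \<longrightarrow> h \<le> 1 \<longrightarrow>
    sqn (\<lambda>\<xi>. sqrt ((1 + \<xi>\<^sup>2) ^ (4 - k)) *\<^sub>R FD k (\<lambda>x. u x * smear h x) \<xi>)
     \<le> ennreal (Cs k) * (sqn (\<lambda>\<xi>. sqrt ((1 + \<xi>\<^sup>2) ^ 4) *\<^sub>R fourier u \<xi>) + sqn (\<lambda>x. complex_of_real (x ^ 4) * u x)))" by blast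
  define h where "h i = 1 / real (Suc i)" for i
  have h: "h i > 0" "h i \<le> 1" "h \<longlonglongrightarrow> 0" for i
    unfolding h_def using LIMSEQ_inverse_real_of_nat by (auto simp: inverse_eq_divide)
  \<comment> \<open>The moment x^4 u_0 lies in L2 but need not be integrable, so the fourth
    derivative of the transform is taken for smeared data.\<close>
  define v where "v i x = cr u0 x * smear (h i) x" for i x
  have [measurable]: "v i \<in> borel_measurable borel" for i unfolding v_def by measurable
  define M' where "M' = (\<Sum>k\<le>4. Cs k) * (2 * K)"
  have Csum0: "(\<Sum>k\<le>4. Cs k) \<ge> 0" using Cs by (intro sum_nonneg) auto
  have M'0: "M' \<ge> 0" unfolding M'_def using Csum0 K by simp
  have Mv: "sqn (\<lambda>\<xi>. sqrt ((1 + \<xi>\<^sup>2) ^ (4 - k)) *\<^sub>R FD k (v i) \<xi>) \<le> ennreal M'" if k: "k \<le> 4" for k i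
  proof -
    have "sqn (\<lambda>\<xi>. sqrt ((1 + \<xi>\<^sup>2) ^ (4 - k)) *\<^sub>R FD k (v i) \<xi>) \<le> ennreal (Cs k) * (sqn (\<lambda>\<xi>. sqrt ((1 + \<xi>\<^sup>2) ^ 4) *\<^sub>R fourier (cr u0) \<xi>) + sqn (\<lambda>x. complex_of_real (x ^ 4) * cr u0 x))"
    proof -
      have "k \<in> {..4}" using k by simp
      from conjunct2[OF bspec[OF Cs this], rule_format, OF u0(1) h(1) h(2)] show ?thesis unfolding v_def[abs_def] .
    qed
    also have "\<dots> \<le> ennreal (\<Sum>k\<le>4. Cs k) * (ennreal K + ennreal K)"
      using Cs k by (intro mult_mono add_mono u0 ennreal_leI member_le_sum) auto
    also have "\<dots> = ennreal M'"
      unfolding M'_def using K Csum0 by (simp add: ennreal_plus[symmetric] ennreal_mult[symmetric] del: ennreal_plus)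
    finally show ?thesis .
  qed
  have dv: "dseq 4 (\<lambda>k. FD k (v i))" for i
    unfolding dseq_def
  proof (intro allI impI)
    fix k :: nat and \<xi> assume k: "k < 4"
    show "(FD k (v i) has_vector_derivative FD (Suc k) (v i) \<xi>) (at \<xi>)"
      unfolding v_def[abs_def] using integrable_smear[OF h(1) u0(1)[OF k], of i]
      by (intro FD_has_vector_derivative) auto
  qed
  have d0: "dseq 3 (\<lambda>k. FD k (cr u0))"
    unfolding dseq_def
  proof (intro allI impI)
    fix k :: nat and \<xi> assume k: "k < 3"
    show "(FD k (cr u0) has_vector_derivative FD (Suc k) (cr u0) \<xi>) (at \<xi>)"
      by (intro FD_has_vector_derivative u0) (use k in auto)
  qed
  define b where "b = \<i> / 2 * complex_of_real T"
  \<comment> \<open>E has three classical derivatives. The approximants A differ from E in the data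
    term only; the Duhamel term has four classical derivatives by itself.\<close>
  define E where "E j \<xi> = chirp a0 (\<lambda>k. FD k (cr u0)) j \<xi> - b * I j \<xi>" for j \<xi>
  define A where "A i j \<xi> = chirp a0 (\<lambda>k. FD k (v i)) j \<xi> - b * I j \<xi>" for i j \<xi>
  define \<alpha> where "\<alpha> = 2 * \<bar>T\<bar>"
  have al: "\<alpha> \<ge> 0" "norm a0 \<le> \<alpha>" "Re a0 = 0" by (auto simp: \<alpha>_def a0_def norm_mult)
  have al2: "norm (a \<sigma>) \<le> \<alpha>" "Re (a \<sigma>) = 0" if "\<sigma> \<in> {0..1}" for \<sigma>
  proof -
    have "\<bar>T\<bar> * \<bar>1 - \<sigma>\<bar> \<le> \<bar>T\<bar> * 1" using that by (intro mult_left_mono) auto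
    then show "norm (a \<sigma>) \<le> \<alpha>" by (simp add: \<alpha>_def a_def norm_mult abs_mult del: of_real_mult of_real_diff)
  qed (simp add: a_def)
  obtain C where C: "C \<ge> 0" "\<And>a (f :: nat \<Rightarrow> real \<Rightarrow> complex) M. Re a = 0 \<Longrightarrow> norm a \<le> \<alpha> \<Longrightarrow> (\<forall>k\<le>4. f k \<in> borel_measurable borel) \<Longrightarrow>
     (\<forall>k\<le>4. sqn (\<lambda>\<xi>. sqrt ((1 + \<xi>\<^sup>2) ^ (4 - k)) *\<^sub>R f k \<xi>) \<le> M) \<Longrightarrow> sqn (chirp a f 4) \<le> ennreal C * M"
    using sqn_chirp[OF al(1), of 4] by blast
  have mQ: "Q \<sigma> k \<in> borel_measurable borel" for \<sigma> k
  proof -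
    have [measurable]: "u (T * \<sigma>) \<in> borel_measurable borel" using u' wclass_measurable by blast
    show ?thesis unfolding Q_def QD_def[abs_def] by measurable
  qed
  have sI: "sqn (I 4) \<le> ennreal (C * M)"
    unfolding I_def
  proof (rule sqn_param_integral[OF cg])
    fix \<sigma> :: real assume s: "\<sigma> \<in> {0..1}"
    have "sqn (chirp (a \<sigma>) (Q \<sigma>) 4) \<le> ennreal C * ennreal M"
      by (rule C(2)[OF al2(2,1)[OF s]]) (use mQ M u[OF s] in \<open>auto simp: Q_def\<close>)
    then show "sqn (\<lambda>\<xi>. g 4 (\<sigma>, \<xi>)) \<le> ennreal (C * M)" using C M0 by (simp add: g_def ennreal_mult)
  qed simp
  have sv: "sqn (chirp a0 (\<lambda>k. FD k (v i)) 4) \<le> ennreal (C * M')" for i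
  proof -
    have "sqn (chirp a0 (\<lambda>k. FD k (v i)) 4) \<le> ennreal C * ennreal M'"
      by (rule C(2)[OF al(3,2)]) (use Mv in auto)
    then show ?thesis using C M'0 by (simp add: ennreal_mult)
  qed
  define L where "L = 2 * (C * M') + 2 * ((norm b)\<^sup>2 * (C * M))"
  have mC: "chirp a0 (\<lambda>k. FD k (v i)) 4 \<in> borel_measurable borel" for i
  proof -
    have "(\<lambda>\<xi>. (chirp_step a0 ^^ j) (\<lambda>k. FD k (v i)) k \<xi>) \<in> borel_measurable borel" for j k
    proof (induction j arbitrary: k)
      case (Suc j)
      note [measurable] = Suc.IH
      show ?case unfolding chirp_step_Suc by measurable
    qed simp
    note [measurable] = this
    show ?thesis unfolding chirp_def[abs_def] by measurable
  qed
  have mA: "A i 4 \<in> borel_measurable borel" for i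
    unfolding A_def using mC[of i] mI by measurable
  have sA: "sqn (A i 4) \<le> ennreal L" for i
  proof -
    have "sqn (A i 4) = sqn (\<lambda>\<xi>. chirp a0 (\<lambda>k. FD k (v i)) 4 \<xi> + (- b) * I 4 \<xi>)" by (simp add: A_def[abs_def])
    also have "\<dots> \<le> 2 * sqn (chirp a0 (\<lambda>k. FD k (v i)) 4) + 2 * sqn (\<lambda>\<xi>. (- b) * I 4 \<xi>)"
      by (rule sqn_add_le[OF mC]) (use mI in auto)
    also have "sqn (\<lambda>\<xi>. (- b) * I 4 \<xi>) = ennreal ((norm b)\<^sup>2) * sqn (I 4)" using sqn_cmult[OF mI, of "- b"] by simp
    also have "2 * sqn (chirp a0 (\<lambda>k. FD k (v i)) 4) + 2 * (ennreal ((norm b)\<^sup>2) * sqn (I 4)) \<le> 2 * ennreal (C * M') + 2 * (ennreal ((norm b)\<^sup>2) * ennreal (C * M))"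
      by (intro add_mono mult_left_mono sv sI) auto
    also have "\<dots> = ennreal L"
      unfolding L_def using C M0 M'0 by (subst ennreal_plus) (auto simp: ennreal_mult)
    finally show ?thesis .
  qed
  have "sqn (\<lambda>x. complex_of_real (x ^ 4) * cr (u T) x) \<le> 2 * ennreal L"
  proof (rule fourth_moment_of_half_line_regularity[OF uT K, where E=E and A=A])
    show "(E j has_vector_derivative E (Suc j) \<xi>) (at \<xi>)" if "j < 3" for j \<xi>
      unfolding E_def using that
      by (intro has_vector_derivative_diff has_vector_derivative_mult_right dI chirp_has_vector_derivative[OF d0]) auto
    show "(A i 3 has_vector_derivative A i 4 \<xi>) (at \<xi>)" for i \<xi>
    proof -
      have "((\<lambda>\<xi>. chirp a0 (\<lambda>k. FD k (v i)) 3 \<xi> - b * I 3 \<xi>) has_vector_derivative chirp a0 (\<lambda>k. FD k (v i)) (Suc 3) \<xi> - b * I (Suc 3) \<xi>) (at \<xi>)"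
        by (intro has_vector_derivative_diff has_vector_derivative_mult_right dI chirp_has_vector_derivative[OF dv]) auto
      then show ?thesis unfolding A_def[abs_def] by (simp add: eval_nat_numeral)
    qed
    show "(\<lambda>i. A i 3 \<xi>) \<longlonglongrightarrow> E 3 \<xi>" for \<xi>
      unfolding A_def E_def
    proof (intro tendsto_diff tendsto_const chirp_tendsto)
      fix k :: nat assume "k \<le> 3"
      then show "(\<lambda>i. FD k (v i) \<xi>) \<longlonglongrightarrow> FD k (cr u0) \<xi>"
        unfolding v_def[abs_def] by (intro FD_smear_tendsto h u0(1)) auto
    qed
    show "fourier (cr (u T)) \<xi> = E 0 \<xi>" if "\<xi> > 0" for \<xi>
      unfolding Duhamel[OF that] E_def chirp_0 a0_def I_def g_def a_def exp_a b_def Q_def fst_conv snd_conv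
      by (simp add: QD_def FD_0)
    \<comment> \<open>Zeroth and second moments give real values of \<open>FD\<close> at 0, first
      and third moments imaginary ones. With a0, a and b imaginary, the real part retains the first
      moment of u_0 and the norm N.\<close>
    show "Re (E 3 0) = 0"
    proof -
      have r: "integrable lborel (\<lambda>x. x ^ j * f x)" if "integrable lborel (\<lambda>x. complex_of_real (x ^ j) * cr f x)" for j f
        using that integrable_Re[OF that] by simp
      define m where "m = (LINT x|lborel. x * u0 x)"
      define s where "s = sqrt (2 * pi)"
      have s0: "s > 0" by (simp add: s_def)
      have 1: "chirp a0 (\<lambda>k. FD k (cr u0)) 3 0 = \<i> * complex_of_real ((LINT x|lborel. x ^ 3 * u0 x) / s) - complex_of_real (6 * T * m / s)"
      proof -
        have f3: "FD 3 (cr u0) 0 = \<i> * complex_of_real ((LINT x|lborel. x ^ 3 * u0 x) / s)"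
          using FD_at_0_moment[OF r[OF u0(1)[of 3]]] by (simp add: s_def power3_eq_cube)
        have f1: "FD 1 (cr u0) 0 = - \<i> * complex_of_real (m / s)"
          using FD_at_0_moment[OF r[OF u0(1)[of 1]]] by (simp add: s_def m_def)
        show ?thesis unfolding chirp_3_at_0 f3 f1 a0_def by (simp add: complex_eq_iff)
      qed
      \<comment> \<open>The second moment of u^2 varies in time, but it enters the real part of
        \<open>g 3\<close> only and is turned imaginary by the factor b.\<close>
      define w where "w \<sigma> = (LINT x|lborel. x ^ 2 * (u (T * \<sigma>) x)\<^sup>2)" for \<sigma>
      have 2: "g 3 (\<sigma>, 0) = complex_of_real (- 3 * w \<sigma> / s) - \<i> * complex_of_real (6 * T * (1 - \<sigma>) * N / s)" if "\<sigma> \<in> {0..1}" for \<sigma>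
      proof -
        have m2: "FD 2 (sq (u (T * \<sigma>))) 0 = - complex_of_real (w \<sigma> / s)"
          using FD_at_0_moment[OF r[OF wclass_sq_moments[OF u[OF that], of 2]]] by (simp add: w_def s_def)
        have m0: "FD 0 (sq (u (T * \<sigma>))) 0 = complex_of_real (N / s)"
          using FD_at_0_moment[OF r[OF wclass_sq_moments[OF u[OF that], of 0]]] mass[OF that] by (simp add: s_def)
        show ?thesis
          unfolding g_def fst_conv snd_conv chirp_3_at_0 Q_def QD_def using m2 m0 by (simp add: a_def)
      qed
      have i3: "(\<lambda>\<sigma>. g 3 (\<sigma>, 0)) integrable_on {0..1}"
        by (intro integrable_continuous_real continuous_on_compose2[OF cg]) (auto intro!: continuous_intros)
      have "Im (I 3 0) = integral {0..1} (\<lambda>\<sigma>. Im (g 3 (\<sigma>, 0)))"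
        unfolding I_def using integral_linear[OF i3 bounded_linear_Im] by (simp add: o_def)
      also have "\<dots> = integral {0..1} (\<lambda>\<sigma>. - (6 * T * (1 - \<sigma>) * N / s))"
        by (intro integral_cong) (simp add: 2)
      also have "\<dots> = - (3 * T * N / s)"
      proof (rule integral_unique)
        define c where "c = - (6 * T * N / s)"
        have "((\<lambda>\<sigma>. c * (1 - \<sigma>)) has_integral ((\<lambda>\<sigma>. c * (\<sigma> - \<sigma>\<^sup>2 / 2)) 1 - (\<lambda>\<sigma>. c * (\<sigma> - \<sigma>\<^sup>2 / 2)) 0)) {0..1}"
          by (rule fundamental_theorem_of_calculus)
            (auto intro!: derivative_eq_intros simp: has_real_derivative_iff_has_vector_derivative[symmetric])
        moreover have "(\<lambda>\<sigma>. c * (1 - \<sigma>)) = (\<lambda>\<sigma>. - (6 * T * (1 - \<sigma>) * N / s))" by (simp add: c_def fun_eq_iff)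
        moreover have "c * (1 - 1\<^sup>2 / 2) - c * (0 - 0\<^sup>2 / 2) = - (3 * T * N / s)" by (simp add: c_def)
        ultimately show "((\<lambda>\<sigma>. - (6 * T * (1 - \<sigma>) * N / s)) has_integral - (3 * T * N / s)) {0..1}" by (simp only:)
      qed
      finally have "Re (E 3 0) = - (6 * T * m / s) - (T / 2) * (3 * T * N / s)"
        unfolding E_def 1 b_def by simp
      also have "\<dots> = - (6 / s) * (T * (m + T * N / 4))" using s0 by (simp add: field_simps)
      also have "\<dots> = 0" using T by (simp add: m_def)
      finally show ?thesis .
    qed
  qed (use mA sA in auto)
  also have "2 * ennreal L < \<infinity>" by (simp add: ennreal_mult_less_top)
  finally show ?thesis .
qed

subsection \<open>The equation on the Fourier side\<close>

text \<open>The set where the functions differ is open; if it were non-empty, it would contain an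
  interval of positive length.\<close>

lemma AE_lborel_continuous_eq:
  fixes f g :: "real \<Rightarrow> 'a::t2_space"
  assumes ae: "AE x in lborel. f x = g x" and c: "continuous_on UNIV f" "continuous_on UNIV g"
  shows "f x = g x"
proof (rule ccontr)
  assume ne: "f x \<noteq> g x"
  have o: "open {y. f y \<noteq> g y}" by (intro open_Collect_neq c)
  obtain e where e: "e > 0" "ball x e \<subseteq> {y. f y \<noteq> g y}" using openE[OF o, of x] ne by auto
  have sub: "{x..x + e / 2} \<subseteq> {y. f y \<noteq> g y}" using e by (auto simp: subset_iff dist_real_def)
  have "AE y in lborel. y \<notin> {y. f y \<noteq> g y}" using ae by simp
  then have "AE y in lborel. y \<notin> {x..x + e / 2}" by eventually_elim (use sub in blast)
  then have "{x..x + e / 2} \<in> null_sets lborel" by (simp add: AE_iff_null_sets)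
  then have "emeasure lborel {x..x + e / 2} = 0" by (rule null_setsD1)
  then show False using e by (simp add: emeasure_lborel_Icc_eq)
qed

text \<open>Of the five powers one pays for integrability, which leaves multipliers of order up to
  four.\<close>

lemma integrable_of_weighted_sqn:
  fixes F w :: "real \<Rightarrow> complex"
  assumes [measurable]: "F \<in> borel_measurable borel" "w \<in> borel_measurable borel"
    and F: "sqn (\<lambda>\<xi>. sqrt ((1 + \<xi>\<^sup>2) ^ 5) *\<^sub>R F \<xi>) < \<infinity>" and w: "\<And>\<xi>. norm (w \<xi>) \<le> sqrt ((1 + \<xi>\<^sup>2) ^ 4)"
  shows "integrable lborel (\<lambda>\<xi>. w \<xi> * F \<xi>)" "sqn (\<lambda>\<xi>. w \<xi> * F \<xi>) < \<infinity>"
proof -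
  have le: "sqn (\<lambda>\<xi>. sqrt (1 + \<xi>\<^sup>2) *\<^sub>R (w \<xi> * F \<xi>)) \<le> sqn (\<lambda>\<xi>. sqrt ((1 + \<xi>\<^sup>2) ^ 5) *\<^sub>R F \<xi>)"
  proof (rule sqn_mono)
    fix \<xi> :: real
    have "sqrt (1 + \<xi>\<^sup>2) * norm (w \<xi>) \<le> sqrt (1 + \<xi>\<^sup>2) * sqrt ((1 + \<xi>\<^sup>2) ^ 4)" by (intro mult_left_mono w) simp
    also have "\<dots> = sqrt ((1 + \<xi>\<^sup>2) ^ 5)" by (simp only: real_sqrt_mult[symmetric] power_Suc[symmetric]) simp
    finally have "sqrt (1 + \<xi>\<^sup>2) * norm (w \<xi>) * norm (F \<xi>) \<le> sqrt ((1 + \<xi>\<^sup>2) ^ 5) * norm (F \<xi>)" by (rule mult_right_mono) simp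
    then show "norm (sqrt (1 + \<xi>\<^sup>2) *\<^sub>R (w \<xi> * F \<xi>)) \<le> norm (sqrt ((1 + \<xi>\<^sup>2) ^ 5) *\<^sub>R F \<xi>)" by (simp add: norm_mult mult.assoc)
  qed
  obtain c where c: "c \<ge> 0" "sqn (\<lambda>\<xi>. sqrt ((1 + \<xi>\<^sup>2) ^ 5) *\<^sub>R F \<xi>) = ennreal c"
    using F by (auto simp: less_top_ennreal)
  have m: "(\<lambda>\<xi>. w \<xi> * F \<xi>) \<in> borel_measurable borel" by measurable
  have "(\<integral>\<^sup>+\<xi>. ennreal (norm (w \<xi> * F \<xi>)) \<partial>lborel)\<^sup>2 \<le> ennreal c * ennreal cauchy_mass"
    using L1_le_weighted_sqn[OF m] mult_right_mono[OF le, of "ennreal cauchy_mass"] c by auto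
  then have b: "(\<integral>\<^sup>+\<xi>. ennreal (norm (w \<xi> * F \<xi>)) \<partial>lborel)\<^sup>2 \<le> ennreal (c * cauchy_mass)"
    using c cauchy_mass_nonneg by (simp add: ennreal_mult)
  show "integrable lborel (\<lambda>\<xi>. w \<xi> * F \<xi>)"
    using c cauchy_mass_nonneg by (intro integrable_of_sq_le(1)[OF m b]) auto
  have "sqn (\<lambda>\<xi>. w \<xi> * F \<xi>) \<le> sqn (\<lambda>\<xi>. sqrt (1 + \<xi>\<^sup>2) *\<^sub>R (w \<xi> * F \<xi>))"
  proof (rule sqn_mono)
    fix \<xi> :: real
    have "1 \<le> sqrt (1 + \<xi>\<^sup>2)" by simp
    then have "1 * norm (w \<xi> * F \<xi>) \<le> sqrt (1 + \<xi>\<^sup>2) * norm (w \<xi> * F \<xi>)" by (rule mult_right_mono) simp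
    then show "norm (w \<xi> * F \<xi>) \<le> norm (sqrt (1 + \<xi>\<^sup>2) *\<^sub>R (w \<xi> * F \<xi>))" by simp
  qed
  with le F show "sqn (\<lambda>\<xi>. w \<xi> * F \<xi>) < \<infinity>" by (meson le_less_trans)
qed

lemma power_le_sqrt_weight:
  fixes \<xi> :: real
  assumes "k \<le> 4"
  shows "\<bar>\<xi>\<bar> ^ k \<le> sqrt ((1 + \<xi>\<^sup>2) ^ 4)"
proof (rule real_le_rsqrt)
  have "(\<bar>\<xi>\<bar> ^ k)\<^sup>2 = (\<xi>\<^sup>2) ^ k" by (simp add: power_mult[symmetric] mult.commute[of k 2]) (simp add: power_mult)
  also have "\<dots> \<le> (1 + \<xi>\<^sup>2) ^ k" by (intro power_mono) auto
  also have "\<dots> \<le> (1 + \<xi>\<^sup>2) ^ 4" using assms by (intro power_increasing) auto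
  finally show "(\<bar>\<xi>\<bar> ^ k)\<^sup>2 \<le> (1 + \<xi>\<^sup>2) ^ 4" .
qed

lemma wclass_fourier:
  assumes u: "wclass K u" and "w \<in> borel_measurable borel" "\<And>\<xi>. norm (w \<xi>) \<le> sqrt ((1 + \<xi>\<^sup>2) ^ 4)"
  shows "integrable lborel (\<lambda>\<xi>. w \<xi> * fourier (cr u) \<xi>)" "sqn (\<lambda>\<xi>. w \<xi> * fourier (cr u) \<xi>) < \<infinity>"
proof -
  have [measurable]: "u \<in> borel_measurable borel" using u by (rule wclass_measurable)
  have m: "fourier (cr u) \<in> borel_measurable borel" by measurable
  have "sqn (\<lambda>\<xi>. sqrt ((1 + \<xi>\<^sup>2) ^ 5) *\<^sub>R fourier (cr u) \<xi>) \<le> ennreal K" using u by (simp add: wclass_def)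
  also have "\<dots> < \<infinity>" by simp
  finally show "integrable lborel (\<lambda>\<xi>. w \<xi> * fourier (cr u) \<xi>)" "sqn (\<lambda>\<xi>. w \<xi> * fourier (cr u) \<xi>) < \<infinity>"
    using integrable_of_weighted_sqn[OF m assms(2) _ assms(3)] by blast+
qed

lemma wclass_fourier_sq:
  assumes u: "wclass K u" "K \<ge> 0" and "w \<in> borel_measurable borel" "\<And>\<xi>. norm (w \<xi>) \<le> sqrt ((1 + \<xi>\<^sup>2) ^ 4)"
  shows "integrable lborel (\<lambda>\<xi>. w \<xi> * fourier (sq u) \<xi>)"
proof -
  have [measurable]: "u \<in> borel_measurable borel" using u(1) by (rule wclass_measurable)
  have m: "fourier (sq u) \<in> borel_measurable borel" by measurable
  obtain M where "sqn (\<lambda>\<xi>. sqrt ((1 + \<xi>\<^sup>2) ^ 5) *\<^sub>R FD 0 (sq u) \<xi>) \<le> ennreal M"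
    using wclass_sq_bounds[OF u(2)] u(1) by blast
  also have "\<dots> < \<infinity>" by simp
  finally show ?thesis
    unfolding FD_0 using integrable_of_weighted_sqn(1)[OF m assms(3) _ assms(4)] by blast
qed

section \<open>Smooth representatives of the solution and its derivatives\<close>

lemma FD_reflect_has_vector_derivative:
  assumes "integrable lborel (\<lambda>x. complex_of_real (x ^ k) * G x)" "integrable lborel (\<lambda>x. complex_of_real (x ^ Suc k) * G x)"
  shows "((\<lambda>x. (-1) ^ k * FD k G (- x)) has_vector_derivative (-1) ^ Suc k * FD (Suc k) G (- x)) (at x)"
proof -
  have "((FD k G \<circ> uminus) has_vector_derivative (-1) *\<^sub>R FD (Suc k) G (- x)) (at x)"
  proof (rule vector_diff_chain_at)
    show "(uminus has_vector_derivative - (1::real)) (at x)" by (auto intro!: derivative_eq_intros)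
    show "(FD k G has_vector_derivative FD (Suc k) G (- x)) (at (- x))" by (rule FD_has_vector_derivative[OF assms])
  qed
  from has_vector_derivative_mult_right[OF this, of "(-1) ^ k"] show ?thesis by (simp add: o_def)
qed

text \<open>The smooth representative of the \<open>k\<close>-th derivative of \<open>u\<close>.\<close>

definition sder :: "nat \<Rightarrow> (real \<Rightarrow> real) \<Rightarrow> real \<Rightarrow> real" where
  "sder k u x = Re ((-1) ^ k * FD k (fourier (cr u)) (- x))"

text \<open>Since u is real, the integrand has Hermitian symmetry and the inverse transform is real,
  so taking the real part in \<open>sder\<close> loses nothing.\<close>

lemma of_real_sder: "complex_of_real (sder k u x) = (-1) ^ k * FD k (fourier (cr u)) (- x)"
proof -
  let ?f = "\<lambda>\<eta>. (- \<i> * complex_of_real \<eta>) ^ k * fourier (cr u) \<eta>"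
  have "(\<lambda>\<eta>. cnj (?f (- \<eta>))) = ?f"
  proof
    fix \<eta>
    have "cnj (fourier (cr u) (- \<eta>)) = fourier (cr u) \<eta>" by (simp add: fourier_of_real_minus)
    then show "cnj (?f (- \<eta>)) = ?f \<eta>" by simp
  qed
  note eq = this
  have "cnj (fourier ?f (- x)) = fourier (\<lambda>\<eta>. cnj (?f \<eta>)) x" by (simp only: fourier_cnj)
  also have "\<dots> = fourier (\<lambda>\<eta>. cnj (?f (- \<eta>))) (- x)" using fourier_reflect[of "\<lambda>\<eta>. cnj (?f \<eta>)" "- x"] by simp
  also have "\<dots> = fourier ?f (- x)" by (simp only: eq)
  finally have "cnj (FD k (fourier (cr u)) (- x)) = FD k (fourier (cr u)) (- x)" by (simp only: FD_def)
  then have "(-1) ^ k * FD k (fourier (cr u)) (- x) \<in> \<real>" by (intro Reals_mult Reals_power) (auto simp: Reals_cnj_iff)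
  from of_real_Re[OF this] show ?thesis unfolding sder_def .
qed

lemma wclass_integrable_monomial:
  assumes "wclass K u" "k \<le> 4"
  shows "integrable lborel (\<lambda>\<xi>. complex_of_real (\<xi> ^ k) * fourier (cr u) \<xi>)"
  by (rule wclass_fourier(1)[OF assms(1)]) (use power_le_sqrt_weight[OF assms(2)] in \<open>auto simp: norm_power power_abs\<close>)

lemma sder_has_real_derivative:
  assumes "wclass K u" "k < 4"
  shows "(sder k u has_real_derivative sder (Suc k) u x) (at x)"
proof -
  have "((\<lambda>x. (-1) ^ k * FD k (fourier (cr u)) (- x)) has_vector_derivative (-1) ^ Suc k * FD (Suc k) (fourier (cr u)) (- x)) (at x)"
    using assms by (intro FD_reflect_has_vector_derivative wclass_integrable_monomial) auto
  from bounded_linear.has_vector_derivative[OF bounded_linear_Re this] show ?thesis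
    unfolding has_real_derivative_iff_has_vector_derivative by (simp only: sder_def[abs_def])
qed

lemma continuous_on_sder:
  assumes "wclass K u" "k \<le> 4"
  shows "continuous_on UNIV (sder k u)"
  unfolding sder_def[abs_def] using assms by (intro continuous_intros wclass_integrable_monomial)

lemma abs_sder_bounded:
  assumes "wclass K u" "k \<le> 4"
  obtains B where "\<And>x. \<bar>sder k u x\<bar> \<le> B"
proof
  fix x
  have "\<bar>sder k u x\<bar> \<le> norm ((-1) ^ k * FD k (fourier (cr u)) (- x))" unfolding sder_def by (rule abs_Re_le_cmod)
  also have "\<dots> \<le> (LINT x|lborel. \<bar>x\<bar> ^ k * norm (fourier (cr u) x)) / sqrt (2 * pi)"
    by (simp add: norm_mult norm_power norm_FD_le)
  finally show "\<bar>sder k u x\<bar> \<le> (LINT x|lborel. \<bar>x\<bar> ^ k * norm (fourier (cr u) x)) / sqrt (2 * pi)" .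
qed

lemma sder_0_AE:
  assumes "wclass K u" "K \<ge> 0"
  shows "AE x in lborel. u x = sder 0 u x"
  using wclass_moment_inversion[OF assms le0]
proof eventually_elim
  case (elim x)
  then have "complex_of_real (u x) = fourier (fourier (cr u)) (- x)" by (simp add: FD_0)
  then have "Re (complex_of_real (u x)) = Re (fourier (fourier (cr u)) (- x))" by (rule arg_cong)
  then show ?case by (simp add: sder_def FD_0)
qed

lemma locally_integrable_measurable:
  assumes "locally_integrable f"
  shows "f \<in> borel_measurable borel"
proof (rule borel_measurable_LIMSEQ_real)
  show "(\<lambda>x. indicator {- real n..real n} x *\<^sub>R f x) \<in> borel_measurable borel" for n
    using assms borel_measurable_integrable unfolding locally_integrable_def set_integrable_def by fastforce
  fix x
  obtain k :: nat where k: "\<bar>x\<bar> \<le> real k" using real_arch_simple by blast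
  have "\<forall>\<^sub>F n in sequentially. indicator {- real n..real n} x *\<^sub>R f x = f x"
    using eventually_ge_at_top[of k] by eventually_elim (use k in \<open>auto split: split_indicator\<close>)
  then show "(\<lambda>n. indicator {- real n..real n} x *\<^sub>R f x) \<longlonglongrightarrow> f x" by (rule tendsto_eventually)
qed

lemma wclass_weak_derivs:
  assumes u: "wclass K u" "K \<ge> 0" and v: "has_weak_deriv u v" and w: "has_weak_deriv v w"
  shows "AE x in lborel. v x = sder 1 u x" "AE x in lborel. w x = sder 2 u x"
    "v \<in> borel_measurable borel" "w \<in> borel_measurable borel"
proof -
  show m: "v \<in> borel_measurable borel" "w \<in> borel_measurable borel"
    using v w by (auto intro!: locally_integrable_measurable simp: has_weak_deriv_def)
  show 1: "AE x in lborel. v x = sder 1 u x"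
    by (rule weak_deriv_eq_deriv[OF v sder_0_AE[OF u] wclass_measurable[OF u(1)]])
      (use sder_has_real_derivative[OF u(1), of 0] continuous_on_sder[OF u(1), of 1] in auto)
  show "AE x in lborel. w x = sder 2 u x"
    by (rule weak_deriv_eq_deriv[OF w 1 m(1)])
      (use sder_has_real_derivative[OF u(1), of 1] continuous_on_sder[OF u(1), of 2] in \<open>auto simp: numeral_2_eq_2\<close>)
qed

text \<open>The transform of the right-hand side of the equation: the Hilbert transform with two
  derivatives has the symbol i \<eta> |\<eta>|, and u u_x is half the derivative of u^2.\<close>

definition BO :: "(real \<Rightarrow> real) \<Rightarrow> real \<Rightarrow> complex" where
  "BO u \<eta> = - \<i> * complex_of_real (\<eta> * \<bar>\<eta>\<bar>) * fourier (cr u) \<eta> - \<i> / 2 * (complex_of_real \<eta> * fourier (sq u) \<eta>)"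

lemma wclass_integrable_hilbert_part:
  assumes "wclass K u"
  shows "integrable lborel (\<lambda>\<eta>. - \<i> * complex_of_real (\<eta> * \<bar>\<eta>\<bar>) * fourier (cr u) \<eta>)"
proof (rule wclass_fourier(1)[OF assms])
  fix \<xi> :: real
  show "norm (- \<i> * complex_of_real (\<xi> * \<bar>\<xi>\<bar>)) \<le> sqrt ((1 + \<xi>\<^sup>2) ^ 4)"
    using power_le_sqrt_weight[of 2 \<xi>] by (simp add: norm_mult power2_eq_square)
qed measurable

lemma wclass_integrable_sq_monomial:
  assumes "wclass K u" "K \<ge> 0" "k \<le> 4"
  shows "integrable lborel (\<lambda>\<xi>. complex_of_real (\<xi> ^ k) * fourier (sq u) \<xi>)"
  by (rule wclass_fourier_sq[OF assms(1,2)]) (use power_le_sqrt_weight[OF assms(3)] in \<open>auto simp: norm_power power_abs\<close>)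

lemma integrable_BO:
  assumes "wclass K u" "K \<ge> 0"
  shows "integrable lborel (BO u)"
  unfolding BO_def using wclass_integrable_sq_monomial[OF assms, of 1]
  by (intro Bochner_Integration.integrable_diff wclass_integrable_hilbert_part[OF assms(1)] integrable_mult_right) simp

text \<open>The second derivative has the symbol (-i \<eta>)^2, and sgn(\<eta>) (-i \<eta>)^2 = -
  \<eta> |\<eta>|.\<close>

lemma hilbert_sder:
  assumes u: "wclass K u" "K \<ge> 0" and w: "AE x in lborel. w x = sder 2 u x" "w \<in> borel_measurable borel"
  shows "complex_of_real (hilbert w x) = - fourier (\<lambda>\<eta>. - \<i> * complex_of_real (\<eta> * \<bar>\<eta>\<bar>) * fourier (cr u) \<eta>) (- x)"
proof -
  let ?G = "\<lambda>\<eta>. (- \<i> * complex_of_real \<eta>)\<^sup>2 * fourier (cr u) \<eta>"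
  have b: "norm ((- \<i> * complex_of_real \<eta>)\<^sup>2) \<le> sqrt ((1 + \<eta>\<^sup>2) ^ 4)" for \<eta> :: real
    using power_le_sqrt_weight[of 2 \<eta>] by (simp add: norm_mult norm_power)
  have G: "integrable lborel ?G" "sqn ?G < \<infinity>"
    by (rule wclass_fourier[OF u(1) _ b]; measurable)+
  have "AE x in lborel. complex_of_real (w x) = fourier ?G (- x)"
    using w(1)
  proof eventually_elim
    case (elim x)
    show ?case unfolding elim of_real_sder by (simp add: FD_def)
  qed
  from hilbert_eq_fourier[OF G w(2) this]
  have "complex_of_real (hilbert w x) = fourier (\<lambda>\<eta>. - \<i> * complex_of_real (sgn \<eta>) * ?G \<eta>) (- x)" .
  also have "(\<lambda>\<eta>. - \<i> * complex_of_real (sgn \<eta>) * ?G \<eta>) = (\<lambda>\<eta>. (-1) * (- \<i> * complex_of_real (\<eta> * \<bar>\<eta>\<bar>) * fourier (cr u) \<eta>))"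
  proof
    fix \<eta> :: real
    have "complex_of_real (sgn \<eta>) * (- \<i> * complex_of_real \<eta>)\<^sup>2 = - complex_of_real (sgn \<eta> * \<eta>\<^sup>2)" by (simp add: power_mult_distrib)
    also have "sgn \<eta> * \<eta>\<^sup>2 = \<eta> * \<bar>\<eta>\<bar>" by (simp add: sgn_if power2_eq_square)
    finally show "- \<i> * complex_of_real (sgn \<eta>) * ?G \<eta> = (-1) * (- \<i> * complex_of_real (\<eta> * \<bar>\<eta>\<bar>) * fourier (cr u) \<eta>)"
      by (metis (no_types, lifting) mult.assoc mult_minus_left mult_minus_right mult_1_left)
  qed
  also have "fourier \<dots> (- x) = (-1) * fourier (\<lambda>\<eta>. - \<i> * complex_of_real (\<eta> * \<bar>\<eta>\<bar>) * fourier (cr u) \<eta>) (- x)"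
    by (rule fourier_cmult)
  finally show ?thesis by simp
qed

text \<open>The square of the smooth representative is the inverse transform of
  \<open>fourier (sq u)\<close>, first almost everywhere and then everywhere by continuity.
  Comparing derivatives gives twice the product.\<close>

lemma sder_product:
  assumes u: "wclass K u" "K \<ge> 0"
  shows "complex_of_real (sder 0 u x * sder 1 u x) = fourier (\<lambda>\<eta>. \<i> / 2 * (complex_of_real \<eta> * fourier (sq u) \<eta>)) (- x)"
proof -
  have [measurable]: "u \<in> borel_measurable borel" using u(1) by (rule wclass_measurable)
  let ?V = "fourier (sq u)"
  have i0: "integrable lborel (\<lambda>x. complex_of_real (x ^ 0) * ?V x)" and i1: "integrable lborel (\<lambda>x. complex_of_real (x ^ Suc 0) * ?V x)"
    by (rule wclass_integrable_sq_monomial[OF u]; simp)+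
  have V: "integrable lborel ?V" using i0 by simp
  have s: "integrable lborel (sq u)" using wclass_sq_moments[OF u(1), of 0] by simp
  have "AE x in lborel. complex_of_real ((sder 0 u x)\<^sup>2) = fourier ?V (- x)"
    using fourier_inversion[OF s V] sder_0_AE[OF u]
  proof eventually_elim
    case (elim x)
    then show ?case by simp
  qed
  then have eq: "complex_of_real ((sder 0 u x)\<^sup>2) = fourier ?V (- x)" for x
    by (rule AE_lborel_continuous_eq; (intro continuous_intros continuous_on_sder[OF u(1)] V; simp)?)
  have d0: "(sder 0 u has_vector_derivative sder 1 u x) (at x)"
    using sder_has_real_derivative[OF u(1), of 0] by (simp add: has_real_derivative_iff_has_vector_derivative)
  have "((\<lambda>x. (sder 0 u x)\<^sup>2) has_real_derivative 2 * (sder 0 u x * sder 1 u x)) (at x)"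
    using sder_has_real_derivative[OF u(1), of 0 x] by (auto intro!: derivative_eq_intros)
  then have d: "((\<lambda>x. complex_of_real ((sder 0 u x)\<^sup>2)) has_vector_derivative complex_of_real (2 * (sder 0 u x * sder 1 u x))) (at x)"
    unfolding has_real_derivative_iff_has_vector_derivative
    by (rule bounded_linear.has_vector_derivative[OF bounded_linear_of_real])
  have "((\<lambda>x. (-1) ^ 0 * FD 0 ?V (- x)) has_vector_derivative (-1) ^ Suc 0 * FD (Suc 0) ?V (- x)) (at x)"
    by (rule FD_reflect_has_vector_derivative[OF i0 i1])
  moreover have "(\<lambda>x. (-1) ^ 0 * FD 0 ?V (- x)) = (\<lambda>x. complex_of_real ((sder 0 u x)\<^sup>2))"
    unfolding eq FD_0 by simp
  moreover have "(-1) ^ Suc 0 * FD (Suc 0) ?V (- x) = - FD 1 ?V (- x)" by simp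
  ultimately have "((\<lambda>x. complex_of_real ((sder 0 u x)\<^sup>2)) has_vector_derivative - FD 1 ?V (- x)) (at x)"
    by (simp only:)
  from vector_derivative_unique_at[OF d this]
  have "2 * complex_of_real (sder 0 u x * sder 1 u x) = - FD 1 ?V (- x)" by (simp only: of_real_mult of_real_numeral)
  then have "complex_of_real (sder 0 u x * sder 1 u x) = (- 1 / 2) * FD 1 ?V (- x)"
    by (metis (no_types) divide_minus_left minus_mult_left mult_1_left nonzero_mult_div_cancel_left times_divide_eq_left zero_neq_numeral)
  also have "\<dots> = fourier (\<lambda>\<eta>. (- 1 / 2) * ((- \<i> * complex_of_real \<eta>) ^ 1 * ?V \<eta>)) (- x)"
    unfolding FD_def by (rule fourier_cmult[symmetric])
  also have "(\<lambda>\<eta>. (- 1 / 2) * ((- \<i> * complex_of_real \<eta>) ^ 1 * ?V \<eta>)) = (\<lambda>\<eta>. \<i> / 2 * (complex_of_real \<eta> * ?V \<eta>))"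
    by (simp add: fun_eq_iff)
  finally show ?thesis .
qed

lemma rhs_eq_fourier_BO:
  assumes u: "wclass K u" "K \<ge> 0" and v: "has_weak_deriv u v" and w: "has_weak_deriv v w"
  shows "AE x in lborel. complex_of_real (- hilbert w x - u x * v x) = fourier (BO u) (- x)"
proof -
  note vw = wclass_weak_derivs[OF u v w]
  let ?L = "\<lambda>\<eta>. - \<i> * complex_of_real (\<eta> * \<bar>\<eta>\<bar>) * fourier (cr u) \<eta>" and ?Q = "\<lambda>\<eta>. \<i> / 2 * (complex_of_real \<eta> * fourier (sq u) \<eta>)"
  have Q: "integrable lborel ?Q"
    using wclass_integrable_sq_monomial[OF u, of 1] by (intro integrable_mult_right) simp
  have "fourier (BO u) (- x) = fourier ?L (- x) - fourier ?Q (- x)" for x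
    unfolding BO_def[abs_def] by (rule fourier_diff[OF wclass_integrable_hilbert_part[OF u(1)] Q])
  note BO = this
  show ?thesis
    using sder_0_AE[OF u] vw(1)
  proof eventually_elim
    case (elim x)
    have "complex_of_real (- hilbert w x - u x * v x) = - complex_of_real (hilbert w x) - complex_of_real (sder 0 u x * sder 1 u x)"
      by (simp add: elim)
    also have "\<dots> = fourier (BO u) (- x)"
      unfolding hilbert_sder[OF u vw(2,4)] sder_product[OF u] BO by simp
    finally show ?case .
  qed
qed

subsection \<open>Evolution of the transform\<close>

text \<open>A pure exponential is not in L2, so a value of the transform is not a pairing in L2. A
  modulated Gaussian is in L2, and pairing with it yields a Gaussian average of the
  transform.\<close>

lemma integral_inverse_transform_gaussian:
  assumes F: "AE x in lborel. F x = fourier G (- x)" and [measurable]: "F \<in> borel_measurable borel"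
    and G: "integrable lborel G" and "\<epsilon> > 0"
  shows "(LINT x|lborel. F x * (cis (- (x * \<xi>)) * gaussian (\<epsilon> * x))) = complex_of_real (sqrt (2 * pi)) * gauss_avg \<epsilon> G \<xi>"
proof -
  have [measurable]: "G \<in> borel_measurable borel" using G by auto
  have "(LINT x|lborel. F x * (cis (- (x * \<xi>)) * gaussian (\<epsilon> * x))) = (LINT x|lborel. fourier G (- x) * (cis (\<xi> * - x) * gaussian (\<epsilon> * - x)))"
    by (rule integral_cong_AE) (use F in \<open>auto simp: mult.commute elim: eventually_mono\<close>)
  also have "\<dots> = (LINT x|lborel. fourier G x * (cis (\<xi> * x) * gaussian (\<epsilon> * x)))"
    by (rule integral_reflect_lborel)
  also have "\<dots> = complex_of_real (sqrt (2 * pi)) * gauss_avg \<epsilon> G \<xi>"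
    by (rule integral_fourier_gaussian[OF G \<open>\<epsilon> > 0\<close>])
  finally show ?thesis .
qed

section \<open>Differentiable curves in L2\<close>

lemma norm_diff_sq_le: "(norm (a - b))\<^sup>2 \<le> 2 * (norm a)\<^sup>2 + 2 * (norm b)\<^sup>2"
  for a b :: "'a::real_normed_vector"
proof -
  have "(norm (a - b))\<^sup>2 \<le> (norm a + norm b)\<^sup>2" by (intro power_mono norm_triangle_ineq4) simp
  also have "\<dots> \<le> 2 * (norm a)\<^sup>2 + 2 * (norm b)\<^sup>2"
    using sum_squares_bound[of "norm a" "norm b"] by (simp add: power2_sum)
  finally show ?thesis .
qed

lemma L2_diff:
  assumes f: "f \<in> L2" and g: "g \<in> L2"
  shows "(\<lambda>x. f x - g x) \<in> L2" "(L2_norm (\<lambda>x. f x - g x))\<^sup>2 \<le> 2 * (L2_norm f)\<^sup>2 + 2 * (L2_norm g)\<^sup>2"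
proof -
  have [measurable]: "f \<in> borel_measurable borel" "g \<in> borel_measurable borel" using f g by (auto simp: L2_def)
  have i: "integrable lborel (\<lambda>x. 2 * (norm (f x))\<^sup>2 + 2 * (norm (g x))\<^sup>2)" using f g by (auto simp: L2_def)
  have fg: "integrable lborel (\<lambda>x. (norm (f x - g x))\<^sup>2)"
    by (rule Bochner_Integration.integrable_bound[OF i]) (auto intro!: AE_I2 norm_diff_sq_le)
  then show "(\<lambda>x. f x - g x) \<in> L2" by (simp add: L2_def)
  have "(LINT x|lborel. (norm (f x - g x))\<^sup>2) \<le> (LINT x|lborel. 2 * (norm (f x))\<^sup>2 + 2 * (norm (g x))\<^sup>2)"
    by (rule integral_mono[OF fg i]) (rule norm_diff_sq_le)
  also have "\<dots> = 2 * (LINT x|lborel. (norm (f x))\<^sup>2) + 2 * (LINT x|lborel. (norm (g x))\<^sup>2)"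
    using f g by (subst Bochner_Integration.integral_add) (auto simp: L2_def)
  finally show "(L2_norm (\<lambda>x. f x - g x))\<^sup>2 \<le> 2 * (L2_norm f)\<^sup>2 + 2 * (L2_norm g)\<^sup>2"
    by (simp add: L2_norm_def integral_nonneg_AE)
qed

lemma L2_mult:
  fixes e :: "real \<Rightarrow> real" and \<psi> :: "real \<Rightarrow> complex"
  assumes e: "e \<in> L2" and \<psi>: "\<psi> \<in> L2"
  shows "integrable lborel (\<lambda>x. cr e x * \<psi> x)" "norm (LINT x|lborel. cr e x * \<psi> x) \<le> L2_norm e * L2_norm \<psi>"
proof -
  have [measurable]: "e \<in> borel_measurable borel" "\<psi> \<in> borel_measurable borel" using e \<psi> by (auto simp: L2_def)
  have e2: "integrable lborel (\<lambda>x. \<bar>e x\<bar>\<^sup>2)" and p2: "integrable lborel (\<lambda>x. (norm (\<psi> x))\<^sup>2)"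
    using e \<psi> by (auto simp: L2_def)
  have me: "(\<lambda>x. \<bar>e x\<bar>) \<in> borel_measurable lborel" and mp: "(\<lambda>x. norm (\<psi> x)) \<in> borel_measurable lborel"
    by measurable
  note CS = Cauchy_Schwarz_LINT[OF me mp e2 p2]
  show i: "integrable lborel (\<lambda>x. cr e x * \<psi> x)"
    by (rule Bochner_Integration.integrable_bound[OF CS(1)]) (auto simp: norm_mult)
  have "norm (LINT x|lborel. cr e x * \<psi> x) \<le> (LINT x|lborel. \<bar>e x\<bar> * norm (\<psi> x))"
    using integral_norm_bound[of lborel "\<lambda>x. cr e x * \<psi> x"] by (simp add: norm_mult)
  also have "\<dots> \<le> L2_norm e * L2_norm \<psi>" using CS(2) by (simp add: L2_norm_def)
  finally show "norm (LINT x|lborel. cr e x * \<psi> x) \<le> L2_norm e * L2_norm \<psi>" .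
qed

lemma L2_tendsto_limit:
  assumes "L2_tendsto d R F" "\<And>i. d i \<in> L2" "F \<noteq> bot"
  shows "R \<in> L2"
proof -
  obtain i where "(\<lambda>x. d i x - R x) \<in> L2"
    using assms eventually_happens'[of F] unfolding L2_tendsto_def by blast
  from L2_diff(1)[OF assms(2)[of i] this] show ?thesis by simp
qed

lemma L2_pairing_tendsto:
  fixes d :: "'i \<Rightarrow> real \<Rightarrow> real" and \<psi> :: "real \<Rightarrow> complex"
  assumes d: "L2_tendsto d R F" "\<And>i. d i \<in> L2" and F: "F \<noteq> bot" and \<psi>: "\<psi> \<in> L2"
  shows "((\<lambda>i. LINT x|lborel. cr (d i) x * \<psi> x) \<longlongrightarrow> (LINT x|lborel. cr R x * \<psi> x)) F"
proof (rule Lim_null[THEN iffD2], rule Lim_null_comparison)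
  have R: "R \<in> L2" by (rule L2_tendsto_limit[OF d F])
  have e: "\<forall>\<^sub>F i in F. (\<lambda>x. d i x - R x) \<in> L2" using d by (simp add: L2_tendsto_def)
  then show "\<forall>\<^sub>F i in F. norm ((LINT x|lborel. cr (d i) x * \<psi> x) - (LINT x|lborel. cr R x * \<psi> x)) \<le> L2_norm (\<lambda>x. d i x - R x) * L2_norm \<psi>"
  proof eventually_elim
    case (elim i)
    have "(LINT x|lborel. cr (d i) x * \<psi> x) - (LINT x|lborel. cr R x * \<psi> x) = (LINT x|lborel. cr (d i) x * \<psi> x - cr R x * \<psi> x)"
      by (rule Bochner_Integration.integral_diff[symmetric]) (intro L2_mult d R \<psi>)+
    also have "\<dots> = (LINT x|lborel. cr (\<lambda>x. d i x - R x) x * \<psi> x)"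
      by (simp add: left_diff_distrib)
    finally show ?case using L2_mult(2)[OF elim \<psi>] by simp
  qed
  have "((\<lambda>i. L2_norm (\<lambda>x. d i x - R x)) \<longlongrightarrow> 0) F" using d by (simp add: L2_tendsto_def)
  from tendsto_mult_left_zero[OF this] show "((\<lambda>i. L2_norm (\<lambda>x. d i x - R x) * L2_norm \<psi>) \<longlongrightarrow> 0) F" .
qed

lemma L2_scale:
  fixes f :: "real \<Rightarrow> real"
  shows "f \<in> L2 \<Longrightarrow> (\<lambda>x. f x / h) \<in> L2"
  by (auto simp: L2_def power_divide)

lemma L2_difference_quotient:
  fixes u :: "real \<Rightarrow> real \<Rightarrow> real"
  assumes "\<And>s. u s \<in> L2"
  shows "(\<lambda>x. (u (t + h) x - u t x) / h) \<in> L2"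
  by (intro L2_scale L2_diff assms)

lemma L2_pairing_has_vector_derivative:
  fixes u :: "real \<Rightarrow> real \<Rightarrow> real" and \<psi> :: "real \<Rightarrow> complex"
  assumes u: "\<And>s. u s \<in> L2" and d: "L2_tendsto (\<lambda>h x. (u (t + h) x - u t x) / h) R (at 0)" and \<psi>: "\<psi> \<in> L2"
  shows "((\<lambda>s. LINT x|lborel. cr (u s) x * \<psi> x) has_vector_derivative (LINT x|lborel. cr R x * \<psi> x)) (at t)"
  unfolding has_vector_derivative_at_iff
proof (rule Lim_transform_eventually)
  show "((\<lambda>h. LINT x|lborel. cr (\<lambda>x. (u (t + h) x - u t x) / h) x * \<psi> x) \<longlongrightarrow> (LINT x|lborel. cr R x * \<psi> x)) (at 0)"
    by (rule L2_pairing_tendsto[OF d L2_difference_quotient[OF u] _ \<psi>]) simp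
  show "\<forall>\<^sub>F h in at 0. (LINT x|lborel. cr (\<lambda>x. (u (t + h) x - u t x) / h) x * \<psi> x) =
     ((LINT x|lborel. cr (u (t + h)) x * \<psi> x) - (LINT x|lborel. cr (u t) x * \<psi> x)) /\<^sub>R h"
  proof (rule eventually_at_filter[THEN iffD2], intro always_eventually allI impI)
    fix h :: real
    have "((LINT x|lborel. cr (u (t + h)) x * \<psi> x) - (LINT x|lborel. cr (u t) x * \<psi> x)) /\<^sub>R h = (LINT x|lborel. (cr (u (t + h)) x * \<psi> x - cr (u t) x * \<psi> x) /\<^sub>R h)"
      by (subst integral_scaleR_right, subst Bochner_Integration.integral_diff) (intro L2_mult u \<psi> refl)+
    also have "\<dots> = (LINT x|lborel. cr (\<lambda>x. (u (t + h) x - u t x) / h) x * \<psi> x)"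
      by (rule Bochner_Integration.integral_cong) (simp_all add: scaleR_conv_of_real field_simps)
    finally show "(LINT x|lborel. cr (\<lambda>x. (u (t + h) x - u t x) / h) x * \<psi> x) = ((LINT x|lborel. cr (u (t + h)) x * \<psi> x) - (LINT x|lborel. cr (u t) x * \<psi> x)) /\<^sub>R h" ..
  qed
qed

text \<open>With d the difference quotient, the quotient of the squared norms is twice the pairing
  of d with u(t), plus h times the squared norm of d.\<close>

lemma L2_norm_sq_has_derivative:
  fixes u :: "real \<Rightarrow> real \<Rightarrow> real"
  assumes u: "\<And>s. u s \<in> L2" and d: "L2_tendsto (\<lambda>h x. (u (t + h) x - u t x) / h) R (at 0)"
  shows "((\<lambda>s. LINT x|lborel. (u s x)\<^sup>2) has_vector_derivative 2 * (LINT x|lborel. R x * u t x)) (at t)"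
  unfolding has_vector_derivative_at_iff
proof (rule Lim_transform_eventually)
  let ?d = "\<lambda>h x. (u (t + h) x - u t x) / h"
  have dL: "?d h \<in> L2" for h by (rule L2_difference_quotient[OF u])
  have R: "R \<in> L2" by (rule L2_tendsto_limit[OF d dL]) simp
  have [measurable]: "u t \<in> borel_measurable borel" using u[of t] by (simp add: L2_def)
  have ut: "cr (u t) \<in> L2" using u[of t] by (simp add: L2_def)
  have i2: "integrable lborel (\<lambda>x. (f x)\<^sup>2)" if "f \<in> L2" for f :: "real \<Rightarrow> real" using that by (simp add: L2_def)
  have im: "integrable lborel (\<lambda>x. f x * g x)" if "f \<in> L2" "g \<in> L2" for f g :: "real \<Rightarrow> real"
    by (rule Cauchy_Schwarz_LINT) (use that in \<open>auto simp: L2_def\<close>)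
  have "((\<lambda>h. Re (LINT x|lborel. cr (?d h) x * cr (u t) x)) \<longlongrightarrow> Re (LINT x|lborel. cr R x * cr (u t) x)) (at 0)"
    by (intro tendsto_Re L2_pairing_tendsto[OF d dL _ ut]) simp
  then have p: "((\<lambda>h. LINT x|lborel. ?d h x * u t x) \<longlongrightarrow> (LINT x|lborel. R x * u t x)) (at 0)"
    by (simp only: of_real_mult[symmetric] integral_complex_of_real Re_complex_of_real)
  \<comment> \<open>The squared norm of d stays bounded near h = 0 because d converges in L2, so the
    factor h forces the limit 0.\<close>
  have q: "((\<lambda>h. h * (LINT x|lborel. (?d h x)\<^sup>2)) \<longlongrightarrow> 0) (at 0)"
  proof (rule Lim_null_comparison)
    have e: "\<forall>\<^sub>F h in at 0. (\<lambda>x. ?d h x - R x) \<in> L2" using d by (simp add: L2_tendsto_def)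
    then show "\<forall>\<^sub>F h in at 0. norm (h * (LINT x|lborel. (?d h x)\<^sup>2)) \<le> \<bar>h\<bar> * (2 * (L2_norm (\<lambda>x. ?d h x - R x))\<^sup>2 + 2 * (L2_norm R)\<^sup>2)"
    proof eventually_elim
      case (elim h)
      have mR: "(\<lambda>x. - R x) \<in> L2" using R by (simp add: L2_def)
      have "(LINT x|lborel. (?d h x)\<^sup>2) = (L2_norm (\<lambda>x. (?d h x - R x) - (- R x)))\<^sup>2"
        by (simp add: L2_norm_def integral_nonneg_AE power_divide)
      also have "\<dots> \<le> 2 * (L2_norm (\<lambda>x. ?d h x - R x))\<^sup>2 + 2 * (L2_norm (\<lambda>x. - R x))\<^sup>2"
        by (rule L2_diff(2)[OF elim mR])
      also have "L2_norm (\<lambda>x. - R x) = L2_norm R" by (simp add: L2_norm_def)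
      finally have "\<bar>h\<bar> * (LINT x|lborel. (?d h x)\<^sup>2) \<le> \<bar>h\<bar> * (2 * (L2_norm (\<lambda>x. ?d h x - R x))\<^sup>2 + 2 * (L2_norm R)\<^sup>2)"
        by (rule mult_left_mono) simp
      moreover have "(LINT x|lborel. (?d h x)\<^sup>2) \<ge> 0" by (rule integral_nonneg_AE) simp
      ultimately show ?case by (simp add: abs_mult)
    qed
    have "((\<lambda>h. L2_norm (\<lambda>x. ?d h x - R x)) \<longlongrightarrow> 0) (at 0)" using d by (simp add: L2_tendsto_def)
    then have "((\<lambda>h. \<bar>h\<bar> * (2 * (L2_norm (\<lambda>x. ?d h x - R x))\<^sup>2 + 2 * (L2_norm R)\<^sup>2)) \<longlongrightarrow> \<bar>0\<bar> * (2 * 0\<^sup>2 + 2 * (L2_norm R)\<^sup>2)) (at 0)"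
      by (intro tendsto_intros)
    then show "((\<lambda>h. \<bar>h\<bar> * (2 * (L2_norm (\<lambda>x. ?d h x - R x))\<^sup>2 + 2 * (L2_norm R)\<^sup>2)) \<longlongrightarrow> 0) (at 0)" by simp
  qed
  have "((\<lambda>h. 2 * (LINT x|lborel. ?d h x * u t x) + h * (LINT x|lborel. (?d h x)\<^sup>2)) \<longlongrightarrow> 2 * (LINT x|lborel. R x * u t x) + 0) (at 0)"
    by (intro tendsto_add tendsto_mult tendsto_const p q)
  then show "((\<lambda>h. 2 * (LINT x|lborel. ?d h x * u t x) + h * (LINT x|lborel. (?d h x)\<^sup>2)) \<longlongrightarrow> 2 * (LINT x|lborel. R x * u t x)) (at 0)" by simp
  show "\<forall>\<^sub>F h in at 0. 2 * (LINT x|lborel. ?d h x * u t x) + h * (LINT x|lborel. (?d h x)\<^sup>2) =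
     ((LINT x|lborel. (u (t + h) x)\<^sup>2) - (LINT x|lborel. (u t x)\<^sup>2)) /\<^sub>R h"
  proof (rule eventually_at_filter[THEN iffD2], intro always_eventually allI impI)
    fix h :: real assume h: "h \<noteq> 0"
    have eq: "((u (t + h) x)\<^sup>2 - (u t x)\<^sup>2) /\<^sub>R h = 2 * (?d h x * u t x) + h * (?d h x)\<^sup>2" for x
      using h by (simp add: field_simps power2_eq_square)
    have "((LINT x|lborel. (u (t + h) x)\<^sup>2) - (LINT x|lborel. (u t x)\<^sup>2)) /\<^sub>R h = (LINT x|lborel. ((u (t + h) x)\<^sup>2 - (u t x)\<^sup>2) /\<^sub>R h)"
      by (subst integral_scaleR_right, subst Bochner_Integration.integral_diff) (intro i2 u refl)+
    also have "\<dots> = (LINT x|lborel. 2 * (?d h x * u t x) + h * (?d h x)\<^sup>2)" by (simp only: eq)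
    also have "\<dots> = 2 * (LINT x|lborel. ?d h x * u t x) + h * (LINT x|lborel. (?d h x)\<^sup>2)"
      using im[OF dL u] i2[OF dL] by (subst Bochner_Integration.integral_add) (auto simp del: times_divide_eq_left)
    finally show "2 * (LINT x|lborel. ?d h x * u t x) + h * (LINT x|lborel. (?d h x)\<^sup>2) = ((LINT x|lborel. (u (t + h) x)\<^sup>2) - (LINT x|lborel. (u t x)\<^sup>2)) /\<^sub>R h" ..
  qed
qed

lemma wclass_L2:
  assumes "wclass K u"
  shows "u \<in> L2"
proof -
  have [measurable]: "u \<in> borel_measurable borel" using assms by (rule wclass_measurable)
  have "(\<integral>\<^sup>+x. ennreal (norm ((norm (u x))\<^sup>2)) \<partial>lborel) \<le> ennreal K"
    using assms by (simp add: wclass_def sqn_def)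
  also have "\<dots> < \<infinity>" by simp
  finally have "integrable lborel (\<lambda>x. (norm (u x))\<^sup>2)" by (intro integrableI_bounded) auto
  then show ?thesis by (simp add: L2_def)
qed

lemma wclass_integral_sq_le:
  assumes "wclass K u" "K \<ge> 0"
  shows "(LINT x|lborel. (u x)\<^sup>2) \<le> K"
proof -
  have "ennreal (LINT x|lborel. (u x)\<^sup>2) = (\<integral>\<^sup>+x. ennreal ((u x)\<^sup>2) \<partial>lborel)"
    using wclass_L2[OF assms(1)] by (intro nn_integral_eq_integral[symmetric]) (auto simp: L2_def)
  also have "\<dots> \<le> ennreal K" using assms(1) by (simp add: wclass_def sqn_def)
  finally show ?thesis using assms(2) by (simp add: ennreal_le_iff)
qed

text \<open>The growth constant is uniform over the class, hence over compact time intervals; it is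
  the majorant when the Gaussian averages are undone.\<close>

lemma wclass_BO_bound:
  assumes K: "K \<ge> 0"
  shows "\<exists>C\<ge>0. \<forall>u. wclass K u \<longrightarrow> (\<forall>\<eta>. norm (BO u \<eta>) \<le> C * (1 + \<eta>\<^sup>2))"
proof (intro exI[of _ "sqrt (4 * cauchy_mass * K) / sqrt (2 * pi) + K / sqrt (2 * pi)"] conjI allI impI)
  let ?A = "sqrt (4 * cauchy_mass * K) / sqrt (2 * pi)" and ?B = "K / sqrt (2 * pi)"
  show "?A + ?B \<ge> 0" using K cauchy_mass_nonneg by simp
  fix u \<eta> assume u: "wclass K u"
  have "norm (fourier (cr u) \<eta>) \<le> (LINT x|lborel. norm (cr u x)) / sqrt (2 * pi)" by (rule norm_fourier_le)
  also have "\<dots> \<le> ?A" using wclass_moments(2)[OF u le0 K] by (intro divide_right_mono) auto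
  finally have 1: "norm (fourier (cr u) \<eta>) \<le> ?A" .
  have "norm (fourier (sq u) \<eta>) \<le> (LINT x|lborel. norm (sq u x)) / sqrt (2 * pi)" by (rule norm_fourier_le)
  also have "\<dots> \<le> ?B" using wclass_integral_sq_le[OF u K] by (intro divide_right_mono) (auto simp: norm_power)
  finally have 2: "norm (fourier (sq u) \<eta>) \<le> ?B" .
  have 3: "\<bar>\<eta>\<bar> \<le> 1 + \<eta>\<^sup>2" using sum_squares_bound[of "\<bar>\<eta>\<bar>" 1] by simp
  have "norm (BO u \<eta>) \<le> norm (- \<i> * complex_of_real (\<eta> * \<bar>\<eta>\<bar>) * fourier (cr u) \<eta>) + norm (\<i> / 2 * (complex_of_real \<eta> * fourier (sq u) \<eta>))"
    unfolding BO_def by (rule norm_triangle_ineq4)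
  also have "\<dots> = \<eta>\<^sup>2 * norm (fourier (cr u) \<eta>) + \<bar>\<eta>\<bar> / 2 * norm (fourier (sq u) \<eta>)"
    by (simp add: norm_mult norm_divide abs_mult power2_eq_square)
  also have "\<dots> \<le> (1 + \<eta>\<^sup>2) * ?A + (1 + \<eta>\<^sup>2) * ?B"
    using 1 2 3 by (intro add_mono mult_mono) auto
  finally show "norm (BO u \<eta>) \<le> (?A + ?B) * (1 + \<eta>\<^sup>2)" by (simp add: algebra_simps)
qed

text \<open>The evolution clause of \<open>benjamin_ono_solution\<close>, separated from the initial
  condition.\<close>

definition BO_flow :: "(real \<Rightarrow> real \<Rightarrow> real) \<Rightarrow> bool" where
  "BO_flow u \<longleftrightarrow> (\<forall>t. \<exists>v w. has_weak_deriv (u t) v \<and> has_weak_deriv v w \<and>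
     L2_tendsto (\<lambda>h x. (u (t + h) x - u t x) / h) (\<lambda>x. - hilbert w x - u t x * v x) (at 0))"

text \<open>The time derivative exists in L2, so it may be paired with the modulated Gaussian; both
  sides then become Gaussian averages on the Fourier side.\<close>

lemma gauss_avg_transform_has_derivative:
  assumes W: "\<And>s. \<exists>K\<ge>0. wclass K (u s)" and sol: "BO_flow u" and \<epsilon>: "\<epsilon> > 0"
  shows "((\<lambda>s. gauss_avg \<epsilon> (fourier (cr (u s))) \<xi>) has_vector_derivative gauss_avg \<epsilon> (BO (u t)) \<xi>) (at t)"
proof -
  obtain v w where v: "has_weak_deriv (u t) v" and w: "has_weak_deriv v w"
    and d: "L2_tendsto (\<lambda>h x. (u (t + h) x - u t x) / h) (\<lambda>x. - hilbert w x - u t x * v x) (at 0)"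
    using sol unfolding BO_flow_def by blast
  let ?R = "\<lambda>x. - hilbert w x - u t x * v x"
  let ?\<psi> = "\<lambda>x. cis (- (x * \<xi>)) * gaussian (\<epsilon> * x)"
  define c where "c = complex_of_real (sqrt (2 * pi))"
  have c0: "c \<noteq> 0" by (simp add: c_def)
  have uL: "u s \<in> L2" for s using W[of s] wclass_L2 by blast
  have R: "?R \<in> L2" by (rule L2_tendsto_limit[OF d L2_difference_quotient[OF uL]]) simp
  have \<psi>: "?\<psi> \<in> L2"
  proof -
    have "integrable lborel (\<lambda>x. norm (gaussian (sqrt 2 * \<epsilon> * x)))"
      using \<epsilon> by (intro integrable_norm integrable_gaussian) simp
    moreover have "norm (gaussian (sqrt 2 * \<epsilon> * x)) = (norm (?\<psi> x))\<^sup>2" for x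
      by (simp add: norm_mult power_mult_distrib exp_double[symmetric])
    ultimately show ?thesis by (simp add: L2_def)
  qed
  have 1: "(LINT x|lborel. cr (u s) x * ?\<psi> x) = c * gauss_avg \<epsilon> (fourier (cr (u s))) \<xi>" for s
    unfolding c_def
  proof (rule integral_inverse_transform_gaussian)
    obtain K where K: "wclass K (u s)" "K \<ge> 0" using W by blast
    show "AE x in lborel. cr (u s) x = fourier (fourier (cr (u s))) (- x)"
      using sder_0_AE[OF K] by eventually_elim (simp add: of_real_sder FD_0)
    show "integrable lborel (fourier (cr (u s)))" using wclass_integrable_monomial[OF K(1), of 0] by simp
    have [measurable]: "u s \<in> borel_measurable borel" using K(1) by (rule wclass_measurable)
    show "cr (u s) \<in> borel_measurable borel" by measurable
  qed (rule \<epsilon>)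
  obtain K where K: "wclass K (u t)" "K \<ge> 0" using W by blast
  have "(LINT x|lborel. cr ?R x * ?\<psi> x) = c * gauss_avg \<epsilon> (BO (u t)) \<xi>"
    unfolding c_def
  proof (rule integral_inverse_transform_gaussian[OF rhs_eq_fourier_BO[OF K v w] _ integrable_BO[OF K] \<epsilon>])
    have [measurable]: "?R \<in> borel_measurable borel" using R by (simp add: L2_def)
    show "cr ?R \<in> borel_measurable borel" by measurable
  qed
  note 2 = this
  from has_vector_derivative_mult_right[OF L2_pairing_has_vector_derivative[OF uL d \<psi>], of "inverse c"]
  have "((\<lambda>s. inverse c * (c * gauss_avg \<epsilon> (fourier (cr (u s))) \<xi>)) has_vector_derivative inverse c * (c * gauss_avg \<epsilon> (BO (u t)) \<xi>)) (at t)"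
    by (simp only: 1 2)
  moreover have "inverse c * (c * z) = z" for z using c0 by simp
  ultimately show ?thesis by (simp only:)
qed

lemma continuous_on_BO:
  assumes "wclass K u" "K \<ge> 0"
  shows "continuous_on UNIV (BO u)"
proof -
  have "integrable lborel (cr u)" "integrable lborel (sq u)"
    using wclass_sq_moments[OF assms(1), of 0] wclass_moments(1)[OF assms(1) le0 assms(2)] by auto
  then show ?thesis unfolding BO_def[abs_def] by (intro continuous_intros)
qed

text \<open>The regularised equation is integrated in time, \<epsilon> is sent to 0 under the time
  integral by dominated convergence, and the result is differentiated, which is possible because
  \<open>BO (u t) \<xi>\<close> is continuous in t.\<close>

lemma fourier_BO_flow:
  assumes W: "\<And>a b. \<exists>K\<ge>0. \<forall>t\<in>{a..b}. wclass K (u t)" and sol: "BO_flow u"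
    and c: "continuous_on UNIV (\<lambda>t. fourier (cr (u t)) \<xi>)" "continuous_on UNIV (\<lambda>t. fourier (sq (u t)) \<xi>)"
  shows "((\<lambda>t. fourier (cr (u t)) \<xi>) has_vector_derivative BO (u t) \<xi>) (at t)"
proof -
  let ?U = "\<lambda>t. fourier (cr (u t))"
  have W1: "\<exists>K\<ge>0. wclass K (u s)" for s using W[of s s] by auto
  have BOc: "continuous_on UNIV (\<lambda>t. BO (u t) \<xi>)" unfolding BO_def by (intro continuous_intros c)
  have FTC: "?U y \<xi> - ?U a \<xi> = integral {a..y} (\<lambda>t. BO (u t) \<xi>)" if "a \<le> y" for a y
  proof -
    define e where "e n = inverse (real (Suc n))" for n
    have e: "e n > 0" "\<bar>e n\<bar> \<le> 1" for n by (auto simp: e_def field_simps)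
    have e0: "e \<longlonglongrightarrow> 0" unfolding e_def by (rule LIMSEQ_inverse_real_of_nat)
    obtain K where K: "K \<ge> 0" "\<And>t. t \<in> {a..y} \<Longrightarrow> wclass K (u t)" using W[of a y] by blast
    obtain C where C: "C \<ge> 0" "\<And>t \<eta>. t \<in> {a..y} \<Longrightarrow> norm (BO (u t) \<eta>) \<le> C * (1 + \<eta>\<^sup>2)"
      using wclass_BO_bound[OF K(1)] K(2) by blast
    have hi: "((\<lambda>t. gauss_avg (e n) (BO (u t)) \<xi>) has_integral (gauss_avg (e n) (?U y) \<xi> - gauss_avg (e n) (?U a) \<xi>)) {a..y}" for n
      by (rule fundamental_theorem_of_calculus[OF that])
        (rule has_vector_derivative_at_within[OF gauss_avg_transform_has_derivative[OF W1 sol e(1)]])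
    have lim: "(\<lambda>n. integral {a..y} (\<lambda>t. gauss_avg (e n) (BO (u t)) \<xi>)) \<longlonglongrightarrow> integral {a..y} (\<lambda>t. BO (u t) \<xi>)"
    proof (rule dominated_convergence(2))
      show "(\<lambda>t. gauss_avg (e n) (BO (u t)) \<xi>) integrable_on {a..y}" for n using hi by (rule has_integral_integrable)
      show "(\<lambda>t. C * (LINT z|lborel. std_normal_density z * (1 + 2 * \<xi>\<^sup>2 + 2 * z\<^sup>2))) integrable_on {a..y}"
        by (rule integrable_const_ivl)
      fix t assume t: "t \<in> {a..y}"
      have cBO: "continuous_on UNIV (BO (u t))" by (rule continuous_on_BO[OF K(2)[OF t] K(1)])
      have m: "BO (u t) \<in> borel_measurable borel" using cBO by (rule borel_measurable_continuous_onI)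
      show "norm (gauss_avg (e n) (BO (u t)) \<xi>) \<le> C * (LINT z|lborel. std_normal_density z * (1 + 2 * \<xi>\<^sup>2 + 2 * z\<^sup>2))" for n
        by (rule norm_gauss_avg_le[OF C(2)[OF t] e(2)])
      have ic: "isCont (BO (u t)) \<xi>" using cBO by (simp add: continuous_on_eq_continuous_at)
      show "(\<lambda>n. gauss_avg (e n) (BO (u t)) \<xi>) \<longlonglongrightarrow> BO (u t) \<xi>"
        by (rule gauss_avg_tendsto[OF m C(2)[OF t] ic e0 e(2)])
    qed
    have U: "(\<lambda>n. gauss_avg (e n) (?U s) \<xi>) \<longlonglongrightarrow> ?U s \<xi>" for s
    proof -
      obtain K where K: "wclass K (u s)" "K \<ge> 0" using W1 by blast
      have i: "integrable lborel (cr (u s))" using wclass_moments(1)[OF K(1) le0 K(2)] by simp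
      let ?B = "(LINT x|lborel. norm (cr (u s) x)) / sqrt (2 * pi)"
      have B0: "?B \<ge> 0" by (intro divide_nonneg_nonneg integral_nonneg_AE) auto
      have b: "norm (?U s \<eta>) \<le> ?B * (1 + \<eta>\<^sup>2)" for \<eta>
      proof -
        have "norm (?U s \<eta>) \<le> ?B * 1" unfolding mult_1_right by (rule norm_fourier_le)
        also have "\<dots> \<le> ?B * (1 + \<eta>\<^sup>2)" by (intro mult_left_mono B0) simp
        finally show ?thesis .
      qed
      have cU: "continuous_on UNIV (?U s)" by (rule continuous_on_fourier[OF i])
      then have "isCont (?U s) \<xi>" by (simp add: continuous_on_eq_continuous_at)
      from gauss_avg_tendsto[OF borel_measurable_continuous_onI[OF cU] b this e0 e(2)] show ?thesis .
    qed
    have "(\<lambda>n. integral {a..y} (\<lambda>t. gauss_avg (e n) (BO (u t)) \<xi>)) \<longlonglongrightarrow> ?U y \<xi> - ?U a \<xi>"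
      unfolding integral_unique[OF hi] by (intro tendsto_diff U)
    from LIMSEQ_unique[OF this lim] show ?thesis .
  qed
  \<comment> \<open>Starting at t - 1 makes t an interior point, so the derivative is
    two-sided.\<close>
  have "((\<lambda>s. integral {t - 1..s} (\<lambda>t. BO (u t) \<xi>)) has_vector_derivative BO (u t) \<xi>) (at t within {t - 1..t + 1})"
    by (rule integral_has_vector_derivative) (auto intro: continuous_on_subset[OF BOc])
  then have "((\<lambda>s. integral {t - 1..s} (\<lambda>t. BO (u t) \<xi>)) has_vector_derivative BO (u t) \<xi>) (at t)"
    by (subst (asm) at_within_interior) (auto simp: interior_atLeastAtMost_real)
  from has_vector_derivative_add[OF has_vector_derivative_const[of "?U (t - 1) \<xi>"] this]
  have "((\<lambda>s. ?U (t - 1) \<xi> + integral {t - 1..s} (\<lambda>t. BO (u t) \<xi>)) has_vector_derivative BO (u t) \<xi>) (at t)" by simp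
  then show ?thesis
  proof (rule has_vector_derivative_transform_within_open[of _ _ _ "{t - 1<..}"])
    fix s assume "s \<in> {t - 1<..}"
    then show "?U (t - 1) \<xi> + integral {t - 1..s} (\<lambda>t. BO (u t) \<xi>) = ?U s \<xi>"
      using FTC[of "t - 1" s] by (simp add: algebra_simps)
  qed auto
qed

section \<open>Conservation of the square norm\<close>

lemma transform_pairing:
  assumes G: "integrable lborel G" and f: "integrable lborel f"
  shows "(LINT x|lborel. fourier G (- x) * f x) = (LINT \<eta>|lborel. G \<eta> * fourier f (- \<eta>))"
proof -
  have "(LINT x|lborel. fourier G (- x) * f x) = (LINT x|lborel. fourier G (- (- x)) * f (- x))"
    by (rule integral_reflect_lborel[symmetric])
  also have "\<dots> = (LINT x|lborel. fourier G x * f (- x))" by simp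
  also have "\<dots> = (LINT \<eta>|lborel. G \<eta> * fourier (\<lambda>x. f (- x)) \<eta>)"
    by (rule fourier_multiplication[OF G]) (use f in \<open>simp add: integrable_reflect_lborel\<close>)
  finally show ?thesis by (simp only: fourier_reflect)
qed

lemma integrable_mult_fourier:
  assumes G: "integrable lborel G" and f: "integrable lborel f"
  shows "integrable lborel (\<lambda>\<eta>. G \<eta> * fourier f (- \<eta>))"
proof (rule Bochner_Integration.integrable_bound)
  have [measurable]: "G \<in> borel_measurable borel" "f \<in> borel_measurable borel" using f G by auto
  let ?B = "(LINT x|lborel. norm (f x)) / sqrt (2 * pi)"
  show "integrable lborel (\<lambda>\<eta>. norm (G \<eta>) * ?B)" using G by (intro integrable_mult_left integrable_norm)
  show "(\<lambda>\<eta>. G \<eta> * fourier f (- \<eta>)) \<in> borel_measurable lborel" by measurable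
  show "AE \<eta> in lborel. norm (G \<eta> * fourier f (- \<eta>)) \<le> norm (norm (G \<eta>) * ?B)"
  proof (rule AE_I2)
    fix \<eta>
    have "norm (fourier f (- \<eta>)) \<le> ?B" by (rule norm_fourier_le)
    moreover have "?B \<le> \<bar>?B\<bar>" by simp
    ultimately have "norm (fourier f (- \<eta>)) \<le> \<bar>?B\<bar>" by linarith
    then have "norm (G \<eta>) * norm (fourier f (- \<eta>)) \<le> norm (G \<eta>) * \<bar>?B\<bar>" by (rule mult_left_mono) simp
    then show "norm (G \<eta> * fourier f (- \<eta>)) \<le> norm (norm (G \<eta>) * ?B)" by (simp only: norm_mult real_norm_def abs_mult abs_norm_cancel)
  qed
qed

text \<open>The dispersive part vanishes because its integrand on the Fourier side is odd in \<eta>.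
  The nonlinear part is the integral of g^2 g' = (g^3 / 3)', with g the smooth representative of
  u.\<close>

lemma integral_rhs_mult_eq_0:
  assumes K: "wclass K u" "K \<ge> 0" and v: "has_weak_deriv u v" and w: "has_weak_deriv v w"
    and m: "(\<lambda>x. - hilbert w x - u x * v x) \<in> borel_measurable borel"
  shows "(LINT x|lborel. (- hilbert w x - u x * v x) * u x) = 0"
proof -
  have [measurable]: "u \<in> borel_measurable borel" using K(1) by (rule wclass_measurable)
  note [measurable] = m
  have i: "integrable lborel (cr u)" using wclass_moments(1)[OF K(1) le0 K(2)] by simp
  let ?U = "fourier (cr u)"
  let ?L = "\<lambda>\<eta>. - \<i> * complex_of_real (\<eta> * \<bar>\<eta>\<bar>) * ?U \<eta>" and ?Q = "\<lambda>\<eta>. \<i> / 2 * (complex_of_real \<eta> * fourier (sq u) \<eta>)"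
  have L: "integrable lborel ?L" by (rule wclass_integrable_hilbert_part[OF K(1)])
  have Q: "integrable lborel ?Q"
    using wclass_integrable_sq_monomial[OF K, of 1] by (intro integrable_mult_right) simp
  have BO: "integrable lborel (BO u)" by (rule integrable_BO[OF K])
  then have [measurable]: "BO u \<in> borel_measurable borel" by auto
  have Q0: "(LINT \<eta>|lborel. ?Q \<eta> * ?U (- \<eta>)) = 0"
  proof -
    let ?g = "sder 0 u" and ?g' = "sder 1 u"
    have "(LINT \<eta>|lborel. ?Q \<eta> * ?U (- \<eta>)) = (LINT x|lborel. fourier ?Q (- x) * cr u x)"
      by (rule transform_pairing[OF Q i, symmetric])
    also have "\<dots> = (LINT x|lborel. complex_of_real (?g x * ?g' x) * cr u x)" by (simp only: sder_product[OF K])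
    also have "\<dots> = (LINT x|lborel. complex_of_real (?g x * ?g' x * u x))" by (simp only: of_real_mult)
    also have "\<dots> = complex_of_real (LINT x|lborel. ?g x * ?g' x * u x)" by (rule integral_complex_of_real)
    also have "(LINT x|lborel. ?g x * ?g' x * u x) = (LINT x|lborel. (?g x)\<^sup>2 * ?g' x)"
    proof (rule integral_cong_AE)
      have [measurable]: "?g \<in> borel_measurable borel" "?g' \<in> borel_measurable borel"
        by (rule borel_measurable_continuous_onI[OF continuous_on_sder[OF K(1)]]; simp)+
      show "(\<lambda>x. ?g x * ?g' x * u x) \<in> borel_measurable lborel" "(\<lambda>x. (?g x)\<^sup>2 * ?g' x) \<in> borel_measurable lborel" by measurable
      show "AE x in lborel. ?g x * ?g' x * u x = (?g x)\<^sup>2 * ?g' x"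
        using sder_0_AE[OF K] by eventually_elim (simp add: power2_eq_square)
    qed
    also have "\<dots> = 0"
    proof (rule integral_of_derivative_eq_0[where F="\<lambda>x. (?g x) ^ 3 / 3"])
      have cg: "continuous_on UNIV ?g" "continuous_on UNIV ?g'" by (rule continuous_on_sder[OF K(1)]; simp)+
      then have [measurable]: "?g \<in> borel_measurable borel" "?g' \<in> borel_measurable borel"
        by (auto intro: borel_measurable_continuous_onI)
      have "integrable lborel (\<lambda>x. (norm (u x))\<^sup>2)" using wclass_L2[OF K(1)] by (simp add: L2_def)
      then have g2: "integrable lborel (\<lambda>x. (?g x)\<^sup>2)"
        by (rule integrable_cong_AE_imp) (use sder_0_AE[OF K] in auto)
      have bd: "integrable lborel (\<lambda>x. (?g x)\<^sup>2 * f x)" if f: "continuous_on UNIV f" "\<And>x. \<bar>f x\<bar> \<le> B" for f B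
      proof (rule Bochner_Integration.integrable_bound)
        have [measurable]: "f \<in> borel_measurable borel" using f(1) by (rule borel_measurable_continuous_onI)
        show "integrable lborel (\<lambda>x. (?g x)\<^sup>2 * B)" using g2 by simp
        show "(\<lambda>x. (?g x)\<^sup>2 * f x) \<in> borel_measurable lborel" by measurable
        show "AE x in lborel. norm ((?g x)\<^sup>2 * f x) \<le> norm ((?g x)\<^sup>2 * B)"
        proof (rule AE_I2)
          fix x
          have "\<bar>f x\<bar> \<le> \<bar>B\<bar>" using f(2)[of x] by linarith
          then show "norm ((?g x)\<^sup>2 * f x) \<le> norm ((?g x)\<^sup>2 * B)" by (simp add: abs_mult mult_left_mono)
        qed
      qed
      obtain B0 where B0: "\<And>x. \<bar>?g x\<bar> \<le> B0" using abs_sder_bounded[OF K(1), of 0] by auto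
      obtain B1 where B1: "\<And>x. \<bar>?g' x\<bar> \<le> B1" using abs_sder_bounded[OF K(1), of 1] by auto
      have "integrable lborel (\<lambda>x. (?g x)\<^sup>2 * ?g x / 3)" by (intro integrable_divide bd[OF cg(1) B0])
      then show "integrable lborel (\<lambda>x. (?g x) ^ 3 / 3)" by (simp add: power2_eq_square power3_eq_cube)
      show "integrable lborel (\<lambda>x. (?g x)\<^sup>2 * ?g' x)" by (rule bd[OF cg(2) B1])
      show "((\<lambda>x. (?g x) ^ 3 / 3) has_vector_derivative (?g x)\<^sup>2 * ?g' x) (at x)" for x
        unfolding has_real_derivative_iff_has_vector_derivative[symmetric]
        using sder_has_real_derivative[OF K(1), of 0 x] by (auto intro!: derivative_eq_intros)
    qed
    finally show ?thesis by simp
  qed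
  have L0: "(LINT \<eta>|lborel. ?L \<eta> * ?U (- \<eta>)) = 0"
  proof -
    let ?h = "\<lambda>\<eta>. ?L \<eta> * ?U (- \<eta>)"
    have "(LINT \<eta>|lborel. ?h \<eta>) = (LINT \<eta>|lborel. ?h (- \<eta>))" by (rule integral_reflect_lborel[symmetric])
    also have "(\<lambda>\<eta>. ?h (- \<eta>)) = (\<lambda>\<eta>. - ?h \<eta>)" by (simp add: fun_eq_iff)
    also have "(LINT \<eta>|lborel. - ?h \<eta>) = - (LINT \<eta>|lborel. ?h \<eta>)" by (rule integral_minus)
    finally have "2 * (LINT \<eta>|lborel. ?h \<eta>) = 0" unfolding mult_2 by (simp only: eq_neg_iff_add_eq_0)
    then show ?thesis by (simp only: mult_eq_0_iff) simp
  qed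
  have "complex_of_real (LINT x|lborel. (- hilbert w x - u x * v x) * u x) = (LINT x|lborel. complex_of_real (- hilbert w x - u x * v x) * cr u x)"
    by (simp only: of_real_mult[symmetric] integral_complex_of_real)
  also have "\<dots> = (LINT x|lborel. fourier (BO u) (- x) * cr u x)"
  proof (rule integral_cong_AE)
    have "cr (\<lambda>x. - hilbert w x - u x * v x) \<in> borel_measurable borel" by measurable
    then show "(\<lambda>x. complex_of_real (- hilbert w x - u x * v x) * cr u x) \<in> borel_measurable lborel" by simp
    show "(\<lambda>x. fourier (BO u) (- x) * cr u x) \<in> borel_measurable lborel" by measurable
    show "AE x in lborel. complex_of_real (- hilbert w x - u x * v x) * cr u x = fourier (BO u) (- x) * cr u x"
      using rhs_eq_fourier_BO[OF K v w] by eventually_elim (simp only:)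
  qed
  also have "\<dots> = (LINT \<eta>|lborel. BO u \<eta> * ?U (- \<eta>))" by (rule transform_pairing[OF BO i])
  also have "\<dots> = (LINT \<eta>|lborel. ?L \<eta> * ?U (- \<eta>) - ?Q \<eta> * ?U (- \<eta>))" by (simp only: BO_def left_diff_distrib)
  also have "\<dots> = 0"
    by (subst Bochner_Integration.integral_diff[OF integrable_mult_fourier[OF L i] integrable_mult_fourier[OF Q i]]) (simp only: L0 Q0 diff_self)
  finally show ?thesis by (simp only: of_real_eq_0_iff)
qed

lemma BO_flow_mass:
  assumes W: "\<And>s. \<exists>K\<ge>0. wclass K (u s)" and sol: "BO_flow u"
  shows "(LINT x|lborel. (u t x)\<^sup>2) = (LINT x|lborel. (u 0 x)\<^sup>2)"
proof -
  have uL: "u s \<in> L2" for s using W[of s] wclass_L2 by blast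
  have "((\<lambda>s. LINT x|lborel. (u s x)\<^sup>2) has_real_derivative 0) (at s)" for s
  proof -
    obtain v w where v: "has_weak_deriv (u s) v" and w: "has_weak_deriv v w"
      and d: "L2_tendsto (\<lambda>h x. (u (s + h) x - u s x) / h) (\<lambda>x. - hilbert w x - u s x * v x) (at 0)"
      using sol unfolding BO_flow_def by blast
    obtain K where K: "wclass K (u s)" "K \<ge> 0" using W by blast
    have "(\<lambda>x. - hilbert w x - u s x * v x) \<in> L2" by (rule L2_tendsto_limit[OF d L2_difference_quotient[OF uL]]) simp
    then have "(\<lambda>x. - hilbert w x - u s x * v x) \<in> borel_measurable borel" by (simp add: L2_def)
    from integral_rhs_mult_eq_0[OF K v w this] L2_norm_sq_has_derivative[OF uL d] show ?thesis
      by (simp add: has_real_derivative_iff_has_vector_derivative)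
  qed
  then show ?thesis by (intro DERIV_isconst_all) auto
qed

lemma cis_linear_has_vector_derivative:
  "((\<lambda>x. cis (a * x)) has_vector_derivative \<i> * complex_of_real a * cis (a * x)) (at x)"
proof -
  have "((\<lambda>z. exp (\<i> * complex_of_real a * z)) has_field_derivative \<i> * complex_of_real a * exp (\<i> * complex_of_real a * complex_of_real x)) (at (complex_of_real x))"
    by (auto intro!: derivative_eq_intros)
  from has_vector_derivative_real_field[OF this] show ?thesis
    by (simp add: cis_conv_exp mult.assoc)
qed

text \<open>For \<xi> > 0 the symbol \<xi> |\<xi>| is \<xi>^2, so cis(T \<xi>^2 \<sigma>) is an
  integrating factor along the path T \<sigma>; the linear terms cancel and only the transform of
  u^2 is integrated.\<close>

lemma BO_flow_Duhamel:
  assumes flow: "\<And>t. ((\<lambda>t. fourier (cr (u t)) \<xi>) has_vector_derivative BO (u t) \<xi>) (at t)" and \<xi>: "\<xi> > 0"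
  shows "fourier (cr (u T)) \<xi> = cis (- (T * \<xi>\<^sup>2)) * fourier (cr (u 0)) \<xi> -
       \<i> / 2 * complex_of_real T * integral {0..1} (\<lambda>\<sigma>. cis (- (T * (1 - \<sigma>) * \<xi>\<^sup>2)) * (complex_of_real \<xi> * fourier (sq (u (T * \<sigma>))) \<xi>))"
proof -
  let ?U = "\<lambda>t. fourier (cr (u t)) \<xi>" and ?V = "\<lambda>t. complex_of_real \<xi> * fourier (sq (u t)) \<xi>"
  let ?f = "\<lambda>\<sigma>. cis (- (T * (1 - \<sigma>) * \<xi>\<^sup>2)) * ?V (T * \<sigma>)"
  define c where "c = cis (- (T * \<xi>\<^sup>2))"
  define k where "k = - \<i> / 2 * complex_of_real T"
  let ?q = "\<lambda>\<sigma>. c * (cis (T * \<xi>\<^sup>2 * \<sigma>) * ?U (T * \<sigma>))"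
  have q: "(?q has_vector_derivative k * ?f \<sigma>) (at \<sigma>)" for \<sigma>
  proof -
    have "((?U \<circ> (\<lambda>\<sigma>. T * \<sigma>)) has_vector_derivative T *\<^sub>R BO (u (T * \<sigma>)) \<xi>) (at \<sigma>)"
      by (rule vector_diff_chain_at) (auto intro!: derivative_eq_intros flow simp: has_real_derivative_iff_has_vector_derivative[symmetric])
    then have "((\<lambda>\<sigma>. ?U (T * \<sigma>)) has_vector_derivative complex_of_real T * BO (u (T * \<sigma>)) \<xi>) (at \<sigma>)"
      by (simp add: o_def scaleR_conv_of_real)
    from has_vector_derivative_mult_right[OF has_vector_derivative_mult[OF cis_linear_has_vector_derivative[of "T * \<xi>\<^sup>2"] this], of c]
    have d: "(?q has_vector_derivative c * (cis (T * \<xi>\<^sup>2 * \<sigma>) * (complex_of_real T * BO (u (T * \<sigma>)) \<xi>) +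
       \<i> * complex_of_real (T * \<xi>\<^sup>2) * cis (T * \<xi>\<^sup>2 * \<sigma>) * ?U (T * \<sigma>))) (at \<sigma>)" .
    have "c * cis (T * \<xi>\<^sup>2 * \<sigma>) = cis (- (T * (1 - \<sigma>) * \<xi>\<^sup>2))" by (simp add: c_def cis_mult algebra_simps)
    then have f: "k * ?f \<sigma> = k * (c * cis (T * \<xi>\<^sup>2 * \<sigma>)) * ?V (T * \<sigma>)" by simp
    have B: "BO (u (T * \<sigma>)) \<xi> = - \<i> * complex_of_real (\<xi>\<^sup>2) * ?U (T * \<sigma>) - \<i> / 2 * ?V (T * \<sigma>)"
      using \<xi> by (simp add: BO_def power2_eq_square)
    have alg: "c * (e * (t * (- \<i> * x2 * U - \<i> / 2 * V)) + \<i> * (t * x2) * e * U) = - \<i> / 2 * t * (c * e) * V" for e t x2 U V :: complex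
      by (simp add: algebra_simps)
    have "c * (cis (T * \<xi>\<^sup>2 * \<sigma>) * (complex_of_real T * BO (u (T * \<sigma>)) \<xi>) +
       \<i> * complex_of_real (T * \<xi>\<^sup>2) * cis (T * \<xi>\<^sup>2 * \<sigma>) * ?U (T * \<sigma>)) = k * ?f \<sigma>"
      unfolding B f of_real_mult[of T] unfolding k_def by (rule alg)
    with d show ?thesis by (simp only:)
  qed
  have "((\<lambda>\<sigma>. k * ?f \<sigma>) has_integral ?q 1 - ?q 0) {0..1}"
    by (rule fundamental_theorem_of_calculus[OF _ has_vector_derivative_at_within[OF q]]) simp
  then have "?q 1 - ?q 0 = k * integral {0..1} ?f" unfolding integral_mult_right[symmetric] by (rule integral_unique[symmetric])
  moreover have "?q 1 = ?U T"
  proof -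
    have "c * cis (T * \<xi>\<^sup>2 * 1) = 1" by (simp add: c_def cis_mult)
    then have "c * cis (T * \<xi>\<^sup>2 * 1) * ?U T = ?U T" by simp
    then show ?thesis by (simp only: mult.assoc mult_1_right)
  qed
  moreover have "?q 0 = c * ?U 0" by simp
  ultimately have "?U T = c * ?U 0 + k * integral {0..1} ?f" by (simp only: diff_eq_eq add.commute)
  then show ?thesis unfolding c_def k_def by simp
qed

subsection \<open>Membership and continuity in the weighted spaces\<close>

lemma L2_iff_sqn: "f \<in> L2 \<longleftrightarrow> f \<in> borel_measurable borel \<and> sqn f < \<infinity>"
  by (auto simp: L2_def sqn_def integrable_iff_bounded)

lemma powr_five_halves: "(1 + \<xi>\<^sup>2) powr (5 / 2) = sqrt ((1 + \<xi>\<^sup>2) ^ 5)" for \<xi> :: real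
  by (simp add: powr_half_sqrt_powr)

lemma has_fourier_L2_diff:
  assumes f: "has_fourier_L2 f F" and g: "has_fourier_L2 g G" and fi: "integrable lborel f" and gi: "integrable lborel g"
  shows "has_fourier_L2 (\<lambda>x. f x - g x) (\<lambda>\<xi>. F \<xi> - G \<xi>)"
  unfolding has_fourier_L2_def
proof (intro conjI)
  show "(\<lambda>x. f x - g x) \<in> L2" "(\<lambda>\<xi>. F \<xi> - G \<xi>) \<in> L2"
    using f g by (auto intro: L2_diff simp: has_fourier_L2_def)
  let ?t = "\<lambda>f (n::nat) x. indicator {- real n..real n} x * f x :: complex"
  have t: "integrable lborel (?t f n)" if "integrable lborel f" for f n
    using integrable_mult_indicator[of "{- real n..real n}" lborel f] that
    by (simp add: indicator_scaleR_complex mult.commute)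
  have eq: "fourier (?t (\<lambda>x. f x - g x) n) \<xi> - (F \<xi> - G \<xi>) = (fourier (?t f n) \<xi> - F \<xi>) - (fourier (?t g n) \<xi> - G \<xi>)" for n \<xi>
    using fourier_diff[OF t[OF fi] t[OF gi]] by (simp add: right_diff_distrib)
  let ?a = "\<lambda>n. L2_norm (\<lambda>\<xi>. fourier (?t f n) \<xi> - F \<xi>)" and ?b = "\<lambda>n. L2_norm (\<lambda>\<xi>. fourier (?t g n) \<xi> - G \<xi>)"
  have e: "\<forall>\<^sub>F n in sequentially. (\<lambda>\<xi>. fourier (?t f n) \<xi> - F \<xi>) \<in> L2" "\<forall>\<^sub>F n in sequentially. (\<lambda>\<xi>. fourier (?t g n) \<xi> - G \<xi>) \<in> L2"
    and l: "?a \<longlonglongrightarrow> 0" "?b \<longlonglongrightarrow> 0"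
    using f g by (auto simp: has_fourier_L2_def L2_tendsto_def)
  show "L2_tendsto (\<lambda>n. fourier (?t (\<lambda>x. f x - g x) n)) (\<lambda>\<xi>. F \<xi> - G \<xi>) sequentially"
    unfolding L2_tendsto_def eq
  proof
    show "\<forall>\<^sub>F n in sequentially. (\<lambda>\<xi>. (fourier (?t f n) \<xi> - F \<xi>) - (fourier (?t g n) \<xi> - G \<xi>)) \<in> L2"
      using e by eventually_elim (rule L2_diff)
    show "(\<lambda>n. L2_norm (\<lambda>\<xi>. (fourier (?t f n) \<xi> - F \<xi>) - (fourier (?t g n) \<xi> - G \<xi>))) \<longlonglongrightarrow> 0"
    proof (rule Lim_null_comparison)
      show "\<forall>\<^sub>F n in sequentially. norm (L2_norm (\<lambda>\<xi>. (fourier (?t f n) \<xi> - F \<xi>) - (fourier (?t g n) \<xi> - G \<xi>))) \<le> sqrt (2 * (?a n)\<^sup>2 + 2 * (?b n)\<^sup>2)"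
        using e
      proof eventually_elim
        case (elim n)
        have "0 \<le> L2_norm (\<lambda>\<xi>. (fourier (?t f n) \<xi> - F \<xi>) - (fourier (?t g n) \<xi> - G \<xi>))"
          unfolding L2_norm_def by (intro real_sqrt_ge_zero integral_nonneg_AE) simp
        then show ?case using real_le_rsqrt[OF L2_diff(2)[OF elim]] by simp
      qed
      have "(\<lambda>n. sqrt (2 * (?a n)\<^sup>2 + 2 * (?b n)\<^sup>2)) \<longlonglongrightarrow> sqrt (2 * 0\<^sup>2 + 2 * 0\<^sup>2)" by (intro tendsto_intros l)
      then show "(\<lambda>n. sqrt (2 * (?a n)\<^sup>2 + 2 * (?b n)\<^sup>2)) \<longlonglongrightarrow> 0" by simp
    qed
  qed
qed

text \<open>\<open>sobolev_norm\<close> uses a transform chosen by \<open>SOME\<close>; any choice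
  agrees almost everywhere with \<open>fourier f\<close> for integrable f.\<close>

lemma sobolev_sqn:
  assumes f: "f \<in> sobolev s" and i: "integrable lborel f"
  shows "sqn (\<lambda>\<xi>. (1 + \<xi>\<^sup>2) powr (s / 2) *\<^sub>R fourier f \<xi>) = ennreal ((sobolev_norm s f)\<^sup>2)"
proof -
  obtain F where F: "has_fourier_L2 f F" "(\<lambda>\<xi>. complex_of_real ((1 + \<xi>\<^sup>2) powr (s / 2)) * F \<xi>) \<in> L2"
    using f by (auto simp: sobolev_def)
  have F': "has_fourier_L2 f (fourier_L2 f)" unfolding fourier_L2_def by (rule someI[of "has_fourier_L2 f", OF F(1)])
  have [measurable]: "fourier_L2 f \<in> borel_measurable borel" using F' by (simp add: has_fourier_L2_def L2_def)
  have ae: "AE \<xi> in lborel. fourier_L2 f \<xi> = fourier f \<xi>" by (rule has_fourier_L2_AE[OF F' i])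
  have "sqn (\<lambda>\<xi>. complex_of_real ((1 + \<xi>\<^sup>2) powr (s / 2)) * fourier_L2 f \<xi>) = sqn (\<lambda>\<xi>. complex_of_real ((1 + \<xi>\<^sup>2) powr (s / 2)) * F \<xi>)"
  proof (rule sqn_cong_AE)
    show "AE \<xi> in lborel. complex_of_real ((1 + \<xi>\<^sup>2) powr (s / 2)) * fourier_L2 f \<xi> = complex_of_real ((1 + \<xi>\<^sup>2) powr (s / 2)) * F \<xi>"
      using ae has_fourier_L2_AE[OF F(1) i] by eventually_elim simp
  qed
  also have "\<dots> < \<infinity>" using F(2) by (simp add: L2_iff_sqn)
  finally have "(\<lambda>\<xi>. complex_of_real ((1 + \<xi>\<^sup>2) powr (s / 2)) * fourier_L2 f \<xi>) \<in> L2" by (simp add: L2_iff_sqn)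
  from sqn_L2[OF this] have "sqn (\<lambda>\<xi>. complex_of_real ((1 + \<xi>\<^sup>2) powr (s / 2)) * fourier_L2 f \<xi>) = ennreal ((sobolev_norm s f)\<^sup>2)"
    by (simp only: sobolev_norm_def)
  moreover have "sqn (\<lambda>\<xi>. (1 + \<xi>\<^sup>2) powr (s / 2) *\<^sub>R fourier f \<xi>) = sqn (\<lambda>\<xi>. complex_of_real ((1 + \<xi>\<^sup>2) powr (s / 2)) * fourier_L2 f \<xi>)"
  proof (rule sqn_cong_AE)
    show "AE \<xi> in lborel. (1 + \<xi>\<^sup>2) powr (s / 2) *\<^sub>R fourier f \<xi> = complex_of_real ((1 + \<xi>\<^sup>2) powr (s / 2)) * fourier_L2 f \<xi>"
      using ae by eventually_elim (simp add: scaleR_conv_of_real)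
  qed
  ultimately show ?thesis by simp
qed

lemma sobolev_diff:
  assumes "f \<in> sobolev s" "g \<in> sobolev s" "integrable lborel f" "integrable lborel g"
  shows "(\<lambda>x. f x - g x) \<in> sobolev s"
proof -
  obtain F G where F: "has_fourier_L2 f F" "(\<lambda>\<xi>. complex_of_real ((1 + \<xi>\<^sup>2) powr (s / 2)) * F \<xi>) \<in> L2"
    and G: "has_fourier_L2 g G" "(\<lambda>\<xi>. complex_of_real ((1 + \<xi>\<^sup>2) powr (s / 2)) * G \<xi>) \<in> L2"
    using assms(1,2) by (auto simp: sobolev_def)
  have "(\<lambda>\<xi>. complex_of_real ((1 + \<xi>\<^sup>2) powr (s / 2)) * (F \<xi> - G \<xi>)) \<in> L2"
    using L2_diff(1)[OF F(2) G(2)] by (simp only: right_diff_distrib)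
  with has_fourier_L2_diff[OF F(1) G(1) assms(3,4)] show ?thesis unfolding sobolev_def by blast
qed

lemma Zdot_diff:
  assumes "f \<in> Zdot s r" "g \<in> Zdot s r"
  shows "(\<lambda>x. f x - g x) \<in> Zdot s r"
  using assms L2_diff(1)[of "\<lambda>x. complex_of_real (\<bar>x\<bar> powr r) * f x" "\<lambda>x. complex_of_real (\<bar>x\<bar> powr r) * g x"]
  by (auto simp: Zdot_def right_diff_distrib fourier_diff intro: sobolev_diff)

lemma Zdot_sqn:
  assumes "f \<in> Zdot s r"
  shows "sqn (\<lambda>\<xi>. (1 + \<xi>\<^sup>2) powr (s / 2) *\<^sub>R fourier f \<xi>) \<le> ennreal ((Zdot_norm s r f)\<^sup>2)"
    "sqn (\<lambda>x. complex_of_real (\<bar>x\<bar> powr r) * f x) \<le> ennreal ((Zdot_norm s r f)\<^sup>2)"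
proof -
  have n: "L2_norm h \<ge> 0" for h :: "real \<Rightarrow> complex"
    unfolding L2_norm_def by (intro real_sqrt_ge_zero integral_nonneg_AE) simp
  have sn: "sobolev_norm s f \<ge> 0" unfolding sobolev_norm_def by (rule n)
  have "sqn (\<lambda>\<xi>. (1 + \<xi>\<^sup>2) powr (s / 2) *\<^sub>R fourier f \<xi>) = ennreal ((sobolev_norm s f)\<^sup>2)"
    using assms by (intro sobolev_sqn) (auto simp: Zdot_def)
  also have "\<dots> \<le> ennreal ((Zdot_norm s r f)\<^sup>2)"
    using n sn unfolding Zdot_norm_def by (intro ennreal_leI power_mono) auto
  finally show "sqn (\<lambda>\<xi>. (1 + \<xi>\<^sup>2) powr (s / 2) *\<^sub>R fourier f \<xi>) \<le> ennreal ((Zdot_norm s r f)\<^sup>2)" .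
  have "sqn (\<lambda>x. complex_of_real (\<bar>x\<bar> powr r) * f x) = ennreal ((L2_norm (\<lambda>x. complex_of_real (\<bar>x\<bar> powr r) * f x))\<^sup>2)"
    using assms by (intro sqn_L2) (auto simp: Zdot_def)
  also have "\<dots> \<le> ennreal ((Zdot_norm s r f)\<^sup>2)"
    using n sn unfolding Zdot_norm_def by (intro ennreal_leI power_mono) auto
  finally show "sqn (\<lambda>x. complex_of_real (\<bar>x\<bar> powr r) * f x) \<le> ennreal ((Zdot_norm s r f)\<^sup>2)" .
qed

lemma sqn_abs_powr_numeral:
  "sqn (\<lambda>x. complex_of_real (\<bar>x\<bar> powr numeral n) * f x) = sqn (\<lambda>x. complex_of_real (x ^ numeral n) * f x)"
proof -
  have "norm (complex_of_real (\<bar>x\<bar> powr numeral n) * f x) = norm (complex_of_real (x ^ numeral n) * f x)" for x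
    by (simp add: norm_mult norm_power)
  then show ?thesis by (simp only: sqn_def)
qed

text \<open>\<open>0 powr 0\<close> is 0, so the weight equals 1 off the origin only; one point is
  null.\<close>

lemma sqn_abs_powr_0: "sqn (\<lambda>x. complex_of_real (\<bar>x\<bar> powr 0) * f x) = sqn f"
  by (rule sqn_cong_AE) (use AE_lborel_singleton[of 0] in \<open>eventually_elim, simp\<close>)

lemma wclass_of_Zdot:
  assumes f: "cr f \<in> Zdot 5 0" "cr f \<in> Zdot 5 3" and N: "Zdot_norm 5 0 (cr f) \<le> \<delta>" "Zdot_norm 5 3 (cr f) \<le> \<delta>"
  shows "wclass (\<delta>\<^sup>2) f"
proof -
  have n: "Zdot_norm s r (cr f) \<ge> 0" for s r
    unfolding Zdot_norm_def sobolev_norm_def L2_norm_def by (intro add_nonneg_nonneg real_sqrt_ge_zero integral_nonneg_AE) auto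
  have le: "ennreal ((Zdot_norm 5 0 (cr f))\<^sup>2) \<le> ennreal (\<delta>\<^sup>2)" "ennreal ((Zdot_norm 5 3 (cr f))\<^sup>2) \<le> ennreal (\<delta>\<^sup>2)"
    using n N by (auto intro!: ennreal_leI power_mono)
  have "integrable lborel (cr f)" using f by (simp add: Zdot_def)
  then have [measurable]: "cr f \<in> borel_measurable borel" by auto
  have "(\<lambda>x. Re (cr f x)) \<in> borel_measurable borel" by measurable
  moreover have "sqn (cr f) \<le> ennreal (\<delta>\<^sup>2)"
    using Zdot_sqn(2)[OF f(1)] le(1) unfolding sqn_abs_powr_0 by (rule order_trans)
  moreover have "sqn (\<lambda>x. complex_of_real (x ^ 3) * cr f x) \<le> ennreal (\<delta>\<^sup>2)"
    using Zdot_sqn(2)[OF f(2)] le(2) unfolding sqn_abs_powr_numeral by (rule order_trans)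
  moreover have "sqn (\<lambda>\<xi>. sqrt ((1 + \<xi>\<^sup>2) ^ 5) *\<^sub>R fourier (cr f) \<xi>) \<le> ennreal (\<delta>\<^sup>2)"
    using Zdot_sqn(1)[OF f(2)] le(2) unfolding powr_five_halves by (rule order_trans)
  ultimately show ?thesis by (simp add: wclass_def)
qed

section \<open>Continuity in time\<close>

text \<open>Continuity of the curve, expressed by smallness of differences in \<open>wclass\<close>,
  so that every estimate for \<open>wclass\<close> becomes a modulus of continuity.\<close>

definition wcontinuous :: "(real \<Rightarrow> real \<Rightarrow> real) \<Rightarrow> bool" where
  "wcontinuous u \<longleftrightarrow> (\<forall>t. \<exists>K\<ge>0. wclass K (u t)) \<and>
     (\<forall>t. \<forall>e>0. \<forall>\<^sub>F \<tau> in nhds t. wclass e (\<lambda>x. u \<tau> x - u t x))"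

lemma wcontinuous_of_Zdot_curves:
  assumes "(\<lambda>t. cr (u t)) \<in> Zdot_curves 5 0" "(\<lambda>t. cr (u t)) \<in> Zdot_curves 5 3"
  shows "wcontinuous u"
  unfolding wcontinuous_def
proof (intro conjI allI impI)
  fix t
  have Z: "cr (u s) \<in> Zdot 5 0" "cr (u s) \<in> Zdot 5 3" for s using assms by (auto simp: Zdot_curves_def)
  show "\<exists>K\<ge>0. wclass K (u t)"
    using wclass_of_Zdot[OF Z, of t "max (Zdot_norm 5 0 (cr (u t))) (Zdot_norm 5 3 (cr (u t)))"] by (intro exI conjI) auto
  fix e :: real assume e: "e > 0"
  have D: "cr (\<lambda>x. u \<tau> x - u t x) \<in> Zdot 5 0" "cr (\<lambda>x. u \<tau> x - u t x) \<in> Zdot 5 3" for \<tau>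
    using Zdot_diff[OF Z(1) Z(1)] Zdot_diff[OF Z(2) Z(2)] by simp_all
  have "((\<lambda>\<tau>. Zdot_norm 5 0 (cr (\<lambda>x. u \<tau> x - u t x))) \<longlongrightarrow> 0) (at t)" "((\<lambda>\<tau>. Zdot_norm 5 3 (cr (\<lambda>x. u \<tau> x - u t x))) \<longlongrightarrow> 0) (at t)"
    using assms by (auto simp: Zdot_curves_def)
  then have "\<forall>\<^sub>F \<tau> in at t. Zdot_norm 5 0 (cr (\<lambda>x. u \<tau> x - u t x)) < sqrt e" "\<forall>\<^sub>F \<tau> in at t. Zdot_norm 5 3 (cr (\<lambda>x. u \<tau> x - u t x)) < sqrt e"
    using e by (auto intro: order_tendstoD)
  then have "\<forall>\<^sub>F \<tau> in at t. wclass e (\<lambda>x. u \<tau> x - u t x)"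
  proof eventually_elim
    case (elim \<tau>)
    then show ?case using wclass_of_Zdot[OF D, of \<tau> "sqrt e"] e by simp
  qed
  moreover have "wclass e (\<lambda>x. u t x - u t x)" by (simp add: wclass_def sqn_def fourier_def)
  ultimately show "\<forall>\<^sub>F \<tau> in nhds t. wclass e (\<lambda>x. u \<tau> x - u t x)" by (auto simp: eventually_nhds_conv_at)
qed

lemma wclass_mono: "wclass K u \<Longrightarrow> K \<le> L \<Longrightarrow> wclass L u"
  by (auto simp: wclass_def intro: order_trans ennreal_leI)

lemma wclass_add:
  assumes f: "wclass a f" "a \<ge> 0" and g: "wclass b g" "b \<ge> 0"
  shows "wclass (2 * a + 2 * b) (\<lambda>x. f x + g x)"
proof -
  have [measurable]: "f \<in> borel_measurable borel" "g \<in> borel_measurable borel" using f g by (auto intro: wclass_measurable)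
  have i: "integrable lborel (cr f)" "integrable lborel (cr g)"
    using wclass_moments(1)[OF f(1) le0 f(2)] wclass_moments(1)[OF g(1) le0 g(2)] by auto
  have le: "sqn (\<lambda>x. p x + q x) \<le> ennreal (2 * a + 2 * b)"
    if "p \<in> borel_measurable borel" "q \<in> borel_measurable borel" "sqn p \<le> ennreal a" "sqn q \<le> ennreal b" for p q :: "real \<Rightarrow> complex"
  proof -
    have "sqn (\<lambda>x. p x + q x) \<le> 2 * sqn p + 2 * sqn q" by (rule sqn_add_le) (use that in auto)
    also have "\<dots> \<le> 2 * ennreal a + 2 * ennreal b" using that by (intro add_mono mult_left_mono) auto
    also have "\<dots> = ennreal (2 * a + 2 * b)" using f g by (simp add: ennreal_mult ennreal_plus)
    finally show ?thesis .
  qed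
  have "sqn (cr (\<lambda>x. f x + g x)) \<le> ennreal (2 * a + 2 * b)"
    using le[of "cr f" "cr g"] f g by (auto simp: wclass_def)
  moreover have "sqn (\<lambda>x. complex_of_real (x ^ 3) * cr f x + complex_of_real (x ^ 3) * cr g x) \<le> ennreal (2 * a + 2 * b)"
    by (rule le) (use f g in \<open>auto simp: wclass_def\<close>)
  moreover have "sqn (\<lambda>\<xi>. sqrt ((1 + \<xi>\<^sup>2) ^ 5) *\<^sub>R fourier (cr f) \<xi> + sqrt ((1 + \<xi>\<^sup>2) ^ 5) *\<^sub>R fourier (cr g) \<xi>) \<le> ennreal (2 * a + 2 * b)"
    by (rule le) (use f g in \<open>auto simp: wclass_def\<close>)
  ultimately show ?thesis
    unfolding wclass_def of_real_add fourier_add[OF i] scaleR_add_right distrib_left by auto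
qed

text \<open>Local bounds and compactness of the time interval; the finitely many local constants are
  simply added.\<close>

lemma wcontinuous_uniform:
  assumes "wcontinuous u"
  shows "\<exists>K\<ge>0. \<forall>t\<in>{a..b}. wclass K (u t)"
proof -
  have "\<exists>S K. open S \<and> t \<in> S \<and> K \<ge> 0 \<and> (\<forall>\<tau>\<in>S. wclass K (u \<tau>))" for t
  proof -
    obtain L where L: "L \<ge> 0" "wclass L (u t)" using assms unfolding wcontinuous_def by blast
    have "\<forall>\<^sub>F \<tau> in nhds t. wclass 1 (\<lambda>x. u \<tau> x - u t x)" using assms by (auto simp: wcontinuous_def)
    then obtain S where S: "open S" "t \<in> S" "\<And>\<tau>. \<tau> \<in> S \<Longrightarrow> wclass 1 (\<lambda>x. u \<tau> x - u t x)" by (auto simp: eventually_nhds)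
    \<comment> \<open>u \<tau> is u t plus a difference in \<open>wclass 1\<close>, and
      \<open>wclass_add\<close> doubles both constants.\<close>
    have "wclass (2 * 1 + 2 * L) (u \<tau>)" if "\<tau> \<in> S" for \<tau>
      using wclass_add[OF S(3)[OF that] _ L(2,1)] by simp
    then show ?thesis using S L by (intro exI[of _ S] exI[of _ "2 * 1 + 2 * L"]) auto
  qed
  then obtain S K where S: "\<And>t. open (S t)" "\<And>t. t \<in> S t" and K: "\<And>t. K t \<ge> (0::real)" "\<And>t \<tau>. \<tau> \<in> S t \<Longrightarrow> wclass (K t) (u \<tau>)"
    by metis
  have "compact {a..b}" by simp
  moreover have "{a..b} \<subseteq> \<Union>(S ` {a..b})" using S(2) by auto
  moreover have "\<And>B. B \<in> S ` {a..b} \<Longrightarrow> open B" using S(1) by auto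
  ultimately obtain C where C: "C \<subseteq> S ` {a..b}" "finite C" "{a..b} \<subseteq> \<Union>C" by (rule compactE)
  then obtain J where J: "J \<subseteq> {a..b}" "finite J" "C = S ` J" by (meson finite_subset_image)
  have "wclass (\<Sum>t\<in>J. K t) (u \<tau>)" if "\<tau> \<in> {a..b}" for \<tau>
  proof -
    have "\<tau> \<in> \<Union>(S ` J)" using subsetD[OF C(3) that] unfolding J(3) .
    then obtain t where t: "t \<in> J" "\<tau> \<in> S t" by blast
    have "K t \<le> (\<Sum>t\<in>J. K t)" using K(1) J(2) t(1) by (intro member_le_sum) auto
    with K(2)[OF t(2)] show ?thesis by (rule wclass_mono)
  qed
  then show ?thesis using K(1) by (intro exI[of _ "\<Sum>t\<in>J. K t"]) (auto intro: sum_nonneg)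
qed

text \<open>Continuity of the curve in L1 controls the change in time uniformly in \<xi>; what
  remains is continuity of one fixed transform.\<close>

lemma fourier_jointly_continuous:
  fixes f :: "real \<Rightarrow> real \<Rightarrow> complex"
  assumes i: "\<And>t. integrable lborel (f t)" and c: "\<And>t. ((\<lambda>\<tau>. LINT x|lborel. norm (f \<tau> x - f t x)) \<longlongrightarrow> 0) (nhds t)"
  shows "continuous_on UNIV (\<lambda>p. fourier (f (fst p)) (snd p))"
proof -
  have "((\<lambda>p. fourier (f (fst p)) (snd p)) \<longlongrightarrow> fourier (f t) \<xi>) (nhds (t, \<xi>))" for t \<xi>
  proof (rule Lim_null[THEN iffD2], rule Lim_null_comparison)
    let ?d = "\<lambda>\<tau>. LINT x|lborel. norm (f \<tau> x - f t x)"
    show "\<forall>\<^sub>F p in nhds (t, \<xi>). norm (fourier (f (fst p)) (snd p) - fourier (f t) \<xi>) \<le> ?d (fst p) / sqrt (2 * pi) + norm (fourier (f t) (snd p) - fourier (f t) \<xi>)"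
    proof (intro always_eventually allI)
      fix p
      have "norm (fourier (f (fst p)) (snd p) - fourier (f t) (snd p)) \<le> ?d (fst p) / sqrt (2 * pi)"
        unfolding fourier_diff[OF i i, symmetric] by (rule norm_fourier_le)
      then show "norm (fourier (f (fst p)) (snd p) - fourier (f t) \<xi>) \<le> ?d (fst p) / sqrt (2 * pi) + norm (fourier (f t) (snd p) - fourier (f t) \<xi>)"
        using norm_triangle_ineq[of "fourier (f (fst p)) (snd p) - fourier (f t) (snd p)" "fourier (f t) (snd p) - fourier (f t) \<xi>"] by simp
    qed
    have fs: "filterlim fst (nhds t) (nhds (t, \<xi>))" "filterlim snd (nhds \<xi>) (nhds (t, \<xi>))"
      unfolding nhds_prod by (rule filterlim_fst filterlim_snd)+
    have "continuous_on UNIV (fourier (f t))" by (rule continuous_on_fourier[OF i])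
    then have "((fourier (f t)) \<longlongrightarrow> fourier (f t) \<xi>) (nhds \<xi>)"
      by (simp add: continuous_on_eq_continuous_at isCont_def tendsto_at_iff_tendsto_nhds)
    from filterlim_compose[OF this fs(2)] have "((\<lambda>p. norm (fourier (f t) (snd p) - fourier (f t) \<xi>)) \<longlongrightarrow> 0) (nhds (t, \<xi>))"
      by (intro tendsto_norm_zero Lim_null[THEN iffD1])
    from tendsto_add[OF tendsto_divide[OF filterlim_compose[OF c fs(1)] tendsto_const] this]
    show "((\<lambda>p. ?d (fst p) / sqrt (2 * pi) + norm (fourier (f t) (snd p) - fourier (f t) \<xi>)) \<longlongrightarrow> 0) (nhds (t, \<xi>))" by simp
  qed
  then have "isCont (\<lambda>p. fourier (f (fst p)) (snd p)) p" for p
    unfolding isCont_def by (cases p) (simp, rule tendsto_mono[OF at_within_le_nhds])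
  then show ?thesis by (simp add: continuous_on_eq_continuous_at)
qed

text \<open>The single weight 1 + x^6 joins the two conditions on u in x and dominates all moments
  of u^2 up to order six.\<close>

lemma wclass_integral_weighted_sq_le:
  assumes u: "wclass K u" "K \<ge> 0"
  shows "integrable lborel (\<lambda>x. (sqrt (1 + x ^ 6) * \<bar>u x\<bar>)\<^sup>2)" "(LINT x|lborel. (sqrt (1 + x ^ 6) * \<bar>u x\<bar>)\<^sup>2) \<le> 2 * K"
proof -
  have [measurable]: "u \<in> borel_measurable borel" using u(1) by (rule wclass_measurable)
  have i: "integrable lborel (\<lambda>x. (norm (complex_of_real (x ^ 3) * cr u x))\<^sup>2)"
  proof (rule integrableI_bounded)
    have "(\<integral>\<^sup>+x. ennreal (norm ((norm (complex_of_real (x ^ 3) * cr u x))\<^sup>2)) \<partial>lborel) \<le> ennreal K"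
      using u by (simp add: wclass_def sqn_def)
    also have "\<dots> < \<infinity>" by simp
    finally show "(\<integral>\<^sup>+x. ennreal (norm ((norm (complex_of_real (x ^ 3) * cr u x))\<^sup>2)) \<partial>lborel) < \<infinity>" .
  qed measurable
  have "ennreal (LINT x|lborel. (norm (complex_of_real (x ^ 3) * cr u x))\<^sup>2) = sqn (\<lambda>x. complex_of_real (x ^ 3) * cr u x)"
    unfolding sqn_def by (rule nn_integral_eq_integral[OF i, symmetric]) simp
  also have "\<dots> \<le> ennreal K" using u by (simp add: wclass_def)
  finally have le: "(LINT x|lborel. (norm (complex_of_real (x ^ 3) * cr u x))\<^sup>2) \<le> K" using u by (simp add: ennreal_le_iff)
  have i0: "integrable lborel (\<lambda>x. (u x)\<^sup>2)" using wclass_L2[OF u(1)] by (simp add: L2_def)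
  have p: "0 \<le> 1 + x ^ 6" for x :: real using zero_le_even_power[of 6 x] by simp
  have eq: "(sqrt (1 + x ^ 6) * \<bar>u x\<bar>)\<^sup>2 = (u x)\<^sup>2 + (norm (complex_of_real (x ^ 3) * cr u x))\<^sup>2" for x
    using p[of x] by (simp add: norm_mult norm_power power_mult_distrib power_even_abs algebra_simps flip: power_mult)
  show "integrable lborel (\<lambda>x. (sqrt (1 + x ^ 6) * \<bar>u x\<bar>)\<^sup>2)" unfolding eq by (intro Bochner_Integration.integrable_add i0 i)
  show "(LINT x|lborel. (sqrt (1 + x ^ 6) * \<bar>u x\<bar>)\<^sup>2) \<le> 2 * K"
    unfolding eq by (subst Bochner_Integration.integral_add[OF i0 i]) (use le wclass_integral_sq_le[OF u] in linarith)
qed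

lemma abs_power_le_1_plus_6:
  fixes x :: real
  assumes "k \<le> 6"
  shows "\<bar>x\<bar> ^ k \<le> 1 + x ^ 6"
proof (cases "\<bar>x\<bar> \<le> 1")
  case True
  then have "\<bar>x\<bar> ^ k \<le> 1" by (intro power_le_one) auto
  moreover have "0 \<le> x ^ 6" by simp
  ultimately show ?thesis by linarith
next
  case False
  then have "\<bar>x\<bar> ^ k \<le> \<bar>x\<bar> ^ 6" using assms by (intro power_increasing) auto
  then show ?thesis by (simp add: power_even_abs)
qed

text \<open>(u + d)^2 - u^2 = d^2 + 2 d u. With the weight split evenly, the cross term falls to
  Cauchy-Schwarz, so the bound tends to 0 with e for fixed K.\<close>

lemma wclass_sq_moment_diff:
  assumes u: "wclass K u" "K \<ge> 0" and d: "wclass e d" "e \<ge> 0" and k: "k \<le> 6"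
  shows "(LINT x|lborel. \<bar>x\<bar> ^ k * \<bar>(u x + d x)\<^sup>2 - (u x)\<^sup>2\<bar>) \<le> 2 * e + 2 * (sqrt (2 * e) * sqrt (2 * K))"
proof -
  have [measurable]: "u \<in> borel_measurable borel" "d \<in> borel_measurable borel" using u(1) d(1) by (auto intro: wclass_measurable)
  let ?p = "\<lambda>u x. sqrt (1 + x ^ 6) * \<bar>u x :: real\<bar>"
  have m: "?p d \<in> borel_measurable lborel" "?p u \<in> borel_measurable lborel" by measurable
  note iu = wclass_integral_weighted_sq_le[OF u] and id = wclass_integral_weighted_sq_le[OF d]
  note CS = Cauchy_Schwarz_LINT[OF m id(1) iu(1)]
  have "(LINT x|lborel. \<bar>x\<bar> ^ k * \<bar>(u x + d x)\<^sup>2 - (u x)\<^sup>2\<bar>) \<le> (LINT x|lborel. (?p d x)\<^sup>2 + 2 * (?p d x * ?p u x))"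
  proof (rule integral_mono_AE')
    show "integrable lborel (\<lambda>x. (?p d x)\<^sup>2 + 2 * (?p d x * ?p u x))"
      by (intro Bochner_Integration.integrable_add integrable_mult_right id(1) CS(1))
    have p: "0 \<le> 1 + x ^ 6" for x :: real using zero_le_even_power[of 6 x] by simp
    show "AE x in lborel. \<bar>x\<bar> ^ k * \<bar>(u x + d x)\<^sup>2 - (u x)\<^sup>2\<bar> \<le> (?p d x)\<^sup>2 + 2 * (?p d x * ?p u x)"
    proof (rule AE_I2)
      fix x
      have "(u x + d x)\<^sup>2 - (u x)\<^sup>2 = (d x)\<^sup>2 + 2 * (d x * u x)" by (simp add: power2_eq_square algebra_simps)
      then have "\<bar>(u x + d x)\<^sup>2 - (u x)\<^sup>2\<bar> \<le> \<bar>(d x)\<^sup>2\<bar> + \<bar>2 * (d x * u x)\<bar>" by (simp only: abs_triangle_ineq)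
      also have "\<dots> = (d x)\<^sup>2 + 2 * (\<bar>d x\<bar> * \<bar>u x\<bar>)" by (simp add: abs_mult)
      finally have "\<bar>x\<bar> ^ k * \<bar>(u x + d x)\<^sup>2 - (u x)\<^sup>2\<bar> \<le> (1 + x ^ 6) * ((d x)\<^sup>2 + 2 * (\<bar>d x\<bar> * \<bar>u x\<bar>))"
        by (intro mult_mono abs_power_le_1_plus_6[OF k] p) auto
      also have "\<dots> = (?p d x)\<^sup>2 + 2 * (?p d x * ?p u x)"
      proof -
        have s: "1 + x ^ 6 = sqrt (1 + x ^ 6) * sqrt (1 + x ^ 6)" using p[of x] by simp
        have "(s * s) * ((d x)\<^sup>2 + 2 * (\<bar>d x\<bar> * \<bar>u x\<bar>)) = (s * \<bar>d x\<bar>)\<^sup>2 + 2 * (s * \<bar>d x\<bar> * (s * \<bar>u x\<bar>))" for s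
          by (simp add: power2_eq_square algebra_simps)
        from this[of "sqrt (1 + x ^ 6)"] show ?thesis unfolding s[symmetric] .
      qed
      finally show "\<bar>x\<bar> ^ k * \<bar>(u x + d x)\<^sup>2 - (u x)\<^sup>2\<bar> \<le> (?p d x)\<^sup>2 + 2 * (?p d x * ?p u x)" .
    qed
    show "AE x in lborel. 0 \<le> (?p d x)\<^sup>2 + 2 * (?p d x * ?p u x)"
      using p by (intro AE_I2 add_nonneg_nonneg mult_nonneg_nonneg) auto
  qed
  also have "\<dots> = (LINT x|lborel. (?p d x)\<^sup>2) + 2 * (LINT x|lborel. ?p d x * ?p u x)"
    using CS(1) by (subst Bochner_Integration.integral_add[OF id(1)]) (auto simp del: times_divide_eq_left)
  also have "\<dots> \<le> 2 * e + 2 * (sqrt (2 * e) * sqrt (2 * K))"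
  proof (intro add_mono mult_left_mono id(2))
    have "(LINT x|lborel. ?p d x * ?p u x) \<le> sqrt (LINT x|lborel. (?p d x)\<^sup>2) * sqrt (LINT x|lborel. (?p u x)\<^sup>2)"
      using CS(2) by (rule order_trans[OF abs_ge_self])
    also have "\<dots> \<le> sqrt (2 * e) * sqrt (2 * K)"
      using id(2) iu(2) d(2) by (intro mult_mono real_sqrt_le_mono) (auto intro!: integral_nonneg_AE)
    finally show "(LINT x|lborel. ?p d x * ?p u x) \<le> sqrt (2 * e) * sqrt (2 * K)" .
  qed simp
  finally show ?thesis .
qed

text \<open>g acts as a modulus of continuity: choose e with g e small, then a neighbourhood in
  which the differences lie in \<open>wclass e\<close>.\<close>

lemma tendsto_0_of_wclass_bound:
  fixes F :: "real \<Rightarrow> real" and g :: "real \<Rightarrow> real"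
  assumes u: "wcontinuous u" and F: "\<And>\<tau> e. e > 0 \<Longrightarrow> wclass e (\<lambda>x. u \<tau> x - u t x) \<Longrightarrow> \<bar>F \<tau>\<bar> \<le> g e"
    and g: "isCont g 0" "g 0 = 0"
  shows "(F \<longlongrightarrow> 0) (nhds t)"
proof (rule tendstoI)
  fix r :: real assume r: "r > 0"
  have "(g \<longlongrightarrow> 0) (at_right 0)" using g by (auto simp: isCont_def intro: tendsto_mono[OF at_le])
  then have "\<forall>\<^sub>F e in at_right 0. g e < r" using r by (rule order_tendstoD)
  then obtain b where b: "b > 0" "\<And>e. 0 < e \<Longrightarrow> e < b \<Longrightarrow> g e < r" by (auto simp: eventually_at_right_field)
  define e where "e = b / 2"
  have e: "e > 0" "g e < r" using b by (auto simp: e_def)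
  have "\<forall>\<^sub>F \<tau> in nhds t. wclass e (\<lambda>x. u \<tau> x - u t x)" using u e(1) unfolding wcontinuous_def by blast
  then show "\<forall>\<^sub>F \<tau> in nhds t. dist (F \<tau>) 0 < r"
    by eventually_elim (use F[OF e(1)] e(2) in \<open>auto intro: le_less_trans\<close>)
qed

lemma wcontinuous_fourier:
  assumes u: "wcontinuous u"
  shows "continuous_on UNIV (\<lambda>p. fourier (cr (u (fst p))) (snd p))"
proof (rule fourier_jointly_continuous)
  have K: "\<exists>K\<ge>0. wclass K (u t)" for t using u unfolding wcontinuous_def by blast
  show "integrable lborel (cr (u t))" for t
    using K[of t] wclass_moments(1)[OF _ le0] by auto
  fix t
  show "((\<lambda>\<tau>. LINT x|lborel. norm (cr (u \<tau>) x - cr (u t) x)) \<longlongrightarrow> 0) (nhds t)"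
  proof (rule tendsto_0_of_wclass_bound[OF u])
    fix \<tau> e :: real assume e: "e > 0" and w: "wclass e (\<lambda>x. u \<tau> x - u t x)"
    have "(LINT x|lborel. norm (cr (u \<tau>) x - cr (u t) x)) \<le> sqrt (4 * cauchy_mass * e)"
      using wclass_moments(2)[OF w le0] e by (simp flip: of_real_diff)
    then show "\<bar>LINT x|lborel. norm (cr (u \<tau>) x - cr (u t) x)\<bar> \<le> sqrt (4 * cauchy_mass * e)" by simp
  qed (auto intro!: continuous_intros)
qed

lemma wcontinuous_FD_sq:
  assumes u: "wcontinuous u" and k: "k \<le> 4"
  shows "continuous_on UNIV (\<lambda>p. FD k (sq (u (fst p))) (snd p))"
  unfolding FD_def
proof (rule fourier_jointly_continuous)
  have K: "\<exists>K\<ge>0. wclass K (u t)" for t using u unfolding wcontinuous_def by blast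
  have k6: "k \<le> 6" using k by simp
  show "integrable lborel (\<lambda>x. (- \<i> * complex_of_real x) ^ k * sq (u t) x)" for t
    unfolding integrable_monomial_iff using K[of t] wclass_sq_moments[OF _ k6] by blast
  fix t
  obtain L where L: "wclass L (u t)" "L \<ge> 0" using K by blast
  show "((\<lambda>\<tau>. LINT x|lborel. norm ((- \<i> * complex_of_real x) ^ k * sq (u \<tau>) x - (- \<i> * complex_of_real x) ^ k * sq (u t) x)) \<longlongrightarrow> 0) (nhds t)"
  proof (rule tendsto_0_of_wclass_bound[OF u])
    fix \<tau> e :: real assume e: "e > 0" and w: "wclass e (\<lambda>x. u \<tau> x - u t x)"
    have eq: "norm ((- \<i> * complex_of_real x) ^ k * sq (u \<tau>) x - (- \<i> * complex_of_real x) ^ k * sq (u t) x) = \<bar>x\<bar> ^ k * \<bar>(u t x + (u \<tau> x - u t x))\<^sup>2 - (u t x)\<^sup>2\<bar>" for x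
      unfolding right_diff_distrib[symmetric] of_real_diff[symmetric] norm_mult norm_power norm_of_real by simp
    have "(LINT x|lborel. \<bar>x\<bar> ^ k * \<bar>(u t x + (u \<tau> x - u t x))\<^sup>2 - (u t x)\<^sup>2\<bar>) \<le> 2 * e + 2 * (sqrt (2 * e) * sqrt (2 * L))"
      by (rule wclass_sq_moment_diff[OF L w _ k6]) (use e in simp)
    moreover have "(LINT x|lborel. \<bar>x\<bar> ^ k * \<bar>(u t x + (u \<tau> x - u t x))\<^sup>2 - (u t x)\<^sup>2\<bar>) \<ge> 0"
      by (rule integral_nonneg_AE) simp
    ultimately show "\<bar>LINT x|lborel. norm ((- \<i> * complex_of_real x) ^ k * sq (u \<tau>) x - (- \<i> * complex_of_real x) ^ k * sq (u t) x)\<bar> \<le> 2 * e + 2 * (sqrt (2 * e) * sqrt (2 * L))"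
      unfolding eq by (simp only: abs_of_nonneg)
  qed (auto intro!: continuous_intros)
qed

lemma wcontinuous_QD:
  assumes u: "wcontinuous u" and k: "k \<le> 4"
  shows "continuous_on UNIV (\<lambda>p. QD k (u (T * fst p)) (snd p))"
proof -
  have c: "continuous_on UNIV (\<lambda>p. FD j (sq (u (T * fst p))) (snd p))" if "j \<le> 4" for j
  proof -
    have "continuous_on UNIV (\<lambda>p::real \<times> real. (T * fst p, snd p))" by (intro continuous_intros)
    from continuous_on_compose2[OF wcontinuous_FD_sq[OF u that] this] show ?thesis by simp
  qed
  show ?thesis unfolding QD_def using k by (intro continuous_intros c) auto
qed

text \<open>Cauchy-Schwarz between u and x^4 u; as before one power of x is lost, hence j <
  4.\<close>

lemma integrable_moment_of_fourth:
  assumes [measurable]: "u \<in> borel_measurable borel" and s: "sqn (cr u) < \<infinity>" "sqn (\<lambda>x. complex_of_real (x ^ 4) * cr u x) < \<infinity>" and j: "j < 4"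
  shows "integrable lborel (\<lambda>x. complex_of_real (x ^ j) * cr u x)"
proof -
  have "sqn (cr u) + sqn (\<lambda>x. complex_of_real (x ^ 4) * cr u x) < \<infinity>" using s by simp
  then obtain c where c: "c \<ge> 0" "sqn (cr u) + sqn (\<lambda>x. complex_of_real (x ^ 4) * cr u x) = ennreal c" by (auto simp: less_top_ennreal)
  have m: "(\<lambda>x. complex_of_real (x ^ j) * cr u x) \<in> borel_measurable borel" by measurable
  have b: "(\<integral>\<^sup>+x. ennreal (norm (complex_of_real (x ^ j) * cr u x)) \<partial>lborel)\<^sup>2 \<le> ennreal (2 * cauchy_mass * c)"
    using moment_L1_le[OF assms(1) j] c cauchy_mass_nonneg unfolding c(2) by (simp only: ennreal_mult zero_le_numeral mult_nonneg_nonneg)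
  show ?thesis by (rule integrable_of_sq_le(1)[OF m b]) (use c(1) cauchy_mass_nonneg in simp)
qed

section \<open>Return to the fourth moment at the critical time\<close>

theorem theorem2:
  fixes u0 :: "real \<Rightarrow> real" and u :: "real \<Rightarrow> real \<Rightarrow> real"
  assumes "(\<lambda>x. complex_of_real (u0 x)) \<in> Zdot 5 4"
    and "(LINT x|lborel. x * u0 x) \<noteq> 0"
    and "\<And>r. 0 \<le> r \<Longrightarrow> r < 7 / 2 \<Longrightarrow> (\<lambda>t x. complex_of_real (u t x)) \<in> Zdot_curves 5 r"
    and "benjamin_ono_solution u0 u"
  shows "(\<lambda>x. complex_of_real (u (- 4 / (L2_norm u0)\<^sup>2 * (LINT x|lborel. x * u0 x)) x)) \<in> Zdot 5 4"
proof -
  define N where "N = (LINT x|lborel. (u0 x)\<^sup>2)"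
  define m where "m = (LINT x|lborel. x * u0 x)"
  define T where "T = - 4 / (L2_norm u0)\<^sup>2 * m"
  have N0: "N \<ge> 0" unfolding N_def by (rule integral_nonneg_AE) simp
  have N: "(L2_norm u0)\<^sup>2 = N" using N0 by (simp add: L2_norm_def N_def)
  \<comment> \<open>The exponents r = 0 and r = 3 supply the two norms in x that make up
    \<open>wclass\<close>.\<close>
  have u: "wcontinuous u" using assms(3)[of 0] assms(3)[of 3] by (intro wcontinuous_of_Zdot_curves) auto
  have W: "\<exists>K\<ge>0. \<forall>t\<in>{a..b}. wclass K (u t)" for a b by (rule wcontinuous_uniform[OF u])
  have W1: "\<exists>K\<ge>0. wclass K (u t)" for t using u unfolding wcontinuous_def by blast
  have flow: "BO_flow u" and ae0: "AE x in lborel. u 0 x = u0 x"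
    using assms(4) unfolding benjamin_ono_solution_def BO_flow_def by auto
  have um: "u t \<in> borel_measurable borel" for t using W1[of t] wclass_measurable by blast
  have i0: "integrable lborel (cr u0)" using assms(1) by (simp add: Zdot_def)
  then have [measurable]: "cr u0 \<in> borel_measurable borel" by auto
  have "(\<lambda>x. Re (cr u0 x)) \<in> borel_measurable borel" by measurable
  then have [measurable]: "u0 \<in> borel_measurable borel" by simp
  have F0: "fourier (cr (u 0)) = fourier (cr u0)"
  proof (rule fourier_cong_AE)
    show "AE x in lborel. cr (u 0) x = cr u0 x" using ae0 by eventually_elim simp
    have [measurable]: "u 0 \<in> borel_measurable borel" by (rule um)
    show "cr (u 0) \<in> borel_measurable lborel" "cr u0 \<in> borel_measurable lborel" by measurable
  qed
  have cU: "continuous_on UNIV (\<lambda>t. fourier (cr (u t)) \<xi>)" for \<xi>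
    using continuous_on_compose2[OF wcontinuous_fourier[OF u], of UNIV "\<lambda>t. (t, \<xi>)"] by (simp add: continuous_on_Pair)
  have cV: "continuous_on UNIV (\<lambda>t. fourier (sq (u t)) \<xi>)" for \<xi>
    using continuous_on_compose2[OF wcontinuous_FD_sq[OF u le0], of UNIV "\<lambda>t. (t, \<xi>)"] by (simp add: continuous_on_Pair FD_0)
  have dU: "((\<lambda>t. fourier (cr (u t)) \<xi>) has_vector_derivative BO (u t) \<xi>) (at t)" for t \<xi>
    by (rule fourier_BO_flow[OF W flow cU cV])
  \<comment> \<open>T may have either sign; the symmetric interval contains all times T
    \<sigma>.\<close>
  obtain K1 where K1: "K1 \<ge> 0" "\<And>t. t \<in> {- \<bar>T\<bar>..\<bar>T\<bar>} \<Longrightarrow> wclass K1 (u t)" using W[of "- \<bar>T\<bar>" "\<bar>T\<bar>"] by blast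
  define K2 where "K2 = (Zdot_norm 5 4 (cr u0))\<^sup>2"
  have u04: "sqn (\<lambda>x. complex_of_real (x ^ 4) * cr u0 x) \<le> ennreal K2" "sqn (\<lambda>\<xi>. sqrt ((1 + \<xi>\<^sup>2) ^ 5) *\<^sub>R fourier (cr u0) \<xi>) \<le> ennreal K2"
    using Zdot_sqn[OF assms(1)] unfolding sqn_abs_powr_numeral powr_five_halves K2_def by auto
  have K: "K1 + K2 \<ge> 0" "K1 \<le> K1 + K2" "K2 \<le> K1 + K2" using K1 by (auto simp: K2_def)
  have uK: "wclass (K1 + K2) (u (T * \<sigma>))" if "\<sigma> \<in> {0..1}" for \<sigma>
  proof (rule wclass_mono[OF K1(2) K(2)])
    have "\<bar>T * \<sigma>\<bar> \<le> \<bar>T\<bar> * 1" unfolding abs_mult using that by (intro mult_left_mono) auto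
    then show "T * \<sigma> \<in> {- \<bar>T\<bar>..\<bar>T\<bar>}" by auto
  qed
  have s0: "sqn (cr u0) < \<infinity>"
    using assms(1) by (auto simp: Zdot_def sobolev_def has_fourier_L2_def L2_iff_sqn)
  have "sqn (\<lambda>x. complex_of_real (x ^ 4) * cr (u T) x) < \<infinity>"
  proof (rule fourth_moment_of_Duhamel[where K="K1 + K2" and T=T and ?u0.0=u0 and u=u and N=N])
    show "K1 + K2 \<ge> 0" by (rule K(1))
    show "wclass (K1 + K2) (u (T * \<sigma>))" if "\<sigma> \<in> {0..1}" for \<sigma> by (rule uK[OF that])
    show "\<exists>K. wclass K (u t)" for t using W1 by blast
    show "continuous_on UNIV (\<lambda>p. QD k (u (T * fst p)) (snd p))" if "k \<le> 4" for k by (rule wcontinuous_QD[OF u that])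
    show "integrable lborel (\<lambda>x. complex_of_real (x ^ j) * cr u0 x)" if "j < 4" for j
      by (rule integrable_moment_of_fourth[OF _ s0 _ that]) (use u04(1) in \<open>auto intro: le_less_trans\<close>)
    have "sqn (\<lambda>\<xi>. sqrt ((1 + \<xi>\<^sup>2) ^ 4) *\<^sub>R fourier (cr u0) \<xi>) \<le> sqn (\<lambda>\<xi>. sqrt ((1 + \<xi>\<^sup>2) ^ 5) *\<^sub>R fourier (cr u0) \<xi>)"
    proof (rule sqn_mono)
      fix \<xi> :: real
      have "sqrt ((1 + \<xi>\<^sup>2) ^ 4) \<le> sqrt ((1 + \<xi>\<^sup>2) ^ 5)" by (intro real_sqrt_le_mono power_increasing) auto
      then show "norm (sqrt ((1 + \<xi>\<^sup>2) ^ 4) *\<^sub>R fourier (cr u0) \<xi>) \<le> norm (sqrt ((1 + \<xi>\<^sup>2) ^ 5) *\<^sub>R fourier (cr u0) \<xi>)"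
        by (simp add: mult_right_mono)
    qed
    also note u04(2)
    also have "ennreal K2 \<le> ennreal (K1 + K2)" by (rule ennreal_leI[OF K(3)])
    finally show "sqn (\<lambda>\<xi>. sqrt ((1 + \<xi>\<^sup>2) ^ 4) *\<^sub>R fourier (cr u0) \<xi>) \<le> ennreal (K1 + K2)" .
    show "sqn (\<lambda>x. complex_of_real (x ^ 4) * cr u0 x) \<le> ennreal (K1 + K2)"
      using u04(1) ennreal_leI[OF K(3)] by (rule order_trans)
    show "fourier (cr (u T)) \<xi> = cis (- (T * \<xi>\<^sup>2)) * fourier (cr u0) \<xi> -
       \<i> / 2 * complex_of_real T * integral {0..1} (\<lambda>\<sigma>. cis (- (T * (1 - \<sigma>) * \<xi>\<^sup>2)) * (complex_of_real \<xi> * fourier (sq (u (T * \<sigma>))) \<xi>))"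
      if "\<xi> > 0" for \<xi> using BO_flow_Duhamel[OF dU that, of T] unfolding F0 .
    have "(LINT x|lborel. (u 0 x)\<^sup>2) = N"
      unfolding N_def by (rule integral_cong_AE) (use ae0 um[of 0] in \<open>auto elim: eventually_mono\<close>)
    then show "(LINT x|lborel. (u (T * \<sigma>) x)\<^sup>2) = N" for \<sigma>
      unfolding BO_flow_mass[OF W1 flow, of "T * \<sigma>"] .
    \<comment> \<open>If N = 0, division by zero makes T = 0 and the product vanishes; otherwise the
      second factor is 0 by the choice of T.\<close>
    show "T * ((LINT x|lborel. x * u0 x) + T * N / 4) = 0"
      unfolding m_def[symmetric] T_def N by (cases "N = 0") simp_all
  qed
  then have "sqn (\<lambda>x. complex_of_real (\<bar>x\<bar> powr 4) * cr (u T) x) < \<infinity>" unfolding sqn_abs_powr_numeral .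
  moreover have "(\<lambda>x. complex_of_real (\<bar>x\<bar> powr 4) * cr (u T) x) \<in> borel_measurable borel"
    using um[of T] by measurable
  ultimately have "(\<lambda>x. complex_of_real (\<bar>x\<bar> powr 4) * cr (u T) x) \<in> L2" by (simp add: L2_iff_sqn)
  \<comment> \<open>The Sobolev condition, integrability and the vanishing mean do not involve r, so
    they are taken from r = 0.\<close>
  moreover have "cr (u T) \<in> Zdot 5 0" using assms(3)[of 0] by (auto simp: Zdot_curves_def)
  ultimately have "cr (u T) \<in> Zdot 5 4" by (simp add: Zdot_def)
  then show ?thesis unfolding T_def m_def .
qed

end
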